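(* Let $\Lambda$ be a row-finite $k$-graph with no sources. (1) Let $T$ be a maximal tail of $\Lambda$ and $\gamma$ a character of $\operatorname{Per}(\Lambda T)$. Suppose that $z\in\mathbb{T}^k$ satisfies $z^{m-n}=\gamma(m-n)$ for all $m-n\in\operatorname{Per}(\Lambda T)$. Suppose that $x\in(\Lambda T)^\infty$ is cofinal in $T$. Then there is an irreducible representation $\pi_{[x],z}:C^*(\Lambda)\to\mathcal{B}(\ell^2([x]))$ determined by $$\pi_{[x],z}(s_\lambda)\xi_y=\begin{cases}z^{d(\lambda)}\xi_{\lambda y}&\text{if }y(0)=s(\lambda)\\0&\text{otherwise,}\end{cases}\qquad \lambda\in\Lambda,\ y\in[x],$$ where $\{\xi_y:y\in[x]\}$ is the canonical orthonormal basis of $\ell^2([x])$. (2) Let $I$ be a primitive ideal in $C^*(\Lambda)$. Then $T=\{v\in\Lambda^0:s_v\notin I\}$ is a maximal tail. Let $H=H_{\operatorname{Per}}(\Lambda T)$. There is a unique character $\gamma$ of $\operatorname{Per}(\Lambda T)$ such that $s_\mu-\gamma(d(\mu)-d(\nu))s_\nu\in I$ whenever $\mu,\nu\in H\Lambda T$ and $\mu\sim_{\Lambda T}\nu$. Suppose that $x\in(\Lambda T)^\infty$ is cofinal in $T$ and that $z\in\mathbb{T}^k$ satisfies $z^{m-n}=\gamma(m-n)$ for all $m-n\in\operatorname{Per}(\Lambda T)$. Then $I=\ker\pi_{[x],z}$, where $\pi_{[x],z}$ is the representation described in (1).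
   Context: Conventions: $\mathbb{N}$ contains $0$; "ideal" means closed two-sided ideal; a primitive ideal is the kernel of a (nonzero) irreducible representation; for $z\in\mathbb{T}^k$, $n\in\mathbb{Z}^k$, $z^n=\prod_i z_i^{n_i}$. A $k$-graph is a countable small category $\Lambda$ (identified with its set of morphisms) with a functor $d:\Lambda\to\mathbb{N}^k$ satisfying the factorisation property: if $d(\lambda)=p+q$ then there are unique $\mu,\nu\in\Lambda$ with $d(\mu)=p$, $d(\nu)=q$, $\lambda=\mu\nu$. Write $\Lambda^n=d^{-1}(n)$; $r(\lambda)$, $s(\lambda)$ are the codomain and domain of $\lambda$. $\Lambda^0$ is the set of identity morphisms, identified with the objects (vertices). For $v,w\in\Lambda^0$, $v\Lambda w=\{\lambda: r(\lambda)=v,s(\lambda)=w\}$, $v\Lambda^n=\{\lambda\in\Lambda^n:r(\lambda)=v\}$, $v\Lambda=\{\lambda:r(\lambda)=v\}$, $\Lambda w=\{\lambda:s(\lambda)=w\}$. $\Lambda$ is row-finite with no sources if $0<|v\Lambda^n|<\infty$ for all $v\in\Lambda^0$, $n\in\mathbb{N}^k$. $C^*(\Lambda)$ is the universal $C^*$-algebra generated by elements $\{s_\lambda:\lambda\in\Lambda\}$ such that: the $s_v$, $v\in\Lambda^0$, are mutually orthogonal projections; $s_\mu s_\nu=s_{\mu\nu}$ if $s(\mu)=r(\nu)$; $s_\lambda^*s_\lambda=s_{s(\lambda)}$; and $s_v=\sum_{\lambda\in v\Lambda^n}s_\lambda s_\lambda^*$ for all $v\in\Lambda^0,n\in\mathbb{N}^k$.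 Infinite paths: $\Omega_k=\{(m,n)\in\mathbb{N}^k\times\mathbb{N}^k:m\le n\}$ is a $k$-graph with $r(m,n)=m$, $s(m,n)=n$, $(m,n)(n,p)=(m,p)$, $d(m,n)=n-m$. $\Lambda^\infty$ is the set of degree-preserving functors $x:\Omega_k\to\Lambda$; $x(n):=x(n,n)$, $\sigma^p(x)(m,n)=x(m+p,n+p)$, and for $\lambda\in\Lambda$ with $s(\lambda)=x(0)$, $\lambda x$ is the unique infinite path with $(\lambda x)(0,d(\lambda))=\lambda$ and $\sigma^{d(\lambda)}(\lambda x)=x$. Write $v\Lambda^\infty=\{x:x(0)=v\}$. The shift-tail equivalence class of $x\in\Lambda^\infty$ is $[x]=\{\lambda\sigma^m(x):m\in\mathbb{N}^k,\lambda\in\Lambda x(m)\}$. Maximal tails: a nonempty $T\subseteq\Lambda^0$ is a maximal tail of $\Lambda$ if (a) for all $v_1,v_2\in T$ there is $w\in T$ with $v_1\Lambda w\neq\emptyset\neq v_2\Lambda w$; (b) for all $v\in T$ and $1\le i\le k$ there is $\lambda\in v\Lambda^{e_i}$ with $s(\lambda)\in T$; (c) if $w\in T$, $v\in\Lambda^0$ and $v\Lambda w\ne\emptyset$ then $v\in T$. For a maximal tail $T$, $\Lambda T=\{\lambda\in\Lambda:s(\lambda)\in T\}$ is a row-finite $k$-graph with no sources, with vertex set $T$, which is a maximal tail of $\Lambda T$. A path $x\in(\Lambda T)^\infty$ is cofinal in $T$ if for each $v\in T$ there is $n\in\mathbb{N}^k$ with $v\Lambda x(n)\ne\emptyset$.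 Periodicity: for a row-finite $k$-graph $\Sigma$ with no sources such that $\Sigma^0$ is a maximal tail, define $\mu\sim_\Sigma\nu$ iff $s(\mu)=s(\nu)$ and $\mu x=\nu x$ for all $x\in s(\mu)\Sigma^\infty$; $\operatorname{Per}(\Sigma)=\{d(\mu)-d(\nu):\mu,\nu\in\Sigma,\ \mu\sim_\Sigma\nu\}$, a subgroup of $\mathbb{Z}^k$; and $H_{\operatorname{Per}}(\Sigma)$ is the set of $v\in\Sigma^0$ such that for all $\lambda\in v\Sigma$ and $m\in\mathbb{N}^k$ with $d(\lambda)-m\in\operatorname{Per}(\Sigma)$ there exists $\mu\in v\Sigma^m$ with $\lambda\sim_\Sigma\mu$. For $H\subseteq T$, $H\Lambda T=\{\lambda\in\Lambda: r(\lambda)\in H,s(\lambda)\in T\}$. *)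

theory Defs
  imports "HOL-Analysis.Analysis" "HOL-Algebra.Module" "HOL-Algebra.AbelCoset"
begin

section \<open>Higher-rank graphs\<close>

text \<open>
  Elements of \<open>\<nat>\<^sup>k\<close> and \<open>\<int>\<^sup>k\<close> are vectors indexed by a finite type with \<open>k\<close> elements. A small
  category is given by its set of morphisms alone: objects are identified with identity
  morphisms, so \<open>src\<close> (domain) and \<open>rng\<close> (codomain) are morphism-valued. The product
  \<open>cmp \<Lambda> \<mu> \<nu>\<close> is \<open>\<mu>\<nu>\<close>, meaningful when \<open>src \<mu> = rng \<nu>\<close>.
\<close>

record ('l, 'k) kgraph =
  mor :: "'l set"
  src :: "'l \<Rightarrow> 'l"
  rng :: "'l \<Rightarrow> 'l"
  cmp :: "'l \<Rightarrow> 'l \<Rightarrow> 'l"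
  deg :: "'l \<Rightarrow> nat ^ 'k"

locale k_graph =
  fixes G :: "('l, 'k::finite) kgraph"
  assumes countable_mor: "countable (mor G)"
    and src_mor: "a \<in> mor G \<Longrightarrow> src G a \<in> mor G"
    and rng_mor: "a \<in> mor G \<Longrightarrow> rng G a \<in> mor G"
    and src_src: "a \<in> mor G \<Longrightarrow> src G (src G a) = src G a"
    and rng_src: "a \<in> mor G \<Longrightarrow> rng G (src G a) = src G a"
    and src_rng: "a \<in> mor G \<Longrightarrow> src G (rng G a) = rng G a"
    and rng_rng: "a \<in> mor G \<Longrightarrow> rng G (rng G a) = rng G a"
    and cmp_mor: "\<lbrakk>a \<in> mor G; b \<in> mor G; src G a = rng G b\<rbrakk> \<Longrightarrow> cmp G a b \<in> mor G"
    and src_cmp: "\<lbrakk>a \<in> mor G; b \<in> mor G; src G a = rng G b\<rbrakk> \<Longrightarrow> src G (cmp G a b) = src G b"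
    and rng_cmp: "\<lbrakk>a \<in> mor G; b \<in> mor G; src G a = rng G b\<rbrakk> \<Longrightarrow> rng G (cmp G a b) = rng G a"
    and cmp_assoc: "\<lbrakk>a \<in> mor G; b \<in> mor G; c \<in> mor G; src G a = rng G b; src G b = rng G c\<rbrakk>
        \<Longrightarrow> cmp G (cmp G a b) c = cmp G a (cmp G b c)"
    and cmp_rng: "a \<in> mor G \<Longrightarrow> cmp G (rng G a) a = a"
    and cmp_src: "a \<in> mor G \<Longrightarrow> cmp G a (src G a) = a"
    and deg_src: "a \<in> mor G \<Longrightarrow> deg G (src G a) = 0"
    and deg_cmp: "\<lbrakk>a \<in> mor G; b \<in> mor G; src G a = rng G b\<rbrakk> \<Longrightarrow> deg G (cmp G a b) = deg G a + deg G b"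
    and factorisation: "\<lbrakk>a \<in> mor G; deg G a = p + q\<rbrakk> \<Longrightarrow>
        \<exists>!(b, c). b \<in> mor G \<and> c \<in> mor G \<and> src G b = rng G c \<and>
          deg G b = p \<and> deg G c = q \<and> a = cmp G b c"

definition verts :: "('l, 'k::finite) kgraph \<Rightarrow> 'l set" where
  "verts G = {v \<in> mor G. src G v = v}"

definition row_finite_no_sources :: "('l, 'k::finite) kgraph \<Rightarrow> bool" where
  "row_finite_no_sources G \<longleftrightarrow>
     (\<forall>v \<in> verts G. \<forall>n. {a \<in> mor G. rng G a = v \<and> deg G a = n} \<noteq> {} \<and>
        finite {a \<in> mor G. rng G a = v \<and> deg G a = n})"

text \<open>\<open>v\<Lambda>w \<noteq> \<emptyset>\<close>\<close>

definition connects :: "('l, 'k::finite) kgraph \<Rightarrow> 'l \<Rightarrow> 'l \<Rightarrow> bool" where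
  "connects G v w \<longleftrightarrow> (\<exists>a \<in> mor G. rng G a = v \<and> src G a = w)"


subsection \<open>Infinite paths\<close>

definition Omega :: "((nat ^ 'k) \<times> (nat ^ 'k), 'k::finite) kgraph" where
  "Omega = \<lparr>mor = {(m, n). m \<le> n}, src = (\<lambda>(m, n). (n, n)), rng = (\<lambda>(m, n). (m, m)),
     cmp = (\<lambda>(m, n) (n', p). (m, p)), deg = (\<lambda>(m, n). n - m)\<rparr>"

type_synonym ('l, 'k) ipath = "(nat ^ 'k) \<times> (nat ^ 'k) \<Rightarrow> 'l"

text \<open>
  Infinite paths are extensional on \<^term>\<open>mor Omega\<close>, so that equality of infinite paths is
  equality of HOL functions.
\<close>

definition inf_paths :: "('l, 'k::finite) kgraph \<Rightarrow> ('l, 'k) ipath set" where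
  "inf_paths G = {x \<in> mor Omega \<rightarrow>\<^sub>E mor G.
     (\<forall>a \<in> mor Omega. x (src Omega a) = src G (x a) \<and> x (rng Omega a) = rng G (x a) \<and>
        deg G (x a) = deg Omega a) \<and>
     (\<forall>a \<in> mor Omega. \<forall>b \<in> mor Omega. src Omega a = rng Omega b \<longrightarrow>
        x (cmp Omega a b) = cmp G (x a) (x b))}"

definition shift :: "nat ^ 'k::finite \<Rightarrow> ('l, 'k) ipath \<Rightarrow> ('l, 'k) ipath" where
  "shift p x = restrict (\<lambda>(m, n). x (m + p, n + p)) (mor Omega)"

definition prepend :: "('l, 'k::finite) kgraph \<Rightarrow> 'l \<Rightarrow> ('l, 'k) ipath \<Rightarrow> ('l, 'k) ipath" where
  "prepend G a x = (THE y. y \<in> inf_paths G \<and> y (0, deg G a) = a \<and> shift (deg G a) y = x)"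

definition shift_tail_class :: "('l, 'k::finite) kgraph \<Rightarrow> ('l, 'k) ipath \<Rightarrow> ('l, 'k) ipath set" where
  "shift_tail_class G x = {prepend G a (shift m x) | a m. a \<in> mor G \<and> src G a = x (m, m)}"


subsection \<open>Maximal tails and periodicity\<close>

definition maximal_tail :: "('l, 'k::finite) kgraph \<Rightarrow> 'l set \<Rightarrow> bool" where
  "maximal_tail G T \<longleftrightarrow> T \<noteq> {} \<and> T \<subseteq> verts G \<and>
     (\<forall>v1 \<in> T. \<forall>v2 \<in> T. \<exists>w \<in> T. connects G v1 w \<and> connects G v2 w) \<and>
     (\<forall>v \<in> T. \<forall>i. \<exists>a \<in> mor G. rng G a = v \<and> deg G a = axis i 1 \<and> src G a \<in> T) \<and>
     (\<forall>w \<in> T. \<forall>v \<in> verts G. connects G v w \<longrightarrow> v \<in> T)"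

text \<open>\<open>\<Lambda>T\<close>\<close>

definition tail_graph :: "('l, 'k::finite) kgraph \<Rightarrow> 'l set \<Rightarrow> ('l, 'k) kgraph" where
  "tail_graph G T = G\<lparr>mor := {a \<in> mor G. src G a \<in> T}\<rparr>"

definition cofinal_path :: "('l, 'k::finite) kgraph \<Rightarrow> 'l set \<Rightarrow> ('l, 'k) ipath \<Rightarrow> bool" where
  "cofinal_path G T x \<longleftrightarrow> (\<forall>v \<in> T. \<exists>n. connects G v (x (n, n)))"

definition per_equiv :: "('l, 'k::finite) kgraph \<Rightarrow> 'l \<Rightarrow> 'l \<Rightarrow> bool" where
  "per_equiv G a b \<longleftrightarrow> a \<in> mor G \<and> b \<in> mor G \<and> src G a = src G b \<and>
     (\<forall>x \<in> inf_paths G. x (0, 0) = src G a \<longrightarrow> prepend G a x = prepend G b x)"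

definition zvec :: "nat ^ 'k::finite \<Rightarrow> int ^ 'k" where
  "zvec n = (\<chi> i. int (n $ i))"

definition Per :: "('l, 'k::finite) kgraph \<Rightarrow> (int ^ 'k) set" where
  "Per G = {zvec (deg G a) - zvec (deg G b) | a b. per_equiv G a b}"

definition H_Per :: "('l, 'k::finite) kgraph \<Rightarrow> 'l set" where
  "H_Per G = {v \<in> verts G. \<forall>a \<in> mor G. rng G a = v \<longrightarrow>
     (\<forall>m. zvec (deg G a) - zvec m \<in> Per G \<longrightarrow>
        (\<exists>b \<in> mor G. rng G b = v \<and> deg G b = m \<and> per_equiv G a b))}"

text \<open>Characters are extensional on \<open>P\<close>, so that they can be unique.\<close>

definition is_character :: "(int ^ 'k::finite) set \<Rightarrow> (int ^ 'k \<Rightarrow> complex) \<Rightarrow> bool" where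
  "is_character P \<gamma> \<longleftrightarrow> \<gamma> \<in> P \<rightarrow>\<^sub>E sphere 0 1 \<and> (\<forall>g \<in> P. \<forall>h \<in> P. \<gamma> (g + h) = \<gamma> g * \<gamma> h)"

definition torus :: "(complex ^ 'k::finite) set" where
  "torus = {z. \<forall>i. z $ i \<in> sphere 0 1}"

definition zpow :: "complex ^ 'k::finite \<Rightarrow> int ^ 'k \<Rightarrow> complex" where
  "zpow z n = (\<Prod>i\<in>UNIV. (z $ i) powi (n $ i))"


section \<open>C*-algebras\<close>

definition complex_ring :: "complex ring" where
  "complex_ring = \<lparr>carrier = UNIV, mult = (*), one = 1, zero = 0, add = (+)\<rparr>"

lemma cring_complex_ring: "cring complex_ring"
proof (rule cringI)
  show "abelian_group complex_ring"
  proof (rule abelian_groupI)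
    fix x :: complex
    show "\<exists>y\<in>carrier complex_ring. y \<oplus>\<^bsub>complex_ring\<^esub> x = \<zero>\<^bsub>complex_ring\<^esub>"
      by (rule bexI[of _ "- x"]) (auto simp: complex_ring_def)
  qed (auto simp: complex_ring_def)
  show "comm_monoid complex_ring"
    by (rule comm_monoidI) (auto simp: complex_ring_def)
qed (auto simp: complex_ring_def algebra_simps)

text \<open>
  The metric of a norm on a subset of a type; it is cut off outside the carrier because
  \<^locale>\<open>Metric_space\<close> asks for symmetry and nonnegativity on the whole type.
\<close>

definition norm_dist :: "('a, 'm) ring_scheme \<Rightarrow> ('a \<Rightarrow> real) \<Rightarrow> 'a \<Rightarrow> 'a \<Rightarrow> real" where
  "norm_dist V N x y = (if x \<in> carrier V \<and> y \<in> carrier V then N (x \<ominus>\<^bsub>V\<^esub> y) else 0)"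

text \<open>
  C*-algebras need not be unital: the field \<open>one\<close>, inherited from the record of modules
  in HOL-Algebra, plays no role.
\<close>

record 'a cstar = "(complex, 'a) Module.module" +
  star :: "'a \<Rightarrow> 'a"
  nrm :: "'a \<Rightarrow> real"

locale cstar_algebra = Module.module complex_ring A for A :: "'a cstar" (structure) +
  assumes mult_closed: "\<lbrakk>x \<in> carrier A; y \<in> carrier A\<rbrakk> \<Longrightarrow> x \<otimes> y \<in> carrier A"
    and mult_assoc: "\<lbrakk>x \<in> carrier A; y \<in> carrier A; z \<in> carrier A\<rbrakk> \<Longrightarrow> (x \<otimes> y) \<otimes> z = x \<otimes> (y \<otimes> z)"
    and mult_l_distr: "\<lbrakk>x \<in> carrier A; y \<in> carrier A; z \<in> carrier A\<rbrakk> \<Longrightarrow> (x \<oplus> y) \<otimes> z = x \<otimes> z \<oplus> y \<otimes> z"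
    and mult_r_distr: "\<lbrakk>x \<in> carrier A; y \<in> carrier A; z \<in> carrier A\<rbrakk> \<Longrightarrow> z \<otimes> (x \<oplus> y) = z \<otimes> x \<oplus> z \<otimes> y"
    and smult_mult_l: "\<lbrakk>x \<in> carrier A; y \<in> carrier A\<rbrakk> \<Longrightarrow> (c \<odot> x) \<otimes> y = c \<odot> (x \<otimes> y)"
    and smult_mult_r: "\<lbrakk>x \<in> carrier A; y \<in> carrier A\<rbrakk> \<Longrightarrow> x \<otimes> (c \<odot> y) = c \<odot> (x \<otimes> y)"
    and star_closed: "x \<in> carrier A \<Longrightarrow> star A x \<in> carrier A"
    and star_star: "x \<in> carrier A \<Longrightarrow> star A (star A x) = x"
    and star_add: "\<lbrakk>x \<in> carrier A; y \<in> carrier A\<rbrakk> \<Longrightarrow> star A (x \<oplus> y) = star A x \<oplus> star A y"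
    and star_smult: "x \<in> carrier A \<Longrightarrow> star A (c \<odot> x) = cnj c \<odot> star A x"
    and star_mult: "\<lbrakk>x \<in> carrier A; y \<in> carrier A\<rbrakk> \<Longrightarrow> star A (x \<otimes> y) = star A y \<otimes> star A x"
    and nrm_nonneg: "x \<in> carrier A \<Longrightarrow> 0 \<le> nrm A x"
    and nrm_eq_0: "x \<in> carrier A \<Longrightarrow> nrm A x = 0 \<longleftrightarrow> x = \<zero>"
    and nrm_triangle: "\<lbrakk>x \<in> carrier A; y \<in> carrier A\<rbrakk> \<Longrightarrow> nrm A (x \<oplus> y) \<le> nrm A x + nrm A y"
    and nrm_smult: "x \<in> carrier A \<Longrightarrow> nrm A (c \<odot> x) = cmod c * nrm A x"
    and nrm_mult: "\<lbrakk>x \<in> carrier A; y \<in> carrier A\<rbrakk> \<Longrightarrow> nrm A (x \<otimes> y) \<le> nrm A x * nrm A y"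
    and cstar_identity: "x \<in> carrier A \<Longrightarrow> nrm A (star A x \<otimes> x) = (nrm A x)\<^sup>2"
    and complete: "Metric_space.mcomplete (carrier A) (norm_dist A (nrm A))"

definition star_hom :: "'a cstar \<Rightarrow> 'b cstar \<Rightarrow> ('a \<Rightarrow> 'b) \<Rightarrow> bool" where
  "star_hom A B \<phi> \<longleftrightarrow> \<phi> \<in> carrier A \<rightarrow> carrier B \<and>
     (\<forall>x \<in> carrier A. \<forall>y \<in> carrier A. \<phi> (x \<oplus>\<^bsub>A\<^esub> y) = \<phi> x \<oplus>\<^bsub>B\<^esub> \<phi> y \<and> \<phi> (x \<otimes>\<^bsub>A\<^esub> y) = \<phi> x \<otimes>\<^bsub>B\<^esub> \<phi> y) \<and>
     (\<forall>c. \<forall>x \<in> carrier A. \<phi> (c \<odot>\<^bsub>A\<^esub> x) = c \<odot>\<^bsub>B\<^esub> \<phi> x) \<and>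
     (\<forall>x \<in> carrier A. \<phi> (star A x) = star B (\<phi> x))"

definition cstar_subalgebra :: "'a cstar \<Rightarrow> 'a set \<Rightarrow> bool" where
  "cstar_subalgebra A S \<longleftrightarrow> submodule S complex_ring A \<and>
     (\<forall>x \<in> S. \<forall>y \<in> S. x \<otimes>\<^bsub>A\<^esub> y \<in> S) \<and> (\<forall>x \<in> S. star A x \<in> S) \<and>
     closedin (Metric_space.mtopology (carrier A) (norm_dist A (nrm A))) S"


subsection \<open>Hilbert spaces and their bounded operators\<close>

text \<open>
  Inner products are linear in the first variable. As in any module of HOL-Algebra, the
  fields \<open>mult\<close> and \<open>one\<close> of the record play no role.
\<close>

record 'h hilbert = "(complex, 'h) Module.module" +
  inprod :: "'h \<Rightarrow> 'h \<Rightarrow> complex"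

definition hnorm :: "'h hilbert \<Rightarrow> 'h \<Rightarrow> real" where
  "hnorm H x = sqrt (Re (inprod H x x))"

locale hilbert_space = Module.module complex_ring H for H :: "'h hilbert" (structure) +
  assumes inprod_add: "\<lbrakk>x \<in> carrier H; y \<in> carrier H; z \<in> carrier H\<rbrakk>
        \<Longrightarrow> inprod H (x \<oplus> y) z = inprod H x z + inprod H y z"
    and inprod_smult: "\<lbrakk>x \<in> carrier H; y \<in> carrier H\<rbrakk> \<Longrightarrow> inprod H (c \<odot> x) y = c * inprod H x y"
    and inprod_cnj: "\<lbrakk>x \<in> carrier H; y \<in> carrier H\<rbrakk> \<Longrightarrow> inprod H y x = cnj (inprod H x y)"
    and inprod_nonneg: "x \<in> carrier H \<Longrightarrow> 0 \<le> Re (inprod H x x)"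
    and inprod_eq_0: "\<lbrakk>x \<in> carrier H; inprod H x x = 0\<rbrakk> \<Longrightarrow> x = \<zero>"
    and complete: "Metric_space.mcomplete (carrier H) (norm_dist H (hnorm H))"

text \<open>\<open>\<B>(H)\<close>; operators are extensional on the carrier of \<open>H\<close>.\<close>

definition bounded_ops :: "'h hilbert \<Rightarrow> ('h \<Rightarrow> 'h) cstar" where
  "bounded_ops H = \<lparr>
     carrier = {S \<in> carrier H \<rightarrow>\<^sub>E carrier H.
       (\<forall>x \<in> carrier H. \<forall>y \<in> carrier H. S (x \<oplus>\<^bsub>H\<^esub> y) = S x \<oplus>\<^bsub>H\<^esub> S y) \<and>
       (\<forall>c. \<forall>x \<in> carrier H. S (c \<odot>\<^bsub>H\<^esub> x) = c \<odot>\<^bsub>H\<^esub> S x) \<and>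
       (\<exists>C. \<forall>x \<in> carrier H. hnorm H (S x) \<le> C * hnorm H x)},
     mult = (\<lambda>S R. compose (carrier H) S R),
     one = (\<lambda>x \<in> carrier H. x),
     zero = (\<lambda>x \<in> carrier H. \<zero>\<^bsub>H\<^esub>),
     add = (\<lambda>S R. \<lambda>x \<in> carrier H. S x \<oplus>\<^bsub>H\<^esub> R x),
     smult = (\<lambda>c S. \<lambda>x \<in> carrier H. c \<odot>\<^bsub>H\<^esub> S x),
     star = (\<lambda>S. THE R. R \<in> carrier H \<rightarrow>\<^sub>E carrier H \<and>
       (\<forall>x \<in> carrier H. \<forall>y \<in> carrier H. inprod H (S x) y = inprod H x (R y))),
     nrm = (\<lambda>S. SUP x \<in> {x \<in> carrier H. hnorm H x \<le> 1}. hnorm H (S x))\<rparr>"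

definition ell2 :: "'i set \<Rightarrow> ('i \<Rightarrow> complex) hilbert" where
  "ell2 X = \<lparr>
     carrier = {f. (\<forall>i. i \<notin> X \<longrightarrow> f i = 0) \<and> (\<lambda>i. (cmod (f i))\<^sup>2) summable_on X},
     mult = undefined,
     one = undefined,
     zero = (\<lambda>i. 0),
     add = (\<lambda>f g i. f i + g i),
     smult = (\<lambda>c f i. c * f i),
     inprod = (\<lambda>f g. \<Sum>\<^sub>\<infinity>i\<in>X. f i * cnj (g i))\<rparr>"

definition basis_vec :: "'i \<Rightarrow> 'i \<Rightarrow> complex" where
  "basis_vec i = (\<lambda>j. if j = i then 1 else 0)"


subsection \<open>Representations and primitive ideals\<close>

definition representation :: "'a cstar \<Rightarrow> 'h hilbert \<Rightarrow> ('a \<Rightarrow> 'h \<Rightarrow> 'h) \<Rightarrow> bool" where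
  "representation A H \<pi> \<longleftrightarrow> hilbert_space H \<and> star_hom A (bounded_ops H) \<pi>"

text \<open>Irreducible representations are required to be nonzero.\<close>

definition irreducible_rep :: "'a cstar \<Rightarrow> 'h hilbert \<Rightarrow> ('a \<Rightarrow> 'h \<Rightarrow> 'h) \<Rightarrow> bool" where
  "irreducible_rep A H \<pi> \<longleftrightarrow> representation A H \<pi> \<and>
     (\<exists>a \<in> carrier A. \<pi> a \<noteq> \<zero>\<^bsub>bounded_ops H\<^esub>) \<and>
     (\<forall>K. submodule K complex_ring H \<and>
          closedin (Metric_space.mtopology (carrier H) (norm_dist H (hnorm H))) K \<and>
          (\<forall>a \<in> carrier A. \<forall>x \<in> K. \<pi> a x \<in> K) \<longrightarrow>
        K = {\<zero>\<^bsub>H\<^esub>} \<or> K = carrier H)"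

text \<open>
  The type argument is the type in which the Hilbert space lives. A primitivity hypothesis
  should be stated for an arbitrary type; it then covers all Hilbert spaces.
\<close>

definition primitive_ideal :: "'h itself \<Rightarrow> 'a cstar \<Rightarrow> 'a set \<Rightarrow> bool" where
  "primitive_ideal _ A I \<longleftrightarrow>
     (\<exists>(H :: 'h hilbert) \<pi>. irreducible_rep A H \<pi> \<and> I = a_kernel A (bounded_ops H) \<pi>)"


section \<open>The C*-algebra of a higher-rank graph\<close>

definition ck_family :: "('l, 'k::finite) kgraph \<Rightarrow> 'a cstar \<Rightarrow> ('l \<Rightarrow> 'a) \<Rightarrow> bool" where
  "ck_family G A s \<longleftrightarrow> s \<in> mor G \<rightarrow> carrier A \<and>
     (\<forall>v \<in> verts G. star A (s v) = s v \<and> s v \<otimes>\<^bsub>A\<^esub> s v = s v) \<and>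
     (\<forall>v \<in> verts G. \<forall>w \<in> verts G. v \<noteq> w \<longrightarrow> s v \<otimes>\<^bsub>A\<^esub> s w = \<zero>\<^bsub>A\<^esub>) \<and>
     (\<forall>a \<in> mor G. \<forall>b \<in> mor G. src G a = rng G b \<longrightarrow> s a \<otimes>\<^bsub>A\<^esub> s b = s (cmp G a b)) \<and>
     (\<forall>a \<in> mor G. star A (s a) \<otimes>\<^bsub>A\<^esub> s a = s (src G a)) \<and>
     (\<forall>v \<in> verts G. \<forall>n.
        s v = (\<Oplus>\<^bsub>A\<^esub>a \<in> {a \<in> mor G. rng G a = v \<and> deg G a = n}. s a \<otimes>\<^bsub>A\<^esub> star A (s a)))"

text \<open>
  \<open>(A, s)\<close> is the universal C*-algebra generated by a family satisfying the relations. HOL cannot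
  quantify over all types inside a formula, so the target \<open>B\<close> ranges over all C*-algebras whose
  underlying set is contained in one fixed type. This loses nothing: replacing \<open>B\<close> by the
  C*-subalgebra generated by the countable family \<open>t\<close>, one may assume that \<open>B\<close> is separable, hence
  has at most continuum many elements, and the type used here has at least continuum many, so that
  an isomorphic copy of \<open>B\<close> lives in it. (The type is that of the elements of \<open>\<B>(\<ell>\<^sup>2(X))\<close>
  for sets \<open>X\<close> of infinite paths.) Uniqueness of \<open>\<phi>\<close> is a consequence of generation.
\<close>

definition graph_algebra :: "('l, 'k::finite) kgraph \<Rightarrow> 'a cstar \<Rightarrow> ('l \<Rightarrow> 'a) \<Rightarrow> bool" where
  "graph_algebra G A s \<longleftrightarrow> cstar_algebra A \<and> ck_family G A s \<and>
     (\<forall>S. cstar_subalgebra A S \<and> s ` mor G \<subseteq> S \<longrightarrow> S = carrier A) \<and>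
     (\<forall>(B :: ((('l, 'k) ipath \<Rightarrow> complex) \<Rightarrow> ('l, 'k) ipath \<Rightarrow> complex) cstar) t.
        cstar_algebra B \<and> ck_family G B t \<longrightarrow>
        (\<exists>\<phi>. star_hom A B \<phi> \<and> (\<forall>a \<in> mor G. \<phi> (s a) = t a)))"

text \<open>\<open>\<pi>\<close> is a representation on \<open>\<ell>\<^sup>2([x])\<close> acting on the generators as \<open>\<pi>\<^bsub>[x],z\<^esub>\<close> does.\<close>

definition is_path_rep ::
  "('l, 'k::finite) kgraph \<Rightarrow> 'a cstar \<Rightarrow> ('l \<Rightarrow> 'a) \<Rightarrow> ('l, 'k) ipath \<Rightarrow> complex ^ 'k \<Rightarrow>
     ('a \<Rightarrow> (('l, 'k) ipath \<Rightarrow> complex) \<Rightarrow> ('l, 'k) ipath \<Rightarrow> complex) \<Rightarrow> bool" where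
  "is_path_rep G A s x z \<pi> \<longleftrightarrow>
     (let H = ell2 (shift_tail_class G x) in
       representation A H \<pi> \<and>
       (\<forall>a \<in> mor G. \<forall>y \<in> shift_tail_class G x.
          \<pi> (s a) (basis_vec y) =
            (if y (0, 0) = src G a
             then zpow z (zvec (deg G a)) \<odot>\<^bsub>H\<^esub> basis_vec (prepend G a y)
             else \<zero>\<^bsub>H\<^esub>)))"

text \<open>\<open>\<gamma>\<close> is a character of \<open>Per(\<Lambda>T)\<close> with \<open>s\<^sub>\<mu> - \<gamma>(d(\<mu>) - d(\<nu>))s\<^sub>\<nu> \<in> I\<close> for all \<open>\<mu> \<sim> \<nu>\<close> in \<open>H\<Lambda>T\<close>, where
  \<open>H = H\<^bsub>Per\<^esub>(\<Lambda>T)\<close>.\<close>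

definition ideal_character ::
  "('l, 'k::finite) kgraph \<Rightarrow> 'a cstar \<Rightarrow> ('l \<Rightarrow> 'a) \<Rightarrow> 'a set \<Rightarrow> 'l set \<Rightarrow> (int ^ 'k \<Rightarrow> complex) \<Rightarrow> bool" where
  "ideal_character G A s I T \<gamma> \<longleftrightarrow>
     (let HGT = {a \<in> mor G. rng G a \<in> H_Per (tail_graph G T) \<and> src G a \<in> T} in
       is_character (Per (tail_graph G T)) \<gamma> \<and>
       (\<forall>\<mu> \<in> HGT. \<forall>\<nu> \<in> HGT. per_equiv (tail_graph G T) \<mu> \<nu> \<longrightarrow>
          s \<mu> \<ominus>\<^bsub>A\<^esub> \<gamma> (zvec (deg G \<mu>) - zvec (deg G \<nu>)) \<odot>\<^bsub>A\<^esub> s \<nu> \<in> I))"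

end

theory Submission
  imports Defs
begin

text \<open>
  Weighted shifts on \<open>\<ell>\<^sup>2([x])\<close> form a Cuntz--Krieger family (\<open>path_op_ck_family\<close>); universality gives the path
  representation and generation its uniqueness. The projections \<open>s\<^sub>b s\<^sub>b\<^sup>*\<close>, for the initial segments \<open>b\<close> of a path \<open>y\<close>,
  decrease to the projection onto the line through \<open>\<xi>\<^sub>y\<close> (\<open>initial_projections_tend\<close>). A nonzero closed invariant
  subspace therefore contains a basis vector, and then all of them, since two paths in \<open>[x]\<close> have a common tail.

  Let \<open>I\<close> be the kernel of an irreducible representation. It is a prime ideal, whence \<open>T\<close> is a maximal tail
  (\<open>T_maximal_tail\<close>). If \<open>\<mu> \<sim> \<nu>\<close>, then \<open>s\<^sub>\<nu>\<^sup>* s\<^sub>\<mu>\<close> replaces a long path \<open>e\<close> by an equivalent one; therefore it commutes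
  modulo \<open>I\<close> with the corner at \<open>s(\<mu>)\<close> (\<open>shifter_commutes\<close>), which acts irreducibly, and is a scalar by Schur's lemma.
  The scalar depends only on \<open>d(\<mu>) - d(\<nu>)\<close> because equivalent paths of the same degree are equal, and applying two
  such elements one after the other to the same path shows that it is multiplicative. The character so obtained is the
  only one because \<open>H\<^bsub>Per\<^esub>\<close> is not empty (\<open>H_Per_nonempty\<close>): by Dickson's lemma the periods are generated by finitely many
  pairs of degrees, and by directedness some vertex realises all of these by equivalent paths.

  For the kernels, call a C*-seminorm adapted if it vanishes at \<open>s\<^sub>v\<close> exactly for \<open>v \<notin> T\<close> and respects the relations
  given by \<open>\<gamma>\<close>; the norms of both representations are adapted. Adapted seminorms agree on the corner at a vertex \<open>v\<close>
  of \<open>H\<^bsub>Per\<^esub>\<close> (\<open>corner_unique\<close>), and since the kernels are prime, this suffices for them to be equal (\<open>kernel_subset\<close>). On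
  the corner, a combination of terms \<open>s\<^sub>a s\<^sub>b\<^sup>*\<close> with \<open>d(a) - d(b)\<close> in the periodicity group can be brought into a form
  where all degrees are equal; such elements form a sum of matrix algebras, on which an adapted seminorm is determined
  (\<open>core_eq\<close>). Terms of other degrees are killed by compressing to projections that commute with the matrix algebra,
  one for each of its summands, and together these compressions are isometric there (\<open>compress_le\<close>). So the part of \<open>x\<close> belonging to one class of degrees modulo
  the periodicity group is not larger than \<open>x\<close>, and two adapted seminorms of \<open>x\<close> differ at most by a factor, the number of
  classes. For the \<open>2\<^sup>n\<close>-th power of \<open>x\<^sup>*x\<close> this number grows polynomially in \<open>2\<^sup>n\<close>, so by the C*-identity the factor
  disappears (\<open>span_le\<close>). This counting takes the place of a conditional expectation onto the core.

  Positivity enters through one iteration (\<open>quasi_sqrt\<close>), which gives square roots without a unit and without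
  spectral theory, hence the contractivity of representations and Schur's lemma; that projections with sum a projection
  are orthogonal is derived from norm estimates alone (\<open>orthogonal_of_sum_proj\<close>).
\<close>

section \<open>Factorisation in a higher-rank graph\<close>

lemma vec_le_iff: "(m :: nat ^ 'k::finite) \<le> n \<longleftrightarrow> (\<forall>i. m $ i \<le> n $ i)"
  by (simp add: less_eq_vec_def)

lemma vec_le_add [simp]: "(m :: nat ^ 'k::finite) \<le> m + n" "m \<le> n + m" "0 \<le> m"
  by (simp_all add: vec_le_iff)

lemma vec_add_diff [simp]: "(m :: nat ^ 'k::finite) \<le> n \<Longrightarrow> m + (n - m) = n" "m \<le> n \<Longrightarrow> (n - m) + m = n"
  by (simp_all add: vec_le_iff vec_eq_iff)

lemma vec_diff_add [simp]: "(m + n :: nat ^ 'k::finite) - m = n" "(n + m :: nat ^ 'k::finite) - m = n"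
  by (simp_all add: vec_eq_iff)

lemma vec_add_le_mono [simp]: "(m + p \<le> n + (p :: nat ^ 'k::finite)) \<longleftrightarrow> m \<le> n"
    "(p + m \<le> p + (n :: nat ^ 'k::finite)) \<longleftrightarrow> m \<le> n"
  by (simp_all add: vec_le_iff)

context k_graph
begin

abbreviation cmpG (infixl "\<cdot>" 70) where "a \<cdot> b \<equiv> cmp G a b"

declare src_mor [simp, intro] rng_mor [simp, intro] src_src [simp] rng_src [simp] src_rng [simp] rng_rng [simp]
  cmp_mor [simp, intro] src_cmp [simp] rng_cmp [simp] cmp_rng [simp] cmp_src [simp] deg_src [simp] deg_cmp [simp]

lemma deg_rng [simp]: "a \<in> mor G \<Longrightarrow> deg G (rng G a) = 0"
  using deg_src[of "rng G a"] by simp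

lemma vertsD: "v \<in> verts G \<Longrightarrow> v \<in> mor G \<and> src G v = v \<and> rng G v = v \<and> deg G v = 0"
  unfolding verts_def by (metis (mono_tags, lifting) deg_src mem_Collect_eq rng_src)

lemma src_verts [simp, intro]: "a \<in> mor G \<Longrightarrow> src G a \<in> verts G"
  and rng_verts [simp, intro]: "a \<in> mor G \<Longrightarrow> rng G a \<in> verts G"
  by (simp_all add: verts_def)

lemma factor_unique:
  assumes "b \<in> mor G" "c \<in> mor G" "src G b = rng G c" "b' \<in> mor G" "c' \<in> mor G" "src G b' = rng G c'"
    and "deg G b = deg G b'" "b \<cdot> c = b' \<cdot> c'"
  shows "b = b'" "c = c'"
proof -
  have "deg G b + deg G c = deg G b' + deg G c'"
    using deg_cmp[OF assms(1-3)] deg_cmp[OF assms(4-6)] assms(8) by metis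
  then have d: "deg G c = deg G c'" using assms(7) by simp
  have "\<exists>!(x, y). x \<in> mor G \<and> y \<in> mor G \<and> src G x = rng G y \<and>
          deg G x = deg G b \<and> deg G y = deg G c \<and> b \<cdot> c = x \<cdot> y"
    by (rule factorisation[OF cmp_mor[OF assms(1-3)] deg_cmp[OF assms(1-3)]])
  then have "(b, c) = (b', c')"
    using assms d by (elim ex1E) (metis (mono_tags, lifting) case_prodI)
  then show "b = b'" "c = c'" by auto
qed

text \<open>The segments \<open>\<lambda>(0, n)\<close> and \<open>\<lambda>(n, d(\<lambda>))\<close> of a path \<open>\<lambda>\<close>, for \<open>n \<le> d(\<lambda>)\<close>.\<close>

definition ini :: "nat ^ 'k \<Rightarrow> 'l \<Rightarrow> 'l" where
  "ini n a = (THE b. \<exists>c. b \<in> mor G \<and> c \<in> mor G \<and> src G b = rng G c \<and> deg G b = n \<and> a = b \<cdot> c)"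

definition fin :: "nat ^ 'k \<Rightarrow> 'l \<Rightarrow> 'l" where
  "fin n a = (THE c. \<exists>b. b \<in> mor G \<and> c \<in> mor G \<and> src G b = rng G c \<and> deg G b = n \<and> a = b \<cdot> c)"

lemma ini_cmp_deg [simp]:
  assumes "a \<in> mor G" "b \<in> mor G" "src G a = rng G b"
  shows "ini (deg G a) (a \<cdot> b) = a" "fin (deg G a) (a \<cdot> b) = b"
proof -
  show "ini (deg G a) (a \<cdot> b) = a"
    unfolding ini_def
  proof (rule the_equality)
    show "\<exists>c. a \<in> mor G \<and> c \<in> mor G \<and> src G a = rng G c \<and> deg G a = deg G a \<and> a \<cdot> b = a \<cdot> c"
      using assms by (intro exI[of _ b]) simp
  next
    fix b'
    assume "\<exists>c. b' \<in> mor G \<and> c \<in> mor G \<and> src G b' = rng G c \<and> deg G b' = deg G a \<and> a \<cdot> b = b' \<cdot> c"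
    then show "b' = a" using factor_unique(1)[OF assms] by metis
  qed
  show "fin (deg G a) (a \<cdot> b) = b"
    unfolding fin_def
  proof (rule the_equality)
    show "\<exists>a'. a' \<in> mor G \<and> b \<in> mor G \<and> src G a' = rng G b \<and> deg G a' = deg G a \<and> a \<cdot> b = a' \<cdot> b"
      using assms by (intro exI[of _ a]) simp
  next
    fix c'
    assume "\<exists>a'. a' \<in> mor G \<and> c' \<in> mor G \<and> src G a' = rng G c' \<and> deg G a' = deg G a \<and> a \<cdot> b = a' \<cdot> c'"
    then show "c' = b" using factor_unique(2)[OF assms] by metis
  qed
qed

lemma ini_fin:
  assumes "a \<in> mor G" "n \<le> deg G a"
  shows "ini n a \<in> mor G" "fin n a \<in> mor G" "src G (ini n a) = rng G (fin n a)"
    "deg G (ini n a) = n" "deg G (fin n a) = deg G a - n" "ini n a \<cdot> fin n a = a"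
    "rng G (ini n a) = rng G a" "src G (fin n a) = src G a"
proof -
  have "deg G a = n + (deg G a - n)" using assms by simp
  from factorisation[OF assms(1) this] obtain b c where *: "b \<in> mor G" "c \<in> mor G" "src G b = rng G c"
    "deg G b = n" "deg G c = deg G a - n" "a = b \<cdot> c" by auto
  then have "ini n a = b" "fin n a = c" using ini_cmp_deg by auto
  with * show "ini n a \<in> mor G" "fin n a \<in> mor G" "src G (ini n a) = rng G (fin n a)"
    "deg G (ini n a) = n" "deg G (fin n a) = deg G a - n" "ini n a \<cdot> fin n a = a"
    "rng G (ini n a) = rng G a" "src G (fin n a) = src G a"  by auto
qed

lemma ini_eqI:
  assumes "b \<in> mor G" "c \<in> mor G" "src G b = rng G c" "deg G b = n" "a = b \<cdot> c"
  shows "ini n a = b" "fin n a = c"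
  using assms by auto

lemma ini_cmp:
  assumes "a \<in> mor G" "b \<in> mor G" "src G a = rng G b" "n \<le> deg G a"
  shows "ini n (a \<cdot> b) = ini n a"
proof (rule ini_eqI(1))
  have f: "src G (fin n a) = rng G b" using ini_fin[OF assms(1,4)] assms by simp
  show "a \<cdot> b = ini n a \<cdot> (fin n a \<cdot> b)"
    using ini_fin[OF assms(1,4)] assms cmp_assoc[of "ini n a" "fin n a" b] f by simp
qed (use ini_fin[OF assms(1,4)] assms in auto)

lemma ini_ini:
  assumes "a \<in> mor G" "m \<le> n" "n \<le> deg G a"
  shows "ini m (ini n a) = ini m a"
  using ini_cmp[of "ini n a" "fin n a" m] ini_fin[OF assms(1,3)] assms by simp

lemma ini_deg [simp]: "a \<in> mor G \<Longrightarrow> ini (deg G a) a = a"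
  using ini_cmp_deg(1)[of a "src G a"] by simp

lemma fin_deg [simp]: "a \<in> mor G \<Longrightarrow> fin (deg G a) a = src G a"
  using ini_cmp_deg(2)[of a "src G a"] by simp

lemma ini_0 [simp]: "a \<in> mor G \<Longrightarrow> ini 0 a = rng G a"
  using ini_eqI(1)[of "rng G a" a 0 a] by simp

lemma fin_0 [simp]: "a \<in> mor G \<Longrightarrow> fin 0 a = a"
  using ini_eqI(2)[of "rng G a" a 0 a] by simp


section \<open>Infinite paths\<close>

lemma inf_pathD:
  assumes "x \<in> inf_paths G" "m \<le> n"
  shows "x (m, n) \<in> mor G" "deg G (x (m, n)) = n - m" "rng G (x (m, n)) = x (m, m)" "src G (x (m, n)) = x (n, n)"
proof -
  have mn: "(m, n) \<in> mor Omega" using assms(2) by (simp add: Omega_def)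
  show "x (m, n) \<in> mor G"
    using assms mn unfolding inf_paths_def by blast
  have "\<forall>a \<in> mor Omega. x (src Omega a) = src G (x a) \<and> x (rng Omega a) = rng G (x a) \<and> deg G (x a) = deg Omega a"
    using assms unfolding inf_paths_def by simp
  from bspec[OF this mn]
  show "deg G (x (m, n)) = n - m" "rng G (x (m, n)) = x (m, m)" "src G (x (m, n)) = x (n, n)"
    by (simp_all add: Omega_def)
qed

lemma inf_path_cmp:
  assumes "x \<in> inf_paths G" "m \<le> n" "n \<le> p"
  shows "x (m, n) \<cdot> x (n, p) = x (m, p)"
proof -
  have "\<forall>a \<in> mor Omega. \<forall>b \<in> mor Omega. src Omega a = rng Omega b \<longrightarrow>
        x (cmp Omega a b) = x a \<cdot> x b"
    using assms unfolding inf_paths_def by simp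
  then have "(m, n) \<in> mor Omega \<Longrightarrow> (n, p) \<in> mor Omega \<Longrightarrow> src Omega (m, n) = rng Omega (n, p) \<Longrightarrow>
     x (cmp Omega (m, n) (n, p)) = x (m, n) \<cdot> x (n, p)" by blast
  then show ?thesis using assms by (simp add: Omega_def)
qed

lemma inf_path_vertex [simp]: "x \<in> inf_paths G \<Longrightarrow> x (n, n) \<in> verts G"
  using inf_pathD(1,4)[of x n n] by (auto simp: verts_def)

lemma inf_path_ini: "x \<in> inf_paths G \<Longrightarrow> m \<le> n \<Longrightarrow> ini m (x (0, n)) = x (0, m) \<and> fin m (x (0, n)) = x (m, n)"
  using ini_eqI[of "x (0, m)" "x (m, n)" m "x (0, n)"] inf_pathD[of x 0 m] inf_pathD[of x m n] inf_path_cmp[of x 0 m n]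
  by simp

lemma inf_path_ext:
  assumes "x \<in> inf_paths G" "y \<in> inf_paths G" "\<And>n. \<exists>N\<ge>n. x (0, N) = y (0, N)"
  shows "x = y"
proof
  fix a :: "(nat ^ 'k) \<times> (nat ^ 'k)"
  obtain m n where a: "a = (m, n)" by force
  show "x a = y a"
  proof (cases "m \<le> n")
    case True
    obtain N where N: "N \<ge> n" "x (0, N) = y (0, N)" using assms(3) by blast
    have "x (0, n) = y (0, n)" using N inf_path_ini[of x n N] inf_path_ini[of y n N] assms by metis
    then show ?thesis using True a inf_path_ini[of x m n] inf_path_ini[of y m n] assms by metis
  next
    case False
    then have "a \<notin> mor Omega" using a by (simp add: Omega_def)
    then show ?thesis using assms unfolding inf_paths_def by (metis (mono_tags, lifting) PiE_arb mem_Collect_eq)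
  qed
qed

text \<open>Infinite paths are the same thing as coherent families of initial segments.\<close>

lemma inf_path_of_initials:
  assumes a: "\<And>n. a n \<in> mor G" "\<And>n. deg G (a n) = n" "\<And>m n. m \<le> n \<Longrightarrow> ini m (a n) = a m"
  shows "\<exists>x \<in> inf_paths G. \<forall>n. x (0, n) = a n"
proof -
  define x where "x = restrict (\<lambda>(m, n). fin m (a n)) (mor Omega)"
  have x: "x (m, n) = fin m (a n)" if "m \<le> n" for m n using that by (simp add: x_def Omega_def)
  have f: "fin m (a n) \<in> mor G" "src G (a m) = rng G (fin m (a n))" "deg G (fin m (a n)) = n - m"
      "src G (fin m (a n)) = src G (a n)" "a m \<cdot> fin m (a n) = a n" if "m \<le> n" for m n
    using ini_fin[of "a n" m] a that by simp_all
  have fnn: "fin n (a n) = src G (a n)" for n using fin_deg[of "a n"] a by simp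
  have c: "fin m (a n) \<cdot> fin n (a p) = fin m (a p)" if "m \<le> n" "n \<le> p" for m n p
  proof -
    have mp: "m \<le> p" using that by simp
    have "a m \<cdot> (fin m (a n) \<cdot> fin n (a p)) = a m \<cdot> fin m (a p)"
      using f[OF that(1)] f[OF that(2)] f[OF mp] cmp_assoc[of "a m" "fin m (a n)" "fin n (a p)"] a by simp
    then show ?thesis
      using factor_unique(2)[of "a m" "fin m (a n) \<cdot> fin n (a p)" "a m" "fin m (a p)"] f[OF that(1)] f[OF that(2)] f[OF mp] a
      by simp
  qed
  have "x \<in> inf_paths G"
    unfolding inf_paths_def
  proof (intro CollectI conjI ballI impI)
    show "x \<in> mor Omega \<rightarrow>\<^sub>E mor G" using f by (auto simp: x_def Omega_def)
  next
    fix e assume "e \<in> mor (Omega :: ((nat ^ 'k) \<times> (nat ^ 'k), 'k) kgraph)"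
    then obtain m n where e: "e = (m, n)" "m \<le> n" by (auto simp: Omega_def)
    then show "x (src Omega e) = src G (x e)" "x (rng Omega e) = rng G (x e)" "deg G (x e) = deg Omega e"
      using f[OF e(2)] fnn by (simp_all add: x) (simp_all add: Omega_def x)
  next
    fix e e' assume "e \<in> mor (Omega :: ((nat ^ 'k) \<times> (nat ^ 'k), 'k) kgraph)"
      "e' \<in> mor (Omega :: ((nat ^ 'k) \<times> (nat ^ 'k), 'k) kgraph)" "src Omega e = rng Omega e'"
    then obtain m n p where e: "e = (m, n)" "m \<le> n" "e' = (n, p)" "n \<le> p" by (auto simp: Omega_def)
    then have "m \<le> p" by simp
    then show "x (cmp Omega e e') = x e \<cdot> x e'" using e c[OF e(2,4)] by (simp add: x) (simp add: Omega_def x)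
  qed
  moreover have "x (0, n) = a n" for n
    using a(1) by (simp add: x)
  ultimately show ?thesis by blast
qed

lemma shift_apply: "m \<le> n \<Longrightarrow> shift p x (m, n) = x (m + p, n + p)"
  by (simp add: shift_def Omega_def)

lemma shift_inf_path [simp, intro]:
  assumes "x \<in> inf_paths G" shows "shift p x \<in> inf_paths G"
proof -
  have "\<exists>y \<in> inf_paths G. \<forall>n. y (0, n) = x (p, n + p)"
  proof (rule inf_path_of_initials)
    fix m n :: "nat ^ 'k"
    show "x (p, n + p) \<in> mor G" "deg G (x (p, n + p)) = n" using inf_pathD[OF assms, of p "n + p"] by simp_all
    assume "m \<le> n"
    then show "ini m (x (p, n + p)) = x (p, m + p)"
      using inf_path_cmp[OF assms, of p "m + p" "n + p"] inf_pathD[OF assms, of p "m + p"] inf_pathD[OF assms, of "m + p" "n + p"]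
        ini_cmp_deg(1)[of "x (p, m + p)" "x (m + p, n + p)"] by simp
  qed
  then obtain y where y: "y \<in> inf_paths G" "\<And>n. y (0, n) = x (p, n + p)" by blast
  have "shift p x = y"
  proof
    fix a :: "(nat ^ 'k) \<times> (nat ^ 'k)"
    obtain m n where a: "a = (m, n)" by force
    show "shift p x a = y a"
    proof (cases "m \<le> n")
      case True
      have "y (m, n) = x (m + p, n + p)"
      proof (rule factor_unique(2)[of "y (0, m)" _ "x (p, m + p)"])
        show "y (0, m) \<cdot> y (m, n) = x (p, m + p) \<cdot> x (m + p, n + p)"
          using inf_path_cmp[OF y(1), of 0 m n] inf_path_cmp[OF assms, of p "m + p" "n + p"] True y(2) by simp
      qed (use inf_pathD[OF assms, of p "m + p"] inf_pathD[OF assms, of "m + p" "n + p"] inf_pathD[OF y(1), of 0 m]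
           inf_pathD[OF y(1), of m n] True in simp_all)
      then show ?thesis using True a by (simp add: shift_apply)
    next
      case False
      then have "a \<notin> mor Omega" using a by (simp add: Omega_def)
      moreover have "y a = undefined" using y(1) \<open>a \<notin> mor Omega\<close> unfolding inf_paths_def
        by (metis (mono_tags, lifting) PiE_arb mem_Collect_eq)
      ultimately show ?thesis by (simp add: shift_def)
    qed
  qed
  then show ?thesis using y by simp
qed

lemma shift_shift [simp]: "x \<in> inf_paths G \<Longrightarrow> shift p (shift q x) = shift (p + q) x"
  by (rule inf_path_ext) (auto simp: shift_apply add_ac)

lemma shift_0 [simp]: "x \<in> inf_paths G \<Longrightarrow> shift 0 x = x"
  by (rule inf_path_ext) (auto simp: shift_apply)

lemma shift_initial: "shift p x (0, n) = x (p, n + p)" "shift p x (n, n) = x (n + p, n + p)"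
  by (simp_all add: shift_apply)

lemma inf_path_eqI_shift:
  assumes "x \<in> inf_paths G" "y \<in> inf_paths G" "x (0, p) = y (0, p)" "shift p x = shift p y"
  shows "x = y"
proof (rule inf_path_ext[OF assms(1,2)])
  fix n
  have "x (p, n + p) = y (p, n + p)" using assms(4) by (metis shift_initial(1))
  then have "x (0, n + p) = y (0, n + p)"
    using assms inf_path_cmp[of x 0 p "n + p"] inf_path_cmp[of y 0 p "n + p"] by simp
  then show "\<exists>N\<ge>n. x (0, N) = y (0, N)" by (meson vec_le_add(1))
qed

lemma prepend_ex1:
  assumes "a \<in> mor G" "x \<in> inf_paths G" "x (0, 0) = src G a"
  shows "\<exists>!y. y \<in> inf_paths G \<and> y (0, deg G a) = a \<and> shift (deg G a) y = x"
proof (rule ex_ex1I)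
  note x = inf_pathD[OF assms(2)]
  have ax: "a \<cdot> x (0, n) \<in> mor G" "deg G (a \<cdot> x (0, n)) = deg G a + n" for n using x[of 0 n] assms by simp_all
  have *: "ini m (a \<cdot> x (0, n)) = ini m (a \<cdot> x (0, m'))" if "m \<le> deg G a + m'" "m' \<le> n" for m m' n
  proof -
    have "a \<cdot> x (0, n) = (a \<cdot> x (0, m')) \<cdot> x (m', n)"
      using cmp_assoc[of a "x (0, m')" "x (m', n)"] x[of 0 m'] x[of m' n] that assms inf_path_cmp[OF assms(2), of 0 m' n]
      by simp
    then show ?thesis using ini_cmp[of "a \<cdot> x (0, m')" "x (m', n)" m] that assms x[of 0 m'] x[of m' n] by simp
  qed
  have "\<exists>y \<in> inf_paths G. \<forall>n. y (0, n) = ini n (a \<cdot> x (0, n))"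
  proof (rule inf_path_of_initials)
    fix m n :: "nat ^ 'k"
    show "ini n (a \<cdot> x (0, n)) \<in> mor G" "deg G (ini n (a \<cdot> x (0, n))) = n"
      using ini_fin[of "a \<cdot> x (0, n)" n] ax[of n] by simp_all
    assume "m \<le> n"
    then show "ini m (ini n (a \<cdot> x (0, n))) = ini m (a \<cdot> x (0, m))"
      using ini_ini[OF ax(1), of m n n] ax(2)[of n] *[of m m n] by simp
  qed
  then obtain y where y: "y \<in> inf_paths G" "\<And>n. y (0, n) = ini n (a \<cdot> x (0, n))" by blast
  have y1: "y (0, deg G a) = a" using y(2)[of "deg G a"] assms x[of 0 "deg G a"] by simp
  have y2: "y (0, n + deg G a) = a \<cdot> x (0, n)" for n
    using y(2)[of "n + deg G a"] *[of "n + deg G a" n "n + deg G a"] ini_deg[OF ax(1), of n] ax(2)[of n] by (simp add: add_ac)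
  have "shift (deg G a) y = x"
  proof (rule inf_path_ext)
    fix n
    have "y (deg G a, n + deg G a) = x (0, n)"
    proof (rule factor_unique(2)[of a _ a])
      show "a \<cdot> y (deg G a, n + deg G a) = a \<cdot> x (0, n)"
        using inf_path_cmp[OF y(1), of 0 "deg G a" "n + deg G a"] y1 y2 by simp
      show "src G a = rng G (y (deg G a, n + deg G a))"
        using inf_pathD[OF y(1), of 0 "deg G a"] inf_pathD[OF y(1), of "deg G a" "n + deg G a"] y1 by simp
    qed (use assms x[of 0 n] inf_pathD[OF y(1), of "deg G a" "n + deg G a"] in simp_all)
    then show "\<exists>N\<ge>n. shift (deg G a) y (0, N) = x (0, N)" by (auto simp: shift_initial)
  qed (use y assms in auto)
  then show "\<exists>y. y \<in> inf_paths G \<and> y (0, deg G a) = a \<and> shift (deg G a) y = x" using y y1 by blast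
next
  fix y y' assume "y \<in> inf_paths G \<and> y (0, deg G a) = a \<and> shift (deg G a) y = x"
    "y' \<in> inf_paths G \<and> y' (0, deg G a) = a \<and> shift (deg G a) y' = x"
  then show "y = y'" using inf_path_eqI_shift[of y y' "deg G a"] by simp
qed

lemma prepend:
  assumes "a \<in> mor G" "x \<in> inf_paths G" "x (0, 0) = src G a"
  shows "prepend G a x \<in> inf_paths G" "prepend G a x (0, deg G a) = a" "shift (deg G a) (prepend G a x) = x"
    "prepend G a x (0, 0) = rng G a" "prepend G a x (0, n + deg G a) = a \<cdot> x (0, n)"
proof -
  have *: "prepend G a x \<in> inf_paths G \<and> prepend G a x (0, deg G a) = a \<and> shift (deg G a) (prepend G a x) = x"
    unfolding prepend_def by (rule theI'[OF prepend_ex1[OF assms]])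
  then show p: "prepend G a x \<in> inf_paths G" "prepend G a x (0, deg G a) = a" "shift (deg G a) (prepend G a x) = x" by auto
  show "prepend G a x (0, 0) = rng G a" using inf_pathD(3)[OF p(1), of 0 "deg G a"] p(2) by simp
  show "prepend G a x (0, n + deg G a) = a \<cdot> x (0, n)"
    using inf_path_cmp[OF p(1), of 0 "deg G a" "n + deg G a"] p(2,3) shift_initial(1)[of "deg G a" "prepend G a x" n] by simp
qed

lemma prepend_eqI:
  assumes "y \<in> inf_paths G" "y (0, deg G a) = a" "shift (deg G a) y = x"
  shows "prepend G a x = y"
proof -
  have "a \<in> mor G" using inf_pathD(1)[OF assms(1), of 0 "deg G a"] assms by simp
  moreover have "x \<in> inf_paths G" using assms by auto
  moreover have "x (0, 0) = src G a" using inf_pathD(4)[OF assms(1), of 0 "deg G a"] assms shift_initial(2)[of "deg G a" y 0] by simp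
  ultimately show ?thesis using prepend(1-3)[of a x] inf_path_eqI_shift[of "prepend G a x" y "deg G a"] assms by simp
qed

lemma prepend_split: "y \<in> inf_paths G \<Longrightarrow> prepend G (y (0, n)) (shift n y) = y"
  using prepend_eqI[of y "y (0, n)"] inf_pathD(2)[of y 0 n] by simp

lemma prepend_vertex: "x \<in> inf_paths G \<Longrightarrow> prepend G (x (0, 0)) x = x"
  using prepend_split[of x 0] by simp

lemma prepend_cmp:
  assumes "a \<in> mor G" "b \<in> mor G" "src G a = rng G b" "x \<in> inf_paths G" "x (0, 0) = src G b"
  shows "prepend G (a \<cdot> b) x = prepend G a (prepend G b x)"
proof (rule prepend_eqI)
  note b = prepend[OF assms(2,4,5)]
  note a = prepend[OF assms(1) b(1)]
  have c: "prepend G b x (0, 0) = src G a" using b assms by simp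
  show "prepend G a (prepend G b x) \<in> inf_paths G" using a c by simp
  show "prepend G a (prepend G b x) (0, deg G (a \<cdot> b)) = a \<cdot> b"
    using a(5)[OF c, of "deg G b"] b assms by (simp add: add_ac)
  show "shift (deg G (a \<cdot> b)) (prepend G a (prepend G b x)) = x"
    using shift_shift[OF a(1)[OF c], of "deg G b" "deg G a"] a(3)[OF c] b assms by (simp add: add_ac)
qed

end

section \<open>Dickson's lemma\<close>

text \<open>One coordinate at a time: there is a monotone subsequence, and a decreasing one is eventually constant.\<close>

lemma common_mono_subseq:
  fixes f :: "nat \<Rightarrow> 'i \<Rightarrow> nat"
  assumes "finite I"
  shows "\<exists>r :: nat \<Rightarrow> nat. strict_mono r \<and> (\<forall>i \<in> I. mono (\<lambda>n. f (r n) i))"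
  using assms
proof induction
  case empty
  show ?case using strict_mono_id by auto
next
  case (insert j I)
  then obtain r :: "nat \<Rightarrow> nat" where r: "strict_mono r" "\<forall>i \<in> I. mono (\<lambda>n. f (r n) i)" by blast
  obtain q :: "nat \<Rightarrow> nat" where q: "strict_mono q" "monoseq (\<lambda>n. f (r (q n)) j)"
    using seq_monosub[of "\<lambda>n. f (r n) j"] by blast
  have "\<exists>q' :: nat \<Rightarrow> nat. strict_mono q' \<and> mono (\<lambda>n. f (r (q' n)) j)"
  proof (cases "mono (\<lambda>n. f (r (q n)) j)")
    case True then show ?thesis using q by blast
  next
    case False
    then have dec: "decseq (\<lambda>n. f (r (q n)) j)" using q(2) by (simp add: monoseq_iff)
    define c where "c = (LEAST c. c \<in> range (\<lambda>n. f (r (q n)) j))"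
    have "c \<in> range (\<lambda>n. f (r (q n)) j)" unfolding c_def by (rule LeastI[of _ "f (r (q 0)) j"]) simp
    then obtain N where N: "f (r (q N)) j = c" by auto
    have "f (r (q (n + N))) j = c" for n
    proof (rule antisym)
      show "f (r (q (n + N))) j \<le> c" using decseqD[OF dec, of N "n + N"] N by simp
      show "c \<le> f (r (q (n + N))) j" unfolding c_def by (rule Least_le) simp
    qed
    then show ?thesis using q(1) by (intro exI[of _ "\<lambda>n. q (n + N)"]) (auto simp: strict_mono_def mono_def)
  qed
  then obtain q' :: "nat \<Rightarrow> nat" where q': "strict_mono q'" "mono (\<lambda>n. f (r (q' n)) j)" by blast
  have "strict_mono (\<lambda>n. r (q' n))" using strict_mono_o[OF r(1) q'(1)] by (simp add: o_def)
  moreover have "mono (\<lambda>n. f (r (q' n)) i)" if "i \<in> I" for i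
    using r(2) that q'(1) by (simp add: mono_def strict_mono_less_eq)
  ultimately show ?case using q'(2) by (intro exI[of _ "\<lambda>n. r (q' n)"]) auto
qed

text \<open>The differences of a set \<open>M\<close> of vectors are only required to stay in \<open>M\<close> when they are nonnegative:
  this is the situation of the nonnegative part of a subgroup, whose minimal nonzero elements are
  finite in number because they are pairwise incomparable.\<close>

lemma finitely_generated_of_diff_closed:
  fixes M :: "(nat ^ 'j::finite) set"
  assumes diff: "\<And>a b. a \<in> M \<Longrightarrow> b \<in> M \<Longrightarrow> a \<le> b \<Longrightarrow> b - a \<in> M"
  shows "\<exists>F \<subseteq> M. finite F \<and>
    (\<forall>P. P 0 \<longrightarrow> (\<forall>a \<in> F. P a) \<longrightarrow> (\<forall>a b. P a \<longrightarrow> P b \<longrightarrow> P (a + b)) \<longrightarrow> (\<forall>a \<in> M. P a))"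
proof -
  define F where "F = {a \<in> M. a \<noteq> 0 \<and> (\<forall>b \<in> M. b \<noteq> 0 \<longrightarrow> b \<le> a \<longrightarrow> b = a)}"
  have "finite F"
  proof (rule ccontr)
    assume "infinite F"
    then obtain f :: "nat \<Rightarrow> nat ^ 'j" where f: "inj f" "range f \<subseteq> F"
      using infinite_countable_subset by blast
    obtain r :: "nat \<Rightarrow> nat" where r: "strict_mono r" "\<forall>i \<in> UNIV. mono (\<lambda>n. f (r n) $ i)"
      using common_mono_subseq[of UNIV "\<lambda>n i. f n $ i"] by auto
    have "f (r 0) \<le> f (r 1)" using r(2) by (auto simp: vec_le_iff mono_def)
    moreover have "f (r 0) \<in> F" "f (r 1) \<in> F" using f(2) by auto
    ultimately have "f (r 0) = f (r 1)" by (auto simp: F_def)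
    then have "r 0 = r 1" using f(1) by (simp add: inj_eq)
    then show False using r(1) by (simp add: strict_mono_eq)
  qed
  moreover have "F \<subseteq> M" by (auto simp: F_def)
  moreover have gen: "P a" if P: "P 0" "\<And>a. a \<in> F \<Longrightarrow> P a" "\<And>a b. P a \<Longrightarrow> P b \<Longrightarrow> P (a + b)" and "a \<in> M"
    for P and a :: "nat ^ 'j"
    using \<open>a \<in> M\<close>
  proof (induction "\<Sum>i\<in>UNIV. a $ i" arbitrary: a rule: less_induct)
    case less
    have smaller: "(\<Sum>i\<in>UNIV. (a - b) $ i) < (\<Sum>i\<in>UNIV. a $ i)" "(\<Sum>i\<in>UNIV. b $ i) < (\<Sum>i\<in>UNIV. a $ i)"
      if "b \<le> a" "b \<noteq> 0" "b \<noteq> a" for b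
    proof -
      obtain i where "b $ i \<noteq> 0" using \<open>b \<noteq> 0\<close> by (auto simp: vec_eq_iff)
      then show "(\<Sum>i\<in>UNIV. (a - b) $ i) < (\<Sum>i\<in>UNIV. a $ i)"
        using that(1) by (intro sum_strict_mono_ex1) (auto simp: vec_le_iff intro!: exI[of _ i] diff_less le_trans[of _ "b $ i"] dest: spec[of _ i])
      obtain i where "b $ i \<noteq> a $ i" using \<open>b \<noteq> a\<close> by (auto simp: vec_eq_iff)
      then show "(\<Sum>i\<in>UNIV. b $ i) < (\<Sum>i\<in>UNIV. a $ i)"
        using that(1) by (intro sum_strict_mono_ex1) (auto simp: vec_le_iff intro!: exI[of _ i] le_neq_trans)
    qed
    show ?case
    proof (cases "a = 0 \<or> a \<in> F")
      case True then show ?thesis using P by auto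
    next
      case False
      then obtain b where b: "b \<in> M" "b \<noteq> 0" "b \<le> a" "b \<noteq> a" using less.prems by (auto simp: F_def)
      then have "P b" "P (a - b)" using less.hyps[OF smaller(2)] less.hyps[OF smaller(1)] diff[OF b(1) less.prems b(3)] by blast+
      then show ?thesis using P(3)[of b "a - b"] b(3) by simp
    qed
  qed
  moreover have "\<forall>P. P 0 \<longrightarrow> (\<forall>a \<in> F. P a) \<longrightarrow> (\<forall>a b. P a \<longrightarrow> P b \<longrightarrow> P (a + b)) \<longrightarrow> (\<forall>a \<in> M. P a)"
    by (intro allI impI ballI) (rule gen; blast)
  ultimately show ?thesis by blast
qed


section \<open>Periodicity\<close>

lemma connectsI: "a \<in> mor G \<Longrightarrow> connects G (rng G a) (src G a)"
  by (auto simp: connects_def)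

lemma zvec_simps [simp]: "zvec 0 = 0" "zvec (m + n) = zvec m + zvec n"
  by (simp_all add: zvec_def vec_eq_iff)

lemma zvec_diff_eq: "zvec m - zvec n = zvec m' - zvec n' \<longleftrightarrow> m + n' = m' + n"
proof -
  have "int a - int b = int c - int d \<longleftrightarrow> a + d = c + b" for a b c d by linarith
  then show ?thesis by (simp add: zvec_def vec_eq_iff)
qed

lemma zvec_surj: "\<exists>m n. g = zvec m - zvec n"
proof (intro exI)
  show "g = zvec (\<chi> i. nat (g $ i)) - zvec (\<chi> i. nat (- (g $ i)))"
    by (auto simp: zvec_def vec_eq_iff)
qed

locale rf_k_graph = k_graph G for G :: "('l, 'k::finite) kgraph" +
  assumes rfns: "row_finite_no_sources G"
begin

lemma ex_path: "v \<in> verts G \<Longrightarrow> \<exists>a \<in> mor G. rng G a = v \<and> deg G a = n"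
  and finite_paths: "v \<in> verts G \<Longrightarrow> finite {a \<in> mor G. rng G a = v \<and> deg G a = n}"
  using rfns unfolding row_finite_no_sources_def by blast+

text \<open>Concatenating paths of degree \<open>(1, \<dots>, 1)\<close> suffices, as their degrees are cofinal in \<open>\<nat>\<^sup>k\<close>.\<close>

lemma ex_inf_path:
  assumes "v \<in> verts G"
  shows "\<exists>x \<in> inf_paths G. x (0, 0) = v"
proof -
  define e where "e u = (SOME e. e \<in> mor G \<and> rng G e = u \<and> deg G e = 1)" for u
  have e: "e u \<in> mor G \<and> rng G (e u) = u \<and> deg G (e u) = 1" if "u \<in> verts G" for u
    unfolding e_def by (rule someI_ex) (use ex_path[OF that] in blast)
  define f where "f = rec_nat v (\<lambda>N p. p \<cdot> e (src G p))"
  have f_simps: "f 0 = v" "f (Suc N) = f N \<cdot> e (src G (f N))" for N by (simp_all add: f_def)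
  define c :: "nat \<Rightarrow> nat ^ 'k" where "c N = (\<chi> i. N)" for N
  have f: "f N \<in> mor G \<and> rng G (f N) = v \<and> deg G (f N) = c N" for N
  proof (induction N)
    case 0 show ?case using vertsD[OF assms] by (simp add: f_simps c_def vec_eq_iff)
  next
    case (Suc N)
    then have "src G (f N) \<in> verts G" by simp
    from e[OF this] show ?case using Suc by (simp add: f_simps c_def vec_eq_iff)
  qed
  have ext: "ini (c M) (f (M + N)) = f M" for M N
  proof (induction N)
    case 0 show ?case using f[of M] ini_deg[of "f M"] by simp
  next
    case (Suc N)
    have "src G (f (M + N)) \<in> verts G" using f by simp
    from e[OF this] show ?case using Suc f[of "M + N"]
      by (simp add: f_simps ini_cmp) (simp add: ini_cmp c_def vec_le_iff)
  qed
  define N where "N n = (\<Sum>i\<in>UNIV. n $ i)" for n :: "nat ^ 'k"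
  have N: "n \<le> c (N n)" for n by (simp add: N_def c_def vec_le_iff member_le_sum)
  have N_mono: "N m \<le> N n" if "m \<le> n" for m n using that by (simp add: N_def vec_le_iff sum_mono)
  have "\<exists>x \<in> inf_paths G. \<forall>n. x (0, n) = ini n (f (N n))"
  proof (rule inf_path_of_initials)
    fix m n
    show "ini n (f (N n)) \<in> mor G" "deg G (ini n (f (N n))) = n" using ini_fin[of "f (N n)" n] f N by simp_all
    assume mn: "m \<le> n"
    have "ini m (ini n (f (N n))) = ini m (f (N n))" using ini_ini[of "f (N n)" m n] f N mn by simp
    also have "\<dots> = ini m (ini (c (N m)) (f (N n)))"
      using ini_ini[of "f (N n)" m "c (N m)"] f[of "N n"] N N_mono[OF mn] by (simp add: c_def vec_le_iff)
    also have "\<dots> = ini m (f (N m))" using ext[of "N m" "N n - N m"] N_mono[OF mn] by simp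
    finally show "ini m (ini n (f (N n))) = ini m (f (N m))" .
  qed
  then obtain x where x: "x \<in> inf_paths G" "\<And>n. x (0, n) = ini n (f (N n))" by blast
  have "x (0, 0) = v" using x(2)[of 0] f[of "N 0"] ini_0[of "f (N 0)"] by simp
  then show ?thesis using x by blast
qed

abbreviation dd :: "'l \<Rightarrow> 'l \<Rightarrow> int ^ 'k" where "dd a b \<equiv> zvec (deg G a) - zvec (deg G b)"

lemma per_equivD: "per_equiv G a b \<Longrightarrow> a \<in> mor G" "per_equiv G a b \<Longrightarrow> b \<in> mor G" "per_equiv G a b \<Longrightarrow> src G b = src G a"
  "per_equiv G a b \<Longrightarrow> x \<in> inf_paths G \<Longrightarrow> x (0, 0) = src G a \<Longrightarrow> prepend G a x = prepend G b x"
  unfolding per_equiv_def by auto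

lemma per_equiv_refl: "a \<in> mor G \<Longrightarrow> per_equiv G a a"
  and per_equiv_sym: "per_equiv G a b \<Longrightarrow> per_equiv G b a"
  and per_equiv_trans: "per_equiv G a b \<Longrightarrow> per_equiv G b c \<Longrightarrow> per_equiv G a c"
  unfolding per_equiv_def by auto

lemma per_equiv_rng: assumes "per_equiv G a b" shows "rng G b = rng G a"
proof -
  note D = per_equivD[OF assms]
  obtain x where "x \<in> inf_paths G" "x (0, 0) = src G a" using ex_inf_path[of "src G a"] D by auto
  then show ?thesis using D prepend(4)[of a x] prepend(4)[of b x] by simp
qed

lemma per_equiv_left:
  assumes "per_equiv G a b" "c \<in> mor G" "src G c = rng G a"
  shows "per_equiv G (c \<cdot> a) (c \<cdot> b)"
  using assms per_equivD[OF assms(1)] per_equiv_rng[OF assms(1)] prepend_cmp[of c a] prepend_cmp[of c b]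
  unfolding per_equiv_def[of G "c \<cdot> a"] by simp

lemma per_equiv_right:
  assumes "per_equiv G a b" "c \<in> mor G" "src G a = rng G c"
  shows "per_equiv G (a \<cdot> c) (b \<cdot> c)"
  using assms per_equivD[OF assms(1)] prepend_cmp[of a c] prepend_cmp[of b c] prepend[of c]
  unfolding per_equiv_def[of G "a \<cdot> c"] by simp

lemma per_equiv_deg_eq:
  assumes "per_equiv G a b" "deg G a = deg G b" shows "a = b"
proof -
  note D = per_equivD[OF assms(1)]
  obtain x where "x \<in> inf_paths G" "x (0, 0) = src G a" using ex_inf_path[of "src G a"] D by auto
  then show ?thesis using D prepend(2)[of a x] prepend(2)[of b x] assms(2) by metis
qed

text \<open>Compare, in the equal paths \<open>cax\<close> and \<open>dx\<close>, the initial segments of degree \<open>d(c)\<close> and what follows them.\<close>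

lemma per_equiv_left_cancel:
  assumes "per_equiv G (c \<cdot> a) d" "c \<in> mor G" "a \<in> mor G" "src G c = rng G a" "deg G c \<le> deg G d"
  obtains b where "b \<in> mor G" "src G c = rng G b" "d = c \<cdot> b" "per_equiv G a b"
proof -
  note D = per_equivD[OF assms(1)]
  note i = ini_fin[OF D(2) assms(5)]
  define b where "b = fin (deg G c) d"
  have *: "ini (deg G c) d = c \<and> prepend G a x = prepend G b x" if x: "x \<in> inf_paths G" "x (0, 0) = src G a" for x
  proof -
    have xb: "x (0, 0) = src G b" using x i D assms by (simp add: b_def)
    note pa = prepend[OF assms(3) x]
    have "b \<in> mor G" "rng G b = src G (ini (deg G c) d)" using i by (simp_all add: b_def)
    note pb = prepend[OF this(1) x(1) xb]
    have cc: "prepend G a x (0, 0) = src G c" using pa assms by simp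
    have dd: "prepend G b x (0, 0) = src G (ini (deg G c) d)" using pb \<open>rng G b = _\<close> by simp
    have "prepend G (c \<cdot> a) x = prepend G d x" using D(4)[OF x(1)] x assms by simp
    also have "\<dots> = prepend G (ini (deg G c) d \<cdot> b) x" using i by (simp add: b_def)
    also have "\<dots> = prepend G (ini (deg G c) d) (prepend G b x)"
      using prepend_cmp[OF i(1) \<open>b \<in> mor G\<close> _ x(1) xb] \<open>rng G b = _\<close> by simp
    finally have eq: "prepend G c (prepend G a x) = prepend G (ini (deg G c) d) (prepend G b x)"
      using prepend_cmp[OF assms(2,3,4) x] by simp
    have "c = ini (deg G c) d" using prepend(2)[OF assms(2) pa(1) cc] prepend(2)[OF i(1) pb(1) dd] eq i(4) by simp
    moreover have "prepend G a x = prepend G b x"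
      using prepend(3)[OF assms(2) pa(1) cc] prepend(3)[OF i(1) pb(1) dd] eq i(4) by simp
    ultimately show ?thesis by simp
  qed
  obtain x where "x \<in> inf_paths G" "x (0, 0) = src G a" using ex_inf_path[of "src G a"] assms by auto
  then have "ini (deg G c) d = c" using * by blast
  moreover have "per_equiv G a b"
    unfolding per_equiv_def
  proof (intro conjI ballI impI)
    show "src G a = src G b" using D(3) i(8) assms by (simp add: b_def)
  qed (use * i assms in \<open>auto simp: b_def\<close>)
  ultimately show ?thesis using that[of b] i(2,3,6) unfolding b_def by metis
qed

text \<open>In contrast to equivalence, \<open>\<sigma>\<^sup>m = \<sigma>\<^sup>n\<close> on \<open>v\<Lambda>\<^sup>\<infinity>\<close> involves degrees only, so it can be translated, cancelled and moved to
  vertices reached from \<open>v\<close>.\<close>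

definition sync :: "nat ^ 'k \<Rightarrow> nat ^ 'k \<Rightarrow> 'l \<Rightarrow> bool" where
  "sync m n v \<longleftrightarrow> (\<forall>x \<in> inf_paths G. x (0, 0) = v \<longrightarrow> shift m x = shift n x)"

lemma sync_desc:
  assumes "sync m n (rng G a)" "a \<in> mor G" shows "sync m n (src G a)"
  unfolding sync_def
proof (intro ballI impI)
  fix y assume y: "y \<in> inf_paths G" "y (0, 0) = src G a"
  note p = prepend[OF assms(2) y]
  have "shift m (prepend G a y) = shift n (prepend G a y)" using assms p unfolding sync_def by blast
  then have "shift (deg G a) (shift m (prepend G a y)) = shift (deg G a) (shift n (prepend G a y))" by simp
  then have "shift m (shift (deg G a) (prepend G a y)) = shift n (shift (deg G a) (prepend G a y))"
    using p(1) by (simp add: add.commute)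
  then show "shift m y = shift n y" using p(3) by simp
qed

lemma per_equiv_sync:
  assumes "per_equiv G a b" shows "sync (deg G a) (deg G b) (src G a)"
  unfolding sync_def
proof (intro ballI impI)
  fix y assume y: "y \<in> inf_paths G" "y (0, 0) = src G a"
  note D = per_equivD[OF assms]
  note pa = prepend[OF D(1) y]
  have yb: "y (0, 0) = src G b" using y D by simp
  note pb = prepend[OF D(2) y(1) yb]
  have "shift (deg G a) (shift (deg G b) (prepend G b y)) = shift (deg G b) (shift (deg G a) (prepend G a y))"
    using pa(1) D(4)[OF y] by (simp add: add.commute)
  then show "shift (deg G a) y = shift (deg G b) y" using pa(3) pb(3) by simp
qed

text \<open>If \<open>\<sigma>\<^sup>m = \<sigma>\<^sup>n\<close> on \<open>v\<Lambda>\<^sup>\<infinity>\<close>, then, for \<open>X = lay\<close> with \<open>y\<close> arbitrary, \<open>\<sigma>\<^sup>n(X) = ay\<close> and \<open>\<sigma>\<^sup>m(X) = by\<close> where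
  \<open>b\<close> is cut out of \<open>la\<close> and so does not depend on \<open>y\<close>. One step of length \<open>n\<close> away from \<open>v\<close> the path
  \<open>b\<close> equivalent to \<open>a\<close> can therefore be chosen uniformly in \<open>y\<close>, which need not be possible at \<open>v\<close>.\<close>

lemma sync_match:
  assumes "sync m n (rng G l)" "l \<in> mor G" "deg G l = n" "a \<in> mor G" "rng G a = src G l" "deg G a = m"
  obtains b where "b \<in> mor G" "deg G b = n" "per_equiv G a b"
proof -
  define c b where "c = ini m (l \<cdot> a)" and "b = fin m (l \<cdot> a)"
  have la: "l \<cdot> a \<in> mor G" "m \<le> deg G (l \<cdot> a)" using assms by simp_all
  have cb: "c \<in> mor G" "b \<in> mor G" "src G c = rng G b" "deg G c = m" "deg G b = n" "c \<cdot> b = l \<cdot> a" "rng G c = rng G l" "src G b = src G a"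
    using ini_fin[OF la] assms by (simp_all add: c_def b_def)
  have "prepend G a y = prepend G b y" if y: "y \<in> inf_paths G" "y (0, 0) = src G a" for y
  proof -
    have y': "y (0, 0) = src G b" using y cb by simp
    note pa = prepend[OF assms(4) y] and pb = prepend[OF cb(2) y(1) y']
    have X: "prepend G l (prepend G a y) = prepend G c (prepend G b y)"
      using prepend_cmp[OF assms(2,4) assms(5)[symmetric] y] prepend_cmp[OF cb(1,2,3) y(1) y'] cb by simp
    have la: "prepend G a y (0, 0) = src G l" using pa assms by simp
    have cb': "prepend G b y (0, 0) = src G c" using pb cb by simp
    have "shift m (prepend G l (prepend G a y)) = shift n (prepend G l (prepend G a y))"
      using assms(1) prepend[OF assms(2) pa(1) la] unfolding sync_def by simp
    then show ?thesis
      using prepend(3)[OF assms(2) pa(1) la] prepend(3)[OF cb(1) pb(1) cb'] X cb assms by simp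
  qed
  then have "per_equiv G a b" using cb assms by (simp add: per_equiv_def)
  then show ?thesis using that cb by blast
qed

lemma sync_add:
  assumes "sync m n v" shows "sync (m + p) (n + p) v"
  unfolding sync_def
proof (intro ballI impI)
  fix x assume x: "x \<in> inf_paths G" "x (0, 0) = v"
  have "shift p (shift m x) = shift p (shift n x)" using assms x by (simp add: sync_def)
  then show "shift (m + p) x = shift (n + p) x" using x by (simp add: add.commute)
qed

lemma sync_cancel:
  assumes "sync (m + deg G l) (n + deg G l) (rng G l)" "l \<in> mor G" shows "sync m n (src G l)"
  unfolding sync_def
proof (intro ballI impI)
  fix y assume y: "y \<in> inf_paths G" "y (0, 0) = src G l"
  note p = prepend[OF assms(2) y]
  have "shift (m + deg G l) (prepend G l y) = shift (n + deg G l) (prepend G l y)"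
    using assms(1) p by (simp add: sync_def)
  then have "shift m (shift (deg G l) (prepend G l y)) = shift n (shift (deg G l) (prepend G l y))"
    using p(1) by simp
  then show "shift m y = shift n y" using p by simp
qed

lemma Per_iff_sync: "g \<in> Per G \<longleftrightarrow> (\<exists>v \<in> verts G. \<exists>m n. sync m n v \<and> g = zvec m - zvec n)"
proof
  assume "g \<in> Per G"
  then obtain a b where ab: "per_equiv G a b" "g = dd a b" by (auto simp: Per_def)
  then show "\<exists>v \<in> verts G. \<exists>m n. sync m n v \<and> g = zvec m - zvec n"
    using per_equiv_sync[OF ab(1)] per_equivD[OF ab(1)] by blast
next
  assume "\<exists>v \<in> verts G. \<exists>m n. sync m n v \<and> g = zvec m - zvec n"
  then obtain v m n where v: "v \<in> verts G" "sync m n v" "g = zvec m - zvec n" by blast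
  obtain l where l: "l \<in> mor G" "rng G l = v" "deg G l = n" using ex_path[OF v(1)] by blast
  obtain a where a: "a \<in> mor G" "rng G a = src G l" "deg G a = m" using ex_path[of "src G l" m] l by auto
  obtain b where b: "deg G b = n" "per_equiv G a b" using sync_match[of m n l a] l a v by blast
  then show "g \<in> Per G" using v(3) a(3) unfolding Per_def by blast
qed

lemma Per_sync:
  assumes "zvec m - zvec n \<in> Per G"
  obtains v where "v \<in> verts G" "sync m n v"
proof -
  obtain u m' n' where u: "u \<in> verts G" "sync m' n' u" "zvec m - zvec n = zvec m' - zvec n'"
    using assms unfolding Per_iff_sync by blast
  have e: "m + n' = m' + n" using u(3) zvec_diff_eq by blast
  obtain l where l: "l \<in> mor G" "rng G l = u" "deg G l = n'" using ex_path[OF u(1)] by blast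
  have "sync (m' + n) (n' + n) u" using sync_add[OF u(2)] .
  then have "sync (m + deg G l) (n + deg G l) (rng G l)" using e l by (simp add: add.commute)
  from sync_cancel[OF this l(1)] show ?thesis using that l(1) by blast
qed

lemma Per_0 [simp]: "verts G \<noteq> {} \<Longrightarrow> 0 \<in> Per G"
  unfolding Per_iff_sync by (auto simp: sync_def intro!: exI[of _ 0])

lemma Per_uminus: "g \<in> Per G \<Longrightarrow> - g \<in> Per G"
  unfolding Per_def using per_equiv_sym by (smt (verit, best) mem_Collect_eq minus_diff_eq)

text \<open>The quantifier over \<open>e\<close> makes the property pass to the vertices reached from \<open>u\<close>, and lets two matches be composed.\<close>

definition matches :: "nat ^ 'k \<Rightarrow> nat ^ 'k \<Rightarrow> 'l \<Rightarrow> bool" where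
  "matches m n u \<longleftrightarrow> (\<forall>e \<in> mor G. rng G e = u \<longrightarrow> (\<forall>a \<in> mor G. rng G a = src G e \<and> deg G a = m \<longrightarrow>
     (\<exists>b \<in> mor G. deg G b = n \<and> per_equiv G a b)))"

lemma matches_desc:
  assumes "matches m n (rng G a)" "a \<in> mor G" shows "matches m n (src G a)"
  unfolding matches_def
proof (intro ballI impI)
  fix e c assume *: "e \<in> mor G" "rng G e = src G a" "c \<in> mor G" "rng G c = src G e \<and> deg G c = m"
  then show "\<exists>b\<in>mor G. deg G b = n \<and> per_equiv G c b"
    using assms unfolding matches_def by (metis cmp_mor rng_cmp src_cmp)
qed

lemma ex_matches:
  assumes "zvec m - zvec n \<in> Per G"
  obtains v where "v \<in> verts G" "matches m n v"
proof -
  obtain v where v: "v \<in> verts G" "sync m n v" using Per_sync[OF assms] .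
  obtain l where l: "l \<in> mor G" "rng G l = v" "deg G l = n" using ex_path[OF v(1)] by blast
  have "matches m n (src G l)"
    unfolding matches_def
  proof (intro ballI impI)
    fix e a assume e: "e \<in> mor G" "rng G e = src G l" and a: "a \<in> mor G" "rng G a = src G e \<and> deg G a = m"
    have le: "l \<cdot> e \<in> mor G" "deg G e \<le> deg G (l \<cdot> e)" using l e by simp_all
    define e' l' where "e' = ini (deg G e) (l \<cdot> e)" and "l' = fin (deg G e) (l \<cdot> e)"
    have el: "e' \<in> mor G" "l' \<in> mor G" "src G e' = rng G l'" "deg G l' = n" "rng G e' = v" "src G l' = src G e"
      using ini_fin[OF le] l e by (simp_all add: e'_def l'_def)
    have "sync m n (rng G l')" using sync_desc[of m n e'] v el by simp
    then show "\<exists>b \<in> mor G. deg G b = n \<and> per_equiv G a b" using sync_match[of m n l' a] el a by metis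
  qed
  then show ?thesis using that l by blast
qed

lemma matches_add:
  assumes "matches m n u" "matches m' n' u" shows "matches (m + m') (n + n') u"
  unfolding matches_def
proof (intro ballI impI)
  fix e a assume e: "e \<in> mor G" "rng G e = u" and a: "a \<in> mor G" "rng G a = src G e \<and> deg G a = m + m'"
  have "m \<le> deg G a" using a by simp
  note i = ini_fin[OF a(1) this]
  obtain b where b: "b \<in> mor G" "deg G b = n" "per_equiv G (ini m a) b"
    using assms(1) e a i unfolding matches_def by metis
  have "e \<cdot> ini m a \<in> mor G" "rng G (e \<cdot> ini m a) = u" "rng G (fin m a) = src G (e \<cdot> ini m a)" "deg G (fin m a) = m'"
    using e i a by simp_all
  then obtain b' where b': "b' \<in> mor G" "deg G b' = n'" "per_equiv G (fin m a) b'"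
    using assms(2) i unfolding matches_def by metis
  have sb: "src G b = rng G (fin m a)" using per_equivD(3)[OF b(3)] i by simp
  have "per_equiv G (ini m a \<cdot> fin m a) (b \<cdot> fin m a)" using per_equiv_right[OF b(3) i(2,3)] .
  moreover have "per_equiv G (b \<cdot> fin m a) (b \<cdot> b')" using per_equiv_left[OF b'(3) b(1) sb] .
  ultimately have "per_equiv G a (b \<cdot> b')" using per_equiv_trans i by metis
  moreover have "deg G (b \<cdot> b') = n + n'" using b b' sb per_equiv_rng[OF b'(3)] by simp
  moreover have "b \<cdot> b' \<in> mor G" using b b' sb per_equiv_rng[OF b'(3)] by simp
  ultimately show "\<exists>b \<in> mor G. deg G b = n + n' \<and> per_equiv G a b" by blast
qed

lemma H_Per_I:
  assumes "u \<in> verts G" "\<And>m n. zvec m - zvec n \<in> Per G \<Longrightarrow> matches m n u"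
  shows "u \<in> H_Per G"
  unfolding H_Per_def
proof (intro CollectI conjI ballI impI allI)
  fix a m assume a: "a \<in> mor G" "rng G a = u" "zvec (deg G a) - zvec m \<in> Per G"
  then obtain b where "b \<in> mor G" "deg G b = m" "per_equiv G a b"
    using assms(2)[OF a(3)] vertsD[OF assms(1)] unfolding matches_def by metis
  then show "\<exists>b\<in>mor G. rng G b = u \<and> deg G b = m \<and> per_equiv G a b" using per_equiv_rng a by metis
qed (rule assms)

lemma H_Per_D:
  assumes "v \<in> H_Per G" "a \<in> mor G" "rng G a = v" "zvec (deg G a) - zvec m \<in> Per G"
  obtains b where "b \<in> mor G" "rng G b = v" "deg G b = m" "per_equiv G a b"
  using assms unfolding H_Per_def by blast

lemma H_Per_verts: "v \<in> H_Per G \<Longrightarrow> v \<in> verts G" by (simp add: H_Per_def)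

end

locale directed_k_graph = rf_k_graph G for G :: "('l, 'k::finite) kgraph" +
  assumes nonempty: "verts G \<noteq> {}"
    and directed: "\<lbrakk>v \<in> verts G; w \<in> verts G\<rbrakk> \<Longrightarrow> \<exists>u. connects G v u \<and> connects G w u"
begin

text \<open>Both periods hold at a vertex reached from the two vertices where they are given.\<close>

lemma Per_add:
  assumes "g \<in> Per G" "h \<in> Per G" shows "g + h \<in> Per G"
proof -
  obtain m1 n1 m2 n2 where g: "g = zvec m1 - zvec n1" and h: "h = zvec m2 - zvec n2" using zvec_surj by metis
  have "zvec (m1 + m2) - zvec (n1 + m2) \<in> Per G" "zvec (n1 + m2) - zvec (n1 + n2) \<in> Per G" using assms g h by simp_all
  then obtain v w where v: "v \<in> verts G" "sync (m1 + m2) (n1 + m2) v" and w: "w \<in> verts G" "sync (n1 + m2) (n1 + n2) w"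
    using Per_sync by metis
  obtain u a b where "a \<in> mor G" "b \<in> mor G" "rng G a = v" "rng G b = w" "src G a = u" "src G b = u"
    using directed[OF v(1) w(1)] unfolding connects_def by blast
  then have "sync (m1 + m2) (n1 + m2) u" "sync (n1 + m2) (n1 + n2) u" "u \<in> verts G"
    using sync_desc[of _ _ a] sync_desc[of _ _ b] v(2) w(2) by auto
  then have "sync (m1 + m2) (n1 + n2) u" by (simp add: sync_def)
  then show ?thesis unfolding Per_iff_sync using \<open>u \<in> verts G\<close> g h
    by (intro bexI[of _ u] exI[of _ "m1 + m2"] exI[of _ "n1 + n2"]) (auto simp: algebra_simps)
qed

lemma Per_diff: "g \<in> Per G \<Longrightarrow> h \<in> Per G \<Longrightarrow> g - h \<in> Per G"
  using Per_add[of g "- h"] Per_uminus[of h] by simp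

text \<open>The pairs \<open>(m, n)\<close> with \<open>m - n\<close> in \<open>Per\<close> are the nonnegative part of a group, so finitely many of them generate the
  others under addition. By directedness some vertex matches all the generators, and sums of matching pairs match.\<close>

lemma H_Per_nonempty: "H_Per G \<noteq> {}"
proof -
  \<comment> \<open>a vector with index set \<open>'k + 'k\<close> stands for the pair \<open>(m, n)\<close>\<close>
  define fs :: "nat ^ ('k + 'k) \<Rightarrow> nat ^ 'k" where "fs a = (\<chi> i. a $ Inl i)" for a
  define sn :: "nat ^ ('k + 'k) \<Rightarrow> nat ^ 'k" where "sn a = (\<chi> i. a $ Inr i)" for a
  define M where "M = {a. zvec (fs a) - zvec (sn a) \<in> Per G}"
  have add: "fs (a + b) = fs a + fs b" "sn (a + b) = sn a + sn b" for a b by (simp_all add: fs_def sn_def vec_eq_iff)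
  have diff: "b - a \<in> M" if "a \<in> M" "b \<in> M" "a \<le> b" for a b
  proof -
    have "fs b = fs a + fs (b - a)" "sn b = sn a + sn (b - a)" using add[of a "b - a"] that by simp_all
    then have "zvec (fs (b - a)) - zvec (sn (b - a)) = (zvec (fs b) - zvec (sn b)) - (zvec (fs a) - zvec (sn a))" by simp
    then show ?thesis using that Per_diff by (simp add: M_def)
  qed
  from finitely_generated_of_diff_closed[of M, OF diff] obtain F where F: "F \<subseteq> M" "finite F"
    "\<forall>P. P 0 \<longrightarrow> (\<forall>a \<in> F. P a) \<longrightarrow> (\<forall>a b. P a \<longrightarrow> P b \<longrightarrow> P (a + b)) \<longrightarrow> (\<forall>a \<in> M. P a)" by blast
  have "\<exists>u \<in> verts G. \<forall>a \<in> F. matches (fs a) (sn a) u"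
    using F(2,1)
  proof induction
    case empty show ?case using nonempty by auto
  next
    case (insert a F)
    then obtain u where u: "u \<in> verts G" "\<forall>a \<in> F. matches (fs a) (sn a) u" by auto
    obtain v where v: "v \<in> verts G" "matches (fs a) (sn a) v" using ex_matches insert.prems by (auto simp: M_def)
    obtain c d where cd: "c \<in> mor G" "d \<in> mor G" "rng G c = u" "rng G d = v" "src G c = src G d"
      using directed[OF u(1) v(1)] unfolding connects_def by metis
    have "matches (fs a) (sn a) (src G c)" using matches_desc[of _ _ d] v cd by simp
    moreover have "\<forall>a \<in> F. matches (fs a) (sn a) (src G c)" using matches_desc[of _ _ c] u cd by simp
    ultimately show ?case using cd by blast
  qed
  then obtain u where u: "u \<in> verts G" "\<forall>a \<in> F. matches (fs a) (sn a) u" by blast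
  have "u \<in> H_Per G"
  proof (rule H_Per_I[OF u(1)])
    fix m n assume mn: "zvec m - zvec n \<in> Per G"
    define a :: "nat ^ ('k + 'k)" where "a = (\<chi> i. case_sum (\<lambda>i. m $ i) (\<lambda>i. n $ i) i)"
    have a: "fs a = m" "sn a = n" by (simp_all add: a_def fs_def sn_def vec_eq_iff)
    have "matches (fs 0) (sn 0) u"
      using per_equiv_refl unfolding matches_def by (auto simp: fs_def sn_def vec_eq_iff zero_vec_def)
    moreover have "\<forall>a b. matches (fs a) (sn a) u \<longrightarrow> matches (fs b) (sn b) u \<longrightarrow> matches (fs (a + b)) (sn (a + b)) u"
      using matches_add add by simp
    ultimately have "\<forall>a \<in> M. matches (fs a) (sn a) u"
      using F(3)[THEN spec, of "\<lambda>a. matches (fs a) (sn a) u"] u(2) by blast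
    moreover have "a \<in> M" using mn a by (simp add: M_def)
    ultimately have "matches (fs a) (sn a) u" by blast
    then show "matches m n u" using a by simp
  qed
  then show ?thesis by blast
qed

end

section \<open>Normed groups and C*-algebras given by records\<close>

locale normed_group = abelian_group V for V (structure) +
  fixes N :: "'a \<Rightarrow> real"
  assumes N_nonneg: "x \<in> carrier V \<Longrightarrow> 0 \<le> N x"
    and N_eq_0: "x \<in> carrier V \<Longrightarrow> N x = 0 \<longleftrightarrow> x = \<zero>"
    and N_triangle: "\<lbrakk>x \<in> carrier V; y \<in> carrier V\<rbrakk> \<Longrightarrow> N (x \<oplus> y) \<le> N x + N y"
    and N_uminus: "x \<in> carrier V \<Longrightarrow> N (\<ominus> x) = N x"
begin

lemma diff_add_diff: "\<lbrakk>x \<in> carrier V; y \<in> carrier V; z \<in> carrier V\<rbrakk> \<Longrightarrow> (x \<ominus> y) \<oplus> (y \<ominus> z) = x \<ominus> z"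
  by (simp add: minus_eq a_assoc r_neg1)

lemma add_diff_add: "\<lbrakk>x \<in> carrier V; y \<in> carrier V; z \<in> carrier V; w \<in> carrier V\<rbrakk> \<Longrightarrow>
    (x \<oplus> y) \<ominus> (z \<oplus> w) = (x \<ominus> z) \<oplus> (y \<ominus> w)"
  by (simp add: minus_eq minus_add a_ac)

lemma uminus_diff: "\<lbrakk>x \<in> carrier V; y \<in> carrier V\<rbrakk> \<Longrightarrow> \<ominus> (x \<ominus> y) = y \<ominus> x"
  by (simp add: minus_eq minus_add a_ac)

lemma diff_eq_0: "\<lbrakk>x \<in> carrier V; y \<in> carrier V\<rbrakk> \<Longrightarrow> x \<ominus> y = \<zero> \<longleftrightarrow> x = y"
  by (metis minus_eq minus_equality minus_minus r_neg a_inv_closed)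

lemma diff_0: "x \<in> carrier V \<Longrightarrow> x \<ominus> \<zero> = x"
  using r_neg[of \<zero>] by (simp add: minus_eq)

lemma N_0 [simp]: "N \<zero> = 0" using N_eq_0 by simp

lemma N_diff_sym: "\<lbrakk>x \<in> carrier V; y \<in> carrier V\<rbrakk> \<Longrightarrow> N (x \<ominus> y) = N (y \<ominus> x)"
  using N_uminus[of "x \<ominus> y"] uminus_diff by simp

lemma N_diff_triangle: "\<lbrakk>x \<in> carrier V; y \<in> carrier V; z \<in> carrier V\<rbrakk> \<Longrightarrow> N (x \<ominus> z) \<le> N (x \<ominus> y) + N (y \<ominus> z)"
  using N_triangle[of "x \<ominus> y" "y \<ominus> z"] diff_add_diff by simp

lemma N_le_diff: "\<lbrakk>x \<in> carrier V; y \<in> carrier V\<rbrakk> \<Longrightarrow> N x \<le> N y + N (x \<ominus> y)"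
  using N_triangle[of y "x \<ominus> y"] by (simp add: minus_eq a_lcomm[of y x "\<ominus> y"] r_neg)

lemma Metric_space: "Metric_space (carrier V) (norm_dist V N)"
proof
  show "0 \<le> norm_dist V N x y" for x y by (simp add: norm_dist_def N_nonneg)
  show "norm_dist V N x y = norm_dist V N y x" for x y by (simp add: norm_dist_def N_diff_sym)
  show "(norm_dist V N x y = 0) = (x = y)" if "x \<in> carrier V" "y \<in> carrier V" for x y
    using that by (simp add: norm_dist_def N_eq_0 diff_eq_0)
  show "norm_dist V N x z \<le> norm_dist V N x y + norm_dist V N y z" if "x \<in> carrier V" "y \<in> carrier V" "z \<in> carrier V" for x y z
    using that by (simp add: norm_dist_def N_diff_triangle)
qed

definition tends :: "(nat \<Rightarrow> 'a) \<Rightarrow> 'a \<Rightarrow> bool" where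
  "tends X l \<longleftrightarrow> (\<forall>n. X n \<in> carrier V) \<and> l \<in> carrier V \<and> (\<lambda>n. N (X n \<ominus> l)) \<longlonglongrightarrow> 0"

lemma tendsI:
  assumes "\<And>n. X n \<in> carrier V" "l \<in> carrier V" "\<And>n. N (X n \<ominus> l) \<le> f n" "f \<longlonglongrightarrow> 0"
  shows "tends X l"
  unfolding tends_def
proof (intro conjI allI)
  show "(\<lambda>n. N (X n \<ominus> l)) \<longlonglongrightarrow> 0"
    by (rule tendsto_sandwich[OF _ _ tendsto_const assms(4)]) (use assms N_nonneg in auto)
qed (use assms in auto)

lemma tends_limitin:
  assumes "\<And>n. X n \<in> carrier V"
  shows "limitin (Metric_space.mtopology (carrier V) (norm_dist V N)) X l sequentially \<longleftrightarrow> tends X l"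
proof -
  interpret M: Metric_space "carrier V" "norm_dist V N" by (rule Metric_space)
  show ?thesis
    unfolding M.limitin_metric tends_def tendsto_iff using assms N_nonneg
    by (auto simp: norm_dist_def elim!: eventually_mono)
qed

lemma closed_iff: "closedin (Metric_space.mtopology (carrier V) (norm_dist V N)) S \<longleftrightarrow>
    S \<subseteq> carrier V \<and> (\<forall>X l. (\<forall>n. X n \<in> S) \<longrightarrow> tends X l \<longrightarrow> l \<in> S)"
proof -
  interpret M: Metric_space "carrier V" "norm_dist V N" by (rule Metric_space)
  show ?thesis
    unfolding M.metric_closedin_iff_sequentially_closed
  proof (intro conj_cong refl iffI allI impI)
    fix X l
    assume S: "S \<subseteq> carrier V" and *: "\<forall>X l. range X \<subseteq> S \<and> limitin M.mtopology X l sequentially \<longrightarrow> l \<in> S"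
      and X: "\<forall>n. X n \<in> S" "tends X l"
    have "limitin M.mtopology X l sequentially" using tends_limitin[of X l] X S by blast
    then show "l \<in> S" using * X by blast
  next
    fix X l
    assume S: "S \<subseteq> carrier V" and *: "\<forall>X l. (\<forall>n. X n \<in> S) \<longrightarrow> tends X l \<longrightarrow> l \<in> S"
      and X: "range X \<subseteq> S \<and> limitin M.mtopology X l sequentially"
    have "tends X l" using tends_limitin[of X l] X S by blast
    then show "l \<in> S" using * X by blast
  qed
qed

lemma tends_of_complete:
  assumes "Metric_space.mcomplete (carrier V) (norm_dist V N)" "\<And>n. X n \<in> carrier V"
    and "\<And>e. e > 0 \<Longrightarrow> \<exists>M. \<forall>m\<ge>M. \<forall>n\<ge>M. N (X m \<ominus> X n) < e"
  shows "\<exists>l. tends X l"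
proof -
  interpret M: Metric_space "carrier V" "norm_dist V N" by (rule Metric_space)
  have "M.MCauchy X" unfolding M.MCauchy_def
    using assms(2) by (auto simp: norm_dist_def) (metis assms(3))
  then obtain l where "limitin M.mtopology X l sequentially" using assms(1) unfolding M.mcomplete_def by blast
  then show ?thesis using tends_limitin[of X l] assms(2) by blast
qed

lemma completeI:
  assumes "\<And>X. (\<And>n. X n \<in> carrier V) \<Longrightarrow> (\<And>e. e > 0 \<Longrightarrow> \<exists>M. \<forall>m\<ge>M. \<forall>n\<ge>M. N (X m \<ominus> X n) < e) \<Longrightarrow> \<exists>l. tends X l"
  shows "Metric_space.mcomplete (carrier V) (norm_dist V N)"
proof -
  interpret M: Metric_space "carrier V" "norm_dist V N" by (rule Metric_space)
  show ?thesis unfolding M.mcomplete_def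
  proof (intro allI impI)
    fix X assume X: "M.MCauchy X"
    then have c: "X n \<in> carrier V" for n by (auto simp: M.MCauchy_def)
    moreover have "\<exists>M. \<forall>m\<ge>M. \<forall>n\<ge>M. N (X m \<ominus> X n) < e" if "e > 0" for e
      using X that c unfolding M.MCauchy_def by (simp add: norm_dist_def)
    ultimately obtain l where "tends X l" using assms by blast
    then show "\<exists>x. limitin M.mtopology X x sequentially" using tends_limitin[of X l] c by blast
  qed
qed

lemma tendsD: "tends X l \<Longrightarrow> X n \<in> carrier V" "tends X l \<Longrightarrow> l \<in> carrier V" "tends X l \<Longrightarrow> (\<lambda>n. N (X n \<ominus> l)) \<longlonglongrightarrow> 0"
  by (auto simp: tends_def)

lemma tends_unique:
  assumes "tends X l" "tends X k" shows "l = k"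
proof -
  have "N (l \<ominus> k) \<le> N (X n \<ominus> l) + N (X n \<ominus> k)" for n
    using N_diff_triangle[of l "X n" k] N_diff_sym[of l "X n"] tendsD[OF assms(1)] tendsD[OF assms(2)] by simp
  moreover have "(\<lambda>n. N (X n \<ominus> l) + N (X n \<ominus> k)) \<longlonglongrightarrow> 0"
    using tendsto_add[OF tendsD(3)[OF assms(1)] tendsD(3)[OF assms(2)]] by simp
  ultimately have "N (l \<ominus> k) \<le> 0" by (intro LIMSEQ_le_const) auto
  then have "N (l \<ominus> k) = 0" using N_nonneg[of "l \<ominus> k"] tendsD[OF assms(1)] tendsD[OF assms(2)] by simp
  then show ?thesis using N_eq_0[of "l \<ominus> k"] diff_eq_0 tendsD[OF assms(1)] tendsD[OF assms(2)] by simp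
qed

lemma tends_Suc: "tends X l \<Longrightarrow> tends (\<lambda>n. X (Suc n)) l"
  unfolding tends_def using LIMSEQ_Suc by auto

lemma tends_const: "l \<in> carrier V \<Longrightarrow> tends (\<lambda>n. l) l"
  by (rule tendsI[of _ _ "\<lambda>n. 0"]) (auto simp: minus_eq r_neg)

lemma tends_add:
  assumes "tends X l" "tends Y k" shows "tends (\<lambda>n. X n \<oplus> Y n) (l \<oplus> k)"
proof (rule tendsI)
  note D = tendsD[OF assms(1)] tendsD[OF assms(2)]
  show "N ((X n \<oplus> Y n) \<ominus> (l \<oplus> k)) \<le> N (X n \<ominus> l) + N (Y n \<ominus> k)" for n
    using D add_diff_add N_triangle by simp
  show "(\<lambda>n. N (X n \<ominus> l) + N (Y n \<ominus> k)) \<longlonglongrightarrow> 0" using tendsto_add[OF D(3,6)] by simp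
qed (use tendsD[OF assms(1)] tendsD[OF assms(2)] in auto)

lemma tends_norm:
  assumes "tends X l" shows "(\<lambda>n. N (X n)) \<longlonglongrightarrow> N l"
proof -
  note D = tendsD[OF assms]
  have "\<bar>N (X n) - N l\<bar> \<le> N (X n \<ominus> l)" for n
    using N_le_diff[of "X n" l] N_le_diff[of l "X n"] N_diff_sym[of l "X n"] D by auto
  then have "(\<lambda>n. N (X n) - N l) \<longlonglongrightarrow> 0"
    by (intro tendsto_rabs_zero_cancel[of "\<lambda>n. N (X n) - N l"] tendsto_sandwich[OF _ _ tendsto_const D(3)]) auto
  then show ?thesis by (simp add: LIM_zero_iff)
qed

end

lemma complex_ring_simps [simp]: "carrier complex_ring = UNIV" "\<zero>\<^bsub>complex_ring\<^esub> = 0" "\<one>\<^bsub>complex_ring\<^esub> = 1"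
  "a \<oplus>\<^bsub>complex_ring\<^esub> b = a + b" "a \<otimes>\<^bsub>complex_ring\<^esub> b = a * b"
  by (simp_all add: complex_ring_def)

lemma complex_ring_uminus [simp]: "\<ominus>\<^bsub>complex_ring\<^esub> a = - a"
proof -
  interpret cring complex_ring by (rule cring_complex_ring)
  show ?thesis by (metis UNIV_I add.inv_equality complex_ring_simps(1,2,4) left_minus)
qed

text \<open>Algebras and Hilbert spaces share these rules, as both records extend that of a module over \<open>complex_ring\<close>.\<close>

locale complex_module = Module.module complex_ring V for V (structure)
begin

lemma smult_cl [simp]: "x \<in> carrier V \<Longrightarrow> c \<odot> x \<in> carrier V"
  using smult_closed by simp

lemma smult_simps: "x \<in> carrier V \<Longrightarrow> (a + b) \<odot> x = a \<odot> x \<oplus> b \<odot> x"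
    "\<lbrakk>x \<in> carrier V; y \<in> carrier V\<rbrakk> \<Longrightarrow> a \<odot> (x \<oplus> y) = a \<odot> x \<oplus> a \<odot> y"
    "x \<in> carrier V \<Longrightarrow> a \<odot> (b \<odot> x) = (a * b) \<odot> x"
  using smult_l_distr smult_r_distr smult_assoc1 by simp_all

lemma smult_1 [simp]: "x \<in> carrier V \<Longrightarrow> 1 \<odot> x = x"
  using smult_one by simp

lemma smult_0 [simp]: "x \<in> carrier V \<Longrightarrow> 0 \<odot> x = \<zero>" "c \<odot> \<zero> = \<zero>"
  using smult_l_null smult_r_null by simp_all

lemma smult_minus [simp]: "x \<in> carrier V \<Longrightarrow> (- a) \<odot> x = \<ominus> (a \<odot> x)" "x \<in> carrier V \<Longrightarrow> a \<odot> (\<ominus> x) = \<ominus> (a \<odot> x)"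
  using smult_l_minus[of a x] smult_r_minus[of a x] by simp_all

lemma smult_diff: "\<lbrakk>x \<in> carrier V; y \<in> carrier V\<rbrakk> \<Longrightarrow> a \<odot> (x \<ominus> y) = a \<odot> x \<ominus> a \<odot> y"
  by (simp add: minus_eq smult_simps)

lemma smult_2: "x \<in> carrier V \<Longrightarrow> 2 \<odot> x = x \<oplus> x"
  using smult_simps(1)[of x 1 1] by simp

lemma smult_half: "x \<in> carrier V \<Longrightarrow> (1/2) \<odot> x \<oplus> (1/2) \<odot> x = x"
  using smult_simps(1)[of x "1/2" "1/2"] by simp

end


subsection \<open>C*-algebras\<close>

context cstar_algebra
begin

sublocale complex_module A ..

declare mult_closed [simp] star_closed [simp] star_star [simp]

lemma nrm_uminus: "x \<in> carrier A \<Longrightarrow> nrm A (\<ominus> x) = nrm A x"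
  using nrm_smult[of x "-1"] smult_minus(1)[of x 1] by simp

sublocale normed_group A "nrm A"
  by unfold_locales (auto simp: nrm_nonneg nrm_eq_0 nrm_triangle nrm_uminus)

lemma mult_0 [simp]: "x \<in> carrier A \<Longrightarrow> \<zero> \<otimes> x = \<zero>" "x \<in> carrier A \<Longrightarrow> x \<otimes> \<zero> = \<zero>"
  using smult_mult_l[of \<zero> x 0] smult_mult_r[of x \<zero> 0] by simp_all

lemma mult_uminus [simp]: "\<lbrakk>x \<in> carrier A; y \<in> carrier A\<rbrakk> \<Longrightarrow> (\<ominus> x) \<otimes> y = \<ominus> (x \<otimes> y)"
    "\<lbrakk>x \<in> carrier A; y \<in> carrier A\<rbrakk> \<Longrightarrow> x \<otimes> (\<ominus> y) = \<ominus> (x \<otimes> y)"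
  using smult_mult_l[of x y "-1"] smult_mult_r[of x y "-1"] by simp_all

lemma mult_diff: "\<lbrakk>x \<in> carrier A; y \<in> carrier A; z \<in> carrier A\<rbrakk> \<Longrightarrow> (x \<ominus> y) \<otimes> z = x \<otimes> z \<ominus> y \<otimes> z"
    "\<lbrakk>x \<in> carrier A; y \<in> carrier A; z \<in> carrier A\<rbrakk> \<Longrightarrow> z \<otimes> (x \<ominus> y) = z \<otimes> x \<ominus> z \<otimes> y"
  by (simp_all add: minus_eq mult_l_distr mult_r_distr)

lemma star_0 [simp]: "star A \<zero> = \<zero>"
  using star_smult[of \<zero> 0] by simp

lemma star_uminus [simp]: "x \<in> carrier A \<Longrightarrow> star A (\<ominus> x) = \<ominus> star A x"
  using star_smult[of x "-1"] by simp

lemma star_diff: "\<lbrakk>x \<in> carrier A; y \<in> carrier A\<rbrakk> \<Longrightarrow> star A (x \<ominus> y) = star A x \<ominus> star A y"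
  by (simp add: minus_eq star_add)

lemma nrm_star [simp]: assumes "x \<in> carrier A" shows "nrm A (star A x) = nrm A x"
proof -
  have le: "nrm A y \<le> nrm A (star A y)" if "y \<in> carrier A" for y
  proof (cases "nrm A y = 0")
    case False
    then have "nrm A y > 0" using nrm_nonneg[OF that] by simp
    moreover have "nrm A y * nrm A y \<le> nrm A (star A y) * nrm A y"
      using cstar_identity[OF that] nrm_mult[of "star A y" y] that by (simp add: power2_eq_square)
    ultimately show ?thesis by simp
  qed (use nrm_nonneg that in simp)
  show ?thesis using le[OF assms] le[of "star A x"] assms by simp
qed

lemma tends_mult:
  assumes "tends X l" "tends Y k" shows "tends (\<lambda>n. X n \<otimes> Y n) (l \<otimes> k)"
proof (rule tendsI)
  note D = tendsD[OF assms(1)] tendsD[OF assms(2)]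
  show "nrm A ((X n \<otimes> Y n) \<ominus> (l \<otimes> k)) \<le> nrm A (X n \<ominus> l) * nrm A (Y n) + nrm A l * nrm A (Y n \<ominus> k)" for n
  proof -
    have "(X n \<otimes> Y n) \<ominus> (l \<otimes> k) = (X n \<ominus> l) \<otimes> Y n \<oplus> l \<otimes> (Y n \<ominus> k)"
      using D by (simp add: mult_diff diff_add_diff)
    then show ?thesis using D N_triangle[of "(X n \<ominus> l) \<otimes> Y n" "l \<otimes> (Y n \<ominus> k)"] nrm_mult[of "X n \<ominus> l" "Y n"] nrm_mult[of l "Y n \<ominus> k"]
      by simp
  qed
  show "(\<lambda>n. nrm A (X n \<ominus> l) * nrm A (Y n) + nrm A l * nrm A (Y n \<ominus> k)) \<longlonglongrightarrow> 0"
    using tendsto_add[OF tendsto_mult[OF D(3) tends_norm[OF assms(2)]] tendsto_mult[OF tendsto_const[of "nrm A l"] D(6)]] by simp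
qed (use tendsD[OF assms(1)] tendsD[OF assms(2)] in auto)

lemma tends_star:
  assumes "tends X l" shows "tends (\<lambda>n. star A (X n)) (star A l)"
  by (rule tendsI[of _ _ "\<lambda>n. nrm A (X n \<ominus> l)"]) (use tendsD[OF assms] star_diff nrm_star[of "_ \<ominus> _"] in \<open>auto simp: star_diff[symmetric]\<close>)

lemma tends_smult:
  assumes "tends X l" shows "tends (\<lambda>n. c \<odot> X n) (c \<odot> l)"
proof (rule tendsI[of _ _ "\<lambda>n. cmod c * nrm A (X n \<ominus> l)"])
  note D = tendsD[OF assms]
  show "nrm A (c \<odot> X n \<ominus> c \<odot> l) \<le> cmod c * nrm A (X n \<ominus> l)" for n
    using D nrm_smult[of "X n \<ominus> l" c] by (simp add: smult_diff)
  show "(\<lambda>n. cmod c * nrm A (X n \<ominus> l)) \<longlonglongrightarrow> 0"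
    using tendsto_mult[OF tendsto_const[of "cmod c"] D(3)] by simp
qed (use tendsD[OF assms] in auto)

text \<open>
  The element \<open>c = 1 - \<surd>(1 - b)\<close>, produced without a unit and without spectral theory: the map
  \<open>c \<mapsto> (b + c\<^sup>2)/2\<close> is iterated from \<open>0\<close>, and the increments are dominated by those of the same iteration
  for the number \<open>b = 1\<close>, which is increasing and bounded by \<open>1\<close>.
\<close>

lemma quasi_sqrt:
  assumes b: "b \<in> carrier A" "nrm A b \<le> 1"
  obtains c where "c \<in> carrier A" "nrm A c \<le> 1" "c \<oplus> c = b \<oplus> c \<otimes> c"
    "\<And>S. \<lbrakk>\<zero> \<in> S; \<And>x. x \<in> S \<Longrightarrow> x \<in> carrier A \<Longrightarrow> (1/2) \<odot> (b \<oplus> x \<otimes> x) \<in> S;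
       \<And>X l. (\<And>n. X n \<in> S) \<Longrightarrow> tends X l \<Longrightarrow> l \<in> S\<rbrakk> \<Longrightarrow> c \<in> S"
proof -
  define f where "f = rec_nat \<zero> (\<lambda>n x. (1/2) \<odot> (b \<oplus> x \<otimes> x))"
  define g where "g = rec_nat (0::real) (\<lambda>n x. (1 + x\<^sup>2) / 2)"
  have f: "f 0 = \<zero>" "f (Suc n) = (1/2) \<odot> (b \<oplus> f n \<otimes> f n)" for n by (simp_all add: f_def)
  have g: "g 0 = 0" "g (Suc n) = (1 + (g n)\<^sup>2) / 2" for n by (simp_all add: g_def)
  have fc [simp]: "f n \<in> carrier A" for n by (induction n) (simp_all add: f b)
  have g01: "0 \<le> g n \<and> g n \<le> 1" for n by (induction n) (auto simp: g power_le_one)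
  have ginc: "g n \<le> g (Suc n)" for n
    using sum_squares_bound[of "g n" 1] by (simp add: g power2_eq_square)
  have fg: "nrm A (f n) \<le> g n" for n
  proof (induction n)
    case (Suc n)
    have "nrm A (f (Suc n)) = (1/2) * nrm A (b \<oplus> f n \<otimes> f n)" using b nrm_smult[of "b \<oplus> f n \<otimes> f n" "1/2"] by (simp add: f)
    also have "nrm A (b \<oplus> f n \<otimes> f n) \<le> 1 + nrm A (f n) * nrm A (f n)"
      using b nrm_triangle[of b "f n \<otimes> f n"] nrm_mult[of "f n" "f n"] by simp
    also have "nrm A (f n) * nrm A (f n) \<le> (g n)\<^sup>2"
      using Suc nrm_nonneg[of "f n"] by (simp add: power2_eq_square mult_mono)
    finally show ?case by (simp add: g)
  qed (simp add: f g)
  have step: "nrm A (f (Suc n) \<ominus> f n) \<le> g (Suc n) - g n" for n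
  proof (induction n)
    case 0
    have "f (Suc 0) \<ominus> f 0 = f (Suc 0)" by (simp add: f(1) minus_eq)
    then show ?case using fg[of "Suc 0"] by (simp add: g)
  next
    case (Suc n)
    let ?y = "f (Suc n)" and ?x = "f n"
    have "f (Suc (Suc n)) \<ominus> f (Suc n) = (1/2) \<odot> (?y \<otimes> (?y \<ominus> ?x) \<oplus> (?y \<ominus> ?x) \<otimes> ?x)"
    proof -
      have "f (Suc (Suc n)) \<ominus> f (Suc n) = (1/2) \<odot> ((b \<oplus> ?y \<otimes> ?y) \<ominus> (b \<oplus> ?x \<otimes> ?x))"
        using b by (simp only: f(2)[of "Suc n"] f(2)[of n] smult_diff[symmetric] a_closed mult_closed fc smult_cl)
      also have "(b \<oplus> ?y \<otimes> ?y) \<ominus> (b \<oplus> ?x \<otimes> ?x) = ?y \<otimes> ?y \<ominus> ?x \<otimes> ?x"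
        using b by (simp add: add_diff_add del: f) (simp add: minus_eq r_neg del: f)
      also have "\<dots> = ?y \<otimes> (?y \<ominus> ?x) \<oplus> (?y \<ominus> ?x) \<otimes> ?x"
        by (simp add: mult_diff diff_add_diff del: f)
      finally show ?thesis .
    qed
    then have "nrm A (f (Suc (Suc n)) \<ominus> f (Suc n)) = (1/2) * nrm A (?y \<otimes> (?y \<ominus> ?x) \<oplus> (?y \<ominus> ?x) \<otimes> ?x)"
      by (simp add: nrm_smult)
    also have "nrm A (?y \<otimes> (?y \<ominus> ?x) \<oplus> (?y \<ominus> ?x) \<otimes> ?x) \<le> nrm A ?y * nrm A (?y \<ominus> ?x) + nrm A (?y \<ominus> ?x) * nrm A ?x"
      using nrm_triangle[of "?y \<otimes> (?y \<ominus> ?x)" "(?y \<ominus> ?x) \<otimes> ?x"] nrm_mult[of ?y "?y \<ominus> ?x"] nrm_mult[of "?y \<ominus> ?x" ?x] by simp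
    also have "nrm A ?y * nrm A (?y \<ominus> ?x) \<le> g (Suc n) * (g (Suc n) - g n)"
      by (intro mult_mono) (use fg Suc nrm_nonneg g01 in auto)
    also have "nrm A (?y \<ominus> ?x) * nrm A ?x \<le> (g (Suc n) - g n) * g n"
      by (intro mult_mono) (use fg Suc nrm_nonneg g01 ginc[of n] in auto)
    finally show ?case by (simp add: g(2)[of "Suc n"] g(2)[of n] power2_eq_square field_simps)
  qed
  have diff: "nrm A (f (n + k) \<ominus> f n) \<le> g (n + k) - g n" for n k
  proof (induction k)
    case 0 show ?case by (simp add: minus_eq r_neg)
  next
    case (Suc k)
    then show ?case using N_diff_triangle[of "f (Suc (n + k))" "f (n + k)" "f n"] step[of "n + k"] by simp
  qed
  have "incseq g" using ginc by (rule incseq_SucI)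
  then have "Cauchy g" using g01 by (intro convergent_Cauchy Bseq_monoseq_convergent BseqI'[of _ 1]) (auto simp: monoseq_iff)
  have "\<exists>l. tends f l"
  proof (rule tends_of_complete[OF complete])
    fix e :: real assume "e > 0"
    then obtain M where M: "\<And>m n. m \<ge> M \<Longrightarrow> n \<ge> M \<Longrightarrow> \<bar>g m - g n\<bar> < e"
      using \<open>Cauchy g\<close> unfolding Cauchy_def dist_real_def by metis
    have "nrm A (f m \<ominus> f n) \<le> \<bar>g m - g n\<bar>" for m n
    proof (cases "n \<le> m")
      case True then show ?thesis using diff[of n "m - n"] by simp
    next
      case False then show ?thesis using diff[of m "n - m"] N_diff_sym[of "f m" "f n"] by simp
    qed
    then show "\<exists>M. \<forall>m\<ge>M. \<forall>n\<ge>M. nrm A (f m \<ominus> f n) < e" using M by (meson le_less_trans)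
  qed simp
  then obtain c where c: "tends f c" ..
  have cc: "c \<in> carrier A" using tendsD[OF c] by simp
  have "tends (\<lambda>n. f (Suc n)) ((1/2) \<odot> (b \<oplus> c \<otimes> c))"
    unfolding f by (intro tends_smult tends_add tends_const tends_mult c b)
  then have "c = (1/2) \<odot> (b \<oplus> c \<otimes> c)" using tends_unique tends_Suc[OF c] by blast
  then have "c \<oplus> c = (1/2) \<odot> (b \<oplus> c \<otimes> c) \<oplus> (1/2) \<odot> (b \<oplus> c \<otimes> c)" by simp
  then have "c \<oplus> c = b \<oplus> c \<otimes> c" using smult_half[of "b \<oplus> c \<otimes> c"] cc b by simp
  moreover have "nrm A c \<le> 1"
    by (rule LIMSEQ_le_const2[OF tends_norm[OF c]]) (use fg g01 order_trans in blast)
  moreover have "c \<in> S" if S: "\<zero> \<in> S" "\<And>x. x \<in> S \<Longrightarrow> x \<in> carrier A \<Longrightarrow> (1/2) \<odot> (b \<oplus> x \<otimes> x) \<in> S"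
       "\<And>X l. (\<And>n. X n \<in> S) \<Longrightarrow> tends X l \<Longrightarrow> l \<in> S" for S
  proof -
    have "f n \<in> S" for n by (induction n) (auto simp: f S)
    then show ?thesis using S(3) c by blast
  qed
  ultimately show ?thesis using that[of c] cc by blast
qed

end


subsection \<open>Comparing C*-seminorms\<close>

lemma exp_beats_power:
  fixes r :: real assumes "r > 1" shows "(\<lambda>n. real n ^ k / r ^ n) \<longlonglongrightarrow> 0"
proof (cases "k = 0")
  case True then show ?thesis using LIMSEQ_inverse_realpow_zero[OF assms] by (simp add: inverse_eq_divide)
next
  case False
  define x where "x = root k (1 / r)"
  have x: "0 < x" "x ^ k = 1 / r" using False assms by (simp_all add: x_def)
  have "x < 1" unfolding x_def using False assms by simp
  then have "(\<lambda>n. real n * x ^ n) \<longlonglongrightarrow> 0" using x by (intro powser_times_n_limit_0) simp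
  then have "(\<lambda>n. (real n * x ^ n) ^ k) \<longlonglongrightarrow> 0 ^ k" by (rule tendsto_power)
  moreover have "(real n * x ^ n) ^ k = real n ^ k / r ^ n" for n
  proof -
    have "(x ^ n) ^ k = (x ^ k) ^ n" by (simp add: power_mult[symmetric] mult.commute)
    then show ?thesis using x by (simp add: power_mult_distrib power_divide)
  qed
  ultimately show ?thesis using False by (simp add: zero_power)
qed

text \<open>If \<open>P > Q\<close>, then \<open>(P/Q)\<^bsup>r\<^esup>\<close> with \<open>r = 2\<^bsup>n+1\<^esup>\<close> outgrows every polynomial in \<open>2\<^sup>n\<close>.\<close>

lemma le_of_power_bounds:
  fixes P Q :: real
  assumes "0 \<le> P" "0 \<le> Q" and bound: "\<And>n. P ^ (2 ^ Suc n) \<le> C * (2 ^ n) ^ k * Q ^ (2 ^ Suc n)"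
  shows "P \<le> Q"
proof (rule ccontr)
  assume "\<not> P \<le> Q"
  then have PQ: "P > Q" by simp
  show False
  proof (cases "Q = 0")
    case True
    then have "P ^ 2 \<le> 0" using bound[of 0] by simp
    then show False using PQ assms by simp
  next
    case False
    then have Q: "Q > 0" using assms by simp
    define r where "r = (P / Q)"
    have r: "r > 1" using PQ Q by (simp add: r_def)
    have b: "r ^ (2 ^ Suc n) \<le> C * (2 ^ n) ^ k" for n
      using bound[of n] Q by (simp add: r_def power_divide divide_le_eq)
    have "1 \<le> C * (real (2 ^ n) ^ k / r ^ (2 ^ n))" for n
    proof -
      have "r ^ (2 ^ n) \<le> r ^ (2 ^ Suc n)" using r by (intro power_increasing) auto
      then have "r ^ (2 ^ n) \<le> C * (2 ^ n) ^ k" using b[of n] by simp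
      then show ?thesis using r by (simp add: le_divide_eq)
    qed
    moreover have "(\<lambda>n. C * (real (2 ^ n) ^ k / r ^ (2 ^ n))) \<longlonglongrightarrow> C * 0"
    proof (rule tendsto_mult[OF tendsto_const])
      have "strict_mono (\<lambda>n. 2 ^ n :: nat)" by (rule strict_monoI) simp
      from LIMSEQ_subseq_LIMSEQ[OF exp_beats_power[OF r, of k] this]
      show "(\<lambda>n. real (2 ^ n) ^ k / r ^ (2 ^ n)) \<longlonglongrightarrow> 0" by (simp add: o_def)
    qed
    ultimately have "1 \<le> C * 0" using LIMSEQ_le_const by blast
    then show False by simp
  qed
qed

context cstar_algebra
begin

definition cstar_seminorm :: "('a \<Rightarrow> real) \<Rightarrow> bool" where
  "cstar_seminorm p \<longleftrightarrow> (\<forall>x \<in> carrier A. 0 \<le> p x \<and> p x \<le> nrm A x \<and> p (star A x \<otimes> x) = (p x)\<^sup>2 \<and>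
     (\<forall>c. p (c \<odot> x) = cmod c * p x) \<and> (\<forall>y \<in> carrier A. p (x \<oplus> y) \<le> p x + p y \<and> p (x \<otimes> y) \<le> p x * p y))"

text \<open>This is \<open>(x\<^sup>*x)\<^bsup>r\<^esup>\<close> with \<open>r = 2\<^sup>n\<close>, written so that the C*-identity applies at every step.\<close>

primrec hpow :: "nat \<Rightarrow> 'a \<Rightarrow> 'a" where
  "hpow 0 x = star A x \<otimes> x"
| "hpow (Suc n) x = star A (hpow n x) \<otimes> hpow n x"

lemma hpow_closed [simp]: "x \<in> carrier A \<Longrightarrow> hpow n x \<in> carrier A"
  by (induction n) simp_all

lemma hpow_value:
  assumes "\<And>y. y \<in> carrier A \<Longrightarrow> y \<in> S \<Longrightarrow> p (star A y \<otimes> y) = (p y :: real)\<^sup>2"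
    "\<And>y. y \<in> carrier A \<Longrightarrow> y \<in> S \<Longrightarrow> star A y \<otimes> y \<in> S" "x \<in> carrier A" "x \<in> S"
  shows "hpow n x \<in> S" "p (hpow n x) = p x ^ (2 ^ Suc n)"
proof -
  have "hpow n x \<in> S \<and> p (hpow n x) = p x ^ (2 ^ Suc n)"
  proof (induction n)
    case (Suc n)
    then show ?case using assms by (simp add: power_mult[symmetric] mult.commute)
  qed (use assms in simp)
  then show "hpow n x \<in> S" "p (hpow n x) = p x ^ (2 ^ Suc n)" by auto
qed

text \<open>For C*-seminorms \<open>p(x)\<close> is the \<open>2\<^sup>n\<close>-th root of the value at the \<open>2\<^sup>n\<close>-th power of \<open>x\<^sup>*x\<close>, up to a factor \<open>2\<close>
  in the exponent; a comparison that loses a subexponential factor therefore loses nothing.\<close>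

lemma seminorm_le_of_power_bounds:
  assumes x: "x \<in> carrier A" "x \<in> S" and S: "\<And>y. y \<in> carrier A \<Longrightarrow> y \<in> S \<Longrightarrow> star A y \<otimes> y \<in> S"
    and p: "\<And>y. y \<in> carrier A \<Longrightarrow> y \<in> S \<Longrightarrow> p (star A y \<otimes> y) = (p y :: real)\<^sup>2" "0 \<le> p x"
    and q: "\<And>y. y \<in> carrier A \<Longrightarrow> y \<in> S \<Longrightarrow> q (star A y \<otimes> y) = (q y :: real)\<^sup>2" "0 \<le> q x"
    and bound: "\<And>n. p (hpow n x) \<le> C * (2 ^ n) ^ k * q (hpow n x)"
  shows "p x \<le> q x"
  by (rule le_of_power_bounds[where C = C and k = k])
    (use p q bound hpow_value(2)[where p = p and S = S, OF p(1) S x] hpow_value(2)[where p = q and S = S, OF q(1) S x] in auto)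

end

section \<open>Hilbert spaces and their bounded operators\<close>

text \<open>Completeness is left out so that the norm is at hand when completeness of \<open>\<ell>\<^sup>2(X)\<close> is proved.\<close>

locale inner_product_space = Module.module complex_ring H for H :: "'h hilbert" (structure) +
  assumes inprod_add: "\<lbrakk>x \<in> carrier H; y \<in> carrier H; z \<in> carrier H\<rbrakk>
        \<Longrightarrow> inprod H (x \<oplus> y) z = inprod H x z + inprod H y z"
    and inprod_smult: "\<lbrakk>x \<in> carrier H; y \<in> carrier H\<rbrakk> \<Longrightarrow> inprod H (c \<odot> x) y = c * inprod H x y"
    and inprod_cnj: "\<lbrakk>x \<in> carrier H; y \<in> carrier H\<rbrakk> \<Longrightarrow> inprod H y x = cnj (inprod H x y)"
    and inprod_nonneg: "x \<in> carrier H \<Longrightarrow> 0 \<le> Re (inprod H x x)"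
    and inprod_eq_0: "\<lbrakk>x \<in> carrier H; inprod H x x = 0\<rbrakk> \<Longrightarrow> x = \<zero>"
begin

sublocale complex_module H ..

abbreviation ip ("\<langle>_,_\<rangle>") where "\<langle>x,y\<rangle> \<equiv> inprod H x y"

lemma ip_add_right: "\<lbrakk>x \<in> carrier H; y \<in> carrier H; z \<in> carrier H\<rbrakk> \<Longrightarrow> \<langle>x, y \<oplus> z\<rangle> = \<langle>x, y\<rangle> + \<langle>x, z\<rangle>"
  using inprod_add[of y z x] inprod_cnj[of "y \<oplus> z" x] inprod_cnj[of y x] inprod_cnj[of z x] by simp

lemma ip_smult_right: "\<lbrakk>x \<in> carrier H; y \<in> carrier H\<rbrakk> \<Longrightarrow> \<langle>x, c \<odot> y\<rangle> = cnj c * \<langle>x, y\<rangle>"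
  using inprod_smult[of y x c] inprod_cnj[of "c \<odot> y" x] inprod_cnj[of y x] by simp

lemma ip_uminus: "\<lbrakk>x \<in> carrier H; y \<in> carrier H\<rbrakk> \<Longrightarrow> \<langle>\<ominus> x, y\<rangle> = - \<langle>x, y\<rangle>" "\<lbrakk>x \<in> carrier H; y \<in> carrier H\<rbrakk> \<Longrightarrow> \<langle>x, \<ominus> y\<rangle> = - \<langle>x, y\<rangle>"
  using inprod_smult[of x y "-1"] ip_smult_right[of x y "-1"] by simp_all

lemma ip_diff: "\<lbrakk>x \<in> carrier H; y \<in> carrier H; z \<in> carrier H\<rbrakk> \<Longrightarrow> \<langle>x \<ominus> y, z\<rangle> = \<langle>x, z\<rangle> - \<langle>y, z\<rangle>"
   "\<lbrakk>x \<in> carrier H; y \<in> carrier H; z \<in> carrier H\<rbrakk> \<Longrightarrow> \<langle>z, x \<ominus> y\<rangle> = \<langle>z, x\<rangle> - \<langle>z, y\<rangle>"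
  by (simp_all add: a_minus_def inprod_add ip_add_right ip_uminus)

lemma ip_0 [simp]: "x \<in> carrier H \<Longrightarrow> \<langle>\<zero>, x\<rangle> = 0" "x \<in> carrier H \<Longrightarrow> \<langle>x, \<zero>\<rangle> = 0"
  using inprod_smult[of \<zero> x 0] ip_smult_right[of x \<zero> 0] by simp_all

lemmas ip_simps = inprod_add inprod_smult ip_add_right ip_smult_right ip_uminus ip_diff

lemma ip_self: "x \<in> carrier H \<Longrightarrow> \<langle>x, x\<rangle> = complex_of_real ((hnorm H x)\<^sup>2)"
proof -
  assume x: "x \<in> carrier H"
  have "Im \<langle>x, x\<rangle> = 0" using arg_cong[OF inprod_cnj[OF x x], of Im] by simp
  then show ?thesis using inprod_nonneg[OF x] by (simp add: hnorm_def complex_eq_iff)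
qed

lemma hnorm_sq: "x \<in> carrier H \<Longrightarrow> (hnorm H x)\<^sup>2 = Re \<langle>x, x\<rangle>"
  using inprod_nonneg by (simp add: hnorm_def)

lemma hnorm_nonneg [simp]: "x \<in> carrier H \<Longrightarrow> 0 \<le> hnorm H x"
  using inprod_nonneg by (simp add: hnorm_def)

lemma hnorm_eq_0: "x \<in> carrier H \<Longrightarrow> hnorm H x = 0 \<longleftrightarrow> x = \<zero>"
  using ip_self[of x] inprod_eq_0[of x] by (auto simp: hnorm_def)

lemma a_minus_eq_0: "\<lbrakk>x \<in> carrier H; y \<in> carrier H\<rbrakk> \<Longrightarrow> x \<ominus> y = \<zero> \<longleftrightarrow> x = y"
  by (metis minus_eq minus_equality minus_minus r_neg a_inv_closed)

lemma vec_eqI: "\<lbrakk>x \<in> carrier H; y \<in> carrier H; \<And>z. z \<in> carrier H \<Longrightarrow> \<langle>x, z\<rangle> = \<langle>y, z\<rangle>\<rbrakk> \<Longrightarrow> x = y"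
  using inprod_eq_0[of "x \<ominus> y"] a_minus_eq_0[of x y] by (simp add: ip_diff)

lemma vec_eqI2: "\<lbrakk>x \<in> carrier H; y \<in> carrier H; \<And>z. z \<in> carrier H \<Longrightarrow> \<langle>z, x\<rangle> = \<langle>z, y\<rangle>\<rbrakk> \<Longrightarrow> x = y"
  using vec_eqI[of x y] inprod_cnj by metis

lemma cauchy_schwarz:
  assumes x: "x \<in> carrier H" and y: "y \<in> carrier H"
  shows "cmod \<langle>x, y\<rangle> \<le> hnorm H x * hnorm H y"
proof (cases "y = \<zero>")
  case True then show ?thesis using x by simp
next
  case False
  define a where "a = \<langle>x, y\<rangle>"
  define s where "s = (hnorm H y)\<^sup>2"
  have s: "s > 0" "\<langle>y, y\<rangle> = of_real s" using False hnorm_eq_0[OF y] ip_self[OF y] by (simp_all add: s_def)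
  have yx: "\<langle>y, x\<rangle> = cnj a" using inprod_cnj[OF x y] by (simp add: a_def)
  define v where "v = x \<ominus> (a / of_real s) \<odot> y"
  have "\<langle>v, v\<rangle> = \<langle>x, x\<rangle> - cnj (a / of_real s) * a - (a / of_real s) * cnj a + (a / of_real s) * cnj (a / of_real s) * of_real s"
    using x y by (simp add: v_def ip_simps yx s a_def[symmetric] algebra_simps)
  also have "\<dots> = \<langle>x, x\<rangle> - (a * cnj a) / of_real s"
    using s by (simp add: field_simps)
  also have "\<dots> = \<langle>x, x\<rangle> - of_real ((cmod a)\<^sup>2 / s)"
    unfolding of_real_divide complex_norm_square ..
  finally have "Re \<langle>v, v\<rangle> = (hnorm H x)\<^sup>2 - (cmod a)\<^sup>2 / s" using hnorm_sq[OF x] by simp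
  moreover have "0 \<le> Re \<langle>v, v\<rangle>" using inprod_nonneg[of v] x y by (simp add: v_def)
  ultimately have "(cmod a)\<^sup>2 \<le> (hnorm H x * hnorm H y)\<^sup>2"
    using s by (simp add: divide_le_eq power_mult_distrib s_def)
  then show ?thesis using x y by (simp add: a_def power2_le_iff_abs_le)
qed

lemma hnorm_add_sq: "\<lbrakk>x \<in> carrier H; y \<in> carrier H\<rbrakk> \<Longrightarrow> (hnorm H (x \<oplus> y))\<^sup>2 = (hnorm H x)\<^sup>2 + (hnorm H y)\<^sup>2 + 2 * Re \<langle>x, y\<rangle>"
  using arg_cong[OF inprod_cnj[of x y], of Re] by (simp add: hnorm_sq ip_simps)

lemma hnorm_diff_sq: "\<lbrakk>x \<in> carrier H; y \<in> carrier H\<rbrakk> \<Longrightarrow> (hnorm H (x \<ominus> y))\<^sup>2 = (hnorm H x)\<^sup>2 + (hnorm H y)\<^sup>2 - 2 * Re \<langle>x, y\<rangle>"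
  using arg_cong[OF inprod_cnj[of x y], of Re] by (simp add: hnorm_sq ip_simps)

lemma hnorm_smult: "x \<in> carrier H \<Longrightarrow> hnorm H (c \<odot> x) = cmod c * hnorm H x"
proof -
  assume x: "x \<in> carrier H"
  have "(hnorm H (c \<odot> x))\<^sup>2 = (cmod c * hnorm H x)\<^sup>2"
  proof -
    have "\<langle>c \<odot> x, c \<odot> x\<rangle> = (c * cnj c) * \<langle>x, x\<rangle>" using x by (simp add: ip_simps)
    also have "\<dots> = complex_of_real ((cmod c)\<^sup>2 * (hnorm H x)\<^sup>2)"
      unfolding ip_self[OF x] of_real_mult complex_norm_square ..
    finally have "\<langle>c \<odot> x, c \<odot> x\<rangle> = complex_of_real ((cmod c)\<^sup>2 * (hnorm H x)\<^sup>2)" .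
    then show ?thesis using x by (simp only: hnorm_sq[of "c \<odot> x"] smult_cl Re_complex_of_real power_mult_distrib)
  qed
  then show ?thesis using x by (simp add: power2_eq_iff_nonneg)
qed

sublocale normed_group H "hnorm H"
proof unfold_locales
  show "hnorm H (x \<oplus> y) \<le> hnorm H x + hnorm H y" if "x \<in> carrier H" "y \<in> carrier H" for x y
  proof (rule power2_le_imp_le)
    have "Re \<langle>x, y\<rangle> \<le> hnorm H x * hnorm H y" using cauchy_schwarz[OF that] complex_Re_le_cmod[of "\<langle>x, y\<rangle>"] by simp
    then show "(hnorm H (x \<oplus> y))\<^sup>2 \<le> (hnorm H x + hnorm H y)\<^sup>2" using that by (simp add: hnorm_add_sq power2_sum)
  qed (use that in simp)
  show "hnorm H (\<ominus> x) = hnorm H x" if "x \<in> carrier H" for x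
    using hnorm_smult[OF that, of "-1"] smult_minus(1)[OF that, of 1] that by simp
qed (simp_all add: hnorm_eq_0)

end

context hilbert_space
begin

sublocale inner_product_space H
  by unfold_locales (fact inprod_add inprod_smult inprod_cnj inprod_nonneg inprod_eq_0)+

text \<open>The Riesz representation theorem: the representing vector is the minimiser of \<open>\<parallel>x\<parallel>\<^sup>2 - 2 Re \<phi>(x)\<close>.
  A minimising sequence is Cauchy by the parallelogram law.\<close>

lemma riesz:
  assumes closed: "\<And>x y. \<lbrakk>x \<in> carrier H; y \<in> carrier H\<rbrakk> \<Longrightarrow> \<phi> (x \<oplus> y) = \<phi> x + \<phi> y"
    and sm: "\<And>c x. x \<in> carrier H \<Longrightarrow> \<phi> (c \<odot> x) = c * \<phi> x"
    and bd: "\<And>x. x \<in> carrier H \<Longrightarrow> cmod (\<phi> x) \<le> C * hnorm H x"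
  shows "\<exists>r \<in> carrier H. \<forall>x \<in> carrier H. \<phi> x = \<langle>x, r\<rangle>"
proof -
  define J where "J x = (hnorm H x)\<^sup>2 - 2 * Re (\<phi> x)" for x
  have J_lower: "- C\<^sup>2 \<le> J x" if "x \<in> carrier H" for x
  proof -
    have "Re (\<phi> x) \<le> C * hnorm H x" using bd[OF that] complex_Re_le_cmod[of "\<phi> x"] by simp
    moreover have "0 \<le> (hnorm H x - C)\<^sup>2" by simp
    ultimately show ?thesis unfolding J_def power2_diff by (simp add: mult.commute)
  qed
  define m where "m = Inf (J ` carrier H)"
  have bdd: "bdd_below (J ` carrier H)" using J_lower by (auto intro!: bdd_belowI)
  have m: "m \<le> J x" if "x \<in> carrier H" for x unfolding m_def by (rule cInf_lower[OF _ bdd]) (use that in simp)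
  have "\<exists>x \<in> carrier H. J x < m + inverse (real (Suc n))" for n
  proof -
    have "Inf (J ` carrier H) < m + inverse (real (Suc n))" by (simp add: m_def)
    then show ?thesis using cInf_lessD[of "J ` carrier H"] by (auto simp: ex_in_conv[symmetric] intro: exI[of _ \<zero>])
  qed
  then obtain X where X: "\<And>n. X n \<in> carrier H" "\<And>n. J (X n) < m + inverse (real (Suc n))" by metis
  have par: "(hnorm H (x \<ominus> y))\<^sup>2 \<le> 2 * (J x - m) + 2 * (J y - m)" if "x \<in> carrier H" "y \<in> carrier H" for x y
  proof -
    have "J ((1/2) \<odot> (x \<oplus> y)) = (hnorm H (x \<oplus> y))\<^sup>2 / 4 - Re (\<phi> x + \<phi> y)"
      using that by (simp add: J_def hnorm_smult sm closed power_divide field_simps)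
    moreover have "m \<le> J ((1/2) \<odot> (x \<oplus> y))" using m that by simp
    ultimately have "4 * m \<le> (hnorm H (x \<oplus> y))\<^sup>2 - 4 * Re (\<phi> x + \<phi> y)" by simp
    then show ?thesis using that by (simp add: J_def hnorm_add_sq hnorm_diff_sq)
  qed
  have "\<exists>l. tends X l"
  proof (rule tends_of_complete[OF complete])
    fix e :: real assume e: "e > 0"
    obtain M where M: "inverse (real (Suc M)) < e\<^sup>2 / 4" using reals_Archimedean[of "e\<^sup>2/4"] e by auto
    have "hnorm H (X a \<ominus> X b) < e" if "a \<ge> M" "b \<ge> M" for a b
    proof (rule power_less_imp_less_base[of _ 2])
      have J: "J (X k) - m < e\<^sup>2 / 4" if "k \<ge> M" for k
      proof -
        have "inverse (real (Suc k)) \<le> inverse (real (Suc M))" using that by simp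
        then show ?thesis using X(2)[of k] M by linarith
      qed
      have "u \<le> 2 * p + 2 * q \<Longrightarrow> p < w / 4 \<Longrightarrow> q < w / 4 \<Longrightarrow> u < w" for u p q w :: real by simp
      from this[OF par[OF X(1) X(1), of a b] J[OF that(1)] J[OF that(2)]]
      show "(hnorm H (X a \<ominus> X b))\<^sup>2 < e\<^sup>2" .
    qed (use e in simp)
    then show "\<exists>M. \<forall>m\<ge>M. \<forall>n\<ge>M. hnorm H (X m \<ominus> X n) < e" by blast
  qed (rule X)
  then obtain r where r: "tends X r" ..
  have rc: "r \<in> carrier H" using tendsD[OF r] by simp
  have phi_diff: "\<phi> (x \<ominus> y) = \<phi> x - \<phi> y" if "x \<in> carrier H" "y \<in> carrier H" for x y
    using closed[of x "\<ominus> y"] sm[of y "-1"] that by (simp add: a_minus_def)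
  have "(\<lambda>n. \<phi> (X n) - \<phi> r) \<longlonglongrightarrow> 0"
  proof (rule tendsto_norm_zero_cancel, rule tendsto_sandwich[OF _ _ tendsto_const])
    show "(\<lambda>n. C * hnorm H (X n \<ominus> r)) \<longlonglongrightarrow> 0" using tendsto_mult_right_zero[OF tendsD(3)[OF r]] .
    show "\<forall>\<^sub>F n in sequentially. norm (\<phi> (X n) - \<phi> r) \<le> C * hnorm H (X n \<ominus> r)"
      using bd[of "X n \<ominus> r" for n] X rc by (simp add: phi_diff)
  qed simp
  then have "(\<lambda>n. \<phi> (X n)) \<longlonglongrightarrow> \<phi> r" by (simp add: LIM_zero_iff)
  then have "(\<lambda>n. J (X n)) \<longlonglongrightarrow> J r"
    unfolding J_def by (intro tendsto_intros tends_norm[OF r])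
  then have "J r \<le> m"
  proof (rule LIMSEQ_le)
    show "(\<lambda>n. m + inverse (real (Suc n))) \<longlonglongrightarrow> m" using LIMSEQ_inverse_real_of_nat_add[of m] by simp
    show "\<exists>N. \<forall>n\<ge>N. J (X n) \<le> m + inverse (real (Suc n))" using X(2) less_imp_le by blast
  qed
  have Re_eq: "Re (\<phi> h) = Re \<langle>h, r\<rangle>" if h: "h \<in> carrier H" for h
  proof (rule ccontr)
    assume ne: "Re (\<phi> h) \<noteq> Re \<langle>h, r\<rangle>"
    define d where "d = Re (\<phi> h) - Re \<langle>h, r\<rangle>"
    define t where "t = d / ((hnorm H h)\<^sup>2 + 1)"
    have pos: "(hnorm H h)\<^sup>2 + 1 > 0" using zero_le_power2[of "hnorm H h"] by linarith
    have "J (r \<oplus> of_real t \<odot> h) = J r + t\<^sup>2 * (hnorm H h)\<^sup>2 - 2 * t * d"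
    proof -
      have "Re \<langle>r, of_real t \<odot> h\<rangle> = t * Re \<langle>h, r\<rangle>"
        using h rc arg_cong[OF inprod_cnj[of r h], of Re] by (simp add: ip_smult_right)
      moreover have "hnorm H (of_real t \<odot> h) = \<bar>t\<bar> * hnorm H h" using hnorm_smult[OF h, of "of_real t"] by simp
      ultimately show ?thesis using h rc by (simp add: J_def hnorm_add_sq closed sm power_mult_distrib d_def algebra_simps)
    qed
    moreover have "m \<le> J (r \<oplus> of_real t \<odot> h)" using m h rc by simp
    ultimately have "2 * t * d \<le> t\<^sup>2 * (hnorm H h)\<^sup>2" using \<open>J r \<le> m\<close> by simp
    moreover have "2 * t * d = 2 * d\<^sup>2 / ((hnorm H h)\<^sup>2 + 1)" by (simp add: t_def power2_eq_square)
    moreover have "t\<^sup>2 * (hnorm H h)\<^sup>2 \<le> d\<^sup>2 / ((hnorm H h)\<^sup>2 + 1)"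
    proof -
      have "t\<^sup>2 * (hnorm H h)\<^sup>2 \<le> t\<^sup>2 * ((hnorm H h)\<^sup>2 + 1)" by (simp add: mult_left_mono)
      also have "\<dots> = d\<^sup>2 / ((hnorm H h)\<^sup>2 + 1)" using pos by (simp add: t_def power2_eq_square)
      finally show ?thesis .
    qed
    ultimately have "d\<^sup>2 / ((hnorm H h)\<^sup>2 + 1) \<le> 0" by simp
    then have "d\<^sup>2 \<le> 0" using pos by (simp add: divide_le_0_iff)
    then show False using ne by (simp add: d_def)
  qed
  have "\<phi> h = \<langle>h, r\<rangle>" if h: "h \<in> carrier H" for h
  proof -
    have "Im z = Re (- \<i> * z)" for z by simp
    then have "Im (\<phi> h) = Im \<langle>h, r\<rangle>"
      using Re_eq[of "(- \<i>) \<odot> h"] h rc sm[of h "- \<i>"] inprod_smult[of h r "- \<i>"] by (simp del: smult_minus)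
    then show ?thesis using Re_eq[OF h] by (simp add: complex_eq_iff)
  qed
  then show ?thesis using rc by blast
qed

end

context normed_group
begin

lemma tends_uminus:
  assumes "tends X l" shows "tends (\<lambda>n. \<ominus> X n) (\<ominus> l)"
proof (rule tendsI[OF _ _ _ tendsD(3)[OF assms]])
  fix n
  have "(\<ominus> X n) \<ominus> (\<ominus> l) = l \<ominus> X n" using tendsD[OF assms] by (simp add: minus_eq a_comm)
  then show "N ((\<ominus> X n) \<ominus> (\<ominus> l)) \<le> N (X n \<ominus> l)" using N_diff_sym[of l "X n"] tendsD[OF assms] by simp
qed (use tendsD[OF assms] in auto)

end

context hilbert_space
begin

abbreviation BH where "BH \<equiv> bounded_ops H"

abbreviation multB (infixl "\<otimes>\<^sub>B" 70) where "S \<otimes>\<^sub>B R \<equiv> S \<otimes>\<^bsub>BH\<^esub> R"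
abbreviation addB (infixl "\<oplus>\<^sub>B" 65) where "S \<oplus>\<^sub>B R \<equiv> S \<oplus>\<^bsub>BH\<^esub> R"
abbreviation minusB (infixl "\<ominus>\<^sub>B" 65) where "S \<ominus>\<^sub>B R \<equiv> S \<ominus>\<^bsub>BH\<^esub> R"
abbreviation smultB (infixr "\<odot>\<^sub>B" 70) where "c \<odot>\<^sub>B S \<equiv> c \<odot>\<^bsub>BH\<^esub> S"
abbreviation zeroB ("\<zero>\<^sub>B") where "\<zero>\<^sub>B \<equiv> \<zero>\<^bsub>BH\<^esub>"

lemma bopI:
  assumes "S \<in> carrier H \<rightarrow>\<^sub>E carrier H"
    and "\<And>x y. \<lbrakk>x \<in> carrier H; y \<in> carrier H\<rbrakk> \<Longrightarrow> S (x \<oplus> y) = S x \<oplus> S y"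
    and "\<And>c x. x \<in> carrier H \<Longrightarrow> S (c \<odot> x) = c \<odot> S x"
    and "\<And>x. x \<in> carrier H \<Longrightarrow> hnorm H (S x) \<le> C * hnorm H x"
  shows "S \<in> carrier BH"
  using assms unfolding bounded_ops_def by (simp, blast)

lemma bopD:
  assumes "S \<in> carrier BH"
  shows "S \<in> carrier H \<rightarrow>\<^sub>E carrier H"
    and "x \<in> carrier H \<Longrightarrow> S x \<in> carrier H"
    and "\<lbrakk>x \<in> carrier H; y \<in> carrier H\<rbrakk> \<Longrightarrow> S (x \<oplus> y) = S x \<oplus> S y"
    and "x \<in> carrier H \<Longrightarrow> S (c \<odot> x) = c \<odot> S x"
    and "\<exists>C. \<forall>x \<in> carrier H. hnorm H (S x) \<le> C * hnorm H x"
  using assms unfolding bounded_ops_def by auto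

lemma bop_zero [simp]: "S \<in> carrier BH \<Longrightarrow> S \<zero> = \<zero>"
  using bopD(4)[of S \<zero> 0] bopD(2)[of S \<zero>] by simp

lemma bop_uminus: "S \<in> carrier BH \<Longrightarrow> x \<in> carrier H \<Longrightarrow> S (\<ominus> x) = \<ominus> S x"
  using bopD(4)[of S x "-1"] bopD(2)[of S x] smult_minus(1)[of x 1] smult_minus(1)[of "S x" 1] by simp

lemma bop_diff: "S \<in> carrier BH \<Longrightarrow> x \<in> carrier H \<Longrightarrow> y \<in> carrier H \<Longrightarrow> S (x \<ominus> y) = S x \<ominus> S y"
  using bopD(2,3)[of S] bop_uminus[of S y] by (simp add: a_minus_def)

lemma BH_simps [simp]:
  "x \<in> carrier H \<Longrightarrow> (S \<otimes>\<^sub>B R) x = S (R x)"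
  "x \<in> carrier H \<Longrightarrow> (S \<oplus>\<^sub>B R) x = S x \<oplus> R x"
  "x \<in> carrier H \<Longrightarrow> (c \<odot>\<^sub>B S) x = c \<odot> S x"
  "x \<in> carrier H \<Longrightarrow> \<zero>\<^sub>B x = \<zero>"
  "x \<in> carrier H \<Longrightarrow> \<one>\<^bsub>BH\<^esub> x = x"
  by (simp_all add: bounded_ops_def compose_def)

lemma bop_eqI: "\<lbrakk>S \<in> carrier BH; R \<in> carrier BH; \<And>x. x \<in> carrier H \<Longrightarrow> S x = R x\<rbrakk> \<Longrightarrow> S = R"
  using bopD(1) by (intro PiE_ext[of S "carrier H" "\<lambda>_. carrier H" R]) auto

lemma op_bdd: assumes "S \<in> carrier BH"
  shows "bdd_above ((\<lambda>x. hnorm H (S x)) ` {x \<in> carrier H. hnorm H x \<le> 1})"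
proof -
  obtain C where C: "\<forall>x \<in> carrier H. hnorm H (S x) \<le> C * hnorm H x" using bopD(5)[OF assms] by blast
  have "hnorm H (S x) \<le> \<bar>C\<bar>" if "x \<in> carrier H" "hnorm H x \<le> 1" for x
  proof -
    have "hnorm H (S x) \<le> C * hnorm H x" using C that by blast
    also have "\<dots> \<le> \<bar>C\<bar> * 1" by (rule mult_mono) (use that in auto)
    finally show ?thesis by simp
  qed
  then show ?thesis by (intro bdd_aboveI[of _ "\<bar>C\<bar>"]) auto
qed

lemma op_norm: "nrm BH S = (SUP x \<in> {x \<in> carrier H. hnorm H x \<le> 1}. hnorm H (S x))"
  by (simp add: bounded_ops_def)

lemma op_norm_le: assumes "S \<in> carrier BH" "x \<in> carrier H" shows "hnorm H (S x) \<le> nrm BH S * hnorm H x"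
proof (cases "x = \<zero>")
  case True then show ?thesis using assms by simp
next
  case False
  then have n: "hnorm H x > 0" using hnorm_eq_0[OF assms(2)] hnorm_nonneg[OF assms(2)] by linarith
  define u where "u = complex_of_real (inverse (hnorm H x)) \<odot> x"
  have "u \<in> carrier H" "hnorm H u = 1" using n assms hnorm_smult[OF assms(2), of "complex_of_real (inverse (hnorm H x))"]
    by (simp_all add: u_def norm_inverse)
  then have "hnorm H (S u) \<le> nrm BH S" unfolding op_norm by (intro cSUP_upper op_bdd assms) simp
  moreover have "hnorm H (S u) = inverse (hnorm H x) * hnorm H (S x)"
    using bopD(4)[OF assms(1,2), of "complex_of_real (inverse (hnorm H x))"] hnorm_smult[OF bopD(2)[OF assms], of "complex_of_real (inverse (hnorm H x))"] n
    by (simp add: u_def norm_inverse)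
  ultimately show ?thesis using n by (simp add: divide_le_eq inverse_eq_divide)
qed

lemma op_norm_leI:
  assumes "\<And>x. x \<in> carrier H \<Longrightarrow> hnorm H (S x) \<le> C * hnorm H x" "0 \<le> C"
  shows "nrm BH S \<le> C"
  unfolding op_norm
proof (rule cSUP_least)
  show "{x \<in> carrier H. hnorm H x \<le> 1} \<noteq> {}" using N_0 zero_closed by force
  fix x assume "x \<in> {x \<in> carrier H. hnorm H x \<le> 1}"
  then show "hnorm H (S x) \<le> C" using assms(1)[of x] mult_left_mono[of "hnorm H x" 1 C] assms(2) by auto
qed

lemma op_norm_nonneg: "S \<in> carrier BH \<Longrightarrow> 0 \<le> nrm BH S"
  unfolding op_norm by (rule cSUP_upper2[OF op_bdd, of _ \<zero>]) auto

lemma adjoint_unique: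
  assumes "R \<in> carrier H \<rightarrow>\<^sub>E carrier H" "R' \<in> carrier H \<rightarrow>\<^sub>E carrier H"
    "\<And>x y. x \<in> carrier H \<Longrightarrow> y \<in> carrier H \<Longrightarrow> \<langle>x, R y\<rangle> = \<langle>x, R' y\<rangle>"
  shows "R = R'"
  by (rule PiE_ext[OF assms(1,2)]) (rule vec_eqI2, use assms in auto)

lemma bop_star_eqI:
  assumes "R \<in> carrier H \<rightarrow>\<^sub>E carrier H" "\<And>x y. x \<in> carrier H \<Longrightarrow> y \<in> carrier H \<Longrightarrow> \<langle>S x, y\<rangle> = \<langle>x, R y\<rangle>"
  shows "star BH S = R"
  unfolding bounded_ops_def using assms
  by (auto intro!: the_equality adjoint_unique[of _ R])

lemma bop_star:
  assumes S: "S \<in> carrier BH"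
  shows "star BH S \<in> carrier BH" "\<lbrakk>x \<in> carrier H; y \<in> carrier H\<rbrakk> \<Longrightarrow> \<langle>S x, y\<rangle> = \<langle>x, star BH S y\<rangle>"
    "nrm BH (star BH S) \<le> nrm BH S"
proof -
  note D = bopD(2-4)[OF S]
  have "\<exists>r \<in> carrier H. \<forall>x \<in> carrier H. \<langle>S x, y\<rangle> = \<langle>x, r\<rangle>" if y: "y \<in> carrier H" for y
  proof (rule riesz)
    fix x assume x: "x \<in> carrier H"
    have "cmod \<langle>S x, y\<rangle> \<le> hnorm H (S x) * hnorm H y" using cauchy_schwarz D x y by simp
    also have "\<dots> \<le> (nrm BH S * hnorm H x) * hnorm H y" by (intro mult_right_mono op_norm_le S x hnorm_nonneg y)
    finally show "cmod \<langle>S x, y\<rangle> \<le> (nrm BH S * hnorm H y) * hnorm H x" by (simp add: mult_ac)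
  qed (use D y in \<open>simp_all add: ip_simps\<close>)
  then obtain R' where R': "\<And>y. y \<in> carrier H \<Longrightarrow> R' y \<in> carrier H \<and> (\<forall>x \<in> carrier H. \<langle>S x, y\<rangle> = \<langle>x, R' y\<rangle>)" by metis
  define R where "R = restrict R' (carrier H)"
  have R: "R \<in> carrier H \<rightarrow>\<^sub>E carrier H" "\<And>x y. x \<in> carrier H \<Longrightarrow> y \<in> carrier H \<Longrightarrow> \<langle>S x, y\<rangle> = \<langle>x, R y\<rangle>"
    using R' by (auto simp: R_def)
  have Rc: "R y \<in> carrier H" if "y \<in> carrier H" for y using R(1) that by auto
  have Rn: "hnorm H (R x) \<le> nrm BH S * hnorm H x" if xy: "x \<in> carrier H" for x
  proof (cases "hnorm H (R x) = 0")
    case True then show ?thesis using op_norm_nonneg[OF S] xy by simp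
  next
    case False
    then have pos: "hnorm H (R x) > 0" using hnorm_nonneg[OF Rc[OF xy]] by linarith
    have "hnorm H (R x) * hnorm H (R x) = Re \<langle>S (R x), x\<rangle>" using R(2)[OF Rc[OF xy] xy] hnorm_sq[OF Rc[OF xy]] by (simp add: power2_eq_square)
    also have "\<dots> \<le> hnorm H (S (R x)) * hnorm H x"
      using cauchy_schwarz[of "S (R x)" x] complex_Re_le_cmod[of "\<langle>S (R x), x\<rangle>"] D Rc xy by (smt (verit))
    also have "\<dots> \<le> (nrm BH S * hnorm H (R x)) * hnorm H x" by (intro mult_right_mono op_norm_le S Rc xy hnorm_nonneg)
    finally have "hnorm H (R x) * hnorm H (R x) \<le> (nrm BH S * hnorm H x) * hnorm H (R x)" by (simp add: mult_ac)
    then show ?thesis using pos by simp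
  qed
  have "R \<in> carrier BH"
  proof (rule bopI[OF R(1)])
    fix x y c assume xy: "x \<in> carrier H"
    show "R (c \<odot> x) = c \<odot> R x"
      by (rule vec_eqI2) (use xy Rc in \<open>simp_all add: R(2)[symmetric] ip_simps D\<close>)
    show "R (x \<oplus> y) = R x \<oplus> R y" if "y \<in> carrier H"
      by (rule vec_eqI2) (use xy that Rc in \<open>simp_all add: R(2)[symmetric] ip_simps D\<close>)
  qed (rule Rn)
  moreover have "nrm BH R \<le> nrm BH S" by (rule op_norm_leI[OF Rn op_norm_nonneg[OF S]])
  moreover have "star BH S = R" by (rule bop_star_eqI[OF R])
  ultimately show "star BH S \<in> carrier BH" "\<lbrakk>x \<in> carrier H; y \<in> carrier H\<rbrakk> \<Longrightarrow> \<langle>S x, y\<rangle> = \<langle>x, star BH S y\<rangle>"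
    "nrm BH (star BH S) \<le> nrm BH S" using R by auto
qed

lemma bop_closed:
  assumes S: "S \<in> carrier BH"
  shows "R \<in> carrier BH \<Longrightarrow> S \<otimes>\<^sub>B R \<in> carrier BH" "R \<in> carrier BH \<Longrightarrow> S \<oplus>\<^sub>B R \<in> carrier BH" "c \<odot>\<^sub>B S \<in> carrier BH"
    "\<zero>\<^sub>B \<in> carrier BH" "\<one>\<^bsub>BH\<^esub> \<in> carrier BH"
proof -
  have SD: "S x \<in> carrier H" "\<lbrakk>x \<in> carrier H; y \<in> carrier H\<rbrakk> \<Longrightarrow> S (x \<oplus> y) = S x \<oplus> S y" "S (c \<odot> x) = c \<odot> S x" if "x \<in> carrier H" for c x y
    using bopD(2-4)[OF S] that by auto
  note n = op_norm_nonneg[OF S] op_norm_le[OF S]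
  show "c \<odot>\<^sub>B S \<in> carrier BH"
  proof (rule bopI[where C = "cmod c * nrm BH S"])
    show "c \<odot>\<^sub>B S \<in> carrier H \<rightarrow>\<^sub>E carrier H" using SD by (auto simp: bounded_ops_def)
    fix x assume x: "x \<in> carrier H"
    show "hnorm H ((c \<odot>\<^sub>B S) x) \<le> cmod c * nrm BH S * hnorm H x"
      using x SD n(2)[OF x] by (simp add: hnorm_smult mult.assoc mult_left_mono)
  qed (use SD in \<open>simp_all add: smult_simps mult.commute\<close>)
  show "\<zero>\<^sub>B \<in> carrier BH"
    by (rule bopI[where C = 0]) (auto simp: bounded_ops_def)
  show "\<one>\<^bsub>BH\<^esub> \<in> carrier BH"
    by (rule bopI[where C = 1]) (auto simp: bounded_ops_def)
  assume R: "R \<in> carrier BH"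
  have RD: "R x \<in> carrier H" "\<lbrakk>x \<in> carrier H; y \<in> carrier H\<rbrakk> \<Longrightarrow> R (x \<oplus> y) = R x \<oplus> R y" "R (c \<odot> x) = c \<odot> R x" if "x \<in> carrier H" for c x y
    using bopD(2-4)[OF R] that by auto
  note m = op_norm_nonneg[OF R] op_norm_le[OF R]
  show "S \<otimes>\<^sub>B R \<in> carrier BH"
  proof (rule bopI[where C = "nrm BH S * nrm BH R"])
    show "S \<otimes>\<^sub>B R \<in> carrier H \<rightarrow>\<^sub>E carrier H" using SD RD by (auto simp: bounded_ops_def compose_def)
    fix x assume x: "x \<in> carrier H"
    show "hnorm H ((S \<otimes>\<^sub>B R) x) \<le> nrm BH S * nrm BH R * hnorm H x"
      using x SD RD n(2)[OF RD(1)[OF x]] mult_left_mono[OF m(2)[OF x] n(1)] by (simp add: mult.assoc)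
  qed (use SD RD in simp_all)
  show "S \<oplus>\<^sub>B R \<in> carrier BH"
  proof (rule bopI[where C = "nrm BH S + nrm BH R"])
    show "S \<oplus>\<^sub>B R \<in> carrier H \<rightarrow>\<^sub>E carrier H" using SD RD by (auto simp: bounded_ops_def)
    fix x assume x: "x \<in> carrier H"
    show "hnorm H ((S \<oplus>\<^sub>B R) x) \<le> (nrm BH S + nrm BH R) * hnorm H x"
      using x SD RD N_triangle[of "S x" "R x"] n(2)[OF x] m(2)[OF x] by (simp add: distrib_right)
  qed (use SD RD in \<open>simp_all add: smult_simps a_ac\<close>)
qed

lemma op_norm_mult: assumes S: "S \<in> carrier BH" and R: "R \<in> carrier BH" shows "nrm BH (S \<otimes>\<^sub>B R) \<le> nrm BH S * nrm BH R"
proof (rule op_norm_leI)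
  fix x assume x: "x \<in> carrier H"
  show "hnorm H ((S \<otimes>\<^sub>B R) x) \<le> nrm BH S * nrm BH R * hnorm H x"
    using x op_norm_le[OF S bopD(2)[OF R x]] mult_left_mono[OF op_norm_le[OF R x] op_norm_nonneg[OF S]] by (simp add: mult.assoc)
qed (use op_norm_nonneg S R in simp)

lemma BH_abelian_group: "abelian_group BH"
proof (rule abelian_groupI)
  have z: "\<zero>\<^sub>B \<in> carrier BH" by (rule bopI[where C = 0]) (auto simp: bounded_ops_def)
  then show "\<zero>\<^sub>B \<in> carrier BH" .
  fix S assume S: "S \<in> carrier BH"
  note SD = bopD(2)[OF S]
  show "\<zero>\<^sub>B \<oplus>\<^sub>B S = S" by (rule bop_eqI) (use S z bop_closed SD in auto)
  show "\<exists>R\<in>carrier BH. R \<oplus>\<^sub>B S = \<zero>\<^sub>B"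
  proof (rule bexI)
    show c: "(-1) \<odot>\<^sub>B S \<in> carrier BH" using bop_closed S by blast
    show "(-1) \<odot>\<^sub>B S \<oplus>\<^sub>B S = \<zero>\<^sub>B" by (rule bop_eqI) (use S z c bop_closed SD in \<open>auto simp: l_neg\<close>)
  qed
  fix R assume R: "R \<in> carrier BH"
  note RD = bopD(2)[OF R]
  show "S \<oplus>\<^sub>B R \<in> carrier BH" using S R bop_closed by blast
  show "S \<oplus>\<^sub>B R = R \<oplus>\<^sub>B S" by (rule bop_eqI) (use S R bop_closed SD RD in \<open>auto simp: a_comm\<close>)
  fix Q assume Q: "Q \<in> carrier BH"
  show "S \<oplus>\<^sub>B R \<oplus>\<^sub>B Q = S \<oplus>\<^sub>B (R \<oplus>\<^sub>B Q)"
    by (rule bop_eqI) (use S R Q bop_closed SD RD bopD(2)[OF Q] in \<open>auto simp: a_assoc\<close>)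
qed

lemma BH_module: "complex_module BH"
  unfolding complex_module_def
  by (rule moduleI[OF cring_complex_ring BH_abelian_group])
     (auto intro!: bop_eqI bop_closed simp: bopD smult_simps mult.commute)

lemma BH_normed_group: "normed_group BH (nrm BH)"
proof -
  interpret B: complex_module BH by (rule BH_module)
  show ?thesis
  proof unfold_locales
    fix S assume S: "S \<in> carrier BH"
    show "0 \<le> nrm BH S" using op_norm_nonneg S .
    show "(nrm BH S = 0) = (S = \<zero>\<^sub>B)"
    proof
      assume "nrm BH S = 0"
      then have "hnorm H (S x) \<le> 0" if "x \<in> carrier H" for x using op_norm_le[OF S that] by simp
      then have "S x = \<zero>" if "x \<in> carrier H" for x
        using that hnorm_eq_0[OF bopD(2)[OF S that]] hnorm_nonneg[OF bopD(2)[OF S that]] by (meson order_antisym)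
      then show "S = \<zero>\<^sub>B" by (intro bop_eqI) (use S in auto)
    next
      assume S0: "S = \<zero>\<^sub>B"
      have "nrm BH S \<le> 0" by (rule op_norm_leI) (auto simp: S0)
      then show "nrm BH S = 0" using op_norm_nonneg[OF S] by simp
    qed
    have e: "\<ominus>\<^bsub>BH\<^esub> S = (-1) \<odot>\<^sub>B S" using B.smult_minus(1)[OF S, of 1] S by simp
    show "nrm BH (\<ominus>\<^bsub>BH\<^esub> S) = nrm BH S"
      unfolding op_norm by (rule SUP_cong) (use bopD(2)[OF S] in \<open>auto simp: e N_uminus\<close>)
    fix R assume R: "R \<in> carrier BH"
    show "nrm BH (S \<oplus>\<^sub>B R) \<le> nrm BH S + nrm BH R"
    proof (rule op_norm_leI)
      fix x assume x: "x \<in> carrier H"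
      show "hnorm H ((S \<oplus>\<^sub>B R) x) \<le> (nrm BH S + nrm BH R) * hnorm H x"
        using x N_triangle[of "S x" "R x"] op_norm_le[OF S x] op_norm_le[OF R x] bopD(2)[OF S] bopD(2)[OF R] by (simp add: distrib_right)
    qed (use op_norm_nonneg S R in simp)
  qed
qed

lemma BH_diff_apply:
  assumes "S \<in> carrier BH" "R \<in> carrier BH" "x \<in> carrier H"
  shows "(S \<ominus>\<^sub>B R) x = S x \<ominus> R x"
proof -
  interpret B: complex_module BH by (rule BH_module)
  have "(\<ominus>\<^bsub>BH\<^esub> R) x = ((-1) \<odot>\<^sub>B R) x" using B.smult_minus(1)[of R 1] assms by simp
  also have "\<dots> = \<ominus> R x" unfolding BH_simps(3)[OF assms(3)] using bopD(2)[OF assms(2,3)] smult_minus(1)[of "R x" 1] by simp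
  finally show ?thesis using assms by (simp add: a_minus_def)
qed

lemma BH_complete: "Metric_space.mcomplete (carrier BH) (norm_dist BH (nrm BH))"
proof -
  interpret B: normed_group BH "nrm BH" by (rule BH_normed_group)
  show ?thesis
  proof (rule B.completeI)
    fix X :: "nat \<Rightarrow> _" assume X: "\<And>n. X n \<in> carrier BH" and ca: "\<And>e. e > 0 \<Longrightarrow> \<exists>M. \<forall>m\<ge>M. \<forall>n\<ge>M. nrm BH (X m \<ominus>\<^sub>B X n) < e"
    note XD = bopD(2-4)[OF X]
    have pt: "hnorm H (X m x \<ominus> X n x) \<le> nrm BH (X m \<ominus>\<^sub>B X n) * hnorm H x" if "x \<in> carrier H" for m n x
      using op_norm_le[of "X m \<ominus>\<^sub>B X n" x] X that BH_diff_apply[OF X X that] by simp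
    have "\<exists>l. tends (\<lambda>n. X n x) l" if x: "x \<in> carrier H" for x
    proof (rule tends_of_complete[OF complete])
      fix e :: real assume e: "e > 0"
      have h: "hnorm H x + 1 > 0" using hnorm_nonneg[OF x] by linarith
      obtain M where M: "\<forall>m\<ge>M. \<forall>n\<ge>M. nrm BH (X m \<ominus>\<^sub>B X n) < e / (hnorm H x + 1)" using ca[of "e / (hnorm H x + 1)"] e h by auto
      have "hnorm H (X m x \<ominus> X n x) < e" if "m \<ge> M" "n \<ge> M" for m n
      proof -
        have "hnorm H (X m x \<ominus> X n x) \<le> nrm BH (X m \<ominus>\<^sub>B X n) * (hnorm H x + 1)"
          by (rule order_trans[OF pt[OF x]], rule mult_left_mono) (use X op_norm_nonneg in auto)
        also have "\<dots> < e" using M that h by (simp add: less_divide_eq)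
        finally show ?thesis .
      qed
      then show "\<exists>M. \<forall>m\<ge>M. \<forall>n\<ge>M. hnorm H (X m x \<ominus> X n x) < e" by blast
    qed (use XD x in simp)
    then obtain L' where L': "\<And>x. x \<in> carrier H \<Longrightarrow> tends (\<lambda>n. X n x) (L' x)" by metis
    define L where "L = restrict L' (carrier H)"
    have L: "tends (\<lambda>n. X n x) (L x)" if "x \<in> carrier H" for x using L' that by (simp add: L_def)
    have Lc: "L x \<in> carrier H" if "x \<in> carrier H" for x using tendsD[OF L[OF that]] by simp
    have near: "hnorm H (X n x \<ominus> L x) \<le> e * hnorm H x"
      if x: "x \<in> carrier H" and M: "\<forall>m\<ge>M. \<forall>n\<ge>M. nrm BH (X m \<ominus>\<^sub>B X n) < e" and n: "n \<ge> M" for x e M n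
    proof (rule LIMSEQ_le_const2)
      have "tends (\<lambda>m. \<ominus> X m x) (\<ominus> L x)" using tends_uminus[OF L[OF x]] .
      then have "tends (\<lambda>m. X n x \<oplus> (\<ominus> X m x)) (X n x \<oplus> (\<ominus> L x))"
        by (intro tends_add tends_const XD x)
      then show "(\<lambda>m. hnorm H (X n x \<ominus> X m x)) \<longlonglongrightarrow> hnorm H (X n x \<ominus> L x)"
        using tends_norm by (simp add: a_minus_def)
      have "hnorm H (X n x \<ominus> X m x) \<le> e * hnorm H x" if "m \<ge> M" for m
        by (rule order_trans[OF pt[OF x]], rule mult_right_mono) (use M n that x in \<open>auto intro: less_imp_le\<close>)
      then show "\<exists>N. \<forall>m\<ge>N. hnorm H (X n x \<ominus> X m x) \<le> e * hnorm H x" by blast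
    qed
    obtain M1 where M1: "\<forall>m\<ge>M1. \<forall>n\<ge>M1. nrm BH (X m \<ominus>\<^sub>B X n) < 1" using ca[of 1] by auto
    have LB: "L \<in> carrier BH"
    proof (rule bopI[where C = "1 + nrm BH (X M1)"])
      show "L \<in> carrier H \<rightarrow>\<^sub>E carrier H" using Lc by (auto simp: L_def)
      fix x assume x: "x \<in> carrier H"
      show "hnorm H (L x) \<le> (1 + nrm BH (X M1)) * hnorm H x"
        using N_le_diff[of "L x" "X M1 x"] near[OF x M1 order_refl] op_norm_le[OF X[of M1] x] N_diff_sym[of "L x" "X M1 x"] Lc[OF x] XD(1)[OF x]
        by (simp add: distrib_right)
      show "L (c \<odot> x) = c \<odot> L x" for c
      proof (rule tends_unique[OF L])
        show "tends (\<lambda>n. X n (c \<odot> x)) (c \<odot> L x)"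
        proof (rule tendsI[of _ _ "\<lambda>n. cmod c * hnorm H (X n x \<ominus> L x)"])
          show "hnorm H (X n (c \<odot> x) \<ominus> c \<odot> L x) \<le> cmod c * hnorm H (X n x \<ominus> L x)" for n
            using x XD Lc by (simp add: smult_diff[symmetric] hnorm_smult)
          show "(\<lambda>n. cmod c * hnorm H (X n x \<ominus> L x)) \<longlonglongrightarrow> 0" using tendsto_mult_right_zero[OF tendsD(3)[OF L[OF x]]] .
        qed (use x XD Lc in auto)
      qed (use x in simp)
      show "L (x \<oplus> y) = L x \<oplus> L y" if y: "y \<in> carrier H" for y
      proof (rule tends_unique[OF L])
        show "tends (\<lambda>n. X n (x \<oplus> y)) (L x \<oplus> L y)"
          using tends_add[OF L[OF x] L[OF y]] XD(2)[OF x y] by simp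
      qed (use x y in simp)
    qed
    have "(\<lambda>n. nrm BH (X n \<ominus>\<^sub>B L)) \<longlonglongrightarrow> 0"
    proof (rule LIMSEQ_I)
      fix r :: real assume r: "r > 0"
      obtain M where M: "\<forall>m\<ge>M. \<forall>n\<ge>M. nrm BH (X m \<ominus>\<^sub>B X n) < r / 2" using ca[of "r/2"] r by auto
      have "nrm BH (X n \<ominus>\<^sub>B L) \<le> r / 2" if "n \<ge> M" for n
        by (rule op_norm_leI) (use near[OF _ M that] BH_diff_apply[OF X LB] r in auto)
      then have "norm (nrm BH (X n \<ominus>\<^sub>B L) - 0) < r" if "n \<ge> M" for n
        using that r op_norm_nonneg[of "X n \<ominus>\<^sub>B L"] X LB by (smt (verit) B.minus_closed real_norm_def field_sum_of_halves)
      then show "\<exists>no. \<forall>n\<ge>no. norm (nrm BH (X n \<ominus>\<^sub>B L) - 0) < r" by blast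
    qed
    then have "B.tends X L" unfolding B.tends_def using X LB by simp
    then show "\<exists>l. B.tends X l" by blast
  qed
qed

lemma BH_cstar: "cstar_algebra BH"
proof -
  interpret B: complex_module BH by (rule BH_module)
  interpret B: normed_group BH "nrm BH" by (rule BH_normed_group)
  show ?thesis
  proof unfold_locales
    fix S assume S: "S \<in> carrier BH"
    note st = bop_star[OF S]
    note SD = bopD(2-4)[OF S] and TD = bopD(2-4)[OF st(1)]
    show "star BH S \<in> carrier BH" by (rule st)
    have st_eq: "star BH Q = R" if "Q \<in> carrier BH" "R \<in> carrier BH" "\<And>x y. x \<in> carrier H \<Longrightarrow> y \<in> carrier H \<Longrightarrow> \<langle>Q x, y\<rangle> = \<langle>x, R y\<rangle>" for Q R
      by (rule bop_star_eqI) (use that bopD(1) in auto)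
    show "star BH (star BH S) = S"
    proof (rule st_eq[OF st(1) S])
      fix x y assume xy: "x \<in> carrier H" "y \<in> carrier H"
      show "\<langle>star BH S x, y\<rangle> = \<langle>x, S y\<rangle>" using st(2)[OF xy(2,1)] inprod_cnj[of "S y" x] inprod_cnj[of y "star BH S x"] SD TD xy by simp
    qed
    show "star BH (c \<odot>\<^sub>B S) = cnj c \<odot>\<^sub>B star BH S" for c
      by (rule st_eq) (use S st SD TD bop_closed in \<open>auto simp: ip_simps\<close>)
    show "0 \<le> nrm BH S" using op_norm_nonneg S .
    show "(nrm BH S = 0) = (S = \<zero>\<^sub>B)" using B.N_eq_0[OF S] .
    show "nrm BH (c \<odot>\<^sub>B S) = cmod c * nrm BH S" for c
    proof (rule antisym)
      have le: "nrm BH (d \<odot>\<^sub>B R) \<le> cmod d * nrm BH R" if R: "R \<in> carrier BH" for d R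
        by (rule op_norm_leI) (use op_norm_le[OF R] bopD(2)[OF R] op_norm_nonneg[OF R] in \<open>auto simp: hnorm_smult mult.assoc mult_left_mono\<close>)
      show "nrm BH (c \<odot>\<^sub>B S) \<le> cmod c * nrm BH S" by (rule le[OF S])
      show "cmod c * nrm BH S \<le> nrm BH (c \<odot>\<^sub>B S)"
      proof (cases "c = 0")
        case True then show ?thesis using op_norm_nonneg[of "c \<odot>\<^sub>B S"] S by simp
      next
        case False
        have "nrm BH S \<le> cmod (inverse c) * nrm BH (c \<odot>\<^sub>B S)"
          using le[of "c \<odot>\<^sub>B S" "inverse c"] S False B.smult_simps(3)[OF S, of "inverse c" c] by simp
        then show ?thesis using False by (simp add: norm_inverse norm_divide field_simps)
      qed
    qed
    show "nrm BH (star BH S \<otimes>\<^sub>B S) = (nrm BH S)\<^sup>2"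
    proof (rule antisym)
      have sq: "nrm BH S \<le> sqrt (nrm BH (star BH S \<otimes>\<^sub>B S))"
      proof (rule op_norm_leI)
        have c: "star BH S \<otimes>\<^sub>B S \<in> carrier BH" using bop_closed st S by blast
        show "0 \<le> sqrt (nrm BH (star BH S \<otimes>\<^sub>B S))" using op_norm_nonneg[OF c] by simp
        fix x assume x: "x \<in> carrier H"
        have "(hnorm H (S x))\<^sup>2 = Re \<langle>x, (star BH S \<otimes>\<^sub>B S) x\<rangle>" using st(2)[of x "S x"] hnorm_sq[of "S x"] SD x by simp
        also have "\<dots> \<le> hnorm H x * hnorm H ((star BH S \<otimes>\<^sub>B S) x)"
          by (rule order_trans[OF complex_Re_le_cmod cauchy_schwarz]) (use bopD(2)[OF c x] x in auto)
        also have "\<dots> \<le> hnorm H x * (nrm BH (star BH S \<otimes>\<^sub>B S) * hnorm H x)"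
          by (intro mult_left_mono op_norm_le c x hnorm_nonneg)
        also have "\<dots> = (sqrt (nrm BH (star BH S \<otimes>\<^sub>B S)) * hnorm H x)\<^sup>2"
          using op_norm_nonneg[OF c] by (simp add: power_mult_distrib) (simp add: power2_eq_square)
        finally show "hnorm H (S x) \<le> sqrt (nrm BH (star BH S \<otimes>\<^sub>B S)) * hnorm H x"
          by (rule power2_le_imp_le) (use op_norm_nonneg[OF c] x in simp)
      qed
      then show ge: "(nrm BH S)\<^sup>2 \<le> nrm BH (star BH S \<otimes>\<^sub>B S)"
        using op_norm_nonneg[OF S] op_norm_nonneg[of "star BH S \<otimes>\<^sub>B S"] bop_closed st S
        by (metis real_le_rsqrt real_sqrt_le_iff real_sqrt_pow2 power_mono)
      show "nrm BH (star BH S \<otimes>\<^sub>B S) \<le> (nrm BH S)\<^sup>2"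
        using op_norm_mult[OF st(1) S] st(3) mult_right_mono[of "nrm BH (star BH S)" "nrm BH S" "nrm BH S"] op_norm_nonneg[OF S] by (simp add: power2_eq_square)
    qed
    fix R assume R: "R \<in> carrier BH"
    note RD = bopD(2-4)[OF R] and rt = bop_star[OF R]
    show "S \<otimes>\<^sub>B R \<in> carrier BH" using bop_closed S R by blast
    show "star BH (S \<oplus>\<^sub>B R) = star BH S \<oplus>\<^sub>B star BH R"
      by (rule st_eq) (use S R st rt SD RD bopD(2)[OF st(1)] bopD(2)[OF rt(1)] bop_closed in \<open>auto simp: ip_simps\<close>)
    show "star BH (S \<otimes>\<^sub>B R) = star BH R \<otimes>\<^sub>B star BH S"
      by (rule st_eq) (use S R st rt SD RD bopD(2)[OF st(1)] bopD(2)[OF rt(1)] bop_closed in \<open>auto simp: ip_simps\<close>)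
    show "nrm BH (S \<oplus>\<^sub>B R) \<le> nrm BH S + nrm BH R" using B.N_triangle S R by blast
    show "nrm BH (S \<otimes>\<^sub>B R) \<le> nrm BH S * nrm BH R" by (rule op_norm_mult[OF S R])
    show "(c \<odot>\<^sub>B S) \<otimes>\<^sub>B R = c \<odot>\<^sub>B (S \<otimes>\<^sub>B R)" "S \<otimes>\<^sub>B (c \<odot>\<^sub>B R) = c \<odot>\<^sub>B (S \<otimes>\<^sub>B R)" for c
      by (rule bop_eqI, use S R SD RD bop_closed in auto)+
    fix Q assume Q: "Q \<in> carrier BH"
    note QD = bopD(2-4)[OF Q]
    show "S \<otimes>\<^sub>B R \<otimes>\<^sub>B Q = S \<otimes>\<^sub>B (R \<otimes>\<^sub>B Q)"
      "(S \<oplus>\<^sub>B R) \<otimes>\<^sub>B Q = S \<otimes>\<^sub>B Q \<oplus>\<^sub>B R \<otimes>\<^sub>B Q"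
      "Q \<otimes>\<^sub>B (S \<oplus>\<^sub>B R) = Q \<otimes>\<^sub>B S \<oplus>\<^sub>B Q \<otimes>\<^sub>B R"
      by (rule bop_eqI, use S R Q SD RD QD bop_closed in auto)+
  qed (rule BH_complete)
qed

end


subsection \<open>Representations\<close>

locale cstar_rep = A: cstar_algebra A + H: hilbert_space H
  for A :: "'a cstar" and H :: "'h hilbert" +
  fixes \<pi> :: "'a \<Rightarrow> 'h \<Rightarrow> 'h"
  assumes hom: "star_hom A (bounded_ops H) \<pi>"
begin

sublocale B: cstar_algebra "bounded_ops H" by (rule H.BH_cstar)

lemma rep_closed [simp]: "a \<in> carrier A \<Longrightarrow> \<pi> a \<in> carrier H.BH"
  using hom by (auto simp: star_hom_def)

lemma rep_apply [simp]: "a \<in> carrier A \<Longrightarrow> x \<in> carrier H \<Longrightarrow> \<pi> a x \<in> carrier H"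
  using H.bopD(2)[OF rep_closed] .

lemma rep_simps:
  "\<lbrakk>a \<in> carrier A; b \<in> carrier A\<rbrakk> \<Longrightarrow> \<pi> (a \<oplus>\<^bsub>A\<^esub> b) = \<pi> a \<oplus>\<^sub>B \<pi> b"
  "\<lbrakk>a \<in> carrier A; b \<in> carrier A\<rbrakk> \<Longrightarrow> \<pi> (a \<otimes>\<^bsub>A\<^esub> b) = \<pi> a \<otimes>\<^sub>B \<pi> b"
  "a \<in> carrier A \<Longrightarrow> \<pi> (c \<odot>\<^bsub>A\<^esub> a) = c \<odot>\<^sub>B \<pi> a"
  "a \<in> carrier A \<Longrightarrow> \<pi> (star A a) = star H.BH (\<pi> a)"
  using hom by (simp_all add: star_hom_def)

lemma rep_zero: "\<pi> \<zero>\<^bsub>A\<^esub> = \<zero>\<^sub>B"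
  using rep_simps(3)[of "\<zero>\<^bsub>A\<^esub>" 0] by simp

lemma rep_uminus: "a \<in> carrier A \<Longrightarrow> \<pi> (\<ominus>\<^bsub>A\<^esub> a) = \<ominus>\<^bsub>H.BH\<^esub> \<pi> a"
  using rep_simps(3)[of a "-1"] A.smult_minus(1)[of a 1] B.smult_minus(1)[of "\<pi> a" 1] by simp

lemma rep_diff: "\<lbrakk>a \<in> carrier A; b \<in> carrier A\<rbrakk> \<Longrightarrow> \<pi> (a \<ominus>\<^bsub>A\<^esub> b) = \<pi> a \<ominus>\<^sub>B \<pi> b"
  by (simp add: a_minus_def rep_simps rep_uminus)

lemma rep_adj: "\<lbrakk>a \<in> carrier A; x \<in> carrier H; y \<in> carrier H\<rbrakk> \<Longrightarrow> inprod H (\<pi> a x) y = inprod H x (\<pi> (star A a) y)"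
  using H.bop_star(2)[of "\<pi> a" x y] rep_simps(4) by simp

text \<open>If \<open>\<parallel>a\<parallel> \<le> 1\<close> and \<open>1 - a\<^sup>*a = (1 - c)\<^sup>2\<close>, then \<open>\<parallel>x\<parallel>\<^sup>2 - \<parallel>\<pi>(a)x\<parallel>\<^sup>2 = \<parallel>x - \<pi>(c)x\<parallel>\<^sup>2 \<ge> 0\<close>.\<close>

lemma rep_contractive_unit:
  assumes a: "a \<in> carrier A" "nrm A a \<le> 1" and x: "x \<in> carrier H"
  shows "hnorm H (\<pi> a x) \<le> hnorm H x"
proof -
  define b where "b = star A a \<otimes>\<^bsub>A\<^esub> a"
  have b: "b \<in> carrier A" "nrm A b \<le> 1" "star A b = b"
    using a A.cstar_identity[OF a(1)] A.nrm_nonneg[OF a(1)] by (simp_all add: b_def power_le_one A.star_mult)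
  obtain c where c: "c \<in> carrier A" "c \<oplus>\<^bsub>A\<^esub> c = b \<oplus>\<^bsub>A\<^esub> c \<otimes>\<^bsub>A\<^esub> c"
    and cS: "\<And>S. \<lbrakk>\<zero>\<^bsub>A\<^esub> \<in> S; \<And>x. x \<in> S \<Longrightarrow> x \<in> carrier A \<Longrightarrow> (1/2) \<odot>\<^bsub>A\<^esub> (b \<oplus>\<^bsub>A\<^esub> x \<otimes>\<^bsub>A\<^esub> x) \<in> S;
       \<And>X l. (\<And>n. X n \<in> S) \<Longrightarrow> A.tends X l \<Longrightarrow> l \<in> S\<rbrakk> \<Longrightarrow> c \<in> S"
    using A.quasi_sqrt[OF b(1,2)] by metis
  have "c \<in> {y. star A y = y}"
  proof (rule cS)
    fix X l assume X: "\<And>n. X n \<in> {y. star A y = y}" "A.tends X l"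
    have "(\<lambda>n. star A (X n)) = X" using X(1) by auto
    then have "A.tends X (star A l)" using A.tends_star[OF X(2)] by simp
    from A.tends_unique[OF this X(2)] show "l \<in> {y. star A y = y}" by simp
  qed (use b in \<open>auto simp: A.star_smult A.star_add A.star_mult\<close>)
  then have sc: "star A c = c" by simp
  note px = rep_apply[OF c(1) x]
  have "\<pi> c x \<oplus>\<^bsub>H\<^esub> \<pi> c x = \<pi> b x \<oplus>\<^bsub>H\<^esub> \<pi> c (\<pi> c x)"
    using arg_cong[OF c(2), of "\<lambda>y. \<pi> y x"] c(1) b(1) x by (simp add: rep_simps)
  then have "Re (inprod H (\<pi> c x \<oplus>\<^bsub>H\<^esub> \<pi> c x) x) = Re (inprod H (\<pi> b x \<oplus>\<^bsub>H\<^esub> \<pi> c (\<pi> c x)) x)" by simp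
  then have *: "2 * Re (inprod H (\<pi> c x) x) = Re (inprod H (\<pi> b x) x) + Re (inprod H (\<pi> c (\<pi> c x)) x)"
    using px x c(1) b(1) H.inprod_add[OF px px x] H.inprod_add[of "\<pi> b x" "\<pi> c (\<pi> c x)" x] by simp
  have "inprod H (\<pi> c (\<pi> c x)) x = inprod H (\<pi> c x) (\<pi> c x)" using rep_adj[OF c(1) px x] sc by simp
  moreover have "inprod H (\<pi> b x) x = inprod H (\<pi> a x) (\<pi> a x)"
    using rep_adj[of "star A a" "\<pi> a x" x] a x by (simp add: b_def rep_simps(2))
  ultimately have "2 * Re (inprod H (\<pi> c x) x) = (hnorm H (\<pi> a x))\<^sup>2 + (hnorm H (\<pi> c x))\<^sup>2"
    using * H.hnorm_sq px a x by simp
  moreover have "Re (inprod H x (\<pi> c x)) = Re (inprod H (\<pi> c x) x)" using H.inprod_cnj[OF px x] by simp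
  ultimately have "(hnorm H (x \<ominus>\<^bsub>H\<^esub> \<pi> c x))\<^sup>2 = (hnorm H x)\<^sup>2 - (hnorm H (\<pi> a x))\<^sup>2"
    using H.hnorm_diff_sq[OF x px] by simp
  then have "(hnorm H (\<pi> a x))\<^sup>2 \<le> (hnorm H x)\<^sup>2" using zero_le_power2[of "hnorm H (x \<ominus>\<^bsub>H\<^esub> \<pi> c x)"] by linarith
  then show ?thesis by (rule power2_le_imp_le) (use x in simp)
qed

lemma rep_contractive:
  assumes "a \<in> carrier A" shows "nrm H.BH (\<pi> a) \<le> nrm A a"
proof (cases "nrm A a = 0")
  case True
  then have "\<pi> a = \<zero>\<^sub>B" using A.nrm_eq_0 assms rep_zero by simp
  then show ?thesis using True by simp
next
  case False
  then have pos: "nrm A a > 0" using A.nrm_nonneg[OF assms] by simp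
  define c where "c = complex_of_real (inverse (nrm A a))"
  have "nrm A (c \<odot>\<^bsub>A\<^esub> a) \<le> 1" using pos A.nrm_smult[OF assms, of c] by (simp add: c_def norm_inverse)
  then have "hnorm H (\<pi> (c \<odot>\<^bsub>A\<^esub> a) x) \<le> 1 * hnorm H x" if "x \<in> carrier H" for x
    using rep_contractive_unit[of "c \<odot>\<^bsub>A\<^esub> a" x] assms that by simp
  then have "nrm H.BH (\<pi> (c \<odot>\<^bsub>A\<^esub> a)) \<le> 1" by (intro H.op_norm_leI) auto
  then have "cmod c * nrm H.BH (\<pi> a) \<le> 1" using assms B.nrm_smult[of "\<pi> a" c] by (simp add: rep_simps)
  then show ?thesis using pos by (simp add: c_def norm_inverse norm_divide divide_le_eq inverse_eq_divide)
qed

definition rep_norm :: "'a \<Rightarrow> real" where "rep_norm a = nrm H.BH (\<pi> a)"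

lemma rep_seminorm: "A.cstar_seminorm rep_norm"
  unfolding A.cstar_seminorm_def rep_norm_def
  using rep_contractive B.nrm_nonneg B.cstar_identity B.nrm_smult B.nrm_triangle B.nrm_mult by (simp add: rep_simps)

lemma kernel_iff: "a_kernel A H.BH \<pi> = {a \<in> carrier A. rep_norm a = 0}"
  by (auto simp: a_kernel_def' rep_norm_def B.nrm_eq_0)

end

section \<open>The Hilbert space of square-summable functions\<close>

lemma ell2_carrier: "f \<in> carrier (ell2 X) \<longleftrightarrow> (\<forall>i. i \<notin> X \<longrightarrow> f i = 0) \<and> (\<lambda>i. (cmod (f i))\<^sup>2) summable_on X"
  by (simp add: ell2_def)

lemma ell2_simps [simp]: "\<zero>\<^bsub>ell2 X\<^esub> = (\<lambda>i. 0)" "f \<oplus>\<^bsub>ell2 X\<^esub> g = (\<lambda>i. f i + g i)" "c \<odot>\<^bsub>ell2 X\<^esub> f = (\<lambda>i. c * f i)"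
  by (simp_all add: ell2_def)

lemma ell2_ip: "inprod (ell2 X) f g = (\<Sum>\<^sub>\<infinity>i\<in>X. f i * cnj (g i))"
  by (simp add: ell2_def)

lemma norm_add_sq_le: "(cmod (a + b))\<^sup>2 \<le> 2 * (cmod a)\<^sup>2 + 2 * (cmod b)\<^sup>2"
proof -
  have "(cmod (a + b))\<^sup>2 \<le> (cmod a + cmod b)\<^sup>2" by (intro power_mono norm_triangle_ineq) simp
  also have "\<dots> \<le> 2 * (cmod a)\<^sup>2 + 2 * (cmod b)\<^sup>2" using sum_squares_bound[of "cmod a" "cmod b"] by (simp add: power2_sum)
  finally show ?thesis .
qed

lemma ell2_add_closed: "f \<in> carrier (ell2 X) \<Longrightarrow> g \<in> carrier (ell2 X) \<Longrightarrow> (\<lambda>i. f i + g i) \<in> carrier (ell2 X)"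
  unfolding ell2_carrier
  by (auto intro!: summable_on_comparison_test[of "\<lambda>i. 2 * (cmod (f i))\<^sup>2 + 2 * (cmod (g i))\<^sup>2"] summable_on_add summable_on_cmult_right norm_add_sq_le)

lemma ell2_smult_closed: "f \<in> carrier (ell2 X) \<Longrightarrow> (\<lambda>i. c * f i) \<in> carrier (ell2 X)"
  unfolding ell2_carrier by (auto simp: norm_mult power_mult_distrib intro: summable_on_cmult_right)

lemma ell2_diff_closed: "f \<in> carrier (ell2 X) \<Longrightarrow> g \<in> carrier (ell2 X) \<Longrightarrow> (\<lambda>i. f i - g i) \<in> carrier (ell2 X)"
  using ell2_add_closed[OF _ ell2_smult_closed[of g X "-1"], of f] by simp

lemma ell2_ip_summable:
  assumes "f \<in> carrier (ell2 X)" "g \<in> carrier (ell2 X)"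
  shows "(\<lambda>i. f i * cnj (g i)) summable_on X"
proof (rule abs_summable_summable, rule summable_on_comparison_test)
  show "(\<lambda>i. (cmod (f i))\<^sup>2 + (cmod (g i))\<^sup>2) summable_on X" using assms by (auto simp: ell2_carrier intro: summable_on_add)
  fix i
  show "norm (f i * cnj (g i)) \<le> (cmod (f i))\<^sup>2 + (cmod (g i))\<^sup>2"
  proof -
    have "0 \<le> cmod (f i) * cmod (g i)" by simp
    then show ?thesis using sum_squares_bound[of "cmod (f i)" "cmod (g i)"] unfolding norm_mult complex_mod_cnj by linarith
  qed
qed simp

lemma ell2_ip_self:
  assumes "f \<in> carrier (ell2 X)"
  shows "inprod (ell2 X) f f = of_real (\<Sum>\<^sub>\<infinity>i\<in>X. (cmod (f i))\<^sup>2)"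
proof -
  have "((\<lambda>i. (cmod (f i))\<^sup>2) has_sum (\<Sum>\<^sub>\<infinity>i\<in>X. (cmod (f i))\<^sup>2)) X" using assms by (simp add: ell2_carrier)
  from has_sum_of_real[OF this, where 'a = complex] show ?thesis
    unfolding ell2_ip complex_norm_square by (rule infsumI)
qed

lemma ell2_abelian_group: "abelian_group (ell2 X)"
proof (rule abelian_groupI)
  fix f assume f: "f \<in> carrier (ell2 X)"
  then show "\<exists>g\<in>carrier (ell2 X). g \<oplus>\<^bsub>ell2 X\<^esub> f = \<zero>\<^bsub>ell2 X\<^esub>"
    using ell2_smult_closed[OF f, of "-1"] by (intro bexI[of _ "\<lambda>i. -1 * f i"]) auto
qed (auto simp: ell2_add_closed algebra_simps, simp add: ell2_carrier)

lemma ell2_module: "Module.module complex_ring (ell2 X)"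
  by (rule moduleI[OF cring_complex_ring ell2_abelian_group]) (auto simp: ell2_smult_closed algebra_simps)

lemma ell2_inner_product_space: "inner_product_space (ell2 X)"
proof -
  interpret Module.module complex_ring "ell2 X" by (rule ell2_module)
  show ?thesis
  proof unfold_locales
    fix f g h :: "'a \<Rightarrow> complex"
    assume f: "f \<in> carrier (ell2 X)"
    note self = ell2_ip_self[OF f]
    then show "0 \<le> Re (inprod (ell2 X) f f)" by (simp add: infsum_nonneg)
    show "f = \<zero>\<^bsub>ell2 X\<^esub>" if "inprod (ell2 X) f f = 0"
    proof -
      have "(\<Sum>\<^sub>\<infinity>i\<in>X. (cmod (f i))\<^sup>2) \<le> 0" using that self by simp
      then have "(cmod (f i))\<^sup>2 = 0" if "i \<in> X" for i
        using nonneg_infsum_le_0D[of "\<lambda>i. (cmod (f i))\<^sup>2" X i] f that by (simp add: ell2_carrier)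
      then show ?thesis using f by (auto simp: ell2_carrier)
    qed
    assume g: "g \<in> carrier (ell2 X)"
    show "inprod (ell2 X) (c \<odot>\<^bsub>ell2 X\<^esub> f) g = c * inprod (ell2 X) f g" for c
      using infsum_cmult_right[of c "\<lambda>i. f i * cnj (g i)" X] ell2_ip_summable[OF f g] by (simp add: ell2_ip mult.assoc)
    show "inprod (ell2 X) g f = cnj (inprod (ell2 X) f g)"
      by (simp add: ell2_ip infsum_cnj[symmetric] mult.commute)
    assume h: "h \<in> carrier (ell2 X)"
    show "inprod (ell2 X) (f \<oplus>\<^bsub>ell2 X\<^esub> g) h = inprod (ell2 X) f h + inprod (ell2 X) g h"
      using infsum_add[OF ell2_ip_summable[OF f h] ell2_ip_summable[OF g h]] by (simp add: ell2_ip distrib_right)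
  qed
qed

lemma ell2_hnorm_sq: "f \<in> carrier (ell2 X) \<Longrightarrow> (hnorm (ell2 X) f)\<^sup>2 = (\<Sum>\<^sub>\<infinity>i\<in>X. (cmod (f i))\<^sup>2)"
  using ell2_ip_self[of f X] by (simp add: hnorm_def infsum_nonneg)

lemma ell2_minus: assumes "f \<in> carrier (ell2 X)" "g \<in> carrier (ell2 X)" shows "f \<ominus>\<^bsub>ell2 X\<^esub> g = (\<lambda>i. f i - g i)"
proof -
  interpret inner_product_space "ell2 X" by (rule ell2_inner_product_space)
  have "\<ominus>\<^bsub>ell2 X\<^esub> g = (-1) \<odot>\<^bsub>ell2 X\<^esub> g" using smult_minus(1)[of g 1] assms by simp
  then show ?thesis by (simp add: a_minus_def)
qed

lemma ell2_finite_sum_le: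
  assumes "f \<in> carrier (ell2 X)" "finite F" "F \<subseteq> X"
  shows "(\<Sum>i\<in>F. (cmod (f i))\<^sup>2) \<le> (hnorm (ell2 X) f)\<^sup>2"
  unfolding ell2_hnorm_sq[OF assms(1)] by (rule finite_sum_le_infsum) (use assms in \<open>auto simp: ell2_carrier\<close>)

lemma ell2_of_finite_bounds:
  assumes "\<And>i. i \<notin> X \<Longrightarrow> f i = 0" "0 \<le> C" "\<And>F. finite F \<Longrightarrow> F \<subseteq> X \<Longrightarrow> (\<Sum>i\<in>F. (cmod (f i))\<^sup>2) \<le> C\<^sup>2"
  shows "f \<in> carrier (ell2 X)" "hnorm (ell2 X) f \<le> C"
proof -
  show f: "f \<in> carrier (ell2 X)"
    unfolding ell2_carrier by (intro conjI nonneg_bdd_above_summable_on bdd_aboveI[of _ "C\<^sup>2"]) (use assms in auto)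
  have "(hnorm (ell2 X) f)\<^sup>2 \<le> C\<^sup>2"
    unfolding ell2_hnorm_sq[OF f] by (rule infsum_le_finite_sums) (use assms f in \<open>auto simp: ell2_carrier\<close>)
  then show "hnorm (ell2 X) f \<le> C" using assms(2) by (rule power2_le_imp_le)
qed

lemma ell2_coord_le: "f \<in> carrier (ell2 X) \<Longrightarrow> cmod (f i) \<le> hnorm (ell2 X) f"
proof (cases "i \<in> X")
  assume f: "f \<in> carrier (ell2 X)"
  have n: "0 \<le> hnorm (ell2 X) f" using inner_product_space.hnorm_nonneg[OF ell2_inner_product_space f] .
  {
    case True
    then have "(cmod (f i))\<^sup>2 \<le> (hnorm (ell2 X) f)\<^sup>2" using ell2_finite_sum_le[OF f, of "{i}"] by simp
    then show ?thesis using n by (rule power2_le_imp_le)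
  next
    case False
    then show ?thesis using f n by (simp add: ell2_carrier)
  }
qed

lemma ell2_hilbert_space: "hilbert_space (ell2 X)"
proof -
  interpret inner_product_space "ell2 X" by (rule ell2_inner_product_space)
  have c: "Metric_space.mcomplete (carrier (ell2 X)) (norm_dist (ell2 X) (hnorm (ell2 X)))"
  proof (rule completeI)
    fix Y :: "nat \<Rightarrow> _ \<Rightarrow> complex"
    assume Y: "\<And>n. Y n \<in> carrier (ell2 X)" and ca: "\<And>e. e > 0 \<Longrightarrow> \<exists>M. \<forall>m\<ge>M. \<forall>n\<ge>M. hnorm (ell2 X) (Y m \<ominus>\<^bsub>ell2 X\<^esub> Y n) < e"
    have d: "Y m \<ominus>\<^bsub>ell2 X\<^esub> Y n = (\<lambda>i. Y m i - Y n i)" for m n using ell2_minus[OF Y Y] .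
    have dc: "(\<lambda>i. Y m i - Y n i) \<in> carrier (ell2 X)" for m n using ell2_diff_closed[OF Y Y] .
    have "Cauchy (\<lambda>n. Y n i)" for i
    proof (rule metric_CauchyI)
      fix e :: real assume "e > 0"
      then obtain M where M: "\<forall>m\<ge>M. \<forall>n\<ge>M. hnorm (ell2 X) (Y m \<ominus>\<^bsub>ell2 X\<^esub> Y n) < e" using ca by blast
      have "dist (Y m i) (Y n i) < e" if "m \<ge> M" "n \<ge> M" for m n
        using ell2_coord_le[OF dc[of m n], of i] M that unfolding d dist_norm by (meson le_less_trans)
      then show "\<exists>M. \<forall>m\<ge>M. \<forall>n\<ge>M. dist (Y m i) (Y n i) < e" by blast
    qed
    then have "\<exists>l. (\<lambda>n. Y n i) \<longlonglongrightarrow> l" for i by (simp add: Cauchy_convergent_iff convergent_def)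
    then obtain f where f: "\<And>i. (\<lambda>n. Y n i) \<longlonglongrightarrow> f i" by metis
    have f0: "f i = 0" if "i \<notin> X" for i
    proof -
      have "(\<lambda>n. Y n i) = (\<lambda>n. 0)" using Y that by (auto simp: ell2_carrier)
      then show ?thesis using f[of i] LIMSEQ_unique[of "\<lambda>n. 0" "f i" 0] by simp
    qed
    have near: "(\<lambda>i. Y n i - f i) \<in> carrier (ell2 X) \<and> hnorm (ell2 X) (\<lambda>i. Y n i - f i) \<le> e"
      if M: "\<forall>m\<ge>M. \<forall>n\<ge>M. hnorm (ell2 X) (Y m \<ominus>\<^bsub>ell2 X\<^esub> Y n) < e" and n: "n \<ge> M" and e: "e > 0" for M n e
    proof -
      have "(\<Sum>i\<in>F. (cmod (Y n i - f i))\<^sup>2) \<le> e\<^sup>2" if F: "finite F" "F \<subseteq> X" for F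
      proof (rule LIMSEQ_le_const2)
        show "(\<lambda>m. \<Sum>i\<in>F. (cmod (Y n i - Y m i))\<^sup>2) \<longlonglongrightarrow> (\<Sum>i\<in>F. (cmod (Y n i - f i))\<^sup>2)"
          by (intro tendsto_intros f)
        have "(\<Sum>i\<in>F. (cmod (Y n i - Y m i))\<^sup>2) \<le> e\<^sup>2" if "m \<ge> M" for m
        proof -
          have "hnorm (ell2 X) (\<lambda>i. Y n i - Y m i) \<le> e" using M n that unfolding d by (simp add: less_imp_le)
          then have "(hnorm (ell2 X) (\<lambda>i. Y n i - Y m i))\<^sup>2 \<le> e\<^sup>2" using hnorm_nonneg[OF dc] by (intro power_mono)
          then show ?thesis using ell2_finite_sum_le[OF dc[of n m] F] by linarith
        qed
        then show "\<exists>N. \<forall>m\<ge>N. (\<Sum>i\<in>F. (cmod (Y n i - Y m i))\<^sup>2) \<le> e\<^sup>2" by blast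
      qed
      moreover have "Y n i - f i = 0" if "i \<notin> X" for i using f0[OF that] Y[of n] that by (simp add: ell2_carrier)
      ultimately show ?thesis using ell2_of_finite_bounds[of X "\<lambda>i. Y n i - f i" e] e by auto
    qed
    obtain M1 where M1: "\<forall>m\<ge>M1. \<forall>n\<ge>M1. hnorm (ell2 X) (Y m \<ominus>\<^bsub>ell2 X\<^esub> Y n) < 1" using ca[of 1] by auto
    have fc: "f \<in> carrier (ell2 X)"
      using ell2_diff_closed[OF Y[of M1] conjunct1[OF near[OF M1 order_refl]]] by simp
    have "(\<lambda>n. hnorm (ell2 X) (Y n \<ominus>\<^bsub>ell2 X\<^esub> f)) \<longlonglongrightarrow> 0"
    proof (rule LIMSEQ_I)
      fix r :: real assume r: "r > 0"
      obtain M where M: "\<forall>m\<ge>M. \<forall>n\<ge>M. hnorm (ell2 X) (Y m \<ominus>\<^bsub>ell2 X\<^esub> Y n) < r / 2" using ca[of "r/2"] r by auto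
      have "norm (hnorm (ell2 X) (Y n \<ominus>\<^bsub>ell2 X\<^esub> f) - 0) < r" if "n \<ge> M" for n
      proof -
        have "hnorm (ell2 X) (Y n \<ominus>\<^bsub>ell2 X\<^esub> f) \<le> r / 2" using near[OF M that] r unfolding ell2_minus[OF Y fc] by simp
        moreover have "0 \<le> hnorm (ell2 X) (Y n \<ominus>\<^bsub>ell2 X\<^esub> f)" using Y fc by simp
        ultimately show ?thesis using r by simp
      qed
      then show "\<exists>no. \<forall>n\<ge>no. norm (hnorm (ell2 X) (Y n \<ominus>\<^bsub>ell2 X\<^esub> f) - 0) < r" by blast
    qed
    then show "\<exists>l. tends Y l" unfolding tends_def using Y fc by blast
  qed
  show ?thesis
    by (intro hilbert_space.intro hilbert_space_axioms.intro ell2_module c)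
      (rule inprod_add inprod_smult inprod_cnj inprod_nonneg inprod_eq_0; assumption)+
qed

lemma basis_vec_carrier [simp]: "i \<in> X \<Longrightarrow> basis_vec i \<in> carrier (ell2 X)"
  by (rule ell2_of_finite_bounds[where C = 1]) (auto simp: basis_vec_def sum.delta if_distrib[of cmod] if_distrib[of "\<lambda>x. x ^ 2"] cong: if_cong)

text \<open>Stated for every \<open>g\<close> dominated by \<open>f\<close>, so that it serves for restrictions of \<open>f\<close> to arbitrary subsets.\<close>

lemma ell2_tail_small:
  assumes f: "f \<in> carrier (ell2 X)" and "e > 0"
  shows "\<exists>F \<subseteq> X. finite F \<and> (\<forall>g \<in> carrier (ell2 X). (\<forall>i \<in> F. g i = 0) \<longrightarrow> (\<forall>i. cmod (g i) \<le> cmod (f i)) \<longrightarrow> hnorm (ell2 X) g \<le> e)"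
proof -
  have s: "(\<lambda>i. (cmod (f i))\<^sup>2) summable_on X" using f by (simp add: ell2_carrier)
  obtain F where F: "finite F" "F \<subseteq> X" "dist (\<Sum>i\<in>F. (cmod (f i))\<^sup>2) (\<Sum>\<^sub>\<infinity>i\<in>X. (cmod (f i))\<^sup>2) \<le> e\<^sup>2"
    using infsum_finite_approximation[OF s, of "e\<^sup>2"] assms(2) by auto
  have small: "hnorm (ell2 X) g \<le> e" if g: "g \<in> carrier (ell2 X)" "\<And>i. i \<in> F \<Longrightarrow> g i = 0" "\<And>i. cmod (g i) \<le> cmod (f i)" for g
  proof (rule ell2_of_finite_bounds(2))
    fix F' assume F': "finite F'" "F' \<subseteq> X"
    have "(\<Sum>i\<in>F'. (cmod (g i))\<^sup>2) = (\<Sum>i\<in>F' - F. (cmod (g i))\<^sup>2)" by (rule sum.mono_neutral_right) (use F' g in auto)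
    also have "\<dots> \<le> (\<Sum>i\<in>F' - F. (cmod (f i))\<^sup>2)" by (intro sum_mono power_mono g) simp
    also have "\<dots> = (\<Sum>i\<in>(F' - F) \<union> F. (cmod (f i))\<^sup>2) - (\<Sum>i\<in>F. (cmod (f i))\<^sup>2)"
      using F F' by (subst sum.union_disjoint) auto
    also have "(\<Sum>i\<in>(F' - F) \<union> F. (cmod (f i))\<^sup>2) \<le> (\<Sum>\<^sub>\<infinity>i\<in>X. (cmod (f i))\<^sup>2)"
      by (rule finite_sum_le_infsum[OF s]) (use F F' in auto)
    finally show "(\<Sum>i\<in>F'. (cmod (g i))\<^sup>2) \<le> e\<^sup>2" using F(3) by (simp add: dist_real_def)
  next
    show "g i = 0" if "i \<notin> X" for i using g(1) that by (simp add: ell2_carrier)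
    show "0 \<le> e" using assms(2) by simp
  qed
  show ?thesis
  proof (intro exI[of _ F] conjI ballI impI F(1,2))
    fix g assume "g \<in> carrier (ell2 X)" "\<forall>i \<in> F. g i = 0" "\<forall>i. cmod (g i) \<le> cmod (f i)"
    then show "hnorm (ell2 X) g \<le> e" by (intro small) blast+
  qed
qed

lemma submodule_simps:
  assumes "submodule K R V"
  shows "x \<in> K \<Longrightarrow> y \<in> K \<Longrightarrow> x \<oplus>\<^bsub>V\<^esub> y \<in> K"
    and "x \<in> K \<Longrightarrow> a \<in> carrier R \<Longrightarrow> a \<odot>\<^bsub>V\<^esub> x \<in> K"
    and "\<zero>\<^bsub>V\<^esub> \<in> K" and "K \<subseteq> carrier V"
proof -
  have s: "subgroup K (add_monoid V)" using assms by (simp add: submodule_def)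
  show "x \<in> K \<Longrightarrow> y \<in> K \<Longrightarrow> x \<oplus>\<^bsub>V\<^esub> y \<in> K" using subgroup.m_closed[OF s, of x y] by simp
  show "x \<in> K \<Longrightarrow> a \<in> carrier R \<Longrightarrow> a \<odot>\<^bsub>V\<^esub> x \<in> K" by (rule submodule.smult_closed[OF assms])
  show "\<zero>\<^bsub>V\<^esub> \<in> K" using subgroup.one_closed[OF s] by simp
  show "K \<subseteq> carrier V" using subgroup.subset[OF s] by simp
qed

lemma ell2_basis_total:
  assumes K: "submodule K complex_ring (ell2 X)"
    and cl: "closedin (Metric_space.mtopology (carrier (ell2 X)) (norm_dist (ell2 X) (hnorm (ell2 X)))) K"
    and b: "\<And>i. i \<in> X \<Longrightarrow> basis_vec i \<in> K"
  shows "K = carrier (ell2 X)"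
proof
  interpret hilbert_space "ell2 X" by (rule ell2_hilbert_space)
  show "K \<subseteq> carrier (ell2 X)" using submodule_simps(4)[OF K] .
  show "carrier (ell2 X) \<subseteq> K"
  proof
    fix f assume f: "f \<in> carrier (ell2 X)"
    have fin: "(\<lambda>i. if i \<in> F then f i else 0) \<in> K" if "finite F" "F \<subseteq> X" for F
      using that
    proof induction
      case empty then show ?case using submodule_simps(3)[OF K] by simp
    next
      case (insert j F)
      have "(\<lambda>i. if i \<in> insert j F then f i else 0) = (\<lambda>i. if i \<in> F then f i else 0) \<oplus>\<^bsub>ell2 X\<^esub> (f j \<odot>\<^bsub>ell2 X\<^esub> basis_vec j)"
        using insert.hyps by (auto simp: basis_vec_def)
      then show ?case using insert b submodule_simps(1)[OF K] submodule_simps(2)[OF K] by simp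
    qed
    have "\<exists>g \<in> K. hnorm (ell2 X) (g \<ominus>\<^bsub>ell2 X\<^esub> f) \<le> inverse (real (Suc n))" for n
    proof -
      have "0 < inverse (real (Suc n))" by simp
      from ell2_tail_small[OF f this] obtain F where F: "finite F" "F \<subseteq> X"
        "\<forall>g \<in> carrier (ell2 X). (\<forall>i \<in> F. g i = 0) \<longrightarrow> (\<forall>i. cmod (g i) \<le> cmod (f i)) \<longrightarrow> hnorm (ell2 X) g \<le> inverse (real (Suc n))"
        by blast
      let ?g = "\<lambda>i. if i \<in> F then f i else 0"
      have g: "?g \<in> K" "?g \<in> carrier (ell2 X)" using fin[OF F(1,2)] submodule_simps(4)[OF K] by auto
      have "hnorm (ell2 X) (?g \<ominus>\<^bsub>ell2 X\<^esub> f) \<le> inverse (real (Suc n))"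
        unfolding ell2_minus[OF g(2) f] by (rule F(3)[rule_format]) (use ell2_diff_closed[OF g(2) f] in auto)
      then show ?thesis using g by blast
    qed
    then obtain Y where Y: "\<And>n. Y n \<in> K" "\<And>n. hnorm (ell2 X) (Y n \<ominus>\<^bsub>ell2 X\<^esub> f) \<le> inverse (real (Suc n))" by metis
    have "tends Y f"
      by (rule tendsI[OF _ f Y(2) LIMSEQ_inverse_real_of_nat]) (use Y submodule_simps(4)[OF K] in auto)
    then show "f \<in> K" using cl Y unfolding closed_iff by blast
  qed
qed

section \<open>Path representations\<close>

text \<open>For \<open>h\<close> injective from \<open>P\<close> into \<open>X\<close> this is the partial isometry \<open>\<xi>\<^bsub>h(y)\<^esub> \<mapsto> c \<xi>\<^sub>y\<close>; its adjoint has the same form.\<close>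

definition partial_perm :: "'i set \<Rightarrow> 'i set \<Rightarrow> ('i \<Rightarrow> 'i) \<Rightarrow> complex \<Rightarrow> ('i \<Rightarrow> complex) \<Rightarrow> 'i \<Rightarrow> complex" where
  "partial_perm X P h c = (\<lambda>f \<in> carrier (ell2 X). (\<lambda>y. if y \<in> P then c * f (h y) else 0))"

lemma partial_perm_apply [simp]:
  "f \<in> carrier (ell2 X) \<Longrightarrow> partial_perm X P h c f = (\<lambda>y. if y \<in> P then c * f (h y) else 0)"
  by (simp add: partial_perm_def)

lemma partial_perm_bounded:
  assumes P: "P \<subseteq> X" and h: "inj_on h P" "h ` P \<subseteq> X" and c: "cmod c = 1"
  shows "partial_perm X P h c \<in> carrier (bounded_ops (ell2 X))"
proof -
  interpret hilbert_space "ell2 X" by (rule ell2_hilbert_space)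
  have *: "(\<lambda>y. if y \<in> P then c * f (h y) else 0) \<in> carrier (ell2 X) \<and> hnorm (ell2 X) (\<lambda>y. if y \<in> P then c * f (h y) else 0) \<le> hnorm (ell2 X) f"
    if f: "f \<in> carrier (ell2 X)" for f
  proof -
    have b: "(\<Sum>y\<in>F. (cmod (if y \<in> P then c * f (h y) else 0))\<^sup>2) \<le> (hnorm (ell2 X) f)\<^sup>2" if F: "finite F" "F \<subseteq> X" for F
    proof -
      have "(\<Sum>y\<in>F. (cmod (if y \<in> P then c * f (h y) else 0))\<^sup>2) = (\<Sum>y\<in>F \<inter> P. (cmod (f (h y)))\<^sup>2)"
        using F c by (auto simp: sum.inter_restrict norm_mult intro!: sum.cong)
      also have "\<dots> = (\<Sum>w\<in>h ` (F \<inter> P). (cmod (f w))\<^sup>2)"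
        by (subst sum.reindex) (use h(1) in \<open>auto intro: inj_on_subset\<close>)
      also have "\<dots> \<le> (hnorm (ell2 X) f)\<^sup>2" by (rule ell2_finite_sum_le[OF f]) (use F h in auto)
      finally show ?thesis .
    qed
    have "(if i \<in> P then c * f (h i) else 0) = 0" if "i \<notin> X" for i using that P by auto
    from ell2_of_finite_bounds[of X "\<lambda>y. if y \<in> P then c * f (h y) else 0" "hnorm (ell2 X) f", OF this _ b] f
    show ?thesis by simp
  qed
  show ?thesis
  proof (rule bopI[where C = 1])
    show "partial_perm X P h c \<in> carrier (ell2 X) \<rightarrow>\<^sub>E carrier (ell2 X)" using * by (auto simp: partial_perm_def)
    fix f a assume f: "f \<in> carrier (ell2 X)"
    show "partial_perm X P h c (f \<oplus>\<^bsub>ell2 X\<^esub> g) = partial_perm X P h c f \<oplus>\<^bsub>ell2 X\<^esub> partial_perm X P h c g"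
      if g: "g \<in> carrier (ell2 X)" for g
      using f g ell2_add_closed[OF f g] by (auto simp: distrib_left)
    show "partial_perm X P h c (a \<odot>\<^bsub>ell2 X\<^esub> f) = a \<odot>\<^bsub>ell2 X\<^esub> partial_perm X P h c f"
      using f ell2_smult_closed[OF f, of a] by auto
    show "hnorm (ell2 X) (partial_perm X P h c f) \<le> 1 * hnorm (ell2 X) f" using * f by simp
  qed
qed

lemma partial_perm_star:
  assumes P: "P \<subseteq> X" "Q \<subseteq> X" and h: "\<And>y. y \<in> P \<Longrightarrow> h y \<in> Q \<and> k (h y) = y" and k: "\<And>w. w \<in> Q \<Longrightarrow> k w \<in> P \<and> h (k w) = w"
    and c: "cmod c = 1"
  shows "star (bounded_ops (ell2 X)) (partial_perm X P h c) = partial_perm X Q k (cnj c)"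
proof -
  interpret hilbert_space "ell2 X" by (rule ell2_hilbert_space)
  have "partial_perm X Q k (cnj c) \<in> carrier (bounded_ops (ell2 X))"
    by (rule partial_perm_bounded) (use P k c in \<open>auto intro!: inj_on_inverseI[of _ h]\<close>)
  then have "partial_perm X Q k (cnj c) \<in> carrier (ell2 X) \<rightarrow>\<^sub>E carrier (ell2 X)" by (rule bopD)
  moreover have "inprod (ell2 X) (partial_perm X P h c f) g = inprod (ell2 X) f (partial_perm X Q k (cnj c) g)"
    if fg: "f \<in> carrier (ell2 X)" "g \<in> carrier (ell2 X)" for f g
  proof -
    have bij: "bij_betw h P Q" by (rule bij_betwI[of _ _ _ k]) (use h k in auto)
    have "inprod (ell2 X) (partial_perm X P h c f) g = (\<Sum>\<^sub>\<infinity>y\<in>P. c * f (h y) * cnj (g (k (h y))))"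
      using fg P h unfolding ell2_ip by (intro infsum_cong_neutral) auto
    also have "\<dots> = (\<Sum>\<^sub>\<infinity>w\<in>Q. c * f w * cnj (g (k w)))"
      using infsum_reindex_bij_betw[OF bij, of "\<lambda>w. c * f w * cnj (g (k w))"] .
    also have "\<dots> = inprod (ell2 X) f (partial_perm X Q k (cnj c) g)"
      using fg P unfolding ell2_ip by (intro infsum_cong_neutral) auto
    finally show ?thesis .
  qed
  ultimately show ?thesis by (rule bop_star_eqI)
qed

lemma ell2_finsum_apply:
  assumes "finite F" "\<And>a. a \<in> F \<Longrightarrow> T a \<in> carrier (bounded_ops (ell2 X))" "f \<in> carrier (ell2 X)"
  shows "(\<Oplus>\<^bsub>bounded_ops (ell2 X)\<^esub>a \<in> F. T a) f = (\<lambda>y. \<Sum>a\<in>F. T a f y)"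
  using assms(1,2)
proof induction
  interpret hilbert_space "ell2 X" by (rule ell2_hilbert_space)
  interpret B: cstar_algebra "bounded_ops (ell2 X)" by (rule BH_cstar)
  case empty show ?case using assms(3) by simp
next
  interpret hilbert_space "ell2 X" by (rule ell2_hilbert_space)
  interpret B: cstar_algebra "bounded_ops (ell2 X)" by (rule BH_cstar)
  case (insert a F)
  have "(\<Oplus>\<^bsub>bounded_ops (ell2 X)\<^esub>a \<in> insert a F. T a) = T a \<oplus>\<^bsub>bounded_ops (ell2 X)\<^esub> (\<Oplus>\<^bsub>bounded_ops (ell2 X)\<^esub>a \<in> F. T a)"
    by (rule B.finsum_insert) (use insert in auto)
  then show ?case using insert assms(3) by simp
qed

lemma zpow_simps:
  assumes "z \<in> torus"
  shows "zpow z 0 = 1" "zpow z (m + n) = zpow z m * zpow z n" "cmod (zpow z n) = 1"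
proof -
  have z: "cmod (z $ i) = 1" for i using assms by (simp add: torus_def)
  then have nz: "z $ i \<noteq> 0" for i by (metis norm_zero zero_neq_one)
  show "zpow z 0 = 1" by (simp add: zpow_def)
  show "zpow z (m + n) = zpow z m * zpow z n" by (simp add: zpow_def power_int_add nz prod.distrib)
  show "cmod (zpow z n) = 1" by (simp add: zpow_def prod_norm[symmetric] norm_power_int z)
qed

locale path_space = rf_k_graph G for G :: "('l, 'k::finite) kgraph" +
  fixes x :: "('l, 'k) ipath" and z :: "complex ^ 'k"
  assumes x: "x \<in> inf_paths G" and z: "z \<in> torus"
begin

abbreviation X where "X \<equiv> shift_tail_class G x"
abbreviation LX where "LX \<equiv> ell2 X"

abbreviation multB (infixl "\<otimes>\<^sub>B" 70) where "S \<otimes>\<^sub>B R \<equiv> S \<otimes>\<^bsub>bounded_ops LX\<^esub> R"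
abbreviation smultB (infixr "\<odot>\<^sub>B" 70) where "c \<odot>\<^sub>B S \<equiv> c \<odot>\<^bsub>bounded_ops LX\<^esub> S"
abbreviation zeroB ("\<zero>\<^sub>B") where "\<zero>\<^sub>B \<equiv> \<zero>\<^bsub>bounded_ops LX\<^esub>"

sublocale H: hilbert_space LX by (rule ell2_hilbert_space)
sublocale B: cstar_algebra "bounded_ops LX" by (rule H.BH_cstar)

lemma X_memD:
  assumes "y \<in> X" obtains a m where "a \<in> mor G" "src G a = x (m, m)" "y = prepend G a (shift m x)"
  using assms unfolding shift_tail_class_def by blast

lemma X_paths: assumes "y \<in> X" shows "y \<in> inf_paths G"
proof -
  obtain a m where "a \<in> mor G" "src G a = x (m, m)" "y = prepend G a (shift m x)" using X_memD[OF assms] .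
  then show ?thesis using prepend(1)[of a "shift m x"] x by (simp add: shift_initial)
qed

lemma X_prepend: assumes "y \<in> X" "b \<in> mor G" "src G b = y (0, 0)" shows "prepend G b y \<in> X"
proof -
  obtain a m where a: "a \<in> mor G" "src G a = x (m, m)" "y = prepend G a (shift m x)" using X_memD[OF assms(1)] .
  have "src G b = rng G a" using prepend(4)[of a "shift m x"] a x assms by (simp add: shift_initial)
  then have "prepend G b y = prepend G (b \<cdot> a) (shift m x)"
    using prepend_cmp[of b a "shift m x"] a x assms by (simp add: shift_initial)
  then show ?thesis unfolding shift_tail_class_def using a assms \<open>src G b = rng G a\<close> by force
qed

lemma X_shift: assumes "y \<in> X" shows "shift p y \<in> X"
proof -
  obtain a m where a: "a \<in> mor G" "src G a = x (m, m)" "y = prepend G a (shift m x)" using X_memD[OF assms] .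
  have sx: "shift m x \<in> inf_paths G" "shift m x (0, 0) = src G a" using a x by (simp_all add: shift_initial)
  note p0 = prepend[OF a(1) sx]
  have y: "y \<in> inf_paths G" using X_paths[OF assms] .
  define b where "b = y (p, p + deg G a)"
  have b: "b \<in> mor G" "deg G b = deg G a" "src G b = y (p + deg G a, p + deg G a)" "rng G b = y (p, p)"
    using inf_pathD[OF y, of p "p + deg G a"] by (simp_all add: b_def)
  have "shift (p + deg G a) y = shift (p + m) x"
    using shift_shift[OF y, of p "deg G a"] p0(3) a(3) x by simp
  moreover have "prepend G b (shift (p + deg G a) y) = shift p y"
  proof (rule prepend_eqI)
    show "shift p y (0, deg G b) = b" by (simp add: shift_initial b(2) add.commute) (simp add: b_def)
    show "shift (deg G b) (shift p y) = shift (p + deg G a) y" using y by (simp add: b(2) add.commute)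
  qed (use y in simp)
  moreover have "src G b = x (p + m, p + m)"
    using b(3) calculation(1) shift_initial(2)[of "p + deg G a" y 0] shift_initial(2)[of "p + m" x 0] by simp
  ultimately show ?thesis unfolding shift_tail_class_def using b by (intro CollectI exI[of _ b] exI[of _ "p + m"]) auto
qed

lemma x_in_X: "x \<in> X"
proof -
  have v: "x (0, 0) \<in> mor G" "src G (x (0, 0)) = x (0, 0)" using inf_pathD[OF x, of 0 0] by simp_all
  have "x = prepend G (x (0, 0)) (shift 0 x)" using prepend_vertex[OF x] x by simp
  then show ?thesis unfolding shift_tail_class_def using v by blast
qed

abbreviation zp :: "nat ^ 'k \<Rightarrow> complex" where "zp n \<equiv> zpow z (zvec n)"

lemma zp_simps [simp]: "zpow z 0 = 1" "cmod (zp n) = 1" "zp n * cnj (zp n) = 1" "zp n \<noteq> 0"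
proof -
  show "zpow z 0 = 1" using zpow_simps(1)[OF z] .
  show 1: "cmod (zp n) = 1" using zpow_simps(3)[OF z] .
  then show "zp n * cnj (zp n) = 1" using complex_norm_square[of "zp n"] by simp
  show "zp n \<noteq> 0" using 1 by auto
qed

definition path_op :: "'l \<Rightarrow> (('l, 'k) ipath \<Rightarrow> complex) \<Rightarrow> ('l, 'k) ipath \<Rightarrow> complex" where
  "path_op a = partial_perm X {y \<in> X. y (0, deg G a) = a} (shift (deg G a)) (zp (deg G a))"

lemma start_iff: "y \<in> inf_paths G \<Longrightarrow> a \<in> mor G \<Longrightarrow> y (0, deg G a) = a \<Longrightarrow> prepend G a (shift (deg G a) y) = y \<and> shift (deg G a) y (0, 0) = src G a"
  using prepend_split[of y "deg G a"] inf_pathD(4)[of y 0 "deg G a"] shift_initial(2)[of "deg G a" y 0] by simp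

lemma path_op_closed: assumes "a \<in> mor G" shows "path_op a \<in> carrier H.BH"
  unfolding path_op_def
proof (rule partial_perm_bounded)
  show "inj_on (shift (deg G a)) {y \<in> X. y (0, deg G a) = a}"
    by (rule inj_onI) (metis (mono_tags, lifting) X_paths assms mem_Collect_eq start_iff)
qed (use X_shift in auto)

lemma path_op_star: assumes a: "a \<in> mor G"
  shows "star H.BH (path_op a) = partial_perm X {y \<in> X. y (0, 0) = src G a} (prepend G a) (cnj (zp (deg G a)))"
  unfolding path_op_def
proof (rule partial_perm_star)
  show "shift (deg G a) y \<in> {y \<in> X. y (0, 0) = src G a} \<and> prepend G a (shift (deg G a) y) = y"
    if "y \<in> {y \<in> X. y (0, deg G a) = a}" for y
    using that start_iff[OF X_paths a, of y] X_shift by simp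
  show "prepend G a w \<in> {y \<in> X. y (0, deg G a) = a} \<and> shift (deg G a) (prepend G a w) = w"
    if "w \<in> {y \<in> X. y (0, 0) = src G a}" for w
    using that prepend[OF a X_paths, of w] X_prepend[of w a] a by simp
qed auto

lemma path_op_apply: "f \<in> carrier LX \<Longrightarrow> path_op a f = (\<lambda>y. if y \<in> X \<and> y (0, deg G a) = a then zp (deg G a) * f (shift (deg G a) y) else 0)"
  by (simp add: path_op_def)

lemma path_op_star_apply: "a \<in> mor G \<Longrightarrow> f \<in> carrier LX \<Longrightarrow>
    star H.BH (path_op a) f = (\<lambda>w. if w \<in> X \<and> w (0, 0) = src G a then cnj (zp (deg G a)) * f (prepend G a w) else 0)"
  by (simp add: path_op_star)

lemma path_op_vertex_apply: "v \<in> verts G \<Longrightarrow> f \<in> carrier LX \<Longrightarrow> path_op v f = (\<lambda>y. if y \<in> X \<and> y (0, 0) = v then f y else 0)"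
  using vertsD[of v] X_paths by (intro ext) (simp add: path_op_apply)

lemma path_op_range_apply:
  assumes "a \<in> mor G" "f \<in> carrier LX"
  shows "(path_op a \<otimes>\<^sub>B star H.BH (path_op a)) f = (\<lambda>y. if y \<in> X \<and> y (0, deg G a) = a then f y else 0)"
proof -
  have c: "star H.BH (path_op a) f \<in> carrier LX" using assms path_op_closed H.bopD(2) B.star_closed by blast
  show ?thesis
    using assms(2)
    by (simp add: path_op_apply[OF c]) (auto simp: path_op_star_apply[OF assms] start_iff[OF X_paths assms(1)] X_shift mult.assoc[symmetric])
qed

lemma path_op_ck_family: "ck_family G (bounded_ops LX) path_op"
  unfolding ck_family_def
proof (intro conjI ballI allI impI)
  note cl = path_op_closed
  note vm = vertsD[THEN conjunct1]
  show "path_op \<in> mor G \<rightarrow> carrier H.BH" using cl by auto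
  {
    fix v assume v: "v \<in> verts G"
    note vD = vertsD[OF v]
    have st: "star H.BH (path_op v) f = path_op v f" if f: "f \<in> carrier LX" for f
    proof (rule ext)
      fix y show "star H.BH (path_op v) f y = path_op v f y"
        using prepend_vertex[OF X_paths, of y] vD by (auto simp: path_op_star_apply[OF _ f] path_op_vertex_apply[OF v f])
    qed
    show "star H.BH (path_op v) = path_op v"
      by (rule H.bop_eqI) (use cl st vD in auto)
    show "path_op v \<otimes>\<^sub>B path_op v = path_op v"
    proof (rule H.bop_eqI)
      fix f assume f: "f \<in> carrier LX"
      then have c: "path_op v f \<in> carrier LX" using cl vD H.bopD(2) by blast
      show "(path_op v \<otimes>\<^sub>B path_op v) f = path_op v f"
        using f by (simp add: path_op_vertex_apply[OF v c]) (auto simp: path_op_vertex_apply[OF v f])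
    qed (use cl vD in auto)
    fix w assume w: "w \<in> verts G" "v \<noteq> w"
    show "path_op v \<otimes>\<^sub>B path_op w = \<zero>\<^sub>B"
    proof (rule H.bop_eqI)
      fix f assume f: "f \<in> carrier LX"
      then have c: "path_op w f \<in> carrier LX" using cl vertsD[OF w(1)] H.bopD(2) by blast
      show "(path_op v \<otimes>\<^sub>B path_op w) f = \<zero>\<^sub>B f"
        using f w(2) by (simp add: path_op_vertex_apply[OF v c]) (auto simp: path_op_vertex_apply[OF w(1) f])
    qed (use cl vD vertsD[OF w(1)] in auto)
  }
  {
    fix a assume a: "a \<in> mor G"
    show "star H.BH (path_op a) \<otimes>\<^sub>B path_op a = path_op (src G a)"
    proof (rule H.bop_eqI)
      fix f assume f: "f \<in> carrier LX"
      then have c: "path_op a f \<in> carrier LX" using cl a H.bopD(2) by blast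
      show "(star H.BH (path_op a) \<otimes>\<^sub>B path_op a) f = path_op (src G a) f"
      proof (rule ext)
        fix y
        show "(star H.BH (path_op a) \<otimes>\<^sub>B path_op a) f y = path_op (src G a) f y"
          using f a X_prepend[of y a] prepend[OF a X_paths, of y]
          by (simp add: path_op_star_apply[OF a c] path_op_vertex_apply[OF src_verts[OF a] f])
             (auto simp: path_op_apply[OF f] mult.assoc[symmetric] mult.commute[of "cnj _"])
      qed
    qed (use cl a in auto)
    fix b assume b: "b \<in> mor G" "src G a = rng G b"
    show "path_op a \<otimes>\<^sub>B path_op b = path_op (cmp G a b)"
    proof (rule H.bop_eqI)
      fix f assume f: "f \<in> carrier LX"
      then have c: "path_op b f \<in> carrier LX" using cl b H.bopD(2) by blast
      have iff: "y (0, deg G a) = a \<and> shift (deg G a) y (0, deg G b) = b \<longleftrightarrow> y (0, deg G (a \<cdot> b)) = a \<cdot> b" if y: "y \<in> X" for y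
      proof -
        have yp: "y \<in> inf_paths G" using X_paths[OF y] .
        have d: "deg G (a \<cdot> b) = deg G a + deg G b" using a b by simp
        have e: "y (0, deg G a) \<cdot> y (deg G a, deg G a + deg G b) = y (0, deg G (a \<cdot> b))" using inf_path_cmp[OF yp] d by simp
        show ?thesis
          using e a b factor_unique[of "y (0, deg G a)" "y (deg G a, deg G a + deg G b)" a b]
            inf_pathD[OF yp, of 0 "deg G a"] inf_pathD[OF yp, of "deg G a" "deg G a + deg G b"]
          by (auto simp: shift_initial add.commute)
      qed
      have "(path_op a \<otimes>\<^sub>B path_op b) f y = path_op (cmp G a b) f y" for y
        using f iff[of y] X_shift[of y "deg G a"] X_paths[of y] a b
        unfolding H.BH_simps(1)[OF f] path_op_apply[OF c]
        by (auto simp: path_op_apply[OF f] zpow_simps[OF z] mult.assoc add.commute)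
      then show "(path_op a \<otimes>\<^sub>B path_op b) f = path_op (cmp G a b) f" by blast
    qed (use cl a b in auto)
  }
  fix v n assume v: "v \<in> verts G"
  let ?E = "{a \<in> mor G. rng G a = v \<and> deg G a = n}"
  have fin: "finite ?E" using finite_paths[OF v] .
  have tcl: "path_op a \<otimes>\<^sub>B star H.BH (path_op a) \<in> carrier H.BH" if "a \<in> ?E" for a
    using cl that by simp
  show "path_op v = (\<Oplus>\<^bsub>bounded_ops LX\<^esub>a \<in> ?E. path_op a \<otimes>\<^sub>B star H.BH (path_op a))"
  proof (rule H.bop_eqI)
    show "path_op v \<in> carrier H.BH" using cl vertsD[OF v] by simp
    show "(\<Oplus>\<^bsub>bounded_ops LX\<^esub>a \<in> ?E. path_op a \<otimes>\<^sub>B star H.BH (path_op a)) \<in> carrier H.BH"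
      by (rule B.finsum_closed) (use tcl in auto)
    fix f assume f: "f \<in> carrier LX"
    have "(\<Oplus>\<^bsub>bounded_ops LX\<^esub>a \<in> ?E. path_op a \<otimes>\<^sub>B star H.BH (path_op a)) f y = path_op v f y" for y
    proof -
      have "(\<Oplus>\<^bsub>bounded_ops LX\<^esub>a \<in> ?E. path_op a \<otimes>\<^sub>B star H.BH (path_op a)) f y
          = (\<Sum>a\<in>?E. if y \<in> X \<and> y (0, deg G a) = a then f y else 0)"
        using ell2_finsum_apply[OF fin tcl f] by (simp add: path_op_range_apply[OF _ f] del: H.BH_simps(1))
      also have "\<dots> = (\<Sum>a\<in>?E. if a = y (0, n) then (if y \<in> X then f y else 0) else 0)"
        by (rule sum.cong) auto
      also have "\<dots> = (if y (0, n) \<in> ?E then (if y \<in> X then f y else 0) else 0)"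
        using fin by (simp add: sum.delta)
      also have "\<dots> = path_op v f y"
        using inf_pathD[OF X_paths, of y 0 n] by (auto simp: path_op_vertex_apply[OF v f])
      finally show ?thesis .
    qed
    then show "path_op v f = (\<Oplus>\<^bsub>bounded_ops LX\<^esub>a \<in> ?E. path_op a \<otimes>\<^sub>B star H.BH (path_op a)) f" by presburger
  qed
qed

lemma path_op_basis:
  assumes "a \<in> mor G" "y \<in> X"
  shows "path_op a (basis_vec y) = (if y (0, 0) = src G a then zp (deg G a) \<odot>\<^bsub>LX\<^esub> basis_vec (prepend G a y) else \<zero>\<^bsub>LX\<^esub>)"
proof -
  have "w \<in> X \<and> w (0, deg G a) = a \<and> shift (deg G a) w = y \<longleftrightarrow> y (0, 0) = src G a \<and> w = prepend G a y" for w
    using start_iff[OF X_paths assms(1), of w] prepend[OF assms(1) X_paths[OF assms(2)]] X_prepend[OF assms(2,1)] by auto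
  note iff = this
  show ?thesis
  proof (rule ext)
    fix w
    show "path_op a (basis_vec y) w = (if y (0, 0) = src G a then zp (deg G a) \<odot>\<^bsub>LX\<^esub> basis_vec (prepend G a y) else \<zero>\<^bsub>LX\<^esub>) w"
      unfolding path_op_apply[OF basis_vec_carrier[OF assms(2)]]
      using iff[of w] by (auto simp: basis_vec_def)
  qed
qed

end

lemma (in hilbert_space) bop_tends:
  assumes "S \<in> carrier BH" "tends X l" shows "tends (\<lambda>n. S (X n)) (S l)"
proof (rule tendsI)
  note D = tendsD[OF assms(2)]
  show "hnorm H (S (X n) \<ominus> S l) \<le> nrm BH S * hnorm H (X n \<ominus> l)" for n
    using op_norm_le[OF assms(1), of "X n \<ominus> l"] bop_diff[OF assms(1)] D by simp
  show "(\<lambda>n. nrm BH S * hnorm H (X n \<ominus> l)) \<longlonglongrightarrow> 0" using tendsto_mult_right_zero[OF D(3)] .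
qed (use bopD(2)[OF assms(1)] tendsD[OF assms(2)] in auto)

lemma ell2_op_eqI:
  assumes S: "S \<in> carrier (bounded_ops (ell2 X))" and R: "R \<in> carrier (bounded_ops (ell2 X))"
    and eq: "\<And>i. i \<in> X \<Longrightarrow> S (basis_vec i) = R (basis_vec i)"
  shows "S = R"
proof -
  interpret hilbert_space "ell2 X" by (rule ell2_hilbert_space)
  let ?K = "{f \<in> carrier (ell2 X). S f = R f}"
  have "?K = carrier (ell2 X)"
  proof (rule ell2_basis_total)
    show "submodule ?K complex_ring (ell2 X)"
      by (rule submoduleI) (auto simp: bopD(3,4)[OF S] bopD(3,4)[OF R] bop_zero[OF S] bop_zero[OF R] bop_uminus[OF S] bop_uminus[OF R] ell2_add_closed ell2_smult_closed simp del: ell2_simps)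
    show "closedin (Metric_space.mtopology (carrier (ell2 X)) (norm_dist (ell2 X) (hnorm (ell2 X)))) ?K"
      unfolding closed_iff
    proof (intro conjI allI impI)
      fix Y l assume Y: "\<forall>n. Y n \<in> ?K" "tends Y l"
      then have "tends (\<lambda>n. S (Y n)) (R l)" using bop_tends[OF R Y(2)] by simp
      from tends_unique[OF bop_tends[OF S Y(2)] this] show "l \<in> ?K" using tendsD[OF Y(2)] by simp
    qed auto
    show "basis_vec i \<in> ?K" if "i \<in> X" for i using eq that by simp
  qed
  then show ?thesis by (intro bop_eqI S R) auto
qed

context cstar_rep
begin

lemma rep_tends:
  assumes "A.tends X l" shows "B.tends (\<lambda>n. \<pi> (X n)) (\<pi> l)"
proof (rule B.tendsI[OF _ _ _ A.tendsD(3)[OF assms]])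
  note D = A.tendsD[OF assms]
  show "nrm H.BH (\<pi> (X n) \<ominus>\<^sub>B \<pi> l) \<le> nrm A (X n \<ominus>\<^bsub>A\<^esub> l)" for n
    using rep_contractive[of "X n \<ominus>\<^bsub>A\<^esub> l"] rep_diff D by simp
qed (use A.tendsD[OF assms] in auto)

end

section \<open>Graph C*-algebras\<close>

locale graph_cstar = rf_k_graph G + A: cstar_algebra A
  for G :: "('l, 'k::finite) kgraph" and A :: "'a cstar" +
  fixes s :: "'l \<Rightarrow> 'a"
  assumes ga: "graph_algebra G A s"
begin

lemma ck: "ck_family G A s" using ga by (simp add: graph_algebra_def)

lemma s_closed [simp]: "a \<in> mor G \<Longrightarrow> s a \<in> carrier A"
  using ck by (auto simp: ck_family_def)

lemma s_vertex: "v \<in> verts G \<Longrightarrow> star A (s v) = s v" "v \<in> verts G \<Longrightarrow> s v \<otimes>\<^bsub>A\<^esub> s v = s v"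
  and s_orth: "\<lbrakk>v \<in> verts G; w \<in> verts G; v \<noteq> w\<rbrakk> \<Longrightarrow> s v \<otimes>\<^bsub>A\<^esub> s w = \<zero>\<^bsub>A\<^esub>"
  and s_cmp: "\<lbrakk>a \<in> mor G; b \<in> mor G; src G a = rng G b\<rbrakk> \<Longrightarrow> s a \<otimes>\<^bsub>A\<^esub> s b = s (cmp G a b)"
  and s_star_s: "a \<in> mor G \<Longrightarrow> star A (s a) \<otimes>\<^bsub>A\<^esub> s a = s (src G a)"
  and s_sum: "v \<in> verts G \<Longrightarrow> s v = (\<Oplus>\<^bsub>A\<^esub>a \<in> {a \<in> mor G. rng G a = v \<and> deg G a = n}. s a \<otimes>\<^bsub>A\<^esub> star A (s a))"
proof -
  note c = ck[unfolded ck_family_def, THEN conjunct2]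
  show "v \<in> verts G \<Longrightarrow> star A (s v) = s v" "v \<in> verts G \<Longrightarrow> s v \<otimes>\<^bsub>A\<^esub> s v = s v"
    using c[THEN conjunct1] by blast+
  note c = c[THEN conjunct2]
  show "\<lbrakk>v \<in> verts G; w \<in> verts G; v \<noteq> w\<rbrakk> \<Longrightarrow> s v \<otimes>\<^bsub>A\<^esub> s w = \<zero>\<^bsub>A\<^esub>" using c[THEN conjunct1] by blast
  note c = c[THEN conjunct2]
  show "\<lbrakk>a \<in> mor G; b \<in> mor G; src G a = rng G b\<rbrakk> \<Longrightarrow> s a \<otimes>\<^bsub>A\<^esub> s b = s (cmp G a b)" using c[THEN conjunct1] by blast
  note c = c[THEN conjunct2]
  show "a \<in> mor G \<Longrightarrow> star A (s a) \<otimes>\<^bsub>A\<^esub> s a = s (src G a)" using c[THEN conjunct1] by blast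
  show "v \<in> verts G \<Longrightarrow> s v = (\<Oplus>\<^bsub>A\<^esub>a \<in> {a \<in> mor G. rng G a = v \<and> deg G a = n}. s a \<otimes>\<^bsub>A\<^esub> star A (s a))"
    by (rule c[THEN conjunct2, rule_format])
qed

lemma generated:
  assumes "S \<subseteq> carrier A" "\<zero>\<^bsub>A\<^esub> \<in> S" "\<And>x y. x \<in> S \<Longrightarrow> y \<in> S \<Longrightarrow> x \<oplus>\<^bsub>A\<^esub> y \<in> S" "\<And>c x. x \<in> S \<Longrightarrow> c \<odot>\<^bsub>A\<^esub> x \<in> S"
    "\<And>x y. x \<in> S \<Longrightarrow> y \<in> S \<Longrightarrow> x \<otimes>\<^bsub>A\<^esub> y \<in> S" "\<And>x. x \<in> S \<Longrightarrow> star A x \<in> S"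
    "\<And>X l. (\<And>n. X n \<in> S) \<Longrightarrow> A.tends X l \<Longrightarrow> l \<in> S" "\<And>a. a \<in> mor G \<Longrightarrow> s a \<in> S"
  shows "S = carrier A"
proof -
  have "cstar_subalgebra A S"
    unfolding cstar_subalgebra_def
  proof (intro conjI ballI)
    show "submodule S complex_ring A"
    proof (rule A.submoduleI)
      show "\<ominus>\<^bsub>A\<^esub> x \<in> S" if "x \<in> S" for x using assms(4)[OF that, of "-1"] A.smult_minus(1)[of x 1] assms(1) that by auto
    qed (use assms(1-4) in auto)
    show "closedin (Metric_space.mtopology (carrier A) (norm_dist A (nrm A))) S"
      unfolding A.closed_iff using assms(1,7) by blast
  qed (use assms(5,6) in blast)+
  then show ?thesis using ga assms(8) unfolding graph_algebra_def by blast
qed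

lemma rep_eqI:
  assumes "cstar_rep A H \<pi>" "cstar_rep A H \<pi>'" "\<And>a. a \<in> mor G \<Longrightarrow> \<pi> (s a) = \<pi>' (s a)" "a \<in> carrier A"
  shows "\<pi> a = \<pi>' a"
proof -
  interpret p: cstar_rep A H \<pi> by fact
  interpret q: cstar_rep A H \<pi>' by fact
  have "{a \<in> carrier A. \<pi> a = \<pi>' a} = carrier A"
  proof (rule generated)
    fix X l assume X: "\<And>n. X n \<in> {a \<in> carrier A. \<pi> a = \<pi>' a}" "A.tends X l"
    then have "(\<lambda>n. \<pi> (X n)) = (\<lambda>n. \<pi>' (X n))" by auto
    then have "p.B.tends (\<lambda>n. \<pi> (X n)) (\<pi>' l)" using q.rep_tends[OF X(2)] by simp
    from p.B.tends_unique[OF p.rep_tends[OF X(2)] this] show "l \<in> {a \<in> carrier A. \<pi> a = \<pi>' a}" using A.tendsD[OF X(2)] by simp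
  qed (use assms(3) p.rep_zero q.rep_zero in \<open>auto simp: p.rep_simps q.rep_simps\<close>)
  then show ?thesis using assms(4) by blast
qed

end

locale path_space_algebra = path_space G x z + graph_cstar G A s
  for G :: "('l, 'k::finite) kgraph" and x :: "('l, 'k) ipath" and z :: "complex ^ 'k" and A :: "'a cstar" and s :: "'l \<Rightarrow> 'a"
begin

lemma is_path_rep_iff: "is_path_rep G A s x z \<pi> \<longleftrightarrow> cstar_rep A LX \<pi> \<and> (\<forall>a \<in> mor G. \<pi> (s a) = path_op a)"
proof
  assume p: "is_path_rep G A s x z \<pi>"
  then have r: "cstar_rep A LX \<pi>"
    unfolding is_path_rep_def representation_def Let_def cstar_rep_def cstar_rep_axioms_def using A.cstar_algebra_axioms by blast
  interpret p: cstar_rep A LX \<pi> by (rule r)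
  have "\<pi> (s a) = path_op a" if a: "a \<in> mor G" for a
  proof (rule ell2_op_eqI)
    show "\<pi> (s a) \<in> carrier H.BH" using a by simp
    show "path_op a \<in> carrier H.BH" using path_op_closed[OF a] .
    fix y assume y: "y \<in> X"
    have "\<pi> (s a) (basis_vec y) = (if y (0, 0) = src G a then zp (deg G a) \<odot>\<^bsub>LX\<^esub> basis_vec (prepend G a y) else \<zero>\<^bsub>LX\<^esub>)"
      using p a y unfolding is_path_rep_def Let_def by blast
    then show "\<pi> (s a) (basis_vec y) = path_op a (basis_vec y)" using path_op_basis[OF a y] by simp
  qed
  then show "cstar_rep A LX \<pi> \<and> (\<forall>a \<in> mor G. \<pi> (s a) = path_op a)" using r by blast
next
  assume p: "cstar_rep A LX \<pi> \<and> (\<forall>a \<in> mor G. \<pi> (s a) = path_op a)"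
  then interpret p: cstar_rep A LX \<pi> by blast
  show "is_path_rep G A s x z \<pi>"
    unfolding is_path_rep_def Let_def representation_def
    using p path_op_basis p.hom ell2_hilbert_space by auto
qed

lemma ex_path_rep: "\<exists>\<pi>. is_path_rep G A s x z \<pi>"
proof -
  obtain \<phi> where "star_hom A (bounded_ops LX) \<phi>" "\<forall>a \<in> mor G. \<phi> (s a) = path_op a"
    using ga path_op_ck_family B.cstar_algebra_axioms unfolding graph_algebra_def by blast
  then have "is_path_rep G A s x z \<phi>"
    unfolding is_path_rep_iff cstar_rep_def cstar_rep_axioms_def using A.cstar_algebra_axioms ell2_hilbert_space by blast
  then show ?thesis by blast
qed

lemma path_rep_unique:
  "is_path_rep G A s x z \<pi> \<Longrightarrow> is_path_rep G A s x z \<pi>' \<Longrightarrow> a \<in> carrier A \<Longrightarrow> \<pi>' a = \<pi> a"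
  unfolding is_path_rep_iff by (rule rep_eqI) auto

text \<open>The projections \<open>s\<^sub>b s\<^sub>b\<^sup>*\<close> for the initial segments \<open>b\<close> of \<open>y\<close> decrease to the projection onto the line through \<open>\<xi>\<^sub>y\<close>,
  so a closed invariant subspace containing a vector with nonzero coefficient at \<open>y\<close> contains \<open>\<xi>\<^sub>y\<close>.\<close>

lemma initial_projections_tend:
  assumes f: "f \<in> carrier LX" and y: "y \<in> X"
  shows "\<exists>b. (\<forall>n. b n \<in> mor G) \<and> H.tends (\<lambda>n. (path_op (b n) \<otimes>\<^sub>B star H.BH (path_op (b n))) f) (f y \<odot>\<^bsub>LX\<^esub> basis_vec y)"
proof (intro exI conjI allI)
  define N :: "nat \<Rightarrow> nat ^ 'k" where "N n = (\<chi> i. n)" for n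
  have yp: "y \<in> inf_paths G" using X_paths[OF y] .
  show bm: "y (0, N n) \<in> mor G" for n using inf_pathD(1)[OF yp] by simp
  have bd: "deg G (y (0, N n)) = N n" for n using inf_pathD(2)[OF yp, of 0 "N n"] by simp
  let ?P = "\<lambda>n. (\<lambda>w. if w \<in> X \<and> w (0, N n) = y (0, N n) then f w else 0)"
  have P: "(path_op (y (0, N n)) \<otimes>\<^sub>B star H.BH (path_op (y (0, N n)))) f = ?P n" for n
    using path_op_range_apply[OF bm f] bd by simp
  have Pc: "?P n \<in> carrier LX" for n
    unfolding P[symmetric] by (rule H.bopD(2)[OF _ f]) (simp add: path_op_closed[OF bm] del: H.BH_simps)
  have lc: "f y \<odot>\<^bsub>LX\<^esub> basis_vec y \<in> carrier LX" using y by (intro H.smult_cl) simp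
  have d: "?P n \<ominus>\<^bsub>LX\<^esub> (f y \<odot>\<^bsub>LX\<^esub> basis_vec y) = (\<lambda>w. if w \<in> X \<and> w \<noteq> y \<and> w (0, N n) = y (0, N n) then f w else 0)" for n
    unfolding ell2_minus[OF Pc lc] using y by (auto simp: basis_vec_def)
  have "(\<lambda>n. hnorm LX (?P n \<ominus>\<^bsub>LX\<^esub> (f y \<odot>\<^bsub>LX\<^esub> basis_vec y))) \<longlonglongrightarrow> 0"
  proof (rule LIMSEQ_I)
    fix r :: real assume r: "r > 0"
    then have "r / 2 > 0" by simp
    from ell2_tail_small[OF f this] obtain F where F: "finite F" "F \<subseteq> X"
      "\<forall>g \<in> carrier LX. (\<forall>i \<in> F. g i = 0) \<longrightarrow> (\<forall>i. cmod (g i) \<le> cmod (f i)) \<longrightarrow> hnorm LX g \<le> r / 2" by blast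
    have "\<exists>M. \<forall>n\<ge>M. w = y \<or> w (0, N n) \<noteq> y (0, N n)" if w: "w \<in> F" for w
    proof (rule ccontr)
      assume *: "\<not> ?thesis"
      have wp: "w \<in> inf_paths G" using X_paths w F by blast
      have "w = y"
      proof (rule inf_path_ext[OF wp yp])
        fix n :: "nat ^ 'k"
        obtain m where m: "m \<ge> (\<Sum>i\<in>UNIV. n $ i)" "w (0, N m) = y (0, N m)" using * by blast
        have "n $ i \<le> m" for i using member_le_sum[of i UNIV "\<lambda>i. n $ i"] m(1) by simp
        then have "n \<le> N m" by (simp add: N_def vec_le_iff)
        then show "\<exists>N\<ge>n. w (0, N) = y (0, N)" using m(2) by blast
      qed
      then show False using * by blast
    qed
    then obtain M' where M': "\<And>w. w \<in> F \<Longrightarrow> \<forall>n\<ge>M' w. w = y \<or> w (0, N n) \<noteq> y (0, N n)" by metis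
    define M where "M = Max (insert 0 (M' ` F))"
    have M: "w = y \<or> w (0, N n) \<noteq> y (0, N n)" if "w \<in> F" "n \<ge> M" for w n
    proof -
      have "M' w \<le> M" unfolding M_def using F(1) that(1) by (intro Max_ge) auto
      then show ?thesis using M'[OF that(1)] that(2) by auto
    qed
    have "norm (hnorm LX (?P n \<ominus>\<^bsub>LX\<^esub> (f y \<odot>\<^bsub>LX\<^esub> basis_vec y)) - 0) < r" if n: "n \<ge> M" for n
    proof -
      have c: "?P n \<ominus>\<^bsub>LX\<^esub> (f y \<odot>\<^bsub>LX\<^esub> basis_vec y) \<in> carrier LX" using Pc lc H.minus_closed by blast
      have "hnorm LX (?P n \<ominus>\<^bsub>LX\<^esub> (f y \<odot>\<^bsub>LX\<^esub> basis_vec y)) \<le> r / 2"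
        by (rule F(3)[rule_format, OF c]; unfold d) (use M n in auto)
      then show ?thesis using r H.hnorm_nonneg[OF c] by simp
    qed
    then show "\<exists>no. \<forall>n\<ge>no. norm (hnorm LX (?P n \<ominus>\<^bsub>LX\<^esub> (f y \<odot>\<^bsub>LX\<^esub> basis_vec y)) - 0) < r" by blast
  qed
  then show "H.tends (\<lambda>n. (path_op (y (0, N n)) \<otimes>\<^sub>B star H.BH (path_op (y (0, N n)))) f) (f y \<odot>\<^bsub>LX\<^esub> basis_vec y)"
    unfolding P H.tends_def using Pc lc by blast
qed

lemma path_rep_irreducible:
  assumes p: "is_path_rep G A s x z \<pi>" shows "irreducible_rep A LX \<pi>"
proof -
  interpret p: cstar_rep A LX \<pi> using p is_path_rep_iff by blast
  have ps: "\<pi> (s a) = path_op a" if "a \<in> mor G" for a using p is_path_rep_iff that by blast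
  have "representation A LX \<pi>" using p by (simp add: is_path_rep_def Let_def)
  moreover have "\<exists>a \<in> carrier A. \<pi> a \<noteq> \<zero>\<^sub>B"
  proof (rule bexI[of _ "s (x (0, 0))"])
    have v: "x (0, 0) \<in> verts G" using x by simp
    have "path_op (x (0, 0)) (basis_vec x) x = 1"
      using path_op_vertex_apply[OF v basis_vec_carrier[OF x_in_X]] x_in_X by (simp add: basis_vec_def)
    then show "\<pi> (s (x (0, 0))) \<noteq> \<zero>\<^sub>B"
      using H.BH_simps(4)[OF basis_vec_carrier[OF x_in_X]] ps vertsD[OF v] by auto
    show "s (x (0, 0)) \<in> carrier A" using vertsD[OF v] by simp
  qed
  moreover have "K = {\<zero>\<^bsub>LX\<^esub>} \<or> K = carrier LX"
    if K: "submodule K complex_ring LX"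
      and cl: "closedin (Metric_space.mtopology (carrier LX) (norm_dist LX (hnorm LX))) K"
      and inv: "\<forall>a \<in> carrier A. \<forall>f \<in> K. \<pi> a f \<in> K" for K
  proof (cases "K = {\<zero>\<^bsub>LX\<^esub>}")
    case False
    note Ks = submodule_simps[OF K]
    obtain f where f: "f \<in> K" "f \<noteq> \<zero>\<^bsub>LX\<^esub>" using False Ks(3) by blast
    have fc: "f \<in> carrier LX" using f Ks by blast
    obtain y where y: "f y \<noteq> 0" using f(2) by (auto simp: fun_eq_iff)
    then have yX: "y \<in> X" using fc by (auto simp: ell2_carrier)
    obtain b where b: "\<And>n. b n \<in> mor G"
      "H.tends (\<lambda>n. (path_op (b n) \<otimes>\<^sub>B star H.BH (path_op (b n))) f) (f y \<odot>\<^bsub>LX\<^esub> basis_vec y)"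
      using initial_projections_tend[OF fc yX] by blast
    have cl': "\<And>Y l. (\<forall>n. Y n \<in> K) \<Longrightarrow> H.tends Y l \<Longrightarrow> l \<in> K" using cl unfolding H.closed_iff by simp
    have "\<forall>n. (path_op (b n) \<otimes>\<^sub>B star H.BH (path_op (b n))) f \<in> K"
      using inv[rule_format, of "s (b n) \<otimes>\<^bsub>A\<^esub> star A (s (b n))" f for n] f b(1) by (simp add: p.rep_simps ps)
    from cl'[OF this b(2)] have "f y \<odot>\<^bsub>LX\<^esub> basis_vec y \<in> K" .
    then have "inverse (f y) \<odot>\<^bsub>LX\<^esub> (f y \<odot>\<^bsub>LX\<^esub> basis_vec y) \<in> K" using Ks(2) by simp
    then have by0: "basis_vec y \<in> K" using y by (simp add: mult.assoc[symmetric])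
    have scale: "basis_vec w \<in> K" if "c \<odot>\<^bsub>LX\<^esub> basis_vec w \<in> K" "c \<noteq> 0" for w c
      using Ks(2)[OF that(1), of "inverse c"] that(2) by (simp add: mult.assoc[symmetric])
    have pre: "basis_vec (prepend G a w) \<in> K" if "basis_vec w \<in> K" "w \<in> X" "a \<in> mor G" "src G a = w (0, 0)" for a w
    proof (rule scale)
      show "zp (deg G a) \<odot>\<^bsub>LX\<^esub> basis_vec (prepend G a w) \<in> K"
        using inv[rule_format, of "s a" "basis_vec w"] that path_op_basis[of a w] ps by simp
    qed simp
    have sh: "basis_vec (shift q w) \<in> K" if w: "basis_vec w \<in> K" "w \<in> X" for q w
    proof (rule scale)
      have wp: "w \<in> inf_paths G" using X_paths w by blast
      let ?a = "w (0, q)"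
      have a: "?a \<in> mor G" "deg G ?a = q" "src G ?a = w (q, q)" using inf_pathD[OF wp, of 0 q] by simp_all
      have "star H.BH (path_op ?a) (basis_vec w) = cnj (zp q) \<odot>\<^bsub>LX\<^esub> basis_vec (shift q w)"
      proof (rule ext)
        fix u
        have "u \<in> X \<and> u (0, 0) = src G ?a \<and> prepend G ?a u = w \<longleftrightarrow> u = shift q w"
        proof
          assume u: "u \<in> X \<and> u (0, 0) = src G ?a \<and> prepend G ?a u = w"
          then have "shift (deg G ?a) (prepend G ?a u) = u" using prepend(3)[OF a(1) X_paths, of u] by blast
          then show "u = shift q w" using u unfolding a(2) by metis
        next
          assume u: "u = shift q w"
          have "shift q w (0, 0) = src G ?a" using a(3) shift_initial(2)[of q w 0] by simp
          then show "u \<in> X \<and> u (0, 0) = src G ?a \<and> prepend G ?a u = w"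
            unfolding u using X_shift[OF w(2)] prepend_split[OF wp] by blast
        qed
        then show "star H.BH (path_op ?a) (basis_vec w) u = (cnj (zp q) \<odot>\<^bsub>LX\<^esub> basis_vec (shift q w)) u"
          unfolding path_op_star_apply[OF a(1) basis_vec_carrier[OF w(2)]]
          unfolding a(2) ell2_simps basis_vec_def by auto
      qed
      then show "cnj (zp q) \<odot>\<^bsub>LX\<^esub> basis_vec (shift q w) \<in> K"
        using inv[rule_format, of "star A (s ?a)" "basis_vec w"] w a by (simp add: p.rep_simps ps)
    qed simp
    have "basis_vec w \<in> K" if w: "w \<in> X" for w
    proof -
      obtain a m where a: "a \<in> mor G" "src G a = x (m, m)" "y = prepend G a (shift m x)" using X_memD[OF yX] .
      obtain b m' where b: "b \<in> mor G" "src G b = x (m', m')" "w = prepend G b (shift m' x)" using X_memD[OF w] .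
      have "shift (deg G a) y = shift m x" using prepend(3)[OF a(1), of "shift m x"] a x by (simp add: shift_initial)
      then have "basis_vec (shift m x) \<in> K" using sh[OF by0 yX, of "deg G a"] by simp
      then have "basis_vec (shift m' (shift m x)) \<in> K" using sh X_shift x_in_X by blast
      then have 1: "basis_vec (shift m (shift m' x)) \<in> K" using x by (simp add: add.commute)
      have sx: "shift m' x \<in> inf_paths G" using x by simp
      have i: "shift m' x (0, m) \<in> mor G" "src G (shift m' x (0, m)) = shift m (shift m' x) (0, 0)"
        using inf_pathD[OF sx, of 0 m] shift_initial(2)[of m "shift m' x" 0] by simp_all
      have "basis_vec (prepend G (shift m' x (0, m)) (shift m (shift m' x))) \<in> K"
        by (rule pre[OF 1 _ i]) (use X_shift x_in_X in blast)
      then have "basis_vec (shift m' x) \<in> K" using prepend_split[OF sx] by simp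
      then show ?thesis using pre[of "shift m' x" b] b X_shift[OF x_in_X] by (simp add: shift_initial)
    qed
    then have "K = carrier LX" by (rule ell2_basis_total[OF K cl])
    then show ?thesis ..
  qed auto
  ultimately show ?thesis unfolding irreducible_rep_def by blast
qed

end

section \<open>Finite sums and projections in a C*-algebra\<close>

context cstar_algebra
begin

lemma finsum_mult_left:
  assumes "finite F" "\<And>i. i \<in> F \<Longrightarrow> f i \<in> carrier A" "y \<in> carrier A"
  shows "(\<Oplus>i\<in>F. f i) \<otimes> y = (\<Oplus>i\<in>F. f i \<otimes> y)"
  using assms(1,2)
proof induction
  case (insert j F)
  then have "(\<Oplus>i\<in>insert j F. f i) = f j \<oplus> (\<Oplus>i\<in>F. f i)" "(\<Oplus>i\<in>insert j F. f i \<otimes> y) = f j \<otimes> y \<oplus> (\<Oplus>i\<in>F. f i \<otimes> y)"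
    using assms(3) by (auto intro!: finsum_insert)
  moreover have "(\<Oplus>i\<in>F. f i) \<in> carrier A" using insert by (intro finsum_closed) auto
  ultimately show ?case using insert assms(3) by (simp add: mult_l_distr)
qed (use assms(3) in simp)

lemma finsum_mult_right:
  assumes "finite F" "\<And>i. i \<in> F \<Longrightarrow> f i \<in> carrier A" "y \<in> carrier A"
  shows "y \<otimes> (\<Oplus>i\<in>F. f i) = (\<Oplus>i\<in>F. y \<otimes> f i)"
  using assms(1,2)
proof induction
  case (insert j F)
  then have "(\<Oplus>i\<in>insert j F. f i) = f j \<oplus> (\<Oplus>i\<in>F. f i)" "(\<Oplus>i\<in>insert j F. y \<otimes> f i) = y \<otimes> f j \<oplus> (\<Oplus>i\<in>F. y \<otimes> f i)"
    using assms(3) by (auto intro!: finsum_insert)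
  moreover have "(\<Oplus>i\<in>F. f i) \<in> carrier A" using insert by (intro finsum_closed) auto
  ultimately show ?case using insert assms(3) by (simp add: mult_r_distr)
qed (use assms(3) in simp)

lemma finsum_mem:
  assumes "finite F" "\<zero> \<in> S" "\<And>x y. x \<in> S \<Longrightarrow> y \<in> S \<Longrightarrow> x \<oplus> y \<in> S" "S \<subseteq> carrier A" "\<And>i. i \<in> F \<Longrightarrow> f i \<in> S"
  shows "(\<Oplus>i\<in>F. f i) \<in> S"
  using assms(1,5)
proof induction
  case (insert j F)
  then have "(\<Oplus>i\<in>insert j F. f i) = f j \<oplus> (\<Oplus>i\<in>F. f i)" using assms(4) by (intro finsum_insert) auto
  then show ?case using insert assms(3) by simp
qed (use assms(2) in simp)

lemma finsum_zero_eq: "finite F \<Longrightarrow> (\<And>i. i \<in> F \<Longrightarrow> f i = \<zero>) \<Longrightarrow> (\<Oplus>i\<in>F. f i) = \<zero>"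
  using finsum_mem[of F "{\<zero>}" f] by simp

lemma finsum_remove:
  assumes "finite F" "j \<in> F" "\<And>i. i \<in> F \<Longrightarrow> f i \<in> carrier A"
  shows "(\<Oplus>i\<in>F. f i) = f j \<oplus> (\<Oplus>i\<in>F - {j}. f i)"
proof -
  have "(\<Oplus>i\<in>insert j (F - {j}). f i) = f j \<oplus> (\<Oplus>i\<in>F - {j}. f i)" by (rule finsum_insert) (use assms in auto)
  then show ?thesis using assms(2) by (simp add: insert_absorb)
qed

lemma finsum_single:
  assumes "finite F" "j \<in> F" "f j \<in> carrier A" "\<And>i. i \<in> F \<Longrightarrow> i \<noteq> j \<Longrightarrow> f i = \<zero>"
  shows "(\<Oplus>i\<in>F. f i) = f j"
proof -
  have "f i \<in> carrier A" if "i \<in> F" for i using assms that by (cases "i = j") auto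
  from finsum_remove[OF assms(1,2) this] finsum_zero_eq[of "F - {j}" f] assms show ?thesis by auto
qed

lemma finsum_star:
  assumes "finite F" "\<And>i. i \<in> F \<Longrightarrow> f i \<in> carrier A"
  shows "star A (\<Oplus>i\<in>F. f i) = (\<Oplus>i\<in>F. star A (f i))"
  using assms
proof induction
  case (insert j F)
  then have "(\<Oplus>i\<in>insert j F. f i) = f j \<oplus> (\<Oplus>i\<in>F. f i)" "(\<Oplus>i\<in>insert j F. star A (f i)) = star A (f j) \<oplus> (\<Oplus>i\<in>F. star A (f i))"
    by (auto intro!: finsum_insert)
  moreover have "(\<Oplus>i\<in>F. f i) \<in> carrier A" using insert by (intro finsum_closed) auto
  ultimately show ?case using insert by (simp add: star_add)
qed simp

definition is_proj :: "'a \<Rightarrow> bool" where "is_proj e \<longleftrightarrow> e \<in> carrier A \<and> star A e = e \<and> e \<otimes> e = e"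

lemma proj_nrm_le: assumes "is_proj e" shows "nrm A e \<le> 1"
proof -
  have "nrm A e = (nrm A e)\<^sup>2" using assms cstar_identity[of e] by (simp add: is_proj_def)
  then show ?thesis using nrm_nonneg[of e] assms by (auto simp: power2_eq_square is_proj_def)
qed

text \<open>Since \<open>1 - 2p\<close> is a symmetry, subtracting \<open>pa\<close> from \<open>a\<close> does not increase the norm.\<close>

lemma proj_compl_nrm:
  assumes p: "is_proj p" and a: "a \<in> carrier A"
  shows "nrm A (a \<ominus> p \<otimes> a) \<le> nrm A a"
proof -
  have pc: "p \<in> carrier A" "star A p = p" "p \<otimes> p = p" using p by (simp_all add: is_proj_def)
  define c where "c = p \<otimes> a"
  have c: "c \<in> carrier A" "p \<otimes> c = c" using pc a by (simp_all add: c_def mult_assoc[symmetric])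
  have cc: "star A a \<otimes> c = star A c \<otimes> c" "star A c \<otimes> a = star A c \<otimes> c"
    using pc a c by (simp_all add: c_def star_mult mult_assoc)
  define d where "d = c \<oplus> c"
  have dc: "d \<in> carrier A" using c by (simp add: d_def)
  define b where "b = a \<ominus> d"
  have bc: "b \<in> carrier A" using a dc by (simp add: b_def)
  let ?k = "star A c \<otimes> c"
  have kc: "?k \<in> carrier A" using c by simp
  have "star A b \<otimes> b = (star A a \<otimes> a \<ominus> star A d \<otimes> a) \<ominus> (star A a \<otimes> d \<ominus> star A d \<otimes> d)"
    using a dc by (simp add: b_def star_diff mult_diff)
  also have "star A d \<otimes> a = ?k \<oplus> ?k" using a c by (simp add: d_def star_add mult_l_distr cc)
  also have "star A a \<otimes> d = ?k \<oplus> ?k" using a c by (simp add: d_def mult_r_distr cc)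
  also have "star A d \<otimes> d = (?k \<oplus> ?k) \<oplus> (?k \<oplus> ?k)" using a c by (simp add: d_def star_add mult_r_distr mult_l_distr)
  also have "(?k \<oplus> ?k) \<ominus> ((?k \<oplus> ?k) \<oplus> (?k \<oplus> ?k)) = \<ominus> (?k \<oplus> ?k)"
    using kc by (simp add: minus_eq minus_add a_ac r_neg1 r_neg2 r_neg l_neg)
  also have "(star A a \<otimes> a \<ominus> (?k \<oplus> ?k)) \<ominus> \<ominus> (?k \<oplus> ?k) = star A a \<otimes> a"
    using kc a by (simp add: minus_eq a_assoc l_neg)
  finally have "(nrm A b)\<^sup>2 = (nrm A a)\<^sup>2" using cstar_identity[OF bc] cstar_identity[OF a] by simp
  then have nb: "nrm A b = nrm A a" using nrm_nonneg a bc by (simp add: power2_eq_iff_nonneg)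
  have "a \<ominus> c = (1/2) \<odot> (a \<oplus> b)"
  proof -
    have "a \<oplus> b = (a \<ominus> c) \<oplus> (a \<ominus> c)" using a c by (simp add: b_def d_def minus_eq minus_add a_ac)
    then show ?thesis using smult_simps(3)[of "a \<ominus> c" "1/2" 2] smult_2[of "a \<ominus> c"] a c by simp
  qed
  then have "nrm A (a \<ominus> c) = 1/2 * nrm A (a \<oplus> b)" using nrm_smult[of "a \<oplus> b" "1/2"] a bc by simp
  also have "\<dots> \<le> nrm A a" using nrm_triangle[of a b] nb a bc by simp
  finally show ?thesis by (simp add: c_def)
qed

lemma proj_compress_near:
  assumes e: "is_proj e" and p: "is_proj p"
  shows "nrm A (e \<ominus> e \<otimes> p \<otimes> e) \<le> 1"
proof -
  have ec: "e \<in> carrier A" "star A e = e" "e \<otimes> e = e" and pc: "p \<in> carrier A" "star A p = p" "p \<otimes> p = p"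
    using e p by (simp_all add: is_proj_def)
  define c where "c = p \<otimes> e"
  have c: "c \<in> carrier A" "e \<otimes> c = e \<otimes> p \<otimes> e" "star A c \<otimes> e = e \<otimes> p \<otimes> e" "star A c \<otimes> c = e \<otimes> p \<otimes> e"
    using ec pc by (simp_all add: c_def star_mult mult_assoc) (simp_all add: mult_assoc[symmetric])
  have k: "e \<otimes> p \<otimes> e \<in> carrier A" using ec pc by simp
  have "star A (e \<ominus> c) \<otimes> (e \<ominus> c) = e \<ominus> e \<otimes> p \<otimes> e"
    using ec c k by (simp add: star_diff mult_diff) (simp add: minus_eq r_neg)
  then have "nrm A (e \<ominus> e \<otimes> p \<otimes> e) = (nrm A (e \<ominus> c))\<^sup>2" using cstar_identity[of "e \<ominus> c"] ec c by simp
  also have "\<dots> \<le> 1"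
  proof (rule power_le_one)
    show "nrm A (e \<ominus> c) \<le> 1" using proj_compl_nrm[OF p ec(1)] proj_nrm_le[OF e] by (simp add: c_def)
  qed (use nrm_nonneg ec c in simp)
  finally show ?thesis .
qed

text \<open>For \<open>\<omega> = e\<^bsup>i\<pi>/4\<^esup>\<close> the element \<open>(e + \<omega>h)\<^sup>*(e + \<omega>h) = e + \<surd>2 h + h\<^sup>2\<close> is a convex combination of \<open>(e + h)\<^sup>2\<close> and
  \<open>(e - h)\<^sup>2\<close>, so \<open>\<parallel>e + \<omega>h\<parallel> \<le> 1\<close>; and the mean of \<open>(e + \<omega>h)\<^sup>2\<close> and its adjoint is \<open>e + \<surd>2 h\<close>, as \<open>\<omega>\<^sup>2 = i\<close>. Likewise for \<open>-h\<close>.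
  Hence \<open>h\<close> may be replaced by \<open>\<surd>2 h\<close> again and again.\<close>

lemma near_unit_both_signs:
  assumes e: "is_proj e" and h: "h \<in> carrier A" "star A h = h" "e \<otimes> h = h" "h \<otimes> e = h"
    and n: "nrm A (e \<oplus> h) \<le> 1" "nrm A (e \<ominus> h) \<le> 1"
  shows "h = \<zero>"
proof -
  have ec: "e \<in> carrier A" "star A e = e" "e \<otimes> e = e" using e by (simp_all add: is_proj_def)
  \<comment> \<open>the elements \<open>ae + bh + c h\<^sup>2\<close>\<close>
  define L where "L k a b c = a \<odot> e \<oplus> (b \<odot> k \<oplus> c \<odot> (k \<otimes> k))" for k a b c
  define good where "good k \<longleftrightarrow> k \<in> carrier A \<and> star A k = k \<and> e \<otimes> k = k \<and> k \<otimes> e = k \<and> nrm A (e \<oplus> k) \<le> 1 \<and> nrm A (e \<ominus> k) \<le> 1" for k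
  have step: "good (of_real (sqrt 2) \<odot> k)" if g: "good k" for k
  proof -
    have k: "k \<in> carrier A" "star A k = k" "e \<otimes> k = k" "k \<otimes> e = k" "nrm A (e \<oplus> k) \<le> 1" "nrm A (e \<ominus> k) \<le> 1"
      using g by (simp_all add: good_def)
    have Lc [simp]: "L k a b c \<in> carrier A" for a b c using k ec by (simp add: L_def)
    have Ladd: "L k a b c \<oplus> L k a' b' c' = L k (a + a') (b + b') (c + c')" for a b c a' b' c'
      using k ec by (simp add: L_def smult_simps(1) a_ac)
    have Lsm: "d \<odot> L k a b c = L k (d * a) (d * b) (d * c)" for a b c d
      using k ec by (simp add: L_def smult_simps(2,3))
    have Lmul: "(e \<oplus> \<alpha> \<odot> k) \<otimes> (e \<oplus> \<beta> \<odot> k) = L k 1 (\<alpha> + \<beta>) (\<alpha> * \<beta>)" for \<alpha> \<beta>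
      using k ec by (simp add: L_def mult_l_distr mult_r_distr smult_mult_l smult_mult_r smult_simps a_ac mult.commute[of \<beta> \<alpha>])
    have nL: "nrm A (L k 1 (\<alpha> + \<beta>) (\<alpha> * \<beta>)) \<le> 1" if "nrm A (e \<oplus> \<alpha> \<odot> k) \<le> 1" "nrm A (e \<oplus> \<beta> \<odot> k) \<le> 1" for \<alpha> \<beta>
    proof -
      have "nrm A (L k 1 (\<alpha> + \<beta>) (\<alpha> * \<beta>)) \<le> nrm A (e \<oplus> \<alpha> \<odot> k) * nrm A (e \<oplus> \<beta> \<odot> k)"
        unfolding Lmul[symmetric] using nrm_mult[of "e \<oplus> \<alpha> \<odot> k" "e \<oplus> \<beta> \<odot> k"] ec k by simp
      also have "\<dots> \<le> 1" using mult_mono[OF that] nrm_nonneg ec k by simp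
      finally show ?thesis .
    qed
    have n1: "nrm A (e \<oplus> 1 \<odot> k) \<le> 1" "nrm A (e \<oplus> (-1) \<odot> k) \<le> 1"
      using k smult_minus(1)[of k 1] by (simp_all add: minus_eq)
    have conv: "nrm A (L k 1 (of_real t) 1) \<le> 1" if t: "\<bar>t\<bar> \<le> 2" for t :: real
    proof -
      have "L k 1 (of_real t) 1 = of_real ((2 + t) / 4) \<odot> L k 1 2 1 \<oplus> of_real ((2 - t) / 4) \<odot> L k 1 (-2) 1"
        unfolding Lsm Ladd by (simp add: field_simps)
      also have "nrm A \<dots> \<le> nrm A (of_real ((2 + t) / 4) \<odot> L k 1 2 1) + nrm A (of_real ((2 - t) / 4) \<odot> L k 1 (-2) 1)"
        by (rule nrm_triangle) simp_all
      also have "\<dots> = (2 + t) / 4 * nrm A (L k 1 2 1) + (2 - t) / 4 * nrm A (L k 1 (-2) 1)"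
        using t by (simp add: nrm_smult del: of_real_divide of_real_add of_real_diff)
      also have "\<dots> \<le> (2 + t) / 4 * 1 + (2 - t) / 4 * 1"
        using nL[OF n1(1) n1(1)] nL[OF n1(2) n1(2)] t by (intro add_mono mult_left_mono) auto
      finally show ?thesis by (simp add: field_simps)
    qed
    have rot: "nrm A (e \<oplus> \<omega> \<odot> k) \<le> 1" if w: "cmod \<omega> = 1" for \<omega>
    proof -
      have st: "star A (e \<oplus> \<omega> \<odot> k) = e \<oplus> cnj \<omega> \<odot> k" using ec k by (simp add: star_add star_smult)
      have "(nrm A (e \<oplus> \<omega> \<odot> k))\<^sup>2 = nrm A (L k 1 (cnj \<omega> + \<omega>) (cnj \<omega> * \<omega>))"
        using cstar_identity[of "e \<oplus> \<omega> \<odot> k"] st Lmul[of "cnj \<omega>" \<omega>] ec k by simp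
      moreover have "cnj \<omega> + \<omega> = of_real (2 * Re \<omega>)" using complex_add_cnj[of \<omega>] by (simp add: add.commute)
      moreover have "cnj \<omega> * \<omega> = 1" using complex_norm_square[of \<omega>] w by (simp add: mult.commute)
      moreover have "\<bar>2 * Re \<omega>\<bar> \<le> 2" using abs_Re_le_cmod[of \<omega>] w by simp
      ultimately have "(nrm A (e \<oplus> \<omega> \<odot> k))\<^sup>2 \<le> 1\<^sup>2" using conv[of "2 * Re \<omega>"] by simp
      then show ?thesis by (rule power2_le_imp_le) simp
    qed
    have avg: "nrm A (e \<oplus> (of_real t * of_real (sqrt 2)) \<odot> k) \<le> 1" if t: "t = 1 \<or> t = -1" for t :: real
    proof -
      define \<omega> where "\<omega> = Complex (t / sqrt 2) (1 / sqrt 2)"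
      have w: "cmod \<omega> = 1" "cmod (cnj \<omega>) = 1" using t by (auto simp: \<omega>_def cmod_def power_divide)
      have w2: "\<omega> + \<omega> + (cnj \<omega> + cnj \<omega>) = 2 * (of_real t * of_real (sqrt 2))" "\<omega> * \<omega> + cnj \<omega> * cnj \<omega> = 0"
        using t by (auto simp: \<omega>_def complex_eq_iff field_simps)
      have "e \<oplus> (of_real t * of_real (sqrt 2)) \<odot> k = (1/2) \<odot> (L k 1 (\<omega> + \<omega>) (\<omega> * \<omega>) \<oplus> L k 1 (cnj \<omega> + cnj \<omega>) (cnj \<omega> * cnj \<omega>))"
        unfolding Lsm Ladd w2 using k ec by (simp add: L_def)
      then have "nrm A (e \<oplus> (of_real t * of_real (sqrt 2)) \<odot> k) = (1/2) * nrm A (L k 1 (\<omega> + \<omega>) (\<omega> * \<omega>) \<oplus> L k 1 (cnj \<omega> + cnj \<omega>) (cnj \<omega> * cnj \<omega>))"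
        using nrm_smult[of "L k 1 (\<omega> + \<omega>) (\<omega> * \<omega>) \<oplus> L k 1 (cnj \<omega> + cnj \<omega>) (cnj \<omega> * cnj \<omega>)" "1/2"] by simp
      also have "\<dots> \<le> (1/2) * (1 + 1)"
        using nrm_triangle[of "L k 1 (\<omega> + \<omega>) (\<omega> * \<omega>)" "L k 1 (cnj \<omega> + cnj \<omega>) (cnj \<omega> * cnj \<omega>)"] nL[OF rot[OF w(1)] rot[OF w(1)]] nL[OF rot[OF w(2)] rot[OF w(2)]] by simp
      finally show ?thesis by simp
    qed
    show ?thesis
      unfolding good_def
      using avg[of 1] avg[of "-1"] k ec smult_minus(1)[of k "of_real (sqrt 2)"] by (simp add: star_smult smult_mult_l smult_mult_r minus_eq)
  qed
  have it: "good (of_real (sqrt 2 ^ m) \<odot> h)" for m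
  proof (induction m)
    case 0 show ?case using h n by (simp add: good_def)
  next
    case (Suc m)
    show ?case using step[OF Suc] h(1) by (simp add: smult_simps(3))
  qed
  have "sqrt 2 ^ m * nrm A h \<le> 2" for m
  proof -
    let ?k = "of_real (sqrt 2 ^ m) \<odot> h"
    have kc: "?k \<in> carrier A" using h by simp
    have "nrm A ?k \<le> nrm A e + nrm A (?k \<ominus> e)" using N_le_diff[OF kc ec(1)] .
    also have "nrm A (?k \<ominus> e) = nrm A (e \<ominus> ?k)" using N_diff_sym[OF kc ec(1)] .
    also have "nrm A e + nrm A (e \<ominus> ?k) \<le> 2" using it[of m] proj_nrm_le[OF e] by (simp add: good_def)
    finally show ?thesis using nrm_smult[OF h(1), of "of_real (sqrt 2 ^ m)"] by (simp add: norm_power)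
  qed
  moreover have "\<exists>m. 2 < sqrt 2 ^ m * nrm A h" if "nrm A h > 0"
  proof -
    obtain m where "2 / nrm A h < sqrt 2 ^ m" using real_arch_pow[of "sqrt 2"] by auto
    then show ?thesis using that by (auto simp: divide_less_eq)
  qed
  ultimately have "\<not> nrm A h > 0" by (meson not_less)
  then show ?thesis using nrm_nonneg[OF h(1)] nrm_eq_0[OF h(1)] by simp
qed

text \<open>A substitute for the positive cone. It contains \<open>epe\<close> for every projection \<open>p\<close> (\<open>proj_compress_near\<close>), and no line
  by \<open>near_unit_both_signs\<close>.\<close>

definition near_cone :: "'a \<Rightarrow> 'a set" where
  "near_cone e = {x \<in> carrier A. \<exists>r\<ge>0. nrm A (of_real r \<odot> e \<ominus> x) \<le> r}"

lemma near_cone_add: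
  assumes "e \<in> carrier A" "x \<in> near_cone e" "y \<in> near_cone e" shows "x \<oplus> y \<in> near_cone e"
proof -
  obtain a b where ab: "a \<ge> 0" "b \<ge> 0" "nrm A (of_real a \<odot> e \<ominus> x) \<le> a" "nrm A (of_real b \<odot> e \<ominus> y) \<le> b" "x \<in> carrier A" "y \<in> carrier A"
    using assms unfolding near_cone_def by blast
  have "of_real (a + b) \<odot> e \<ominus> (x \<oplus> y) = (of_real a \<odot> e \<ominus> x) \<oplus> (of_real b \<odot> e \<ominus> y)"
    using assms(1) ab by (simp add: smult_simps(1) add_diff_add)
  then have "nrm A (of_real (a + b) \<odot> e \<ominus> (x \<oplus> y)) \<le> a + b"
    using nrm_triangle[of "of_real a \<odot> e \<ominus> x" "of_real b \<odot> e \<ominus> y"] assms(1) ab by simp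
  then show ?thesis using ab unfolding near_cone_def by (intro CollectI conjI exI[of _ "a + b"]) auto
qed

lemma near_cone_no_line:
  assumes e: "is_proj e" and h: "star A h = h" "e \<otimes> h = h" "h \<otimes> e = h" "h \<in> near_cone e" "\<ominus> h \<in> near_cone e"
  shows "h = \<zero>"
proof -
  have ec: "e \<in> carrier A" using e by (simp add: is_proj_def)
  obtain a b where ab: "a \<ge> 0" "b \<ge> 0" "nrm A (of_real a \<odot> e \<ominus> h) \<le> a" "nrm A (of_real b \<odot> e \<ominus> \<ominus> h) \<le> b" "h \<in> carrier A"
    using h unfolding near_cone_def by blast
  define m where "m = a + b + 1"
  define k where "k = of_real (1/m) \<odot> h"
  have m: "m \<ge> 1" using ab by (simp add: m_def)
  have scale: "nrm A (e \<ominus> of_real (1/m) \<odot> u) \<le> 1" if u: "u \<in> carrier A" "nrm A (of_real r \<odot> e \<ominus> u) \<le> r" "r \<le> m" for r u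
  proof -
    have "of_real m \<odot> e \<ominus> u = of_real (m - r) \<odot> e \<oplus> (of_real r \<odot> e \<ominus> u)"
      using ec u smult_simps(1)[OF ec, of "of_real (m - r)" "of_real r"] by (simp add: minus_eq a_assoc)
    then have "nrm A (of_real m \<odot> e \<ominus> u) \<le> nrm A (of_real (m - r) \<odot> e) + nrm A (of_real r \<odot> e \<ominus> u)"
      using nrm_triangle ec u(1) by simp
    also have "\<dots> \<le> (m - r) * 1 + r"
      using nrm_smult[OF ec, of "of_real (m - r)"] mult_left_mono[OF proj_nrm_le[OF e], of "m - r"] u(2,3) by (simp del: of_real_diff)
    finally have "nrm A (of_real m \<odot> e \<ominus> u) \<le> m" by simp
    moreover have "e \<ominus> of_real (1/m) \<odot> u = of_real (1/m) \<odot> (of_real m \<odot> e \<ominus> u)"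
      using ec u m by (simp add: smult_diff smult_simps(3))
    ultimately show ?thesis
      using nrm_smult[of "of_real m \<odot> e \<ominus> u" "of_real (1/m)"] ec u m by (simp add: norm_divide divide_le_eq)
  qed
  have "k = \<zero>"
  proof (rule near_unit_both_signs[OF e])
    show "nrm A (e \<ominus> k) \<le> 1" unfolding k_def by (rule scale[OF ab(5,3)]) (use ab in \<open>simp add: m_def\<close>)
    have "nrm A (e \<ominus> of_real (1/m) \<odot> \<ominus> h) \<le> 1" by (rule scale[OF _ ab(4)]) (use ab in \<open>simp_all add: m_def\<close>)
    then show "nrm A (e \<oplus> k) \<le> 1" using ab ec by (simp add: k_def minus_eq)
  qed (use h ab ec in \<open>simp_all add: k_def star_smult smult_mult_l smult_mult_r\<close>)
  then have "of_real m \<odot> k = \<zero>" by simp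
  then show ?thesis using m ab by (simp add: k_def smult_simps(3))
qed

text \<open>With \<open>e = p\<^sub>i\<close>, compressing the sum to \<open>e\<close> gives \<open>\<Sum>\<^bsub>k \<noteq> i\<^esub> e p\<^sub>k e = 0\<close>. All summands lie in the cone, so each of them vanishes.\<close>

lemma orthogonal_of_sum_proj:
  assumes F: "finite F" and p: "\<And>i. i \<in> F \<Longrightarrow> is_proj (p i)" and sum: "is_proj (\<Oplus>i\<in>F. p i)"
    and i: "i \<in> F" and j: "j \<in> F" "i \<noteq> j" and le: "p i \<otimes> (\<Oplus>i\<in>F. p i) = p i"
  shows "p j \<otimes> p i = \<zero>"
proof -
  define e where "e = p i"
  have e: "is_proj e" "e \<in> carrier A" "star A e = e" "e \<otimes> e = e" using p i by (simp_all add: e_def is_proj_def)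
  have pc: "p k \<in> carrier A" "star A (p k) = p k" "p k \<otimes> p k = p k" if "k \<in> F" for k using p[OF that] by (simp_all add: is_proj_def)
  define x where "x k = e \<otimes> p k \<otimes> e" for k
  have xc: "x k \<in> carrier A" if "k \<in> F" for k using e pc that by (simp add: x_def)
  have xC: "x k \<in> near_cone e" if "k \<in> F" for k
    using proj_compress_near[OF e(1) p[OF that]] xc[OF that] e unfolding near_cone_def x_def by (intro CollectI conjI exI[of _ 1]) simp_all
  define y where "y = (\<Oplus>k\<in>F - {i} - {j}. x k)"
  have yC: "y \<in> near_cone e"
    unfolding y_def
  proof (rule finsum_mem)
    show "\<zero> \<in> near_cone e" using nrm_uminus[of \<zero>] e(2) unfolding near_cone_def by (auto intro!: exI[of _ 0] simp: minus_eq)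
  qed (use F xC near_cone_add[OF e(2)] in \<open>auto simp: near_cone_def\<close>)
  then have yc: "y \<in> carrier A" by (simp add: near_cone_def)
  have "e = e \<otimes> (\<Oplus>k\<in>F. p k) \<otimes> e" using le e by (simp add: e_def)
  also have "\<dots> = (\<Oplus>k\<in>F. x k)"
    unfolding x_def using F e pc by (simp add: finsum_mult_right finsum_mult_left)
  also have "\<dots> = x i \<oplus> (\<Oplus>k\<in>F - {i}. x k)" by (rule finsum_remove[OF F i xc])
  also have "(\<Oplus>k\<in>F - {i}. x k) = x j \<oplus> y"
    unfolding y_def by (rule finsum_remove) (use F j xc in auto)
  also have "x i = e" using e by (simp add: x_def e_def[symmetric])
  finally have z: "e \<oplus> (x j \<oplus> y) = e" by simp
  have "x j \<oplus> y = \<zero>" using z e xc[OF j(1)] yc by (metis a_closed add.l_cancel_one')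
  then have "y = \<ominus> x j" using xc[OF j(1)] yc by (metis a_comm minus_equality minus_minus)
  then have "\<ominus> x j \<in> near_cone e" using yC by simp
  moreover have "e \<otimes> x j = x j" using j e pc by (simp add: x_def) (simp add: mult_assoc[symmetric] e)
  moreover have "x j \<otimes> e = x j" using j e pc by (simp add: x_def mult_assoc)
  moreover have "star A (x j) = x j" using j e pc by (simp add: x_def star_mult mult_assoc)
  ultimately have "x j = \<zero>" using near_cone_no_line[OF e(1)] xC[OF j(1)] by blast
  moreover have "star A (p j \<otimes> e) \<otimes> (p j \<otimes> e) = x j"
  proof -
    have "star A (p j \<otimes> e) \<otimes> (p j \<otimes> e) = e \<otimes> ((p j \<otimes> p j) \<otimes> e)" using e(2,3) pc(1,2)[OF j(1)] by (simp only: star_mult mult_assoc mult_closed)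
    then show ?thesis unfolding pc(3)[OF j(1)] using e pc[OF j(1)] by (simp add: x_def mult_assoc)
  qed
  ultimately have "(nrm A (p j \<otimes> e))\<^sup>2 = 0" using cstar_identity[of "p j \<otimes> e"] e pc[OF j(1)] by simp
  then show ?thesis using nrm_eq_0[of "p j \<otimes> e"] e pc[OF j(1)] by (simp add: e_def)
qed

end

section \<open>The algebra of a Cuntz--Krieger family\<close>

context graph_cstar
begin

abbreviation st ("_\<^sup>\<star>" [1000] 999) where "st x \<equiv> star A x"
abbreviation mulA (infixl "\<otimes>" 70) where "x \<otimes> y \<equiv> x \<otimes>\<^bsub>A\<^esub> y"
abbreviation addA (infixl "\<oplus>" 65) where "x \<oplus> y \<equiv> x \<oplus>\<^bsub>A\<^esub> y"
abbreviation minA (infixl "\<ominus>" 65) where "x \<ominus> y \<equiv> x \<ominus>\<^bsub>A\<^esub> y"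
abbreviation smA (infixr "\<odot>" 70) where "c \<odot> x \<equiv> c \<odot>\<^bsub>A\<^esub> x"
abbreviation zA ("\<zero>") where "zA \<equiv> \<zero>\<^bsub>A\<^esub>"

lemma s_vertex_closed [simp]: "v \<in> verts G \<Longrightarrow> s v \<in> carrier A"
  using vertsD by simp

lemma s_rng [simp]: "a \<in> mor G \<Longrightarrow> s (rng G a) \<otimes> s a = s a"
  and s_src [simp]: "a \<in> mor G \<Longrightarrow> s a \<otimes> s (src G a) = s a"
  using s_cmp[of "rng G a" a] s_cmp[of a "src G a"] by simp_all

lemma st_rng [simp]: "a \<in> mor G \<Longrightarrow> (s a)\<^sup>\<star> \<otimes> s (rng G a) = (s a)\<^sup>\<star>"
  and st_src [simp]: "a \<in> mor G \<Longrightarrow> s (src G a) \<otimes> (s a)\<^sup>\<star> = (s a)\<^sup>\<star>"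
proof -
  assume a: "a \<in> mor G"
  show "(s a)\<^sup>\<star> \<otimes> s (rng G a) = (s a)\<^sup>\<star>"
    using A.star_mult[of "s (rng G a)" "s a"] a s_vertex(1)[of "rng G a"] by simp
  show "s (src G a) \<otimes> (s a)\<^sup>\<star> = (s a)\<^sup>\<star>"
    using A.star_mult[of "s a" "s (src G a)"] a s_vertex(1)[of "src G a"] by simp
qed

lemma s_vertex_s: assumes "v \<in> verts G" "a \<in> mor G"
  shows "s v \<otimes> s a = (if rng G a = v then s a else \<zero>)" "(s a)\<^sup>\<star> \<otimes> s v = (if rng G a = v then (s a)\<^sup>\<star> else \<zero>)"
  using assms s_orth[of v "rng G a"] s_orth[of "rng G a" v] A.mult_assoc[of "s v" "s (rng G a)" "s a"]
    A.mult_assoc[of "(s a)\<^sup>\<star>" "s (rng G a)" "s v"] by auto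

definition rp :: "'l \<Rightarrow> 'a" where "rp a = s a \<otimes> (s a)\<^sup>\<star>"

lemma rp_closed [simp]: "a \<in> mor G \<Longrightarrow> rp a \<in> carrier A" by (simp add: rp_def)

lemma rp_proj: assumes "a \<in> mor G" shows "A.is_proj (rp a)"
proof -
  have "rp a \<otimes> rp a = s a \<otimes> ((s a)\<^sup>\<star> \<otimes> s a) \<otimes> (s a)\<^sup>\<star>" using assms by (simp add: rp_def A.mult_assoc)
  then show ?thesis using assms by (simp add: A.is_proj_def s_star_s) (simp add: rp_def A.star_mult)
qed

lemma vertex_proj: "v \<in> verts G \<Longrightarrow> A.is_proj (s v)"
  using s_vertex by (simp add: A.is_proj_def)

lemma rp_s [simp]: "a \<in> mor G \<Longrightarrow> rp a \<otimes> s a = s a" "a \<in> mor G \<Longrightarrow> (s a)\<^sup>\<star> \<otimes> rp a = (s a)\<^sup>\<star>"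
proof -
  assume a: "a \<in> mor G"
  show "rp a \<otimes> s a = s a" using a by (simp add: rp_def A.mult_assoc s_star_s)
  show "(s a)\<^sup>\<star> \<otimes> rp a = (s a)\<^sup>\<star>" using a A.mult_assoc[of "(s a)\<^sup>\<star>" "s a" "(s a)\<^sup>\<star>"] by (simp add: rp_def s_star_s)
qed

text \<open>The relation for \<open>s\<^sub>v\<close> writes a projection as a sum of projections, which are then orthogonal.\<close>

lemma rp_orth:
  assumes "a \<in> mor G" "b \<in> mor G" "rng G a = rng G b" "deg G a = deg G b" "a \<noteq> b"
  shows "rp b \<otimes> rp a = \<zero>"
proof -
  let ?F = "{c \<in> mor G. rng G c = rng G a \<and> deg G c = deg G a}"
  have sum: "s (rng G a) = (\<Oplus>\<^bsub>A\<^esub>c\<in>?F. rp c)" unfolding rp_def by (rule s_sum) (use assms in simp)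
  show ?thesis
  proof (rule A.orthogonal_of_sum_proj[of ?F rp a b])
    show "A.is_proj (\<Oplus>\<^bsub>A\<^esub>c\<in>?F. rp c)" unfolding sum[symmetric] using vertex_proj assms by simp
    have "rp a \<otimes> s (rng G a) = rp a" using st_rng[OF assms(1)] assms(1) by (simp add: rp_def A.mult_assoc)
    then show "rp a \<otimes> (\<Oplus>\<^bsub>A\<^esub>c\<in>?F. rp c) = rp a" unfolding sum[symmetric] .
  qed (use assms finite_paths rp_proj in auto)
qed

lemma s_star_s_orth:
  assumes "a \<in> mor G" "b \<in> mor G" "deg G a = deg G b" "a \<noteq> b"
  shows "(s a)\<^sup>\<star> \<otimes> s b = \<zero>"
proof (cases "rng G a = rng G b")
  case True
  have "(s a)\<^sup>\<star> \<otimes> s b = ((s a)\<^sup>\<star> \<otimes> rp a) \<otimes> (rp b \<otimes> s b)" using assms by simp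
  also have "\<dots> = (s a)\<^sup>\<star> \<otimes> ((rp a \<otimes> rp b) \<otimes> s b)" using assms by (simp only: A.mult_assoc A.mult_closed A.star_closed rp_closed s_closed)
  finally show ?thesis using rp_orth[of b a] assms True by simp
next
  case False
  have "(s a)\<^sup>\<star> \<otimes> s b = ((s a)\<^sup>\<star> \<otimes> s (rng G b)) \<otimes> s b" using assms by (simp add: A.mult_assoc)
  then show ?thesis using s_vertex_s(2)[of "rng G b" a] False assms by simp
qed

lemma star_s_cmp: "\<lbrakk>a \<in> mor G; b \<in> mor G; src G a = rng G b\<rbrakk> \<Longrightarrow> (s (a \<cdot> b))\<^sup>\<star> = (s b)\<^sup>\<star> \<otimes> (s a)\<^sup>\<star>"
  using s_cmp[of a b] A.star_mult[of "s a" "s b"] by simp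

lemma star_s_mult_ini:
  assumes "b \<in> mor G" "e \<in> mor G" "deg G b \<le> deg G e"
  shows "(s b)\<^sup>\<star> \<otimes> s e = (if ini (deg G b) e = b then s (fin (deg G b) e) else \<zero>)"
proof -
  note i = ini_fin[OF assms(2,3)]
  have "(s b)\<^sup>\<star> \<otimes> s e = ((s b)\<^sup>\<star> \<otimes> s (ini (deg G b) e)) \<otimes> s (fin (deg G b) e)"
    using s_cmp[OF i(1,2,3)] i assms A.mult_assoc[of "(s b)\<^sup>\<star>" "s (ini (deg G b) e)" "s (fin (deg G b) e)"] by simp
  then show ?thesis
    using s_star_s_orth[OF assms(1) i(1)] i s_star_s[OF assms(1)] s_rng[OF i(2)] by auto
qed

lemma s_star_mult_ini:
  assumes "b \<in> mor G" "e \<in> mor G" "deg G b \<le> deg G e"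
  shows "(s e)\<^sup>\<star> \<otimes> s b = (if ini (deg G b) e = b then (s (fin (deg G b) e))\<^sup>\<star> else \<zero>)"
proof -
  have "(s e)\<^sup>\<star> \<otimes> s b = ((s b)\<^sup>\<star> \<otimes> s e)\<^sup>\<star>" using assms by (simp add: A.star_mult)
  then show ?thesis using star_s_mult_ini[OF assms] by simp
qed

lemma no_common_extension:
  assumes "a \<in> mor G" "b \<in> mor G" "n \<le> deg G a" "n \<le> deg G b" "ini n a \<noteq> ini n b"
  shows "(s a)\<^sup>\<star> \<otimes> s b = \<zero>"
proof -
  note a = ini_fin[OF assms(1,3)] and b = ini_fin[OF assms(2,4)]
  have "(s a)\<^sup>\<star> \<otimes> s b = ((s (fin n a))\<^sup>\<star> \<otimes> (s (ini n a))\<^sup>\<star>) \<otimes> (s (ini n b) \<otimes> s (fin n b))"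
    using star_s_cmp[OF a(1,2,3)] s_cmp[OF b(1,2,3)] a(6) b(6) by simp
  also have "\<dots> = (s (fin n a))\<^sup>\<star> \<otimes> (((s (ini n a))\<^sup>\<star> \<otimes> s (ini n b)) \<otimes> s (fin n b))"
    using a b by (simp add: A.mult_assoc)
  finally show ?thesis using s_star_s_orth[OF a(1) b(1)] a b assms(5) by simp
qed

text \<open>An additive statement about \<open>x s\<^sub>v y\<close> may be checked on the summands \<open>x s\<^sub>e s\<^sub>e\<^sup>* y\<close> of \<open>s\<^sub>v\<close>.\<close>

lemma expand_vertex:
  assumes "v \<in> verts G" "x \<in> carrier A" "y \<in> carrier A"
  shows "x \<otimes> s v \<otimes> y = (\<Oplus>\<^bsub>A\<^esub>e \<in> {e \<in> mor G. rng G e = v \<and> deg G e = n}. (x \<otimes> s e) \<otimes> ((s e)\<^sup>\<star> \<otimes> y))"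
proof -
  let ?F = "{e \<in> mor G. rng G e = v \<and> deg G e = n}"
  have F: "finite ?F" "\<And>e. e \<in> ?F \<Longrightarrow> s e \<otimes> (s e)\<^sup>\<star> \<in> carrier A" "\<And>e. e \<in> ?F \<Longrightarrow> x \<otimes> (s e \<otimes> (s e)\<^sup>\<star>) \<in> carrier A"
    using finite_paths[OF assms(1)] assms(2) by auto
  have "x \<otimes> s v \<otimes> y = (\<Oplus>\<^bsub>A\<^esub>e\<in>?F. x \<otimes> (s e \<otimes> (s e)\<^sup>\<star>) \<otimes> y)"
    unfolding s_sum[OF assms(1), of n]
    using A.finsum_mult_right[OF F(1,2) assms(2)] A.finsum_mult_left[OF F(1,3) assms(3)] by simp
  also have "\<dots> = (\<Oplus>\<^bsub>A\<^esub>e\<in>?F. (x \<otimes> s e) \<otimes> ((s e)\<^sup>\<star> \<otimes> y))"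
    using assms by (intro A.finsum_cong') (auto simp: A.mult_assoc)
  finally show ?thesis .
qed

lemma expand_mem:
  assumes "v \<in> verts G" "x \<in> carrier A" "y \<in> carrier A"
    and S: "\<zero> \<in> S" "\<And>x y. x \<in> S \<Longrightarrow> y \<in> S \<Longrightarrow> x \<oplus> y \<in> S" "S \<subseteq> carrier A"
    and e: "\<And>e. e \<in> mor G \<Longrightarrow> rng G e = v \<Longrightarrow> deg G e = n \<Longrightarrow> (x \<otimes> s e) \<otimes> ((s e)\<^sup>\<star> \<otimes> y) \<in> S"
  shows "x \<otimes> s v \<otimes> y \<in> S"
  unfolding expand_vertex[OF assms(1-3), of n]
  by (rule A.finsum_mem) (use finite_paths[OF assms(1)] S e in auto)


subsection \<open>Spans of the elements \<open>s\<^sub>a s\<^sub>b\<^sup>*\<close>\<close>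

text \<open>The predicate selects which terms \<open>s\<^sub>a s\<^sub>b\<^sup>*\<close> may occur, so that one induction principle serves all the spans needed.\<close>

inductive_set mspan :: "('l \<Rightarrow> 'l \<Rightarrow> bool) \<Rightarrow> 'a set" for P where
  zero: "\<zero> \<in> mspan P"
| step: "x \<in> mspan P \<Longrightarrow> a \<in> mor G \<Longrightarrow> b \<in> mor G \<Longrightarrow> src G a = src G b \<Longrightarrow> P a b \<Longrightarrow> c \<odot> (s a \<otimes> (s b)\<^sup>\<star>) \<oplus> x \<in> mspan P"

lemma mspan_carrier: "x \<in> mspan P \<Longrightarrow> x \<in> carrier A"
  by (induction rule: mspan.induct) auto

lemma mspan_gen: "a \<in> mor G \<Longrightarrow> b \<in> mor G \<Longrightarrow> src G a = src G b \<Longrightarrow> P a b \<Longrightarrow> s a \<otimes> (s b)\<^sup>\<star> \<in> mspan P"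
  using mspan.step[OF mspan.zero, of a b P 1] by simp

lemma mspan_add: "x \<in> mspan P \<Longrightarrow> y \<in> mspan P \<Longrightarrow> x \<oplus> y \<in> mspan P"
proof (induction rule: mspan.induct)
  case (step x a b c)
  then show ?case using mspan.step[of "x \<oplus> y" P a b c] by (simp add: mspan_carrier A.a_assoc)
qed (simp add: mspan_carrier)

lemma mspan_smult: "x \<in> mspan P \<Longrightarrow> d \<odot> x \<in> mspan P"
proof (induction rule: mspan.induct)
  case (step x a b c)
  then show ?case using mspan.step[of "d \<odot> x" P a b "d * c"] by (simp add: mspan_carrier A.smult_simps)
qed (simp add: mspan.zero)

lemma mspan_mono: "x \<in> mspan P \<Longrightarrow> (\<And>a b. P a b \<Longrightarrow> Q a b) \<Longrightarrow> x \<in> mspan Q"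
  by (induction rule: mspan.induct) (auto intro: mspan.intros)

lemma mspan_star: "x \<in> mspan P \<Longrightarrow> (\<And>a b. P a b \<Longrightarrow> Q b a) \<Longrightarrow> x\<^sup>\<star> \<in> mspan Q"
proof (induction rule: mspan.induct)
  case (step x a b c)
  then show ?case using mspan.step[of "x\<^sup>\<star>" Q b a "cnj c"] by (simp add: mspan_carrier A.star_add A.star_smult A.star_mult)
qed (simp add: mspan.zero)

lemma mspan_mult:
  assumes x: "x \<in> mspan P" and y: "y \<in> mspan Q"
    and gen: "\<And>a b c d. \<lbrakk>a \<in> mor G; b \<in> mor G; src G a = src G b; P a b; c \<in> mor G; d \<in> mor G; src G c = src G d; Q c d\<rbrakk>
      \<Longrightarrow> (s a \<otimes> (s b)\<^sup>\<star>) \<otimes> (s c \<otimes> (s d)\<^sup>\<star>) \<in> mspan R"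
  shows "x \<otimes> y \<in> mspan R"
  using x
proof (induction rule: mspan.induct)
  case zero show ?case using y by (simp add: mspan_carrier mspan.zero)
next
  case (step x a b k)
  have "(s a \<otimes> (s b)\<^sup>\<star>) \<otimes> y \<in> mspan R"
    using y
  proof (induction rule: mspan.induct)
    case zero show ?case using step by (simp add: mspan.zero)
  next
    case (step y c d l)
    have "(s a \<otimes> (s b)\<^sup>\<star>) \<otimes> (l \<odot> (s c \<otimes> (s d)\<^sup>\<star>) \<oplus> y) = l \<odot> ((s a \<otimes> (s b)\<^sup>\<star>) \<otimes> (s c \<otimes> (s d)\<^sup>\<star>)) \<oplus> (s a \<otimes> (s b)\<^sup>\<star>) \<otimes> y"
      using step.hyps \<open>a \<in> mor G\<close> \<open>b \<in> mor G\<close> by (simp add: mspan_carrier A.mult_r_distr A.smult_mult_r)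
    then show ?case using step gen \<open>a \<in> mor G\<close> \<open>b \<in> mor G\<close> \<open>src G a = src G b\<close> \<open>P a b\<close> by (simp add: mspan_add mspan_smult)
  qed
  moreover have "(k \<odot> (s a \<otimes> (s b)\<^sup>\<star>) \<oplus> x) \<otimes> y = k \<odot> ((s a \<otimes> (s b)\<^sup>\<star>) \<otimes> y) \<oplus> x \<otimes> y"
    using step.hyps y by (simp add: mspan_carrier A.mult_l_distr A.smult_mult_l)
  ultimately show ?case using step by (simp add: mspan_add mspan_smult)
qed

text \<open>Insert the expansion of the unit at \<open>r(b)\<close> over the paths \<open>e\<close> of degree \<open>d(b) + d(c)\<close>: then \<open>s\<^sub>b\<^sup>* s\<^sub>e\<close> and \<open>s\<^sub>e\<^sup>* s\<^sub>c\<close> are \<open>0\<close> or come from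
  a path.\<close>

lemma gen_mult:
  assumes "a \<in> mor G" "b \<in> mor G" "src G a = src G b" "c \<in> mor G" "d \<in> mor G" "src G c = src G d"
  shows "(s a \<otimes> (s b)\<^sup>\<star>) \<otimes> (s c \<otimes> (s d)\<^sup>\<star>) \<in> mspan (\<lambda>u w. rng G u = rng G a \<and> rng G w = rng G d \<and>
     dd u w = (dd a b) + (dd c d))"
    (is "_ \<in> ?M")
proof -
  let ?v = "rng G b"
  have "(s a \<otimes> (s b)\<^sup>\<star>) \<otimes> s ?v \<otimes> (s c \<otimes> (s d)\<^sup>\<star>) \<in> ?M"
  proof (rule expand_mem[where n = "deg G b + deg G c"])
    fix e assume e: "e \<in> mor G" "rng G e = ?v" "deg G e = deg G b + deg G c"
    have be: "(s b)\<^sup>\<star> \<otimes> s e = (if ini (deg G b) e = b then s (fin (deg G b) e) else \<zero>)"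
      by (rule star_s_mult_ini) (use e assms in simp_all)
    have ec: "(s e)\<^sup>\<star> \<otimes> s c = (if ini (deg G c) e = c then (s (fin (deg G c) e))\<^sup>\<star> else \<zero>)"
      by (rule s_star_mult_ini) (use e assms in simp_all)
    have eq: "(s a \<otimes> (s b)\<^sup>\<star> \<otimes> s e) \<otimes> ((s e)\<^sup>\<star> \<otimes> (s c \<otimes> (s d)\<^sup>\<star>)) = (s a \<otimes> ((s b)\<^sup>\<star> \<otimes> s e)) \<otimes> (((s e)\<^sup>\<star> \<otimes> s c) \<otimes> (s d)\<^sup>\<star>)"
      using e assms by (simp add: A.mult_assoc)
    show "(s a \<otimes> (s b)\<^sup>\<star> \<otimes> s e) \<otimes> ((s e)\<^sup>\<star> \<otimes> (s c \<otimes> (s d)\<^sup>\<star>)) \<in> ?M"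
    proof (cases "ini (deg G b) e = b \<and> ini (deg G c) e = c")
      case False
      then show ?thesis unfolding eq be ec using e assms ini_fin[OF e(1), of "deg G b"] ini_fin[OF e(1), of "deg G c"] by (auto simp: mspan.zero)
    next
      case True
      have b': "fin (deg G b) e \<in> mor G" "b = ini (deg G b) e" "src G b = rng G (fin (deg G b) e)" "deg G (fin (deg G b) e) = deg G c" "src G (fin (deg G b) e) = src G e"
        using True ini_fin[OF e(1), of "deg G b"] e(3) by simp_all
      have c': "fin (deg G c) e \<in> mor G" "src G c = rng G (fin (deg G c) e)" "deg G (fin (deg G c) e) = deg G b" "src G (fin (deg G c) e) = src G e"
        using True ini_fin[OF e(1), of "deg G c"] e(3) by simp_all
      have "(s a \<otimes> s (fin (deg G b) e)) \<otimes> ((s (fin (deg G c) e))\<^sup>\<star> \<otimes> (s d)\<^sup>\<star>) = s (a \<cdot> fin (deg G b) e) \<otimes> (s (d \<cdot> fin (deg G c) e))\<^sup>\<star>"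
        using b' c' assms by (simp add: s_cmp star_s_cmp)
      moreover have "s (a \<cdot> fin (deg G b) e) \<otimes> (s (d \<cdot> fin (deg G c) e))\<^sup>\<star> \<in> ?M"
        by (rule mspan_gen) (use b'(1,3,4,5) c' assms in \<open>auto simp: zvec_diff_eq algebra_simps\<close>)
      ultimately show ?thesis unfolding eq be ec using True by simp
    qed
  qed (use assms in \<open>auto simp: mspan.zero mspan_add mspan_carrier\<close>)
  moreover have "(s a \<otimes> (s b)\<^sup>\<star>) \<otimes> s ?v = s a \<otimes> (s b)\<^sup>\<star>" using assms by (simp add: A.mult_assoc)
  ultimately show ?thesis by simp
qed

text \<open>By \<open>gen_mult\<close> the closure of the span is a C*-subalgebra, and it contains the generators.\<close>

lemma mspan_dense:
  assumes "x \<in> carrier A" "e > 0"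
  obtains y where "y \<in> mspan (\<lambda>a b. True)" "nrm A (x \<ominus> y) < e"
proof -
  let ?M = "mspan (\<lambda>a b. True)"
  have MM: "y \<otimes> y' \<in> ?M" if "y \<in> ?M" "y' \<in> ?M" for y y'
    by (rule mspan_mult[OF that]) (rule mspan_mono[OF gen_mult], auto)
  define S where "S = {x \<in> carrier A. \<forall>e>0. \<exists>y \<in> ?M. nrm A (x \<ominus> y) < e}"
  have S_iff: "x \<in> S \<longleftrightarrow> (\<exists>X. (\<forall>n. X n \<in> ?M) \<and> A.tends X x)" for x
  proof
    assume x: "x \<in> S"
    then have "\<exists>y \<in> ?M. nrm A (x \<ominus> y) < inverse (real (Suc n))" for n by (simp add: S_def)
    then obtain X where X: "\<And>n. X n \<in> ?M" "\<And>n. nrm A (x \<ominus> X n) < inverse (real (Suc n))" by metis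
    have "A.tends X x"
    proof (rule A.tendsI[OF _ _ _ LIMSEQ_inverse_real_of_nat])
      show "nrm A (X n \<ominus> x) \<le> inverse (real (Suc n))" for n
        using X[of n] A.N_diff_sym[of "X n" x] x by (simp add: S_def mspan_carrier less_imp_le)
    qed (use mspan_carrier[OF X(1)] x in \<open>auto simp: S_def\<close>)
    then show "\<exists>X. (\<forall>n. X n \<in> ?M) \<and> A.tends X x" using X by blast
  next
    assume "\<exists>X. (\<forall>n. X n \<in> ?M) \<and> A.tends X x"
    then obtain X where X: "\<And>n. X n \<in> ?M" "A.tends X x" by blast
    have "\<exists>y \<in> ?M. nrm A (x \<ominus> y) < e" if e: "e > 0" for e
    proof -
      obtain n where "norm (nrm A (X n \<ominus> x) - 0) < e" using LIMSEQ_D[OF A.tendsD(3)[OF X(2)] e] by blast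
      then have "nrm A (X n \<ominus> x) < e" by simp
      then show ?thesis using X(1)[of n] A.N_diff_sym[of "X n" x] A.tendsD[OF X(2)] by auto
    qed
    then show "x \<in> S" using A.tendsD[OF X(2)] by (simp add: S_def)
  qed
  have "S = carrier A"
  proof (rule generated)
    show "S \<subseteq> carrier A" by (auto simp: S_def)
    show "\<zero> \<in> S" unfolding S_iff using mspan.zero A.tends_const[of \<zero>] by (intro exI[of _ "\<lambda>n. \<zero>"]) simp
    fix x assume x: "x \<in> S"
    then obtain X where X: "\<And>n. X n \<in> ?M" "A.tends X x" unfolding S_iff by blast
    show "c \<odot> x \<in> S" for c
      unfolding S_iff by (intro exI[of _ "\<lambda>n. c \<odot> X n"] conjI allI mspan_smult X A.tends_smult)
    show "x\<^sup>\<star> \<in> S"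
      unfolding S_iff by (intro exI[of _ "\<lambda>n. (X n)\<^sup>\<star>"] conjI allI A.tends_star X mspan_star[OF X(1)])
    fix y assume "y \<in> S"
    then obtain Y where Y: "\<And>n. Y n \<in> ?M" "A.tends Y y" unfolding S_iff by blast
    show "x \<oplus> y \<in> S"
      unfolding S_iff by (intro exI[of _ "\<lambda>n. X n \<oplus> Y n"] conjI allI A.tends_add X Y mspan_add)
    show "x \<otimes> y \<in> S"
      unfolding S_iff by (intro exI[of _ "\<lambda>n. X n \<otimes> Y n"] conjI allI A.tends_mult X Y MM)
  next
    fix X l assume X: "\<And>n. X n \<in> S" "A.tends X l"
    have "\<exists>y \<in> ?M. nrm A (l \<ominus> y) < e" if "e > 0" for e
    proof -
      have "e / 2 > 0" using that by simp
      then obtain n where "norm (nrm A (X n \<ominus> l) - 0) < e / 2" using LIMSEQ_D[OF A.tendsD(3)[OF X(2)], of "e / 2"] by blast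
      then have n: "nrm A (X n \<ominus> l) < e / 2" by simp
      obtain y where y: "y \<in> ?M" "nrm A (X n \<ominus> y) < e / 2" using X(1)[of n] \<open>e / 2 > 0\<close> unfolding S_def by blast
      have "nrm A (l \<ominus> y) \<le> nrm A (l \<ominus> X n) + nrm A (X n \<ominus> y)"
        using A.N_diff_triangle[of l "X n" y] A.tendsD[OF X(2)] y mspan_carrier by blast
      then show ?thesis using n y A.N_diff_sym[of "X n" l] A.tendsD[OF X(2)] by (intro bexI[of _ y]) auto
    qed
    then show "l \<in> S" using A.tendsD[OF X(2)] by (simp add: S_def)
  next
    fix a assume a: "a \<in> mor G"
    have "s a \<otimes> (s (src G a))\<^sup>\<star> \<in> ?M" by (rule mspan_gen) (use a in auto)
    then have "s a \<in> ?M" using a s_vertex(1)[of "src G a"] by simp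
    then show "s a \<in> S" unfolding S_iff using A.tends_const[of "s a"] a by (intro exI[of _ "\<lambda>n. s a"]) simp
  qed
  then show ?thesis using that assms unfolding S_def by blast
qed

text \<open>Used for the difference of two seminorms and for a seminorm of a linear expression.\<close>

lemma le_0_by_density:
  fixes F :: "'a \<Rightarrow> real"
  assumes lip: "\<And>a b. a \<in> carrier A \<Longrightarrow> b \<in> carrier A \<Longrightarrow> F a \<le> F b + K * nrm A (a \<ominus> b)" and K: "0 < K"
    and span: "\<And>b. b \<in> mspan (\<lambda>a b. True) \<Longrightarrow> F b \<le> 0" and a: "a \<in> carrier A"
  shows "F a \<le> 0"
proof (rule field_le_epsilon)
  fix e :: real assume "e > 0"
  then have "e / K > 0" using K by simp
  from mspan_dense[OF a this] obtain b where b: "b \<in> mspan (\<lambda>a b. True)" "nrm A (a \<ominus> b) < e / K" .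
  have "K * nrm A (a \<ominus> b) \<le> e" using b(2) K by (simp add: pos_less_divide_eq mult.commute)
  then show "F a \<le> 0 + e" using lip[OF a mspan_carrier[OF b(1)]] span[OF b(1)] by simp
qed

end

section \<open>The graph of a maximal tail\<close>

context rf_k_graph
begin

lemma tail_graph_simps [simp]: "mor (tail_graph G T) = {a \<in> mor G. src G a \<in> T}" "src (tail_graph G T) = src G"
  "rng (tail_graph G T) = rng G" "cmp (tail_graph G T) = cmp G" "deg (tail_graph G T) = deg G"
  by (simp_all add: tail_graph_def)

lemma maximal_tailD:
  assumes "maximal_tail G T"
  shows "T \<noteq> {}" "v \<in> T \<Longrightarrow> v \<in> verts G"
    "v \<in> T \<Longrightarrow> w \<in> T \<Longrightarrow> \<exists>u \<in> T. connects G v u \<and> connects G w u"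
    "v \<in> T \<Longrightarrow> \<exists>a \<in> mor G. rng G a = v \<and> deg G a = axis i 1 \<and> src G a \<in> T"
    "a \<in> mor G \<Longrightarrow> src G a \<in> T \<Longrightarrow> rng G a \<in> T"
  using assms connectsI[of a G] unfolding maximal_tail_def by (blast, blast, blast, blast, meson rng_verts)

lemma verts_tail: "maximal_tail G T \<Longrightarrow> verts (tail_graph G T) = T"
  using maximal_tailD(2)[of T] vertsD by (fastforce simp: verts_def[of "tail_graph G T"])

lemma tail_paths:
  assumes T: "maximal_tail G T" and v: "v \<in> T"
  shows "\<exists>a \<in> mor G. rng G a = v \<and> deg G a = n \<and> src G a \<in> T"
  using v
proof (induction "\<Sum>i\<in>UNIV. n $ i" arbitrary: n v rule: less_induct)
  case less
  show ?case
  proof (cases "n = 0")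
    case True
    then show ?thesis using vertsD[OF maximal_tailD(2)[OF T less.prems]] less.prems by (intro bexI[of _ v]) auto
  next
    case False
    then obtain i where i: "n $ i \<noteq> 0" by (auto simp: vec_eq_iff)
    define n' where "n' = n - axis i 1"
    have n': "n = axis i 1 + n'" using i by (auto simp: n'_def vec_eq_iff axis_def)
    obtain e where e: "e \<in> mor G" "rng G e = v" "deg G e = axis i 1" "src G e \<in> T" using maximal_tailD(4)[OF T less.prems] by blast
    have "(\<Sum>j\<in>UNIV. n' $ j) < (\<Sum>j\<in>UNIV. n $ j)"
      by (intro sum_strict_mono_ex1) (use i in \<open>auto simp: n'_def axis_def intro!: exI[of _ i]\<close>)
    then obtain a where a: "a \<in> mor G" "rng G a = src G e" "deg G a = n'" "src G a \<in> T" using less.hyps e(4) by blast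
    then show ?thesis using e n' by (intro bexI[of _ "e \<cdot> a"]) auto
  qed
qed

lemma tail_directed:
  assumes T: "maximal_tail G T" shows "directed_k_graph (tail_graph G T)"
proof -
  note TD = maximal_tailD[OF T]
  have fac: "\<exists>!(b, c). b \<in> mor (tail_graph G T) \<and> c \<in> mor (tail_graph G T) \<and> src (tail_graph G T) b = rng (tail_graph G T) c \<and>
          deg (tail_graph G T) b = p \<and> deg (tail_graph G T) c = q \<and> a = cmp (tail_graph G T) b c"
    if a: "a \<in> mor (tail_graph G T)" "deg (tail_graph G T) a = p + q" for a p q
  proof -
    have a': "a \<in> mor G" "src G a \<in> T" "p \<le> deg G a" "deg G a = p + q" using a by simp_all
    note i = ini_fin[OF a'(1,3)]
    show ?thesis
    proof (rule ex1I[of _ "(ini p a, fin p a)"])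
      show "case (ini p a, fin p a) of (b, c) \<Rightarrow> b \<in> mor (tail_graph G T) \<and> c \<in> mor (tail_graph G T) \<and> src (tail_graph G T) b = rng (tail_graph G T) c \<and>
          deg (tail_graph G T) b = p \<and> deg (tail_graph G T) c = q \<and> a = cmp (tail_graph G T) b c"
        using i a' TD(5)[OF i(2)] by simp
      fix bc assume "case bc of (b, c) \<Rightarrow> b \<in> mor (tail_graph G T) \<and> c \<in> mor (tail_graph G T) \<and> src (tail_graph G T) b = rng (tail_graph G T) c \<and>
          deg (tail_graph G T) b = p \<and> deg (tail_graph G T) c = q \<and> a = cmp (tail_graph G T) b c"
      then show "bc = (ini p a, fin p a)" by (auto split: prod.splits)
    qed
  qed
  have k: "k_graph (tail_graph G T)"
  proof (unfold_locales)
    show "countable (mor (tail_graph G T))" using countable_mor by (rule countable_subset[rotated]) auto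
  qed (use fac TD(5) in \<open>auto simp: cmp_assoc\<close>)
  have rf: "row_finite_no_sources (tail_graph G T)"
    unfolding row_finite_no_sources_def verts_tail[OF T]
  proof (intro ballI allI conjI)
    fix v n assume v: "v \<in> T"
    show "{a \<in> mor (tail_graph G T). rng (tail_graph G T) a = v \<and> deg (tail_graph G T) a = n} \<noteq> {}"
      using tail_paths[OF T v, of n] by auto
    show "finite {a \<in> mor (tail_graph G T). rng (tail_graph G T) a = v \<and> deg (tail_graph G T) a = n}"
      by (rule finite_subset[OF _ finite_paths[OF TD(2)[OF v], of n]]) auto
  qed
  show ?thesis
    unfolding directed_k_graph_def rf_k_graph_def rf_k_graph_axioms_def directed_k_graph_axioms_def verts_tail[OF T]
  proof (intro conjI allI impI k rf TD(1))
    fix v w assume "v \<in> T" "w \<in> T"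
    then obtain u where "u \<in> T" "connects G v u" "connects G w u" using TD(3) by blast
    then obtain a b where "a \<in> mor G" "rng G a = v" "src G a = u" "b \<in> mor G" "rng G b = w" "src G b = u" "u \<in> T"
      unfolding connects_def by blast
    then show "\<exists>u. connects (tail_graph G T) v u \<and> connects (tail_graph G T) w u"
      unfolding connects_def by (intro exI[of _ u]) auto
  qed
qed

end

section \<open>C*-seminorms with prescribed vertices and periodicity\<close>

locale cseminorm = cstar_algebra A for A :: "'a cstar" (structure) +
  fixes p :: "'a \<Rightarrow> real"
  assumes sn: "cstar_seminorm p"
begin

lemma sn_simps:
  "x \<in> carrier A \<Longrightarrow> 0 \<le> p x" "x \<in> carrier A \<Longrightarrow> p x \<le> nrm A x" "x \<in> carrier A \<Longrightarrow> p (star A x \<otimes> x) = (p x)\<^sup>2"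
  "x \<in> carrier A \<Longrightarrow> p (c \<odot> x) = cmod c * p x"
  "\<lbrakk>x \<in> carrier A; y \<in> carrier A\<rbrakk> \<Longrightarrow> p (x \<oplus> y) \<le> p x + p y"
  "\<lbrakk>x \<in> carrier A; y \<in> carrier A\<rbrakk> \<Longrightarrow> p (x \<otimes> y) \<le> p x * p y"
  using sn unfolding cstar_seminorm_def by auto

lemma sn_zero [simp]: "p \<zero> = 0" using sn_simps(4)[of \<zero> 0] by simp

lemma sn_uminus: "x \<in> carrier A \<Longrightarrow> p (\<ominus> x) = p x"
  using sn_simps(4)[of x "-1"] smult_minus(1)[of x 1] by simp

lemma sn_le_diff: "\<lbrakk>x \<in> carrier A; y \<in> carrier A\<rbrakk> \<Longrightarrow> p x \<le> p y + p (x \<ominus> y)"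
proof -
  assume xy: "x \<in> carrier A" "y \<in> carrier A"
  have "y \<oplus> (x \<ominus> y) = x" using xy by (simp add: minus_eq a_lcomm[of y x "\<ominus> y"] r_neg)
  then show ?thesis using sn_simps(5)[of y "x \<ominus> y"] xy by simp
qed

lemma sn_diff_sym: "\<lbrakk>x \<in> carrier A; y \<in> carrier A\<rbrakk> \<Longrightarrow> p (x \<ominus> y) = p (y \<ominus> x)"
  using sn_uminus[of "x \<ominus> y"] uminus_diff by simp

lemma sn_eq_of_null: "\<lbrakk>x \<in> carrier A; y \<in> carrier A; p (x \<ominus> y) = 0\<rbrakk> \<Longrightarrow> p x = p y"
  using sn_le_diff[of x y] sn_le_diff[of y x] sn_diff_sym[of x y] by simp

lemma sn_star [simp]: assumes "x \<in> carrier A" shows "p (star A x) = p x"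
proof -
  have le: "p y \<le> p (star A y)" if "y \<in> carrier A" for y
  proof (cases "p y = 0")
    case False
    then have "p y > 0" using sn_simps(1)[OF that] by simp
    moreover have "p y * p y \<le> p (star A y) * p y"
      using sn_simps(3)[OF that] sn_simps(6)[of "star A y" y] that by (simp add: power2_eq_square)
    ultimately show ?thesis by simp
  qed (use sn_simps(1) that in simp)
  show ?thesis using le[OF assms] le[of "star A x"] assms by simp
qed

lemma sn_proj: assumes "is_proj e" shows "p e = 0 \<or> p e = 1" "p e \<le> 1"
proof -
  have "p e = (p e)\<^sup>2" using sn_simps(3)[of e] assms by (simp add: is_proj_def)
  then show "p e = 0 \<or> p e = 1" by (simp add: power2_eq_square)
  then show "p e \<le> 1" by auto
qed

lemma sn_mult_le: "\<lbrakk>x \<in> carrier A; y \<in> carrier A; p x \<le> 1\<rbrakk> \<Longrightarrow> p (x \<otimes> y) \<le> p y"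
    "\<lbrakk>x \<in> carrier A; y \<in> carrier A; p y \<le> 1\<rbrakk> \<Longrightarrow> p (x \<otimes> y) \<le> p x"
  using sn_simps(6)[of x y] mult_right_mono[of "p x" 1 "p y"] mult_left_mono[of "p y" 1 "p x"] sn_simps(1)[of x] sn_simps(1)[of y] by simp_all

lemma sn_finsum:
  assumes "finite F" "\<And>i. i \<in> F \<Longrightarrow> f i \<in> carrier A"
  shows "p (\<Oplus>i\<in>F. f i) \<le> (\<Sum>i\<in>F. p (f i))"
  using assms
proof induction
  case (insert j F)
  have "(\<Oplus>i\<in>insert j F. f i) = f j \<oplus> (\<Oplus>i\<in>F. f i)" by (rule finsum_insert) (use insert in auto)
  moreover have "(\<Oplus>i\<in>F. f i) \<in> carrier A" using insert by (intro finsum_closed) auto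
  ultimately show ?case using insert sn_simps(5)[of "f j" "\<Oplus>i\<in>F. f i"] by simp
qed simp

definition ker :: "'a set" where "ker = {x \<in> carrier A. p x = 0}"

lemma ker_carrier: "x \<in> ker \<Longrightarrow> x \<in> carrier A" by (simp add: ker_def)

lemma ker_simps:
  "\<zero> \<in> ker" "x \<in> ker \<Longrightarrow> y \<in> ker \<Longrightarrow> x \<oplus> y \<in> ker" "x \<in> ker \<Longrightarrow> c \<odot> x \<in> ker" "x \<in> ker \<Longrightarrow> y \<in> ker \<Longrightarrow> x \<ominus> y \<in> ker"
  "x \<in> ker \<Longrightarrow> y \<in> carrier A \<Longrightarrow> x \<otimes> y \<in> ker" "x \<in> ker \<Longrightarrow> y \<in> carrier A \<Longrightarrow> y \<otimes> x \<in> ker" "x \<in> ker \<Longrightarrow> star A x \<in> ker"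
proof -
  show "\<zero> \<in> ker" by (simp add: ker_def)
  assume x: "x \<in> ker"
  show "c \<odot> x \<in> ker" "star A x \<in> ker" using x by (simp_all add: ker_def sn_simps)
  show add: "x \<oplus> y \<in> ker" if "y \<in> ker" for y using x that sn_simps(5)[of x y] sn_simps(1)[of "x \<oplus> y"] by (simp add: ker_def)
  show "x \<ominus> y \<in> ker" if "y \<in> ker" using add[of "\<ominus> y"] that by (simp add: ker_def sn_uminus minus_eq)
  show "x \<otimes> y \<in> ker" "y \<otimes> x \<in> ker" if "y \<in> carrier A"
    using x that sn_simps(6)[of x y] sn_simps(6)[of y x] sn_simps(1)[of "x \<otimes> y"] sn_simps(1)[of "y \<otimes> x"] by (simp_all add: ker_def)
qed

end

locale tail_data = graph_cstar G A s
  for G :: "('l, 'k::finite) kgraph" and A :: "'a cstar" and s :: "'l \<Rightarrow> 'a" +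
  fixes T :: "'l set" and \<gamma> :: "int ^ 'k \<Rightarrow> complex"
  assumes mt: "maximal_tail G T" and char: "is_character (Per (tail_graph G T)) \<gamma>"
begin

abbreviation Sg where "Sg \<equiv> tail_graph G T"

sublocale S: directed_k_graph Sg by (rule tail_directed[OF mt])

lemmas TD = maximal_tailD[OF mt]

text \<open>The norms of quotients by ideals with vertex set \<open>T\<close> and character \<open>\<gamma>\<close>.\<close>

definition adapted :: "('a \<Rightarrow> real) \<Rightarrow> bool" where
  "adapted p \<longleftrightarrow> A.cstar_seminorm p \<and> (\<forall>v \<in> verts G. p (s v) = 0 \<longleftrightarrow> v \<notin> T) \<and>
     (\<forall>a b. per_equiv Sg a b \<longrightarrow> rng G a \<in> H_Per Sg \<longrightarrow> p (s a \<ominus> \<gamma> (dd a b) \<odot> s b) = 0)"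

lemma adapted_cseminorm: "adapted p \<Longrightarrow> cseminorm A p"
  unfolding adapted_def cseminorm_def cseminorm_axioms_def using A.cstar_algebra_axioms by blast

lemma adapted_vertex: assumes "adapted p" "v \<in> verts G" shows "p (s v) = (if v \<in> T then 1 else 0)"
proof -
  interpret p: cseminorm A p by (rule adapted_cseminorm[OF assms(1)])
  show ?thesis using p.sn_proj(1)[OF vertex_proj[OF assms(2)]] assms unfolding adapted_def by auto
qed

lemma adapted_s: assumes "adapted p" "a \<in> mor G" shows "p (s a) = (if src G a \<in> T then 1 else 0)"
proof -
  interpret p: cseminorm A p by (rule adapted_cseminorm[OF assms(1)])
  have "(p (s a))\<^sup>2 = p (s (src G a))" using p.sn_simps(3)[of "s a"] s_star_s[OF assms(2)] assms by simp
  then show ?thesis using adapted_vertex[OF assms(1), of "src G a"] p.sn_simps(1)[of "s a"] assms by (auto simp: power2_eq_1_iff split: if_splits)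
qed

text \<open>Computing modulo this ideal treats all adapted seminorms at once and spares the construction of quotients.\<close>

definition nul :: "'a set" where "nul = {x \<in> carrier A. \<forall>p. adapted p \<longrightarrow> p x = 0}"

lemma nulD: "x \<in> nul \<Longrightarrow> x \<in> carrier A" "x \<in> nul \<Longrightarrow> adapted p \<Longrightarrow> p x = 0"
  by (auto simp: nul_def)

lemma nul_simps:
  "\<zero> \<in> nul" "x \<in> nul \<Longrightarrow> y \<in> nul \<Longrightarrow> x \<oplus> y \<in> nul" "x \<in> nul \<Longrightarrow> c \<odot> x \<in> nul"
  "x \<in> nul \<Longrightarrow> y \<in> carrier A \<Longrightarrow> x \<otimes> y \<in> nul"
proof -
  have "nul = {x \<in> carrier A. \<forall>p. adapted p \<longrightarrow> x \<in> cseminorm.ker A p}"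
    using cseminorm.ker_def[OF adapted_cseminorm] by (auto simp: nul_def)
  then show "\<zero> \<in> nul" "x \<in> nul \<Longrightarrow> y \<in> nul \<Longrightarrow> x \<oplus> y \<in> nul" "x \<in> nul \<Longrightarrow> c \<odot> x \<in> nul"
    "x \<in> nul \<Longrightarrow> y \<in> carrier A \<Longrightarrow> x \<otimes> y \<in> nul"
    using cseminorm.ker_simps[OF adapted_cseminorm] by simp_all
qed

lemma s_nul: "a \<in> mor G \<Longrightarrow> src G a \<notin> T \<Longrightarrow> s a \<in> nul"
  using adapted_s[of _ a] by (auto simp: nul_def)

lemma per_equiv_nul:
  assumes "per_equiv Sg a b" "rng G a \<in> H_Per Sg" shows "s a \<ominus> \<gamma> (dd a b) \<odot> s b \<in> nul"
  using assms S.per_equivD[OF assms(1)] unfolding nul_def adapted_def by auto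

definition modn :: "'a set \<Rightarrow> 'a set" where "modn M = {x \<in> carrier A. \<exists>y \<in> M. x \<ominus> y \<in> nul}"

lemma modn_add: "x \<in> modn (mspan P) \<Longrightarrow> y \<in> modn (mspan P) \<Longrightarrow> x \<oplus> y \<in> modn (mspan P)"
proof -
  assume "x \<in> modn (mspan P)" "y \<in> modn (mspan P)"
  then obtain x' y' where *: "x \<in> carrier A" "y \<in> carrier A" "x' \<in> mspan P" "y' \<in> mspan P" "x \<ominus> x' \<in> nul" "y \<ominus> y' \<in> nul"
    unfolding modn_def by blast
  then have "(x \<oplus> y) \<ominus> (x' \<oplus> y') \<in> nul" using nul_simps(2)[of "x \<ominus> x'" "y \<ominus> y'"] by (simp add: A.add_diff_add mspan_carrier)
  then show ?thesis using * mspan_add[of x' P y'] unfolding modn_def by blast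
qed

lemma modn_smult: "x \<in> modn (mspan P) \<Longrightarrow> c \<odot> x \<in> modn (mspan P)"
proof -
  assume "x \<in> modn (mspan P)"
  then obtain x' where *: "x \<in> carrier A" "x' \<in> mspan P" "x \<ominus> x' \<in> nul" unfolding modn_def by blast
  then have "c \<odot> x \<ominus> c \<odot> x' \<in> nul" using nul_simps(3)[of "x \<ominus> x'" c] by (simp add: A.smult_diff mspan_carrier)
  then show ?thesis using * mspan_smult[of x' P c] unfolding modn_def by auto
qed

lemma modn_nul: "x \<in> nul \<Longrightarrow> x \<in> modn (mspan P)"
proof -
  assume x: "x \<in> nul"
  have "x \<ominus> \<zero> = x" using nulD(1)[OF x] by (rule A.diff_0)
  then show ?thesis unfolding modn_def using x mspan.zero[of P] nulD(1)[OF x] by (auto intro!: bexI[of _ \<zero>])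
qed

lemma modn_in: "x \<in> mspan P \<Longrightarrow> x \<in> modn (mspan P)"
  unfolding modn_def using mspan_carrier[of x P] nul_simps(1) by (auto simp: A.minus_eq A.r_neg intro!: bexI[of _ x])

lemma modn_carrier: "modn M \<subseteq> carrier A" by (auto simp: modn_def)

lemma modn_trans: assumes "x \<in> carrier A" "y \<in> modn (mspan P)" "x \<ominus> y \<in> nul" shows "x \<in> modn (mspan P)"
proof -
  have "x = (x \<ominus> y) \<oplus> y" using assms modn_carrier by (auto simp: A.minus_eq A.a_assoc A.l_neg modn_def)
  then show ?thesis using modn_add[OF modn_nul[OF assms(3)] assms(2)] by simp
qed

text \<open>The element is the sum of the \<open>s\<^bsub>ae\<^esub> s\<^bsub>be\<^esub>\<^sup>*\<close> over the paths \<open>e\<close> of degree \<open>n\<close> with range \<open>s(a)\<close>.\<close>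

lemma gen_extend:
  assumes "a \<in> mor G" "b \<in> mor G" "src G a = src G b"
    and S: "\<zero> \<in> S" "\<And>x y. x \<in> S \<Longrightarrow> y \<in> S \<Longrightarrow> x \<oplus> y \<in> S" "S \<subseteq> carrier A"
    and e: "\<And>e. e \<in> mor G \<Longrightarrow> rng G e = src G a \<Longrightarrow> deg G e = n \<Longrightarrow> s (a \<cdot> e) \<otimes> (s (b \<cdot> e))\<^sup>\<star> \<in> S"
  shows "s a \<otimes> (s b)\<^sup>\<star> \<in> S"
proof -
  have "s a \<otimes> s (src G a) \<otimes> (s b)\<^sup>\<star> \<in> S"
  proof (rule expand_mem[where n = n])
    fix c assume c: "c \<in> mor G" "rng G c = src G a" "deg G c = n"
    then show "(s a \<otimes> s c) \<otimes> ((s c)\<^sup>\<star> \<otimes> (s b)\<^sup>\<star>) \<in> S" using e[OF c] assms by (simp add: s_cmp star_s_cmp)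
  qed (use assms in auto)
  then show ?thesis using s_src[OF assms(1)] by simp
qed

end

locale tail_vertex = tail_data G A s T \<gamma>
  for G :: "('l, 'k::finite) kgraph" and A :: "'a cstar" and s T \<gamma> +
  fixes v :: 'l
  assumes vH: "v \<in> H_Per (tail_graph G T)"
begin

abbreviation PerS where "PerS \<equiv> Per Sg"

abbreviation corner :: "(int ^ 'k \<Rightarrow> bool) \<Rightarrow> 'a set" where
  "corner R \<equiv> mspan (\<lambda>a b. rng G a = v \<and> rng G b = v \<and> R (dd a b))"

definition V :: "nat ^ 'k \<Rightarrow> 'l set" where "V m = {a \<in> mor Sg. rng G a = v \<and> deg G a = m}"

abbreviation half :: "(int ^ 'k \<Rightarrow> bool) \<Rightarrow> nat ^ 'k \<Rightarrow> 'a set" where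
  "half R m \<equiv> mspan (\<lambda>a b. a \<in> mor Sg \<and> rng G a = v \<and> b \<in> V m \<and> R (dd a b))"

text \<open>A direct sum of matrix algebras, one for each vertex \<open>w\<close>, with the matrix units \<open>s\<^sub>a s\<^sub>b\<^sup>*\<close>, \<open>s(a) = s(b) = w\<close>.\<close>

abbreviation Fm :: "nat ^ 'k \<Rightarrow> 'a set" where "Fm m \<equiv> mspan (\<lambda>a b. a \<in> V m \<and> b \<in> V m)"

lemma vT: "v \<in> T" "v \<in> verts G" "v \<in> mor G"
proof -
  show 1: "v \<in> T" using S.H_Per_verts[OF vH] verts_tail[OF mt] by simp
  then show 2: "v \<in> verts G" using TD(2) by blast
  then show "v \<in> mor G" using vertsD by blast
qed

lemma V_D: "a \<in> V m \<Longrightarrow> a \<in> mor G" "a \<in> V m \<Longrightarrow> rng G a = v" "a \<in> V m \<Longrightarrow> deg G a = m" "a \<in> V m \<Longrightarrow> src G a \<in> T"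
  by (auto simp: V_def)

lemma V_finite: "finite (V m)"
  by (rule finite_subset[OF _ finite_paths[OF vT(2), of m]]) (auto simp: V_def)

text \<open>Extend \<open>a\<close> and \<open>b\<close> by all \<open>e\<close> with \<open>d(be) = m\<close>; the terms with \<open>s(e) \<notin> T\<close> are null.\<close>

lemma normalise_right:
  assumes "x \<in> corner R"
  shows "\<exists>m0. \<forall>m\<ge>m0. x \<in> modn (half R m)"
  using assms
proof (induction rule: mspan.induct)
  case zero show ?case using modn_in[OF mspan.zero] by blast
next
  case (step x a b c)
  then obtain m0 where m0: "\<And>m. m \<ge> m0 \<Longrightarrow> x \<in> modn (half R m)" by blast
  show ?case
  proof (intro exI[of _ "m0 + deg G b"] allI impI)
    fix m assume m: "m0 + deg G b \<le> m"
    have m1: "m \<ge> m0" using m vec_le_add(1) order_trans by blast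
    have m2: "m \<ge> deg G b" using m vec_le_add(2) order_trans by blast
    let ?M = "modn (half R m)"
    have "s a \<otimes> (s b)\<^sup>\<star> \<in> ?M"
    proof (rule gen_extend[OF step.hyps(2,3,4), where n = "m - deg G b"])
      fix e assume e: "e \<in> mor G" "rng G e = src G a" "deg G e = m - deg G b"
      show "s (a \<cdot> e) \<otimes> (s (b \<cdot> e))\<^sup>\<star> \<in> ?M"
      proof (cases "src G e \<in> T")
        case True
        have "R (dd (a \<cdot> e) (b \<cdot> e))" using step.hyps e by simp
        then show ?thesis
          using step.hyps e True m2 by (intro modn_in mspan_gen) (auto simp: V_def)
      next
        case False
        then have "s (a \<cdot> e) \<in> nul" using s_nul[of "a \<cdot> e"] step.hyps e by simp
        then show ?thesis using step.hyps e by (intro modn_nul nul_simps(4)) auto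
      qed
    qed (use modn_add modn_in[OF mspan.zero] modn_carrier in auto)
    then show "c \<odot> (s a \<otimes> (s b)\<^sup>\<star>) \<oplus> x \<in> ?M" using m0[OF m1] by (intro modn_add modn_smult)
  qed
qed

text \<open>As \<open>v\<close> lies in \<open>H\<^bsub>Per\<^esub>\<close>, the first path is equivalent to one of degree \<open>m\<close>, which may take its place up to a scalar.\<close>

lemma normalise_core:
  assumes "x \<in> corner (\<lambda>g. g \<in> PerS)"
  shows "\<exists>m0. \<forall>m\<ge>m0. x \<in> modn (Fm m)"
proof -
  obtain m0 where m0: "\<And>m. m \<ge> m0 \<Longrightarrow> x \<in> modn (half (\<lambda>g. g \<in> PerS) m)"
    using normalise_right[OF assms] by blast
  have "x \<in> modn (Fm m)" if m: "m \<ge> m0" for m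
  proof -
    have *: "y \<in> modn (Fm m)" if "y \<in> half (\<lambda>g. g \<in> PerS) m" for y
      using that
    proof (induction rule: mspan.induct)
      case zero show ?case using modn_in[OF mspan.zero] .
    next
      case (step y a b c)
      then have a: "a \<in> mor Sg" "rng Sg a = v" "zvec (deg Sg a) - zvec m \<in> PerS" by (auto simp: V_def)
      obtain a' where a': "a' \<in> mor Sg" "rng Sg a' = v" "deg Sg a' = m" "per_equiv Sg a a'" using S.H_Per_D[OF vH a] .
      define g where "g = \<gamma> (dd a a')"
      have an: "s a \<ominus> g \<odot> s a' \<in> nul" unfolding g_def by (rule per_equiv_nul[OF a'(4)]) (use a vH in simp)
      have ac: "s a \<in> carrier A" "s a' \<in> carrier A" "(s b)\<^sup>\<star> \<in> carrier A" using step.hyps a' by auto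
      have "s a' \<otimes> (s b)\<^sup>\<star> \<in> modn (Fm m)"
        using a' step.hyps S.per_equivD(3)[OF a'(4)] by (intro modn_in mspan_gen) (auto simp: V_def)
      then have 1: "g \<odot> (s a' \<otimes> (s b)\<^sup>\<star>) \<in> modn (Fm m)" by (rule modn_smult)
      have "s a \<otimes> (s b)\<^sup>\<star> \<ominus> g \<odot> (s a' \<otimes> (s b)\<^sup>\<star>) = (s a \<ominus> g \<odot> s a') \<otimes> (s b)\<^sup>\<star>"
        using ac by (simp add: A.mult_diff A.smult_mult_l)
      then have "s a \<otimes> (s b)\<^sup>\<star> \<ominus> g \<odot> (s a' \<otimes> (s b)\<^sup>\<star>) \<in> nul" using nul_simps(4)[OF an ac(3)] by simp
      then have "s a \<otimes> (s b)\<^sup>\<star> \<in> modn (Fm m)" using ac by (intro modn_trans[OF _ 1]) simp_all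
      then show ?case using step.IH by (intro modn_add modn_smult)
    qed
    obtain y where y: "x \<in> carrier A" "y \<in> half (\<lambda>g. g \<in> PerS) m" "x \<ominus> y \<in> nul"
      using m0[OF m] unfolding modn_def by blast
    show ?thesis using modn_trans[OF y(1) *[OF y(2)] y(3)] .
  qed
  then show ?thesis by blast
qed

subsection \<open>Matrix algebras\<close>

lemma Fm_corner: "x \<in> Fm m \<Longrightarrow> x \<in> carrier A \<and> s v \<otimes> x = x \<and> x \<otimes> s v = x"
proof (induction rule: mspan.induct)
  case zero then show ?case using vT by simp
next
  case (step x a b c)
  have "s v \<otimes> (s a \<otimes> (s b)\<^sup>\<star>) = s a \<otimes> (s b)\<^sup>\<star>" "(s a \<otimes> (s b)\<^sup>\<star>) \<otimes> s v = s a \<otimes> (s b)\<^sup>\<star>"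
    using step.hyps(2-5) s_rng[of a] st_rng[of b] V_D(2)[of a m] V_D(2)[of b m] vT(3) A.mult_assoc[of "s v" "s a" "(s b)\<^sup>\<star>"]
    by (auto simp: A.mult_assoc[of "s a"])
  then show ?case using step vT(2,3) by (simp add: A.mult_r_distr A.mult_l_distr A.smult_mult_l A.smult_mult_r)
qed

lemma Fm_star_mult: assumes "x \<in> Fm m" shows "x\<^sup>\<star> \<otimes> x \<in> Fm m"
proof (rule mspan_mult[OF mspan_star[OF assms] assms])
  fix a b c d assume *: "a \<in> mor G" "b \<in> mor G" "src G a = src G b" "a \<in> V m \<and> b \<in> V m"
    "c \<in> mor G" "d \<in> mor G" "src G c = src G d" "c \<in> V m \<and> d \<in> V m"
  have "(s a \<otimes> (s b)\<^sup>\<star>) \<otimes> (s c \<otimes> (s d)\<^sup>\<star>) = s a \<otimes> (((s b)\<^sup>\<star> \<otimes> s c) \<otimes> (s d)\<^sup>\<star>)" using * by (simp add: A.mult_assoc)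
  also have "\<dots> = (if b = c then s a \<otimes> (s d)\<^sup>\<star> else \<zero>)"
    using * s_star_s_orth[of b c] V_D(3) by (auto simp: s_star_s)
  finally show "(s a \<otimes> (s b)\<^sup>\<star>) \<otimes> (s c \<otimes> (s d)\<^sup>\<star>) \<in> Fm m"
    using * mspan_gen[of a d "\<lambda>a b. a \<in> V m \<and> b \<in> V m"] mspan.zero by auto
qed auto

text \<open>The number \<open>\<beta>\<close> is the matrix entry at \<open>(c, d)\<close>.\<close>

lemma Fm_coeff:
  assumes "x \<in> Fm m" "c \<in> mor G" "d \<in> mor G" "deg G c = m" "deg G d = m"
  shows "\<exists>\<beta>. (s c)\<^sup>\<star> \<otimes> x \<otimes> s d = \<beta> \<odot> s (src G c) \<and> (\<beta> \<noteq> 0 \<longrightarrow> c \<in> V m \<and> d \<in> V m \<and> src G c = src G d)"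
  using assms(1)
proof (induction rule: mspan.induct)
  case zero show ?case using assms by (intro exI[of _ 0]) simp
next
  case (step x a b k)
  then obtain \<beta> where b: "(s c)\<^sup>\<star> \<otimes> x \<otimes> s d = \<beta> \<odot> s (src G c)" "\<beta> \<noteq> 0 \<longrightarrow> c \<in> V m \<and> d \<in> V m \<and> src G c = src G d" by blast
  have x: "x \<in> carrier A" using mspan_carrier step.hyps(1) .
  have "(s c)\<^sup>\<star> \<otimes> (s a \<otimes> (s b)\<^sup>\<star>) \<otimes> s d = ((s c)\<^sup>\<star> \<otimes> s a) \<otimes> ((s b)\<^sup>\<star> \<otimes> s d)"
    using step.hyps assms by (simp add: A.mult_assoc)
  also have "\<dots> = (if c = a \<and> d = b then s (src G c) else \<zero>)"
  proof (cases "c = a \<and> d = b")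
    case True
    then show ?thesis using step.hyps s_star_s[of a] s_star_s[of b] s_vertex(2)[of "src G a"] by simp
  next
    case False
    have "deg G a = m" "deg G b = m" using step.hyps(5) V_D(3) by blast+
    then have "(s c)\<^sup>\<star> \<otimes> s a = \<zero> \<or> (s b)\<^sup>\<star> \<otimes> s d = \<zero>"
      using s_star_s_orth[of c a] s_star_s_orth[of b d] False step.hyps(2,3) assms by metis
    moreover have "(s c)\<^sup>\<star> \<otimes> s a \<in> carrier A" "(s b)\<^sup>\<star> \<otimes> s d \<in> carrier A" using step.hyps assms by simp_all
    ultimately show ?thesis unfolding if_not_P[OF False] by auto
  qed
  finally have g: "(s c)\<^sup>\<star> \<otimes> (s a \<otimes> (s b)\<^sup>\<star>) \<otimes> s d = (if c = a \<and> d = b then s (src G c) else \<zero>)" .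
  have "(s c)\<^sup>\<star> \<otimes> (k \<odot> (s a \<otimes> (s b)\<^sup>\<star>) \<oplus> x) \<otimes> s d = k \<odot> ((s c)\<^sup>\<star> \<otimes> (s a \<otimes> (s b)\<^sup>\<star>) \<otimes> s d) \<oplus> (s c)\<^sup>\<star> \<otimes> x \<otimes> s d"
    using step.hyps assms x by (simp add: A.mult_r_distr A.mult_l_distr A.smult_mult_l A.smult_mult_r)
  also have "\<dots> = ((if c = a \<and> d = b then k else 0) + \<beta>) \<odot> s (src G c)"
    unfolding g b(1) using assms by (simp add: A.smult_simps(1))
  finally show ?case using b(2) step.hyps by (intro exI[of _ "(if c = a \<and> d = b then k else 0) + \<beta>"]) auto
qed

lemma Fm_entry_bound:
  assumes p: "adapted p" and x: "x \<in> Fm m" and K: "0 \<le> K"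
    and entry: "\<And>c d \<beta>. c \<in> V m \<Longrightarrow> d \<in> V m \<Longrightarrow> src G c = src G d \<Longrightarrow> (s c)\<^sup>\<star> \<otimes> x \<otimes> s d = \<beta> \<odot> s (src G c) \<Longrightarrow> cmod \<beta> \<le> K"
  shows "p x \<le> (real (card {e \<in> mor G. rng G e = v \<and> deg G e = m}))\<^sup>2 * K"
proof -
  interpret p: cseminorm A p by (rule adapted_cseminorm[OF p])
  let ?E = "{e \<in> mor G. rng G e = v \<and> deg G e = m}"
  have fin: "finite ?E" using finite_paths vT by blast
  note xc = Fm_corner[OF x]
  have ps: "p (s a) \<le> 1" if "a \<in> mor G" for a using adapted_s[OF p that] by simp
  have ent: "p ((s c)\<^sup>\<star> \<otimes> x \<otimes> s d) \<le> K" if cd: "c \<in> ?E" "d \<in> ?E" for c d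
  proof -
    obtain \<beta> where b: "(s c)\<^sup>\<star> \<otimes> x \<otimes> s d = \<beta> \<odot> s (src G c)" "\<beta> \<noteq> 0 \<longrightarrow> c \<in> V m \<and> d \<in> V m \<and> src G c = src G d"
      using Fm_coeff[OF x, of c d] cd by auto
    have "cmod \<beta> \<le> K" using entry[of c d \<beta>] b K by (cases "\<beta> = 0") auto
    then show ?thesis unfolding b(1) using p.sn_simps(4)[of "s (src G c)" \<beta>] ps[of "src G c"] p.sn_simps(1)[of "s (src G c)"] cd
        mult_left_mono[of "p (s (src G c))" 1 "cmod \<beta>"] by simp
  qed
  have row: "p ((s c)\<^sup>\<star> \<otimes> x) \<le> real (card ?E) * K" if c: "c \<in> ?E" for c
  proof -
    have cx: "(s c)\<^sup>\<star> \<otimes> x \<in> carrier A" "(s c)\<^sup>\<star> \<otimes> x \<otimes> s v \<otimes> s v = (s c)\<^sup>\<star> \<otimes> x" using c xc vT by (simp_all add: A.mult_assoc)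
    have "p ((s c)\<^sup>\<star> \<otimes> x \<otimes> s v \<otimes> s v) \<le> (\<Sum>d\<in>?E. p (((s c)\<^sup>\<star> \<otimes> x \<otimes> s d) \<otimes> ((s d)\<^sup>\<star> \<otimes> s v)))"
      unfolding expand_vertex[OF vT(2) cx(1) s_closed[OF vT(3)], of m] by (rule p.sn_finsum[OF fin]) (use c xc vT in auto)
    also have "\<dots> \<le> (\<Sum>d\<in>?E. K)"
    proof (rule sum_mono)
      fix d assume d: "d \<in> ?E"
      have "p (((s c)\<^sup>\<star> \<otimes> x \<otimes> s d) \<otimes> ((s d)\<^sup>\<star> \<otimes> s v)) \<le> p ((s c)\<^sup>\<star> \<otimes> x \<otimes> s d)"
        by (rule p.sn_mult_le) (use c d xc vT st_rng[of d] ps[of d] in auto)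
      then show "p (((s c)\<^sup>\<star> \<otimes> x \<otimes> s d) \<otimes> ((s d)\<^sup>\<star> \<otimes> s v)) \<le> K" using ent[OF c d] by simp
    qed
    finally show ?thesis using cx(2) by simp
  qed
  have "p (s v \<otimes> s v \<otimes> x) \<le> (\<Sum>c\<in>?E. p ((s v \<otimes> s c) \<otimes> ((s c)\<^sup>\<star> \<otimes> x)))"
    unfolding expand_vertex[OF vT(2) s_closed[OF vT(3)] conjunct1[OF xc], of m] by (rule p.sn_finsum[OF fin]) (use xc vT in auto)
  also have "\<dots> \<le> (\<Sum>c\<in>?E. real (card ?E) * K)"
  proof (rule sum_mono)
    fix c assume c: "c \<in> ?E"
    have "p ((s v \<otimes> s c) \<otimes> ((s c)\<^sup>\<star> \<otimes> x)) \<le> p ((s c)\<^sup>\<star> \<otimes> x)"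
      by (rule p.sn_mult_le) (use c xc vT s_rng[of c] ps[of c] in auto)
    then show "p ((s v \<otimes> s c) \<otimes> ((s c)\<^sup>\<star> \<otimes> x)) \<le> real (card ?E) * K" using row[OF c] by simp
  qed
  finally show ?thesis using xc vT s_vertex(2)[OF vT(2)] by (simp add: power2_eq_square)
qed

text \<open>Entries bound the norm of a matrix up to a factor depending on the size only, which the power trick removes.\<close>

lemma Fm_le_of_entries:
  assumes p: "adapted p" and x: "x \<in> Fm m"
    and q: "\<And>y. y \<in> carrier A \<Longrightarrow> 0 \<le> q y" "\<And>y. y \<in> Fm m \<Longrightarrow> q (y\<^sup>\<star> \<otimes> y) = (q y)\<^sup>2"
    and entry: "\<And>y c d \<beta>. y \<in> Fm m \<Longrightarrow> c \<in> V m \<Longrightarrow> d \<in> V m \<Longrightarrow> src G c = src G d \<Longrightarrow> (s c)\<^sup>\<star> \<otimes> y \<otimes> s d = \<beta> \<odot> s (src G c) \<Longrightarrow> cmod \<beta> \<le> q y"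
  shows "p x \<le> q x"
proof (rule A.seminorm_le_of_power_bounds[where S = "Fm m" and k = 0])
  interpret p: cseminorm A p by (rule adapted_cseminorm[OF p])
  have xc: "x \<in> carrier A" using mspan_carrier[OF x] .
  show "p (y\<^sup>\<star> \<otimes> y) = (p y)\<^sup>2" if "y \<in> carrier A" for y using p.sn_simps(3) that .
  fix n
  have y: "A.hpow n x \<in> Fm m" using A.hpow_value(1)[of "Fm m" p x n] p.sn_simps(3) Fm_star_mult xc x by auto
  show "p (A.hpow n x) \<le> (real (card {e \<in> mor G. rng G e = v \<and> deg G e = m}))\<^sup>2 * (2 ^ n) ^ 0 * q (A.hpow n x)"
    using Fm_entry_bound[OF p y q(1)[OF mspan_carrier[OF y]] entry[OF y]] by simp
qed (use q x mspan_carrier[OF x] Fm_star_mult adapted_cseminorm[OF p, THEN cseminorm.sn_simps(1)] in auto)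

lemma Fm_le:
  assumes p: "adapted p" and q: "adapted q" and x: "x \<in> Fm m"
  shows "p x \<le> q x"
proof (rule Fm_le_of_entries[OF p x])
  interpret q: cseminorm A q by (rule adapted_cseminorm[OF q])
  show "0 \<le> q y" if "y \<in> carrier A" for y using q.sn_simps(1)[OF that] .
  fix y assume "y \<in> Fm m"
  then have yc: "y \<in> carrier A" by (rule mspan_carrier)
  then show "q (y\<^sup>\<star> \<otimes> y) = (q y)\<^sup>2" by (rule q.sn_simps(3))
  fix c d \<beta> assume cd: "c \<in> V m" "d \<in> V m" "src G c = src G d" "(s c)\<^sup>\<star> \<otimes> y \<otimes> s d = \<beta> \<odot> s (src G c)"
  have c: "c \<in> mor G" "src G c \<in> T" and d: "d \<in> mor G" using cd V_D by auto
  have "cmod \<beta> = q ((s c)\<^sup>\<star> \<otimes> y \<otimes> s d)" unfolding cd(4) using c adapted_vertex[OF q, of "src G c"] by (simp add: q.sn_simps(4))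
  also have "\<dots> \<le> q ((s c)\<^sup>\<star> \<otimes> y)" by (rule q.sn_mult_le(2)) (use c d yc adapted_s[OF q] in auto)
  also have "\<dots> \<le> q y" by (rule q.sn_mult_le(1)) (use c d yc adapted_s[OF q] in auto)
  finally show "cmod \<beta> \<le> q y" .
qed

lemma core_eq:
  assumes p: "adapted p" and q: "adapted q" and x: "x \<in> corner (\<lambda>g. g \<in> PerS)"
  shows "p x = q x"
proof -
  interpret p: cseminorm A p by (rule adapted_cseminorm[OF p])
  interpret q: cseminorm A q by (rule adapted_cseminorm[OF q])
  obtain m where "x \<in> modn (Fm m)" using normalise_core[OF x] by blast
  then obtain y where y: "x \<in> carrier A" "y \<in> Fm m" "x \<ominus> y \<in> nul" unfolding modn_def by blast
  have "p x = p y" "q x = q y" using p.sn_eq_of_null[OF y(1) mspan_carrier[OF y(2)]] q.sn_eq_of_null[OF y(1) mspan_carrier[OF y(2)]] nulD(2)[OF y(3)] p q by auto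
  then show ?thesis using Fm_le[OF p q y(2)] Fm_le[OF q p y(2)] by simp
qed

end

section \<open>Splitting off the terms of other degrees\<close>

context tail_data
begin

text \<open>A pair with degree difference outside the periodicity group is not equivalent, so some infinite path separates it;
  a long enough initial segment of that path does so as well, and keeps doing so when extended.\<close>

lemma separate:
  assumes "finite Z" "w \<in> T"
    and "\<And>a b. (a, b) \<in> Z \<Longrightarrow> a \<in> mor G \<and> b \<in> mor G \<and> src G a = w \<and> src G b = w \<and> dd a b \<notin> Per Sg"
  shows "\<exists>l \<in> mor G. rng G l = w \<and> src G l \<in> T \<and> (\<forall>(a, b) \<in> Z. (s (a \<cdot> l))\<^sup>\<star> \<otimes> s (b \<cdot> l) = \<zero>)"
  using assms(1,3)
proof induction
  case empty
  then show ?case using vertsD[OF TD(2)[OF assms(2)]] assms(2) by (intro bexI[of _ w]) auto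
next
  case (insert ab Z)
  obtain a b where ab: "ab = (a, b)" by force
  obtain l where l: "l \<in> mor G" "rng G l = w" "src G l \<in> T" "\<forall>(a, b) \<in> Z. (s (a \<cdot> l))\<^sup>\<star> \<otimes> s (b \<cdot> l) = \<zero>"
    using insert by (metis insertI2)
  have a: "a \<in> mor G" "b \<in> mor G" "src G a = w" "src G b = w" "dd a b \<notin> Per Sg"
    using insert.prems[of a b] ab by auto
  have al: "a \<cdot> l \<in> mor Sg" "b \<cdot> l \<in> mor Sg" "src G (a \<cdot> l) = src G l" "src G (b \<cdot> l) = src G l" using a l by auto
  have "\<not> per_equiv Sg (a \<cdot> l) (b \<cdot> l)"
  proof
    assume "per_equiv Sg (a \<cdot> l) (b \<cdot> l)"
    then have "zvec (deg Sg (a \<cdot> l)) - zvec (deg Sg (b \<cdot> l)) \<in> Per Sg" unfolding Per_def by blast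
    then show False using a l by simp
  qed
  then obtain y where y: "y \<in> inf_paths Sg" "y (0, 0) = src G l" "prepend Sg (a \<cdot> l) y \<noteq> prepend Sg (b \<cdot> l) y"
    using al unfolding per_equiv_def by auto
  have ya: "y (0, 0) = src Sg (a \<cdot> l)" "y (0, 0) = src Sg (b \<cdot> l)" using y(2) al by simp_all
  note pa = S.prepend[OF al(1) y(1) ya(1)] and pb = S.prepend[OF al(2) y(1) ya(2)]
  obtain n where n: "\<And>N. N \<ge> n \<Longrightarrow> prepend Sg (a \<cdot> l) y (0, N) \<noteq> prepend Sg (b \<cdot> l) y (0, N)"
    using S.inf_path_ext[OF pa(1) pb(1)] y(3) by blast
  define t where "t = y (0, n)"
  have t: "t \<in> mor G" "rng G t = src G l" "src G t \<in> T" "deg G t = n"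
    using S.inf_pathD[OF y(1), of 0 n] y(2) by (simp_all add: t_def)
  have e: "prepend Sg (a \<cdot> l) y (0, n + deg G (a \<cdot> l)) = a \<cdot> (l \<cdot> t)" "prepend Sg (b \<cdot> l) y (0, n + deg G (b \<cdot> l)) = b \<cdot> (l \<cdot> t)"
    using pa(5)[of n] pb(5)[of n] a l t by (simp_all add: t_def cmp_assoc)
  have "ini n (a \<cdot> (l \<cdot> t)) = prepend Sg (a \<cdot> l) y (0, n)"
    unfolding e(1)[symmetric] using inf_path_ini S.inf_path_cmp[OF pa(1), of 0 n "n + deg G (a \<cdot> l)"] S.inf_pathD[OF pa(1), of 0 n] S.inf_pathD[OF pa(1), of n "n + deg G (a \<cdot> l)"]
    by (intro ini_eqI(1)[of _ "prepend Sg (a \<cdot> l) y (n, n + deg G (a \<cdot> l))"]) auto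
  moreover have "ini n (b \<cdot> (l \<cdot> t)) = prepend Sg (b \<cdot> l) y (0, n)"
    unfolding e(2)[symmetric] using inf_path_ini S.inf_path_cmp[OF pb(1), of 0 n "n + deg G (b \<cdot> l)"] S.inf_pathD[OF pb(1), of 0 n] S.inf_pathD[OF pb(1), of n "n + deg G (b \<cdot> l)"]
    by (intro ini_eqI(1)[of _ "prepend Sg (b \<cdot> l) y (n, n + deg G (b \<cdot> l))"]) auto
  ultimately have ne: "ini n (a \<cdot> (l \<cdot> t)) \<noteq> ini n (b \<cdot> (l \<cdot> t))" using n[of n] by simp
  have new: "(s (a \<cdot> (l \<cdot> t)))\<^sup>\<star> \<otimes> s (b \<cdot> (l \<cdot> t)) = \<zero>"
  proof (rule no_common_extension[OF _ _ _ _ ne])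
    have "n \<le> deg G a + (deg G l + n)" "n \<le> deg G b + (deg G l + n)" using vec_le_add(2) add.assoc by metis+
    then show "n \<le> deg G (a \<cdot> (l \<cdot> t))" "n \<le> deg G (b \<cdot> (l \<cdot> t))" using a l t by simp_all
  qed (use a l t in auto)
  have old: "(s (c \<cdot> (l \<cdot> t)))\<^sup>\<star> \<otimes> s (d \<cdot> (l \<cdot> t)) = \<zero>" if cd: "(c, d) \<in> Z" for c d
  proof -
    have c: "c \<in> mor G" "d \<in> mor G" "src G c = w" "src G d = w" using insert.prems[of c d] cd by auto
    have z: "(s (c \<cdot> l))\<^sup>\<star> \<otimes> s (d \<cdot> l) = \<zero>" using l(4) cd by blast
    have "(s (c \<cdot> (l \<cdot> t)))\<^sup>\<star> \<otimes> s (d \<cdot> (l \<cdot> t)) = ((s t)\<^sup>\<star> \<otimes> (s (c \<cdot> l))\<^sup>\<star>) \<otimes> (s (d \<cdot> l) \<otimes> s t)"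
      using c l t star_s_cmp[of "c \<cdot> l" t] s_cmp[of "d \<cdot> l" t] by (simp add: cmp_assoc)
    also have "\<dots> = (s t)\<^sup>\<star> \<otimes> (((s (c \<cdot> l))\<^sup>\<star> \<otimes> s (d \<cdot> l)) \<otimes> s t)" using c l t by (simp add: A.mult_assoc)
    finally show ?thesis using z t by simp
  qed
  show ?case
    by (rule bexI[of _ "l \<cdot> t"]) (use new old l t ab in auto)
qed

end

context tail_vertex
begin

abbreviation Wm :: "nat ^ 'k \<Rightarrow> 'l set" where "Wm m \<equiv> src G ` V m"

definition Vw :: "nat ^ 'k \<Rightarrow> 'l \<Rightarrow> 'l set" where "Vw m w = {a \<in> V m. src G a = w}"

text \<open>This is \<open>\<Sum>\<^sub>a s\<^sub>a (s\<^sub>l s\<^sub>l\<^sup>*) s\<^sub>a\<^sup>*\<close>, that is, the projection \<open>s\<^sub>l s\<^sub>l\<^sup>*\<close> placed in all diagonal entries at once; so it commutes with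
  the matrix units.\<close>

definition Q :: "nat ^ 'k \<Rightarrow> 'l \<Rightarrow> 'a" where "Q m l = (\<Oplus>\<^bsub>A\<^esub>a \<in> Vw m (rng G l). rp (a \<cdot> l))"

lemma Vw_D: "a \<in> Vw m w \<Longrightarrow> a \<in> mor G" "a \<in> Vw m w \<Longrightarrow> rng G a = v" "a \<in> Vw m w \<Longrightarrow> deg G a = m" "a \<in> Vw m w \<Longrightarrow> src G a = w"
  using V_D by (auto simp: Vw_def)

lemma Vw_finite: "finite (Vw m w)"
  using V_finite[of m] by (simp add: Vw_def)

lemma Q_closed [simp]: "l \<in> mor G \<Longrightarrow> Q m l \<in> carrier A"
  unfolding Q_def by (rule A.finsum_closed) (use Vw_D in auto)

lemma Q_star: assumes "l \<in> mor G" shows "(Q m l)\<^sup>\<star> = Q m l"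
proof -
  have c: "rp (a \<cdot> l) \<in> carrier A" "(rp (a \<cdot> l))\<^sup>\<star> = rp (a \<cdot> l)" if "a \<in> Vw m (rng G l)" for a
    using rp_proj[of "a \<cdot> l"] Vw_D[OF that] assms by (auto simp: A.is_proj_def)
  have "(Q m l)\<^sup>\<star> = (\<Oplus>\<^bsub>A\<^esub>a \<in> Vw m (rng G l). (rp (a \<cdot> l))\<^sup>\<star>)"
    unfolding Q_def by (rule A.finsum_star) (use c Vw_finite in auto)
  also have "\<dots> = Q m l" unfolding Q_def by (rule A.finsum_cong') (use c in auto)
  finally show ?thesis .
qed

lemma Q_s:
  assumes l: "l \<in> mor G" and d: "d \<in> V m"
  shows "Q m l \<otimes> s d = (if src G d = rng G l then s d \<otimes> rp l else \<zero>)"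
proof -
  have dD: "d \<in> mor G" "deg G d = m" using V_D d by auto
  have t: "rp (a \<cdot> l) \<otimes> s d = (if a = d then s d \<otimes> rp l else \<zero>)" if "a \<in> Vw m (rng G l)" for a
  proof -
    note aD = Vw_D[OF that]
    have "rp (a \<cdot> l) \<otimes> s d = (s a \<otimes> rp l) \<otimes> ((s a)\<^sup>\<star> \<otimes> s d)"
      using aD l dD by (simp add: rp_def s_cmp[OF aD(1) l aD(4), symmetric] A.star_mult A.mult_assoc)
    also have "\<dots> = (if a = d then s d \<otimes> rp l else \<zero>)"
    proof (cases "a = d")
      case True
      have "rp l \<otimes> s (src G d) = rp l" using st_rng[OF l] l aD True by (simp add: rp_def A.mult_assoc)
      then show ?thesis using True dD l by (simp add: s_star_s A.mult_assoc)
    next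
      case False
      then show ?thesis using s_star_s_orth[of a d] aD dD l by simp
    qed
    finally show ?thesis .
  qed
  have rc: "rp (a \<cdot> l) \<in> carrier A" if "a \<in> Vw m (rng G l)" for a using Vw_D[OF that] l by simp
  have "Q m l \<otimes> s d = (\<Oplus>\<^bsub>A\<^esub>a \<in> Vw m (rng G l). rp (a \<cdot> l) \<otimes> s d)"
    unfolding Q_def by (rule A.finsum_mult_left) (use rc Vw_finite dD in auto)
  also have "\<dots> = (\<Oplus>\<^bsub>A\<^esub>a \<in> Vw m (rng G l). (if a = d then s d \<otimes> rp l else \<zero>))"
    by (rule A.finsum_cong') (use t dD l in auto)
  also have "\<dots> = (if src G d = rng G l then s d \<otimes> rp l else \<zero>)"
  proof (cases "src G d = rng G l")
    case True
    then have "d \<in> Vw m (rng G l)" using d by (simp add: Vw_def)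
    then show ?thesis using True A.finsum_single[of "Vw m (rng G l)" d "\<lambda>a. if a = d then s d \<otimes> rp l else \<zero>"] Vw_finite dD l by simp
  next
    case False
    then show ?thesis using A.finsum_zero_eq[of "Vw m (rng G l)" "\<lambda>a. if a = d then s d \<otimes> rp l else \<zero>"] Vw_D(4) Vw_finite by force
  qed
  finally show ?thesis .
qed

lemma s_Q:
  assumes l: "l \<in> mor G" and d: "d \<in> V m"
  shows "(s d)\<^sup>\<star> \<otimes> Q m l = (if src G d = rng G l then rp l \<otimes> (s d)\<^sup>\<star> else \<zero>)"
proof -
  have "(s d)\<^sup>\<star> \<otimes> Q m l = (Q m l \<otimes> s d)\<^sup>\<star>" using V_D(1)[OF d] l Q_star[OF l] by (simp add: A.star_mult)
  then show ?thesis using Q_s[OF l d] V_D(1)[OF d] l rp_proj[OF l] by (simp add: A.star_mult A.is_proj_def)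
qed

lemma Q_commutes:
  assumes l: "l \<in> mor G" and x: "x \<in> Fm m" shows "Q m l \<otimes> x = x \<otimes> Q m l"
  using x
proof (induction rule: mspan.induct)
  case zero show ?case using l by simp
next
  case (step x a b c)
  have "Q m l \<otimes> (s a \<otimes> (s b)\<^sup>\<star>) = (Q m l \<otimes> s a) \<otimes> (s b)\<^sup>\<star>" using step.hyps l by (simp add: A.mult_assoc)
  also have "\<dots> = s a \<otimes> ((s b)\<^sup>\<star> \<otimes> Q m l)" using step.hyps l Q_s[OF l, of a m] s_Q[OF l, of b m] by (auto simp: A.mult_assoc)
  also have "\<dots> = (s a \<otimes> (s b)\<^sup>\<star>) \<otimes> Q m l" using step.hyps l by (simp add: A.mult_assoc)
  finally show ?case using step.IH step.hyps l mspan_carrier[OF step.hyps(1)]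
    by (simp add: A.mult_r_distr A.mult_l_distr A.smult_mult_l A.smult_mult_r)
qed

lemma Q_idem: assumes l: "l \<in> mor G" shows "Q m l \<otimes> Q m l = Q m l"
proof -
  have t: "Q m l \<otimes> rp (a \<cdot> l) = rp (a \<cdot> l)" if "a \<in> Vw m (rng G l)" for a
  proof -
    note aD = Vw_D[OF that]
    have aV: "a \<in> V m" using that by (simp add: Vw_def)
    have "Q m l \<otimes> rp (a \<cdot> l) = (Q m l \<otimes> s a) \<otimes> (s l \<otimes> (s (a \<cdot> l))\<^sup>\<star>)"
      using aD l by (simp add: rp_def s_cmp[OF aD(1) l aD(4), symmetric] A.mult_assoc)
    also have "\<dots> = (s a \<otimes> rp l) \<otimes> (s l \<otimes> (s (a \<cdot> l))\<^sup>\<star>)" using Q_s[OF l aV] aD by simp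
    also have "\<dots> = s a \<otimes> ((rp l \<otimes> s l) \<otimes> (s (a \<cdot> l))\<^sup>\<star>)" using aD l by (simp only: A.mult_assoc s_closed rp_closed A.star_closed cmp_mor A.mult_closed)
    also have "\<dots> = rp (a \<cdot> l)" using aD l s_cmp[of a l] by (simp add: rp_def[of "a \<cdot> l"] A.mult_assoc[symmetric])
    finally show ?thesis .
  qed
  have rc: "rp (a \<cdot> l) \<in> carrier A" if "a \<in> Vw m (rng G l)" for a using Vw_D[OF that] l by simp
  have "Q m l \<otimes> Q m l = (\<Oplus>\<^bsub>A\<^esub>a \<in> Vw m (rng G l). Q m l \<otimes> rp (a \<cdot> l))"
    unfolding Q_def[of m l, symmetric] using A.finsum_mult_right[of "Vw m (rng G l)" "\<lambda>a. rp (a \<cdot> l)" "Q m l"] rc Vw_finite l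
    by (simp add: Q_def[of m l, symmetric])
  also have "\<dots> = Q m l" unfolding Q_def[of m l] by (rule A.finsum_cong') (use t rc in \<open>auto simp: Q_def\<close>)
  finally show ?thesis .
qed

lemma Q_proj: "l \<in> mor G \<Longrightarrow> A.is_proj (Q m l)"
  using Q_star Q_idem by (simp add: A.is_proj_def)

text \<open>Each term of the compression of \<open>s\<^sub>a s\<^sub>b\<^sup>*\<close> contains a factor \<open>s\<^bsub>cl\<^esub>\<^sup>* s\<^bsub>al\<^esub>\<close> with \<open>c \<in> V m\<close>, so a path \<open>l\<close> that separates the
  finitely many pairs \<open>(c, a)\<close> kills \<open>r\<close>.\<close>

lemma compress_zero:
  assumes "r \<in> half (\<lambda>g. g \<notin> PerS) m"
  shows "\<exists>Z. finite Z \<and> (\<forall>(c, a) \<in> Z. c \<in> mor G \<and> a \<in> mor G \<and> src G c = w \<and> src G a = w \<and> dd c a \<notin> PerS) \<and>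
    (\<forall>l \<in> mor G. rng G l = w \<longrightarrow> (\<forall>(c, a) \<in> Z. (s (c \<cdot> l))\<^sup>\<star> \<otimes> s (a \<cdot> l) = \<zero>) \<longrightarrow> Q m l \<otimes> r \<otimes> Q m l = \<zero>)"
  using assms
proof (induction rule: mspan.induct)
  case zero show ?case by (intro exI[of _ "{}"]) simp
next
  case (step r a b k)
  then obtain Z where Z: "finite Z" "\<forall>(c, a) \<in> Z. c \<in> mor G \<and> a \<in> mor G \<and> src G c = w \<and> src G a = w \<and> dd c a \<notin> PerS"
    "\<forall>l \<in> mor G. rng G l = w \<longrightarrow> (\<forall>(c, a) \<in> Z. (s (c \<cdot> l))\<^sup>\<star> \<otimes> s (a \<cdot> l) = \<zero>) \<longrightarrow> Q m l \<otimes> r \<otimes> Q m l = \<zero>"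
    by (elim exE conjE) (rule that)
  have bV: "b \<in> V m" "a \<in> mor G" "b \<in> mor G" "src G a = src G b" "dd a b \<notin> PerS" using step.hyps by auto
  define Z' where "Z' = Z \<union> (if src G a = w then (\<lambda>c. (c, a)) ` Vw m w else {})"
  have "dd c a \<notin> PerS" if "c \<in> Vw m w" for c
  proof
    assume "dd c a \<in> PerS"
    from S.Per_uminus[OF this] show False using bV Vw_D(3)[OF that] V_D(3)[OF bV(1)] by simp
  qed
  then have 1: "\<forall>(c, a) \<in> Z'. c \<in> mor G \<and> a \<in> mor G \<and> src G c = w \<and> src G a = w \<and> dd c a \<notin> PerS"
    using Z(2) bV Vw_D unfolding Z'_def by auto
  have 2: "Q m l \<otimes> (k \<odot> (s a \<otimes> (s b)\<^sup>\<star>) \<oplus> r) \<otimes> Q m l = \<zero>"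
    if l: "l \<in> mor G" "rng G l = w" and *: "\<forall>(c, a) \<in> Z'. (s (c \<cdot> l))\<^sup>\<star> \<otimes> s (a \<cdot> l) = \<zero>" for l
  proof -
    have cl: "s a \<in> carrier A" "s b \<in> carrier A" "r \<in> carrier A" "Q m l \<in> carrier A" "s l \<in> carrier A"
      using bV l mspan_carrier[OF step.hyps(1)] by simp_all
    have "Q m l \<otimes> (s a \<otimes> (s b)\<^sup>\<star>) \<otimes> Q m l = (Q m l \<otimes> s a) \<otimes> ((s b)\<^sup>\<star> \<otimes> Q m l)" using cl by (simp add: A.mult_assoc)
    also have "\<dots> = \<zero>"
    proof (cases "src G b = w")
      case False
      then show ?thesis using s_Q[OF l(1) bV(1)] l cl by simp
    next
      case True
      have rc: "rp (c \<cdot> l) \<in> carrier A" "c \<cdot> l \<in> mor G" if "c \<in> Vw m w" for c using Vw_D[OF that] l by simp_all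
      have "rp (c \<cdot> l) \<otimes> s (a \<cdot> l) = \<zero>" if c: "c \<in> Vw m w" for c
      proof -
        have "(s (c \<cdot> l))\<^sup>\<star> \<otimes> s (a \<cdot> l) = \<zero>" using * c True bV by (auto simp: Z'_def)
        then show ?thesis using rc[OF c] bV l True by (simp add: rp_def A.mult_assoc)
      qed
      then have "Q m l \<otimes> s (a \<cdot> l) = \<zero>"
        unfolding Q_def l(2) using A.finsum_mult_left[of "Vw m w" "\<lambda>c. rp (c \<cdot> l)" "s (a \<cdot> l)"] rc Vw_finite bV l True
          A.finsum_zero_eq[of "Vw m w" "\<lambda>c. rp (c \<cdot> l) \<otimes> s (a \<cdot> l)"] by simp
      then have "(Q m l \<otimes> s a) \<otimes> s l = \<zero>" using s_cmp[of a l] bV l True cl by (simp add: A.mult_assoc)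
      then show ?thesis
        using s_Q[OF l(1) bV(1)] l True cl A.mult_assoc[of "Q m l \<otimes> s a" "s l" "(s l)\<^sup>\<star> \<otimes> (s b)\<^sup>\<star>"] by (simp add: rp_def A.mult_assoc)
    qed
    finally have z: "Q m l \<otimes> (s a \<otimes> (s b)\<^sup>\<star>) \<otimes> Q m l = \<zero>" .
    have "Q m l \<otimes> (k \<odot> (s a \<otimes> (s b)\<^sup>\<star>) \<oplus> r) \<otimes> Q m l = k \<odot> (Q m l \<otimes> (s a \<otimes> (s b)\<^sup>\<star>) \<otimes> Q m l) \<oplus> Q m l \<otimes> r \<otimes> Q m l"
      using cl by (simp add: A.mult_r_distr A.mult_l_distr A.smult_mult_l A.smult_mult_r)
    moreover have "Q m l \<otimes> r \<otimes> Q m l = \<zero>" using Z(3) l * unfolding Z'_def by blast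
    ultimately show ?thesis unfolding z by simp
  qed
  have "finite Z'" unfolding Z'_def using Z(1) Vw_finite[of m w] by simp
  then show ?case using 1 2 by (intro exI[of _ Z']) blast
qed

text \<open>Choose for each \<open>w\<close> a path \<open>l\<close> for which \<open>Q m l\<close> kills \<open>r\<close>. As \<open>Q m l\<close> commutes with \<open>Fm m\<close>, the maximum \<open>q(y)\<close> over \<open>w\<close> of
  \<open>p(y Q m l)\<close> satisfies the C*-identity on \<open>Fm m\<close>; and it dominates the entries of \<open>y\<close>, which can be read off at \<open>al\<close>
  instead of \<open>a\<close>. Hence \<open>p(x) \<le> q(x) \<le> p(x + r)\<close>, the latter because \<open>q(x)\<close> is a value of \<open>p\<close> at a compression of \<open>x + r\<close>.\<close>

lemma compress_le:
  assumes p: "adapted p" and x: "x \<in> Fm m"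
    and r: "r \<in> half (\<lambda>g. g \<notin> PerS) m"
  shows "p x \<le> p (x \<oplus> r)"
proof -
  interpret p: cseminorm A p by (rule adapted_cseminorm[OF p])
  note xc = mspan_carrier[OF x] and rc = mspan_carrier[OF r]
  have "\<exists>l \<in> mor G. rng G l = w \<and> src G l \<in> T \<and> Q m l \<otimes> r \<otimes> Q m l = \<zero>" if w: "w \<in> Wm m" for w
  proof -
    have wT: "w \<in> T" using w V_D(4) by auto
    from compress_zero[OF r, of w] obtain Z where Z: "finite Z" "\<forall>(c, a) \<in> Z. c \<in> mor G \<and> a \<in> mor G \<and> src G c = w \<and> src G a = w \<and> dd c a \<notin> PerS"
      "\<forall>l \<in> mor G. rng G l = w \<longrightarrow> (\<forall>(c, a) \<in> Z. (s (c \<cdot> l))\<^sup>\<star> \<otimes> s (a \<cdot> l) = \<zero>) \<longrightarrow> Q m l \<otimes> r \<otimes> Q m l = \<zero>"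
      by (elim exE conjE) (rule that)
    have "\<exists>l \<in> mor G. rng G l = w \<and> src G l \<in> T \<and> (\<forall>(c, a) \<in> Z. (s (c \<cdot> l))\<^sup>\<star> \<otimes> s (a \<cdot> l) = \<zero>)"
      by (rule separate[OF Z(1) wT]) (use Z(2) in auto)
    then show ?thesis using Z(3) by blast
  qed
  then obtain L where L: "\<And>w. w \<in> Wm m \<Longrightarrow> L w \<in> mor G" "\<And>w. w \<in> Wm m \<Longrightarrow> rng G (L w) = w" "\<And>w. w \<in> Wm m \<Longrightarrow> src G (L w) \<in> T"
      "\<And>w. w \<in> Wm m \<Longrightarrow> Q m (L w) \<otimes> r \<otimes> Q m (L w) = \<zero>" by metis
  define W where "W = Wm m"
  have W: "finite W" "W \<noteq> {}"
  proof -
    show "finite W" using V_finite by (simp add: W_def)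
    obtain e where "e \<in> mor Sg" "rng Sg e = v" "deg Sg e = m" using S.ex_path[of v m] vT verts_tail[OF mt] by auto
    then have "e \<in> V m" by (simp add: V_def)
    then show "W \<noteq> {}" by (auto simp: W_def)
  qed
  define q where "q y = Max ((\<lambda>w. p (y \<otimes> Q m (L w))) ` W)" for y
  have q_ge: "p (y \<otimes> Q m (L w)) \<le> q y" if "w \<in> W" for y w unfolding q_def using W that by simp
  have q_ex: "\<exists>w \<in> W. q y = p (y \<otimes> Q m (L w))" for y
  proof -
    have "q y \<in> (\<lambda>w. p (y \<otimes> Q m (L w))) ` W" unfolding q_def by (rule Max_in) (use W in auto)
    then show ?thesis by blast
  qed
  have Qc: "Q m (L w) \<in> carrier A" "A.is_proj (Q m (L w))" if "w \<in> W" for w using L that Q_proj by (simp_all add: W_def)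
  have q0: "0 \<le> q y" if "y \<in> carrier A" for y using q_ex[of y] p.sn_simps(1) that Qc by auto
  have sq: "p ((y\<^sup>\<star> \<otimes> y) \<otimes> Q m (L w)) = (p (y \<otimes> Q m (L w)))\<^sup>2" if y: "y \<in> Fm m" and w: "w \<in> W" for y w
  proof -
    have yc: "y \<in> carrier A" using mspan_carrier[OF y] .
    have Qp: "(Q m (L w))\<^sup>\<star> = Q m (L w)" "Q m (L w) \<otimes> Q m (L w) = Q m (L w)" using Qc[OF w] by (simp_all add: A.is_proj_def)
    have "(y \<otimes> Q m (L w))\<^sup>\<star> \<otimes> (y \<otimes> Q m (L w)) = Q m (L w) \<otimes> (y\<^sup>\<star> \<otimes> y) \<otimes> Q m (L w)"
      using yc Qc[OF w] Qp by (simp add: A.star_mult A.mult_assoc)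
    also have "Q m (L w) \<otimes> (y\<^sup>\<star> \<otimes> y) = (y\<^sup>\<star> \<otimes> y) \<otimes> Q m (L w)" by (rule Q_commutes[OF _ Fm_star_mult[OF y]]) (use L w in \<open>simp add: W_def\<close>)
    also have "\<dots> \<otimes> Q m (L w) = (y\<^sup>\<star> \<otimes> y) \<otimes> Q m (L w)" using yc Qc[OF w] Qp by (simp add: A.mult_assoc)
    finally show ?thesis using p.sn_simps(3)[of "y \<otimes> Q m (L w)"] yc Qc[OF w] by simp
  qed
  have q_sq: "q (y\<^sup>\<star> \<otimes> y) = (q y)\<^sup>2" if y: "y \<in> Fm m" for y
  proof (rule antisym)
    have yc: "y \<in> carrier A" using mspan_carrier[OF y] .
    obtain w where w: "w \<in> W" "q (y\<^sup>\<star> \<otimes> y) = p ((y\<^sup>\<star> \<otimes> y) \<otimes> Q m (L w))" using q_ex by blast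
    show "q (y\<^sup>\<star> \<otimes> y) \<le> (q y)\<^sup>2" unfolding w(2) sq[OF y w(1)] by (intro power_mono q_ge w p.sn_simps(1)) (use yc Qc[OF w(1)] in simp)
    obtain w where w: "w \<in> W" "q y = p (y \<otimes> Q m (L w))" using q_ex by blast
    show "(q y)\<^sup>2 \<le> q (y\<^sup>\<star> \<otimes> y)" unfolding w(2) sq[OF y w(1), symmetric] by (rule q_ge[OF w(1)])
  qed
  have pq: "p x \<le> q x"
  proof (rule Fm_le_of_entries[OF p x, of q])
    show "0 \<le> q y" if "y \<in> carrier A" for y using q0[OF that] .
    fix y assume y: "y \<in> Fm m"
    show "q (y\<^sup>\<star> \<otimes> y) = (q y)\<^sup>2" by (rule q_sq[OF y])
    have yc: "y \<in> carrier A" using mspan_carrier[OF y] .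
    fix c d \<beta> assume cd: "c \<in> V m" "d \<in> V m" "src G c = src G d" "(s c)\<^sup>\<star> \<otimes> y \<otimes> s d = \<beta> \<odot> s (src G c)"
    define w where "w = src G c"
    have w: "w \<in> W" using cd by (simp add: w_def W_def)
    define l where "l = L w"
    have l: "l \<in> mor G" "rng G l = w" "src G l \<in> T" using L w by (simp_all add: l_def W_def)
    have c: "c \<in> mor G" and d: "d \<in> mor G" using cd V_D by auto
    have cl: "c \<cdot> l \<in> mor G" "d \<cdot> l \<in> mor G" using c d l cd w_def by auto
    have Qd: "Q m l \<otimes> s (d \<cdot> l) = s d \<otimes> s l"
    proof -
      have "Q m l \<otimes> s (d \<cdot> l) = (Q m l \<otimes> s d) \<otimes> s l" using s_cmp[of d l] d l cd w_def by (simp add: A.mult_assoc)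
      also have "Q m l \<otimes> s d = s d \<otimes> rp l" using Q_s[OF l(1) cd(2)] cd(3) l w_def by simp
      also have "s d \<otimes> rp l \<otimes> s l = s d \<otimes> s l" using A.mult_assoc[of "s d" "rp l" "s l"] d l by simp
      finally show ?thesis .
    qed
    have "(s (c \<cdot> l))\<^sup>\<star> \<otimes> (y \<otimes> Q m l) \<otimes> s (d \<cdot> l) = ((s l)\<^sup>\<star> \<otimes> (s c)\<^sup>\<star>) \<otimes> (y \<otimes> (Q m l \<otimes> s (d \<cdot> l)))"
      using star_s_cmp[of c l] c l cl yc w_def by (simp add: A.mult_assoc)
    also have "\<dots> = (s l)\<^sup>\<star> \<otimes> (((s c)\<^sup>\<star> \<otimes> y \<otimes> s d) \<otimes> s l)"
      unfolding Qd using c d l yc by (simp add: A.mult_assoc)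
    also have "\<dots> = \<beta> \<odot> s (src G l)"
      unfolding cd(4) using c l w_def s_rng[OF l(1)] s_star_s[OF l(1)] by (simp add: A.smult_mult_l A.smult_mult_r)
    finally have e: "(s (c \<cdot> l))\<^sup>\<star> \<otimes> (y \<otimes> Q m l) \<otimes> s (d \<cdot> l) = \<beta> \<odot> s (src G l)" .
    have "cmod \<beta> = p (\<beta> \<odot> s (src G l))" using l adapted_vertex[OF p, of "src G l"] by (simp add: p.sn_simps(4))
    also have "\<dots> = p ((s (c \<cdot> l))\<^sup>\<star> \<otimes> (y \<otimes> Q m l) \<otimes> s (d \<cdot> l))" unfolding e ..
    also have "\<dots> \<le> p ((s (c \<cdot> l))\<^sup>\<star> \<otimes> (y \<otimes> Q m l))" by (rule p.sn_mult_le(2)) (use cl l yc adapted_s[OF p] in auto)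
    also have "\<dots> \<le> p (y \<otimes> Q m l)" by (rule p.sn_mult_le(1)) (use cl l yc adapted_s[OF p] in auto)
    also have "\<dots> \<le> q y" using q_ge[OF w] by (simp add: l_def)
    finally show "cmod \<beta> \<le> q y" .
  qed
  obtain w where w: "w \<in> W" "q x = p (x \<otimes> Q m (L w))" using q_ex by blast
  have "p (x \<otimes> Q m (L w)) \<le> p (x \<oplus> r)"
  proof -
    let ?Q = "Q m (L w)"
    have Qp: "?Q \<otimes> ?Q = ?Q" using Qc[OF w(1)] by (simp add: A.is_proj_def)
    have "?Q \<otimes> (x \<oplus> r) \<otimes> ?Q = ?Q \<otimes> x \<otimes> ?Q \<oplus> ?Q \<otimes> r \<otimes> ?Q" using Qc[OF w(1)] xc rc by (simp add: A.mult_r_distr A.mult_l_distr)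
    also have "?Q \<otimes> r \<otimes> ?Q = \<zero>" using L(4) w by (simp add: W_def)
    also have "?Q \<otimes> x = x \<otimes> ?Q" by (rule Q_commutes[OF _ x]) (use L w in \<open>simp add: W_def\<close>)
    also have "x \<otimes> ?Q \<otimes> ?Q \<oplus> \<zero> = x \<otimes> ?Q" using xc Qc[OF w(1)] Qp by (simp add: A.mult_assoc)
    finally have e: "x \<otimes> ?Q = ?Q \<otimes> (x \<oplus> r) \<otimes> ?Q" by simp
    have "p (?Q \<otimes> (x \<oplus> r) \<otimes> ?Q) \<le> p (?Q \<otimes> (x \<oplus> r))" by (rule p.sn_mult_le(2)) (use Qc[OF w(1)] xc rc p.sn_proj in auto)
    also have "\<dots> \<le> p (x \<oplus> r)" by (rule p.sn_mult_le(1)) (use Qc[OF w(1)] xc rc p.sn_proj in auto)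
    finally show ?thesis unfolding e .
  qed
  with pq w show ?thesis by simp
qed

text \<open>Modulo null elements both summands take the form of \<open>compress_le\<close> for one large degree \<open>m\<close>.\<close>

lemma core_component_le:
  assumes p: "adapted p" and x: "x \<in> corner (\<lambda>g. g \<in> PerS)" and r: "r \<in> corner (\<lambda>g. g \<notin> PerS)"
  shows "p x \<le> p (x \<oplus> r)"
proof -
  interpret p: cseminorm A p by (rule adapted_cseminorm[OF p])
  obtain m1 where m1: "\<And>m. m \<ge> m1 \<Longrightarrow> x \<in> modn (Fm m)" using normalise_core[OF x] by blast
  obtain m2 where m2: "\<And>m. m \<ge> m2 \<Longrightarrow> r \<in> modn (half (\<lambda>g. g \<notin> PerS) m)"
    using normalise_right[OF r] by blast
  define m where "m = m1 + m2"
  obtain y where y: "x \<in> carrier A" "y \<in> Fm m" "x \<ominus> y \<in> nul" using m1[of m] unfolding modn_def m_def by auto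
  obtain u where u: "r \<in> carrier A" "u \<in> half (\<lambda>g. g \<notin> PerS) m" "r \<ominus> u \<in> nul"
    using m2[of m] unfolding modn_def m_def by auto
  note yc = mspan_carrier[OF y(2)] and uc = mspan_carrier[OF u(2)]
  have "(x \<oplus> r) \<ominus> (y \<oplus> u) \<in> nul" using nul_simps(2)[OF y(3) u(3)] y u yc uc by (simp add: A.add_diff_add)
  then have "p (x \<oplus> r) = p (y \<oplus> u)" using p.sn_eq_of_null[of "x \<oplus> r" "y \<oplus> u"] y u yc uc nulD(2) p by simp
  moreover have "p x = p y" using p.sn_eq_of_null[OF y(1) yc] nulD(2)[OF y(3) p] by simp
  ultimately show ?thesis using compress_le[OF p y(2) u(2)] by simp
qed

lemma corner_star_mult:
  assumes x: "x \<in> corner R1" and y: "y \<in> corner R2" and R: "\<And>g h. R1 g \<Longrightarrow> R2 h \<Longrightarrow> R (h - g)"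
  shows "x\<^sup>\<star> \<otimes> y \<in> corner R"
proof (rule mspan_mult[OF mspan_star[OF x] y])
  show "(s a \<otimes> (s b)\<^sup>\<star>) \<otimes> (s c \<otimes> (s d)\<^sup>\<star>) \<in> corner R"
    if *: "a \<in> mor G" "b \<in> mor G" "src G a = src G b" "rng G a = v \<and> rng G b = v \<and> R1 (dd b a)"
      "c \<in> mor G" "d \<in> mor G" "src G c = src G d" "rng G c = v \<and> rng G d = v \<and> R2 (dd c d)" for a b c d
  proof -
    have "R (dd c d - dd b a)" using R * by blast
    moreover have "dd a b + dd c d = dd c d - dd b a" by simp
    ultimately have "R (dd a b + dd c d)" by metis
    then show ?thesis using mspan_mono[OF gen_mult[OF *(1-3,5-7)]] * by force
  qed
qed auto

text \<open>If all degrees lie in one class, those of \<open>x\<^sup>*x\<close> lie in the periodicity group.\<close>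

lemma class_eq:
  assumes p: "adapted p" and q: "adapted q" and x: "x \<in> corner (\<lambda>h. h - g \<in> PerS)"
  shows "p x = q x"
proof -
  interpret p: cseminorm A p by (rule adapted_cseminorm[OF p])
  interpret q: cseminorm A q by (rule adapted_cseminorm[OF q])
  have xc: "x \<in> carrier A" using mspan_carrier[OF x] .
  have "x\<^sup>\<star> \<otimes> x \<in> corner (\<lambda>h. h \<in> PerS)"
  proof (rule corner_star_mult[OF x x])
    fix h k assume "h - g \<in> PerS" "k - g \<in> PerS"
    then show "k - h \<in> PerS" using S.Per_diff[of "k - g" "h - g"] by simp
  qed
  then have "(p x)\<^sup>2 = (q x)\<^sup>2" using core_eq[OF p q] p.sn_simps(3)[OF xc] q.sn_simps(3)[OF xc] by simp
  then show ?thesis using p.sn_simps(1)[OF xc] q.sn_simps(1)[OF xc] by (simp add: power2_eq_iff_nonneg)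
qed

text \<open>Multiplication by \<open>x\<^sup>*\<close> moves the class of \<open>g\<close> to the periodicity group.\<close>

lemma class_component_le:
  assumes p: "adapted p" and x: "x \<in> corner (\<lambda>h. h - g \<in> PerS)" and r: "r \<in> corner (\<lambda>h. h - g \<notin> PerS)"
  shows "p x \<le> p (x \<oplus> r)"
proof -
  interpret p: cseminorm A p by (rule adapted_cseminorm[OF p])
  have xc: "x \<in> carrier A" and rc: "r \<in> carrier A" using mspan_carrier x r by blast+
  have 1: "x\<^sup>\<star> \<otimes> x \<in> corner (\<lambda>h. h \<in> PerS)"
  proof (rule corner_star_mult[OF x x])
    fix h k assume "h - g \<in> PerS" "k - g \<in> PerS"
    then show "k - h \<in> PerS" using S.Per_diff[of "k - g" "h - g"] by simp
  qed
  have 2: "x\<^sup>\<star> \<otimes> r \<in> corner (\<lambda>h. h \<notin> PerS)"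
  proof (rule corner_star_mult[OF x r])
    fix h k assume "h - g \<in> PerS" "k - g \<notin> PerS"
    then show "k - h \<notin> PerS" using S.Per_add[of "k - h" "h - g"] by auto
  qed
  have "(p x)\<^sup>2 = p (x\<^sup>\<star> \<otimes> x)" using p.sn_simps(3)[OF xc] by simp
  also have "\<dots> \<le> p (x\<^sup>\<star> \<otimes> x \<oplus> x\<^sup>\<star> \<otimes> r)" by (rule core_component_le[OF p 1 2])
  also have "\<dots> = p (x\<^sup>\<star> \<otimes> (x \<oplus> r))" using xc rc by (simp add: A.mult_r_distr)
  also have "\<dots> \<le> p x * p (x \<oplus> r)" using p.sn_simps(6)[of "x\<^sup>\<star>" "x \<oplus> r"] xc rc by simp
  finally have "p x * p x \<le> p x * p (x \<oplus> r)" by (simp add: power2_eq_square)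
  then show ?thesis using p.sn_simps(1)[OF xc] p.sn_simps(1)[of "x \<oplus> r"] xc rc by (cases "p x = 0") auto
qed

end

section \<open>Counting degrees\<close>

lemma card_box_le:
  "finite {g :: int ^ 'k::finite. \<forall>i. \<bar>g $ i\<bar> \<le> int N}"
  "card {g :: int ^ 'k::finite. \<forall>i. \<bar>g $ i\<bar> \<le> int N} \<le> (2 * N + 1) ^ CARD('k)"
proof -
  let ?P = "PiE (UNIV :: 'k set) (\<lambda>_. {- int N..int N})"
  have sub: "{g :: int ^ 'k. \<forall>i. \<bar>g $ i\<bar> \<le> int N} \<subseteq> vec_lambda ` ?P"
  proof
    fix g :: "int ^ 'k" assume g: "g \<in> {g. \<forall>i. \<bar>g $ i\<bar> \<le> int N}"
    have "g = vec_lambda (\<lambda>i. g $ i)" by simp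
    moreover have "(\<lambda>i. g $ i) \<in> ?P" using g by (auto simp: abs_le_iff) (metis minus_le_iff)
    ultimately show "g \<in> vec_lambda ` ?P" by blast
  qed
  have fin: "finite ?P" by (simp add: finite_PiE)
  have "card ?P = (2 * N + 1) ^ CARD('k)" by (simp add: card_PiE nat_add_distrib nat_mult_distrib)
  then have "card (vec_lambda ` ?P) \<le> (2 * N + 1) ^ CARD('k)" using card_image_le[OF fin, of vec_lambda] by simp
  then show "finite {g :: int ^ 'k. \<forall>i. \<bar>g $ i\<bar> \<le> int N}" "card {g :: int ^ 'k::finite. \<forall>i. \<bar>g $ i\<bar> \<le> int N} \<le> (2 * N + 1) ^ CARD('k)"
    using finite_subset[OF sub finite_imageI[OF fin]] card_mono[OF finite_imageI[OF fin] sub] by linarith+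
qed

context tail_vertex
begin

text \<open>Constant on classes, so that its values index them.\<close>

definition repr :: "int ^ 'k \<Rightarrow> int ^ 'k" where "repr g = (SOME h. h - g \<in> PerS)"

lemma repr: "repr g - g \<in> PerS" "g - h \<in> PerS \<Longrightarrow> repr g = repr h" "repr (repr g) = repr g"
proof -
  have 0: "0 \<in> PerS" using S.Per_0 S.nonempty by simp
  show 1: "repr g - g \<in> PerS" for g unfolding repr_def by (rule someI[of _ g]) (use 0 in simp)
  show 2: "repr g = repr h" if "g - h \<in> PerS" for g h
  proof -
    have "(\<lambda>k. k - g \<in> PerS) = (\<lambda>k. k - h \<in> PerS)"
    proof
      fix k show "(k - g \<in> PerS) = (k - h \<in> PerS)"
        using S.Per_add[of "k - g" "g - h"] S.Per_diff[of "k - h" "g - h"] that by auto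
    qed
    then show ?thesis unfolding repr_def by simp
  qed
  show "repr (repr g) = repr g" using 2[OF 1] .
qed

lemma repr_iff: "repr j = j \<Longrightarrow> repr h = j \<longleftrightarrow> h - j \<in> PerS"
  using repr(1)[of h] repr(2)[of h j] S.Per_uminus[of "repr h - h"] by auto

lemma class_decomposition:
  assumes J: "finite J" and x: "x \<in> corner (\<lambda>h. h \<in> J)"
  shows "\<exists>y. (\<forall>j. y j \<in> corner (\<lambda>h. repr h = j)) \<and> x = (\<Oplus>\<^bsub>A\<^esub>j \<in> repr ` J. y j)"
  using x
proof (induction rule: mspan.induct)
  case zero
  show ?case
    using A.finsum_zero_eq[of "repr ` J" "\<lambda>j. \<zero>"] J by (intro exI[of _ "\<lambda>j. \<zero>"]) (auto intro: mspan.zero)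
next
  case (step x a b c)
  then obtain y where y: "\<And>j. y j \<in> corner (\<lambda>h. repr h = j)" "x = (\<Oplus>\<^bsub>A\<^esub>j \<in> repr ` J. y j)" by blast
  define j0 where "j0 = repr (dd a b)"
  have j0: "j0 \<in> repr ` J" using step.hyps by (simp add: j0_def)
  define g where "g = c \<odot> (s a \<otimes> (s b)\<^sup>\<star>)"
  have gc: "g \<in> corner (\<lambda>h. repr h = j0)" unfolding g_def
    by (rule mspan_smult, rule mspan_gen) (use step.hyps in \<open>auto simp: j0_def\<close>)
  define y' where "y' j = (if j = j0 then g else \<zero>) \<oplus> y j" for j
  have 1: "y' j \<in> corner (\<lambda>h. repr h = j)" for j
    unfolding y'_def using mspan_add[OF gc y(1)[of j0]] y(1)[of j] mspan_carrier[OF y(1)[of j]] by auto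
  have cl: "y j \<in> carrier A" "y' j \<in> carrier A" "(if j = j0 then g else \<zero>) \<in> carrier A" for j
    using mspan_carrier y(1) 1 gc by auto
  have "(\<Oplus>\<^bsub>A\<^esub>j \<in> repr ` J. y' j) = (\<Oplus>\<^bsub>A\<^esub>j \<in> repr ` J. (if j = j0 then g else \<zero>)) \<oplus> (\<Oplus>\<^bsub>A\<^esub>j \<in> repr ` J. y j)"
    unfolding y'_def by (rule A.finsum_addf) (use cl in auto)
  also have "(\<Oplus>\<^bsub>A\<^esub>j \<in> repr ` J. (if j = j0 then g else \<zero>)) = g"
    using A.finsum_single[of "repr ` J" j0 "\<lambda>j. if j = j0 then g else \<zero>"] J j0 mspan_carrier[OF gc] by simp
  finally have "g \<oplus> x = (\<Oplus>\<^bsub>A\<^esub>j \<in> repr ` J. y' j)" using y(2) by simp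
  then show ?case using 1 unfolding g_def by (intro exI[of _ y']) simp
qed

text \<open>Split \<open>x\<close> into its classes; each part is dominated by \<open>x\<close> and has the same seminorms.\<close>

lemma le_card_classes:
  assumes p: "adapted p" and q: "adapted q" and J: "finite J" and x: "x \<in> corner (\<lambda>h. h \<in> J)"
  shows "p x \<le> real (card J) * q x"
proof -
  interpret p: cseminorm A p by (rule adapted_cseminorm[OF p])
  interpret q: cseminorm A q by (rule adapted_cseminorm[OF q])
  obtain y where y: "\<And>j. y j \<in> corner (\<lambda>h. repr h = j)" "x = (\<Oplus>\<^bsub>A\<^esub>j \<in> repr ` J. y j)" using class_decomposition[OF J x] by blast
  have yc: "y j \<in> carrier A" for j using mspan_carrier[OF y(1)] .
  have xc: "x \<in> carrier A" using mspan_carrier[OF x] .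
  have F: "finite (repr ` J)" using J by simp
  have comp: "p (y j) \<le> q x" if j: "j \<in> repr ` J" for j
  proof -
    have jj: "repr j = j" using j repr(3) by auto
    have 1: "y j \<in> corner (\<lambda>h. h - j \<in> PerS)" by (rule mspan_mono[OF y(1)]) (use repr_iff[OF jj] in auto)
    have 2: "(\<Oplus>\<^bsub>A\<^esub>i \<in> repr ` J - {j}. y i) \<in> corner (\<lambda>h. h - j \<notin> PerS)"
    proof (rule A.finsum_mem)
      show "y i \<in> corner (\<lambda>h. h - j \<notin> PerS)" if "i \<in> repr ` J - {j}" for i
        by (rule mspan_mono[OF y(1)]) (use repr_iff[OF jj] that in blast)
    qed (use F mspan.zero mspan_add mspan_carrier in auto)
    have "p (y j) = q (y j)" by (rule class_eq[OF p q 1])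
    also have "\<dots> \<le> q (y j \<oplus> (\<Oplus>\<^bsub>A\<^esub>i \<in> repr ` J - {j}. y i))" by (rule class_component_le[OF q 1 2])
    also have "y j \<oplus> (\<Oplus>\<^bsub>A\<^esub>i \<in> repr ` J - {j}. y i) = x" using A.finsum_remove[OF F j yc] y(2) by simp
    finally show ?thesis .
  qed
  have "p x \<le> (\<Sum>j\<in>repr ` J. p (y j))" unfolding y(2) by (rule p.sn_finsum[OF F yc])
  also have "\<dots> \<le> (\<Sum>j\<in>repr ` J. q x)" by (rule sum_mono) (rule comp)
  also have "\<dots> = real (card (repr ` J)) * q x" by simp
  also have "\<dots> \<le> real (card J) * q x" by (intro mult_right_mono) (use card_image_le[OF J, of repr] q.sn_simps(1)[OF xc] in auto)
  finally show ?thesis .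
qed

abbreviation box :: "nat \<Rightarrow> 'a set" where "box N \<equiv> corner (\<lambda>h. h \<in> {g. \<forall>i. \<bar>g $ i\<bar> \<le> int N})"

lemma in_some_box:
  assumes "x \<in> corner (\<lambda>h. True)" shows "\<exists>N. x \<in> box N"
  using assms
proof (induction rule: mspan.induct)
  case zero show ?case using mspan.zero by blast
next
  case (step x a b c)
  then obtain N where N: "x \<in> box N" by blast
  define M where "M = N + nat (\<Sum>i\<in>UNIV. \<bar>dd a b $ i\<bar>)"
  have "\<bar>dd a b $ i\<bar> \<le> int M" for i
    using member_le_sum[of i UNIV "\<lambda>i. \<bar>dd a b $ i\<bar>"] unfolding M_def by simp
  then have "s a \<otimes> (s b)\<^sup>\<star> \<in> box M" using step.hyps by (intro mspan_gen) auto
  moreover have "x \<in> box M" by (rule mspan_mono[OF N]) (auto simp: M_def intro: order_trans)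
  ultimately have "c \<odot> (s a \<otimes> (s b)\<^sup>\<star>) \<oplus> x \<in> box M" by (intro mspan_add mspan_smult)
  then show ?case by blast
qed

lemma box_star_mult: assumes "x \<in> box N" shows "x\<^sup>\<star> \<otimes> x \<in> box (2 * N)"
proof (rule corner_star_mult[OF assms assms])
  fix h k :: "int ^ 'k" assume *: "h \<in> {g. \<forall>i. \<bar>g $ i\<bar> \<le> int N}" "k \<in> {g. \<forall>i. \<bar>g $ i\<bar> \<le> int N}"
  have "\<bar>(k - h) $ i\<bar> \<le> int (2 * N)" for i
  proof -
    have "\<bar>h $ i\<bar> \<le> int N" "\<bar>k $ i\<bar> \<le> int N" using * by auto
    then show ?thesis by simp
  qed
  then show "k - h \<in> {g. \<forall>i. \<bar>g $ i\<bar> \<le> int (2 * N)}" by blast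
qed

lemma hpow_box: "x \<in> box N \<Longrightarrow> A.hpow n x \<in> box (2 ^ Suc n * N)"
proof (induction n)
  case 0 then show ?case using box_star_mult[of x N] by simp
next
  case (Suc n) then show ?case using box_star_mult[of "A.hpow n x" "2 ^ Suc n * N"] by (simp add: mult.assoc)
qed

text \<open>The number of degrees occurring in the \<open>2\<^sup>n\<close>-th power of \<open>x\<^sup>*x\<close> grows polynomially in \<open>2\<^sup>n\<close>, so the loss of
  that factor in comparing two seminorms class by class is harmless.\<close>

lemma span_le:
  assumes p: "adapted p" and q: "adapted q" and x: "x \<in> corner (\<lambda>h. True)"
  shows "p x \<le> q x"
proof -
  interpret p: cseminorm A p by (rule adapted_cseminorm[OF p])
  interpret q: cseminorm A q by (rule adapted_cseminorm[OF q])
  have xc: "x \<in> carrier A" using mspan_carrier[OF x] .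
  obtain N where N: "x \<in> box N" using in_some_box[OF x] by blast
  show ?thesis
  proof (rule A.seminorm_le_of_power_bounds[where S = UNIV and C = "real ((4 * N + 1) ^ CARD('k))" and k = "CARD('k)"])
    fix n
    let ?B = "{g :: int ^ 'k. \<forall>i. \<bar>g $ i\<bar> \<le> int (2 ^ Suc n * N)}"
    have "p (A.hpow n x) \<le> real (card ?B) * q (A.hpow n x)"
      by (rule le_card_classes[OF p q card_box_le(1) hpow_box[OF N]])
    also have "\<dots> \<le> (real ((4 * N + 1) ^ CARD('k)) * (2 ^ n) ^ CARD('k)) * q (A.hpow n x)"
    proof (rule mult_right_mono)
      have "card ?B \<le> (2 * (2 ^ Suc n * N) + 1) ^ CARD('k)" by (rule card_box_le(2))
      also have "\<dots> \<le> ((4 * N + 1) * 2 ^ n) ^ CARD('k)" by (rule power_mono) (auto simp: algebra_simps)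
      finally have "real (card ?B) \<le> real (((4 * N + 1) * 2 ^ n) ^ CARD('k))" by (rule of_nat_mono)
      then show "real (card ?B) \<le> real ((4 * N + 1) ^ CARD('k)) * (2 ^ n) ^ CARD('k)" by (simp only: power_mult_distrib of_nat_mult of_nat_power of_nat_numeral)
    qed (use q.sn_simps(1) xc in simp)
    finally show "p (A.hpow n x) \<le> real ((4 * N + 1) ^ CARD('k)) * (2 ^ n) ^ CARD('k) * q (A.hpow n x)" .
  qed (use xc p.sn_simps q.sn_simps in auto)
qed

lemma corner_of_mspan:
  assumes "b \<in> mspan (\<lambda>a b. True)" shows "s v \<otimes> b \<otimes> s v \<in> corner (\<lambda>h. True)"
  using assms
proof (induction rule: mspan.induct)
  case zero show ?case using vT by (simp add: mspan.zero)
next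
  case (step x c d k)
  have "s v \<otimes> (s c \<otimes> (s d)\<^sup>\<star>) \<otimes> s v = (s v \<otimes> s c) \<otimes> ((s d)\<^sup>\<star> \<otimes> s v)" using step.hyps vT by (simp add: A.mult_assoc)
  then have "s v \<otimes> (s c \<otimes> (s d)\<^sup>\<star>) \<otimes> s v \<in> corner (\<lambda>h. True)"
    using step.hyps vT s_vertex_s[OF vT(2)] mspan_gen[of c d "\<lambda>a b. rng G a = v \<and> rng G b = v \<and> True"] mspan.zero by auto
  moreover have "s v \<otimes> (k \<odot> (s c \<otimes> (s d)\<^sup>\<star>) \<oplus> x) \<otimes> s v = k \<odot> (s v \<otimes> (s c \<otimes> (s d)\<^sup>\<star>) \<otimes> s v) \<oplus> s v \<otimes> x \<otimes> s v"
    using step.hyps vT mspan_carrier[OF step.hyps(1)] by (simp add: A.mult_r_distr A.mult_l_distr A.smult_mult_l A.smult_mult_r)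
  ultimately show ?case using step.IH by (simp add: mspan_add mspan_smult)
qed

theorem corner_unique:
  assumes p: "adapted p" and q: "adapted q" and a: "a \<in> carrier A"
  shows "p (s v \<otimes> a \<otimes> s v) = q (s v \<otimes> a \<otimes> s v)"
proof -
  interpret p: cseminorm A p by (rule adapted_cseminorm[OF p])
  interpret q: cseminorm A q by (rule adapted_cseminorm[OF q])
  have pq: "p c \<le> nrm A c \<and> q c \<le> nrm A c" if "c \<in> carrier A" for c using p.sn_simps(2) q.sn_simps(2) that by blast
  have sv: "p (s v) \<le> 1" "q (s v) \<le> 1" using adapted_vertex[OF p vT(2)] adapted_vertex[OF q vT(2)] by simp_all
  have comp: "p (s v \<otimes> c \<otimes> s v) \<le> p c" "q (s v \<otimes> c \<otimes> s v) \<le> q c" if "c \<in> carrier A" for c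
    using that vT sv p.sn_mult_le(2)[of "s v \<otimes> c" "s v"] p.sn_mult_le(1)[of "s v" c] q.sn_mult_le(2)[of "s v \<otimes> c" "s v"] q.sn_mult_le(1)[of "s v" c]
    by simp_all
  have "\<bar>p (s v \<otimes> a \<otimes> s v) - q (s v \<otimes> a \<otimes> s v)\<bar> \<le> 0"
  proof (rule le_0_by_density[OF _ _ _ a, of _ 2])
    fix c d assume c: "c \<in> carrier A" "d \<in> carrier A"
    let ?c = "s v \<otimes> c \<otimes> s v" and ?d = "s v \<otimes> d \<otimes> s v"
    have cl: "?c \<in> carrier A" "?d \<in> carrier A" using c vT by simp_all
    have "?c \<ominus> ?d = s v \<otimes> (c \<ominus> d) \<otimes> s v" using c vT by (simp add: A.mult_diff)
    then have "p (?c \<ominus> ?d) \<le> nrm A (c \<ominus> d)" "q (?c \<ominus> ?d) \<le> nrm A (c \<ominus> d)"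
      using comp[of "c \<ominus> d"] pq[of "c \<ominus> d"] c by auto
    then show "\<bar>p ?c - q ?c\<bar> \<le> \<bar>p ?d - q ?d\<bar> + 2 * nrm A (c \<ominus> d)"
      using p.sn_le_diff[OF cl] p.sn_le_diff[OF cl(2,1)] q.sn_le_diff[OF cl] q.sn_le_diff[OF cl(2,1)] p.sn_diff_sym[OF cl] q.sn_diff_sym[OF cl]
      by linarith
  next
    fix b assume "b \<in> mspan (\<lambda>a b. True)"
    then show "\<bar>p (s v \<otimes> b \<otimes> s v) - q (s v \<otimes> b \<otimes> s v)\<bar> \<le> 0"
      using span_le[OF p q corner_of_mspan] span_le[OF q p corner_of_mspan] by simp
  qed simp
  then show ?thesis by simp
qed

end

section \<open>Schur's lemma\<close>

context hilbert_space
begin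

sublocale BB: cstar_algebra BH by (rule BH_cstar)

abbreviation closed_sub :: "'h set \<Rightarrow> bool" where
  "closed_sub K \<equiv> submodule K complex_ring H \<and> closedin (Metric_space.mtopology (carrier H) (norm_dist H (hnorm H))) K"

lemma closed_subI:
  assumes "K \<subseteq> carrier H" "\<zero> \<in> K" "\<And>x y. x \<in> K \<Longrightarrow> y \<in> K \<Longrightarrow> x \<oplus> y \<in> K" "\<And>c x. x \<in> K \<Longrightarrow> c \<odot> x \<in> K"
    "\<And>X l. (\<And>n. X n \<in> K) \<Longrightarrow> tends X l \<Longrightarrow> l \<in> K"
  shows "closed_sub K"
proof
  show "submodule K complex_ring H"
  proof (rule submoduleI)
    show "\<ominus> x \<in> K" if "x \<in> K" for x using assms(4)[OF that, of "-1"] smult_minus(1)[of x 1] assms(1) that by auto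
  qed (use assms in auto)
  show "closedin (Metric_space.mtopology (carrier H) (norm_dist H (hnorm H))) K"
    unfolding closed_iff using assms(1,5) by blast
qed

lemma closed_subD:
  assumes "closed_sub K"
  shows "K \<subseteq> carrier H" "(\<And>n. X n \<in> K) \<Longrightarrow> tends X l \<Longrightarrow> l \<in> K"
  using assms unfolding closed_iff by blast+

lemma closed_sub_equaliser:
  assumes "S \<in> carrier BH" "R \<in> carrier BH" "P \<in> carrier BH"
  shows "closed_sub {x \<in> carrier H. P x = x \<and> S x = R x}"
proof (rule closed_subI)
  fix X l assume X: "\<And>n. X n \<in> {x \<in> carrier H. P x = x \<and> S x = R x}" "tends X l"
  have "tends (\<lambda>n. S (X n)) (R l)" using bop_tends[OF assms(2) X(2)] X(1) by simp
  moreover have "tends (\<lambda>n. P (X n)) l" using X by simp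
  ultimately show "l \<in> {x \<in> carrier H. P x = x \<and> S x = R x}"
    using tends_unique[OF bop_tends[OF assms(1) X(2)]] tends_unique[OF bop_tends[OF assms(3) X(2)]] tendsD(2)[OF X(2)] by blast
qed (use assms in \<open>auto simp: bopD(3,4)\<close>)

text \<open>Irreducibility on the range of a projection, stated inside \<open>\<B>(H)\<close> so that a corner does not need a Hilbert space of its own.\<close>

definition irreducible_on :: "('h \<Rightarrow> 'h) set \<Rightarrow> ('h \<Rightarrow> 'h) \<Rightarrow> bool" where
  "irreducible_on M P \<longleftrightarrow> BB.is_proj P \<and> (\<forall>m \<in> M. m \<in> carrier BH \<and> P \<otimes>\<^sub>B m = m \<and> m \<otimes>\<^sub>B P = m) \<and>
     (\<forall>K. closed_sub K \<longrightarrow> (\<forall>x \<in> K. P x = x) \<longrightarrow> (\<forall>m \<in> M. \<forall>x \<in> K. m x \<in> K) \<longrightarrow> K = {\<zero>} \<or> (\<forall>x \<in> carrier H. P x \<in> K))"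

definition commutant_on :: "('h \<Rightarrow> 'h) set \<Rightarrow> ('h \<Rightarrow> 'h) \<Rightarrow> ('h \<Rightarrow> 'h) \<Rightarrow> bool" where
  "commutant_on M P h \<longleftrightarrow> h \<in> carrier BH \<and> P \<otimes>\<^sub>B h = h \<and> h \<otimes>\<^sub>B P = h \<and> (\<forall>m \<in> M. h \<otimes>\<^sub>B m = m \<otimes>\<^sub>B h)"

lemma irreducible_onD:
  assumes "irreducible_on M P"
  shows "P \<in> carrier BH" "star BH P = P" "P \<otimes>\<^sub>B P = P" "m \<in> M \<Longrightarrow> m \<in> carrier BH" "m \<in> M \<Longrightarrow> P \<otimes>\<^sub>B m = m" "m \<in> M \<Longrightarrow> m \<otimes>\<^sub>B P = m"
    "closed_sub K \<Longrightarrow> (\<And>x. x \<in> K \<Longrightarrow> P x = x) \<Longrightarrow> (\<And>m x. m \<in> M \<Longrightarrow> x \<in> K \<Longrightarrow> m x \<in> K) \<Longrightarrow> K = {\<zero>} \<or> (\<forall>x \<in> carrier H. P x \<in> K)"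
  using assms unfolding irreducible_on_def BB.is_proj_def by blast+

lemma commutant_simps:
  assumes i: "irreducible_on M P"
  shows "commutant_on M P P" "commutant_on M P h \<Longrightarrow> commutant_on M P k \<Longrightarrow> commutant_on M P (h \<oplus>\<^sub>B k)"
    "commutant_on M P h \<Longrightarrow> commutant_on M P (c \<odot>\<^sub>B h)" "commutant_on M P h \<Longrightarrow> commutant_on M P k \<Longrightarrow> commutant_on M P (h \<otimes>\<^sub>B k)"
    "commutant_on M P h \<Longrightarrow> x \<in> carrier H \<Longrightarrow> h x = h (P x)"
proof -
  note D = irreducible_onD[OF i]
  show "commutant_on M P P" using D by (simp add: commutant_on_def)
  show "commutant_on M P (c \<odot>\<^sub>B h)" if "commutant_on M P h"
    using that D by (simp add: commutant_on_def BB.smult_mult_l BB.smult_mult_r)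
  show "h x = h (P x)" if "commutant_on M P h" "x \<in> carrier H"
    using that unfolding commutant_on_def by (metis BH_simps(1))
  assume h: "commutant_on M P h" and k: "commutant_on M P k"
  show "commutant_on M P (h \<oplus>\<^sub>B k)" using h k D by (simp add: commutant_on_def BB.mult_l_distr BB.mult_r_distr)
  show "commutant_on M P (h \<otimes>\<^sub>B k)"
  proof -
    have 1: "P \<otimes>\<^sub>B (h \<otimes>\<^sub>B k) = h \<otimes>\<^sub>B k" using h k D BB.mult_assoc[of P h k] by (simp add: commutant_on_def)
    have 2: "h \<otimes>\<^sub>B k \<otimes>\<^sub>B P = h \<otimes>\<^sub>B k" using h k D BB.mult_assoc[of h k P] by (simp add: commutant_on_def)
    have "h \<otimes>\<^sub>B k \<otimes>\<^sub>B m = m \<otimes>\<^sub>B (h \<otimes>\<^sub>B k)" if "m \<in> M" for m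
      using h k D(4)[OF that] that BB.mult_assoc[of h k m] BB.mult_assoc[of h m k] BB.mult_assoc[of m h k] by (simp add: commutant_on_def)
    then show ?thesis using 1 2 h k by (simp add: commutant_on_def)
  qed
qed

text \<open>The vectors of the range of \<open>P\<close> on which \<open>h\<close> and \<open>k\<close> agree form a closed invariant subspace.\<close>

lemma commutant_eqI:
  assumes i: "irreducible_on M P" and h: "commutant_on M P h" and k: "commutant_on M P k"
    and x: "x \<in> carrier H" "P x = x" "h x = k x" "x \<noteq> \<zero>"
  shows "h = k"
proof (rule bop_eqI)
  note D = irreducible_onD[OF i]
  show hk: "h \<in> carrier BH" "k \<in> carrier BH" using h k by (simp_all add: commutant_on_def)
  define K where "K = {x \<in> carrier H. P x = x \<and> h x = k x}"
  have "K = {\<zero>} \<or> (\<forall>x \<in> carrier H. P x \<in> K)"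
  proof (rule D(7))
    show "closed_sub K" unfolding K_def by (rule closed_sub_equaliser[OF hk D(1)])
    fix m x assume m: "m \<in> M" and x: "x \<in> K"
    have "P (m x) = m x" using D(5)[OF m] x unfolding K_def by (metis (mono_tags, lifting) BH_simps(1) mem_Collect_eq)
    moreover have "h (m x) = m (h x)" "k (m x) = m (k x)"
      using h k m x unfolding K_def commutant_on_def by (metis (mono_tags, lifting) BH_simps(1) mem_Collect_eq)+
    ultimately show "m x \<in> K" using x bopD(2)[OF D(4)[OF m]] by (simp add: K_def)
  qed (simp add: K_def)
  moreover have "x \<in> K" using x by (simp add: K_def)
  ultimately have "\<forall>x \<in> carrier H. P x \<in> K" using x(4) by blast
  then show "h y = k y" if y: "y \<in> carrier H" for y
    using y commutant_simps(5)[OF i h y] commutant_simps(5)[OF i k y] by (simp add: K_def)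
qed

text \<open>Let \<open>q\<close> be the positive square root of \<open>h\<^sup>2\<close>, so that \<open>q\<^sup>2 = h\<^sup>2\<close> and \<open>qh = hq\<close>, hence \<open>(q - h)(q + h) = 0\<close>. The kernels of
  operators commuting with \<open>M\<close> are invariant, so \<open>h = q\<close> or \<open>h = -q\<close>. Now \<open>q \<ge> 0\<close>, so a vector on which the form of \<open>h\<close>
  vanishes lies in the kernel of \<open>h\<close>, which is invariant as well.\<close>

lemma zero_of_null_vector:
  assumes i: "irreducible_on M P" and h: "commutant_on M P h" "star BH h = h" "nrm BH h \<le> 1"
    and v: "v \<in> carrier H" "P v = v" "v \<noteq> \<zero>" "Re \<langle>h v, v\<rangle> = 0"
  shows "h = \<zero>\<^sub>B"
proof -
  note D = irreducible_onD[OF i] and cs = commutant_simps[OF i]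
  have hc: "h \<in> carrier BH" "P \<otimes>\<^sub>B h = h" "h \<otimes>\<^sub>B P = h" using h(1) by (auto simp: commutant_on_def)
  have Pc: "P x \<in> carrier H" if "x \<in> carrier H" for x using bopD(2)[OF D(1) that] .
  have hx: "h x \<in> carrier H" "hnorm H (h x) \<le> hnorm H x" if "x \<in> carrier H" for x
    using bopD(2)[OF hc(1) that] op_norm_le[OF hc(1) that] mult_right_mono[OF h(3) hnorm_nonneg[OF that]] by auto
  have hadj: "\<langle>h x, y\<rangle> = \<langle>x, h y\<rangle>" if "x \<in> carrier H" "y \<in> carrier H" for x y
    using bop_star(2)[OF hc(1) that] h(2) by simp
  define b where "b = P \<ominus>\<^sub>B h \<otimes>\<^sub>B h"
  have bB: "b \<in> carrier BH" using D hc by (simp add: b_def)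
  have b_comm: "commutant_on M P b"
    unfolding b_def BB.minus_eq using cs(2)[OF cs(1) cs(3)[OF cs(4)[OF h(1) h(1)], of "-1"]] D hc BB.smult_minus(1)[of "h \<otimes>\<^sub>B h" 1] by simp
  have bn: "nrm BH b \<le> 1"
  proof (rule op_norm_leI)
    fix x assume x: "x \<in> carrier H"
    define y where "y = P x"
    have y: "y \<in> carrier H" "hnorm H y \<le> hnorm H x"
      using Pc[OF x] op_norm_le[OF D(1) x] BB.proj_nrm_le[of P] D(1-3) mult_right_mono[of "nrm BH P" 1 "hnorm H x"] hnorm_nonneg[OF x]
      by (auto simp: y_def BB.is_proj_def)
    have "b x = y \<ominus> h (h y)"
      using x hc D cs(5)[OF h(1) x] by (simp add: b_def BH_diff_apply y_def)
    moreover have "(hnorm H (y \<ominus> h (h y)))\<^sup>2 \<le> (hnorm H y)\<^sup>2"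
    proof -
      have "\<langle>y, h (h y)\<rangle> = \<langle>h y, h y\<rangle>" using hadj[of y "h y"] hx y by simp
      then have "(hnorm H (y \<ominus> h (h y)))\<^sup>2 = (hnorm H y)\<^sup>2 + (hnorm H (h (h y)))\<^sup>2 - 2 * (hnorm H (h y))\<^sup>2"
        using y hx by (simp add: hnorm_diff_sq hnorm_sq[of "h y"])
      moreover have "(hnorm H (h (h y)))\<^sup>2 \<le> (hnorm H (h y))\<^sup>2" using hx[of "h y"] hx[of y] y by (intro power_mono) auto
      ultimately show ?thesis using zero_le_power2[of "hnorm H (h y)"] by linarith
    qed
    ultimately have "(hnorm H (b x))\<^sup>2 \<le> (hnorm H y)\<^sup>2" by simp
    then have "hnorm H (b x) \<le> hnorm H y" by (rule power2_le_imp_le[OF _ hnorm_nonneg[OF y(1)]])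
    then show "hnorm H (b x) \<le> 1 * hnorm H x" using y by simp
  qed simp
  obtain c where c: "c \<in> carrier BH" "nrm BH c \<le> 1" "c \<oplus>\<^sub>B c = b \<oplus>\<^sub>B c \<otimes>\<^sub>B c"
    and cS: "\<And>S. \<lbrakk>\<zero>\<^sub>B \<in> S; \<And>x. x \<in> S \<Longrightarrow> x \<in> carrier BH \<Longrightarrow> (1/2) \<odot>\<^sub>B (b \<oplus>\<^sub>B x \<otimes>\<^sub>B x) \<in> S;
       \<And>X l. (\<And>n. X n \<in> S) \<Longrightarrow> BB.tends X l \<Longrightarrow> l \<in> S\<rbrakk> \<Longrightarrow> c \<in> S"
    using BB.quasi_sqrt[OF bB bn] by metis
  define M' where "M' = insert h M"
  have i': "commutant_on M' P y \<longleftrightarrow> commutant_on M P y \<and> y \<otimes>\<^sub>B h = h \<otimes>\<^sub>B y" for y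
    by (auto simp: commutant_on_def M'_def)
  have M'c: "m \<in> carrier BH" if "m \<in> M'" for m using that D hc by (auto simp: M'_def)
  have bh: "commutant_on M' P b"
    unfolding i' using b_comm hc D by (simp add: b_def BB.mult_diff BB.mult_assoc)
  have "c \<in> {y. commutant_on M' P y}"
  proof (rule cS)
    show "\<zero>\<^sub>B \<in> {y. commutant_on M' P y}" using D M'c by (simp add: commutant_on_def)
    fix y assume "y \<in> {y. commutant_on M' P y}" "y \<in> carrier BH"
    then have y: "commutant_on M P y" "y \<otimes>\<^sub>B h = h \<otimes>\<^sub>B y" "y \<in> carrier BH" unfolding i' by auto
    have "commutant_on M P ((1/2) \<odot>\<^sub>B (b \<oplus>\<^sub>B y \<otimes>\<^sub>B y))" by (intro cs(2-4) b_comm y(1))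
    moreover have "(y \<otimes>\<^sub>B y) \<otimes>\<^sub>B h = h \<otimes>\<^sub>B (y \<otimes>\<^sub>B y)"
      using y(2,3) hc(1) BB.mult_assoc[of y y h] BB.mult_assoc[of y h y] BB.mult_assoc[of h y y] by simp
    moreover have "b \<otimes>\<^sub>B h = h \<otimes>\<^sub>B b" using bh unfolding i' by blast
    ultimately show "(1/2) \<odot>\<^sub>B (b \<oplus>\<^sub>B y \<otimes>\<^sub>B y) \<in> {y. commutant_on M' P y}"
      unfolding i' using y(3) bB hc(1) by (simp add: i' BB.smult_mult_l BB.smult_mult_r BB.mult_l_distr BB.mult_r_distr)
  next
    fix X l assume X: "\<And>n. X n \<in> {y. commutant_on M' P y}" "BB.tends X l"
    have com: "l \<otimes>\<^sub>B m = m \<otimes>\<^sub>B l" if m: "m \<in> M'" for m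
    proof (rule BB.tends_unique)
      show "BB.tends (\<lambda>n. X n \<otimes>\<^sub>B m) (l \<otimes>\<^sub>B m)" by (rule BB.tends_mult[OF X(2) BB.tends_const[OF M'c[OF m]]])
      have "(\<lambda>n. X n \<otimes>\<^sub>B m) = (\<lambda>n. m \<otimes>\<^sub>B X n)" using X(1) m by (auto simp: commutant_on_def)
      then show "BB.tends (\<lambda>n. X n \<otimes>\<^sub>B m) (m \<otimes>\<^sub>B l)" using BB.tends_mult[OF BB.tends_const[OF M'c[OF m]] X(2)] by simp
    qed
    have "(\<lambda>n. P \<otimes>\<^sub>B X n) = X" "(\<lambda>n. X n \<otimes>\<^sub>B P) = X" using X(1) by (auto simp: commutant_on_def)
    then have "P \<otimes>\<^sub>B l = l" "l \<otimes>\<^sub>B P = l"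
      using BB.tends_unique[OF BB.tends_mult[OF BB.tends_const[OF D(1)] X(2)]] BB.tends_unique[OF BB.tends_mult[OF X(2) BB.tends_const[OF D(1)]]] X(2) by simp_all
    then show "l \<in> {y. commutant_on M' P y}" using com BB.tendsD(2)[OF X(2)] by (simp add: commutant_on_def)
  qed
  then have cM: "commutant_on M P c" "c \<otimes>\<^sub>B h = h \<otimes>\<^sub>B c" unfolding i' by auto
  have cx: "c x \<in> carrier H" "hnorm H (c x) \<le> hnorm H x" if "x \<in> carrier H" for x
    using bopD(2)[OF c(1) that] op_norm_le[OF c(1) that] mult_right_mono[OF c(2) hnorm_nonneg[OF that]] by auto
  define q where "q = P \<ominus>\<^sub>B c"
  have qB: "q \<in> carrier BH" using D c by (simp add: q_def)
  have q_comm: "commutant_on M P q"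
    unfolding q_def BB.minus_eq using cs(2)[OF cs(1) cs(3)[OF cM(1), of "-1"]] c(1) BB.smult_minus(1)[of c 1] by simp
  have qP: "q y = y \<ominus> c y" if "y \<in> carrier H" "P y = y" for y
    using that D c BH_diff_apply by (simp add: q_def)
  have qh: "q (q y) = h (h y)" if y: "y \<in> carrier H" "P y = y" for y
  proof -
    have Pcy: "P (c y) = c y" using cM(1) y(1) unfolding commutant_on_def by (metis BH_simps(1))
    have cc: "c y \<oplus> c y = (y \<ominus> h (h y)) \<oplus> c (c y)"
      using arg_cong[OF c(3), of "\<lambda>z. z y"] y hc(1) c(1) D(1) by (simp add: b_def BH_diff_apply)
    have "q (q y) = (y \<ominus> c y) \<ominus> (c y \<ominus> c (c y))"
      unfolding qP[OF y] using bop_diff[OF qB y(1) cx(1)[OF y(1)]] qP[OF y] qP[OF cx(1)[OF y(1)] Pcy] by simp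
    also have "\<dots> = h (h y)"
    proof (rule vec_eqI)
      fix w assume w: "w \<in> carrier H"
      have "\<langle>c y \<oplus> c y, w\<rangle> = \<langle>(y \<ominus> h (h y)) \<oplus> c (c y), w\<rangle>" using cc by simp
      then show "\<langle>(y \<ominus> c y) \<ominus> (c y \<ominus> c (c y)), w\<rangle> = \<langle>h (h y), w\<rangle>"
        using y w cx hx by (simp add: ip_simps algebra_simps)
    qed (use y cx hx in auto)
    finally show ?thesis .
  qed
  have qhc: "q (h y) = h (q y)" if y: "y \<in> carrier H" for y
  proof -
    have "q \<otimes>\<^sub>B h = h \<otimes>\<^sub>B q" using cM(2) hc D c(1) by (simp add: q_def BB.mult_diff)
    then show ?thesis using y by (metis BH_simps(1))
  qed
  have Pinv: "P (k y) = k y" if "commutant_on M P k" "y \<in> carrier H" for k y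
    using that unfolding commutant_on_def by (metis BH_simps(1))
  have "q v = h v \<or> q v \<oplus> h v = \<zero>"
  proof (rule disjCI)
    assume ne: "q v \<oplus> h v \<noteq> \<zero>"
    have qv: "q v \<in> carrier H" "h v \<in> carrier H" using bopD(2)[OF qB v(1)] hx v(1) by auto
    have "q = h"
    proof (rule commutant_eqI[OF i q_comm h(1) _ _ _ ne])
      show "q v \<oplus> h v \<in> carrier H" using qv by simp
      show "P (q v \<oplus> h v) = q v \<oplus> h v"
        using Pinv[OF q_comm v(1)] Pinv[OF h(1) v(1)] bopD(3)[OF D(1) qv] by simp
      show "q (q v \<oplus> h v) = h (q v \<oplus> h v)"
        using bopD(3)[OF qB qv] bopD(3)[OF hc(1) qv] qh[OF v(1,2)] qhc[OF v(1)] qv hx a_comm[of "h (h v)" "h (q v)"] by simp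
    qed
    then show "q v = h v" by simp
  qed
  moreover have "q v = \<zero>"
  proof -
    have qv: "q v \<in> carrier H" "h v \<in> carrier H" using bopD(2)[OF qB v(1)] hx v(1) by auto
    have "Re \<langle>q v \<oplus> h v, v\<rangle> = Re \<langle>q v, v\<rangle> + Re \<langle>h v, v\<rangle>" using qv v by (simp add: ip_simps)
    then have "Re \<langle>q v, v\<rangle> = 0" using calculation v(1,4) by auto
    then have "Re \<langle>c v, v\<rangle> = (hnorm H v)\<^sup>2" unfolding qP[OF v(1,2)] using v cx by (simp add: ip_diff hnorm_sq)
    moreover have "(hnorm H (c v))\<^sup>2 \<le> (hnorm H v)\<^sup>2" using cx[OF v(1)] by (intro power_mono) auto
    ultimately have "(hnorm H (c v \<ominus> v))\<^sup>2 \<le> 0" using v cx by (simp add: hnorm_diff_sq)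
    then have "c v \<ominus> v = \<zero>" using hnorm_eq_0 v cx by simp
    then show ?thesis unfolding qP[OF v(1,2)] using v cx a_minus_eq_0 by metis
  qed
  ultimately have "h v = \<zero>" using hx[OF v(1)] by auto
  moreover have "commutant_on M P \<zero>\<^sub>B" using D by (simp add: commutant_on_def)
  ultimately show ?thesis using commutant_eqI[OF i h(1) _ v(1,2) _ v(3), of "\<zero>\<^sub>B"] v(1) by simp
qed

lemma schur_selfadjoint:
  assumes i: "irreducible_on M P" and h: "commutant_on M P h" "star BH h = h"
  shows "\<exists>t :: real. h = of_real t \<odot>\<^sub>B P"
proof (cases "\<exists>x \<in> carrier H. P x \<noteq> \<zero>")
  case False
  note D = irreducible_onD[OF i]
  have hc: "h \<in> carrier BH" using h by (simp add: commutant_on_def)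
  have "h x = \<zero>" if "x \<in> carrier H" for x
    using commutant_simps(5)[OF i h(1) that] False that hc by simp
  then have "h = of_real 0 \<odot>\<^sub>B P" by (intro bop_eqI) (use hc D(1) bopD(2)[OF D(1)] in auto)
  then show ?thesis by blast
next
  case True
  note D = irreducible_onD[OF i] and cs = commutant_simps[OF i]
  have hc: "h \<in> carrier BH" using h by (simp add: commutant_on_def)
  obtain x0 where x0: "x0 \<in> carrier H" "P x0 \<noteq> \<zero>" using True by blast
  define y where "y = P x0"
  have y: "y \<in> carrier H" "y \<noteq> \<zero>" "P y = y"
    using x0 bopD(2)[OF D(1) x0(1)] D(3) unfolding y_def by (auto) (metis BH_simps(1))
  \<comment> \<open>\<open>t\<close> is the mean of \<open>h\<close> in the vector \<open>y\<close>, and \<open>k = r(h - t)\<close> is a contraction with mean \<open>0\<close>.\<close>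
  define t where "t = Re \<langle>h y, y\<rangle> / (hnorm H y)\<^sup>2"
  define k0 where "k0 = h \<oplus>\<^sub>B of_real (- t) \<odot>\<^sub>B P"
  have k0c: "k0 \<in> carrier BH" using hc D(1) by (simp add: k0_def)
  define r where "r = inverse (nrm BH k0 + 1)"
  have r: "r > 0" "r * nrm BH k0 \<le> 1" using op_norm_nonneg[OF k0c] by (simp_all add: r_def divide_le_eq inverse_eq_divide)
  have "of_real r \<odot>\<^sub>B k0 = \<zero>\<^sub>B"
  proof (rule zero_of_null_vector[OF i _ _ _ y(1,3,2)])
    show "commutant_on M P (of_real r \<odot>\<^sub>B k0)" unfolding k0_def by (intro cs(2,3) h(1) cs(1))
    show "star BH (of_real r \<odot>\<^sub>B k0) = of_real r \<odot>\<^sub>B k0"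
      using hc D(1,2) h(2) by (simp add: k0_def BB.star_add BB.star_smult del: of_real_minus)
    show "nrm BH (of_real r \<odot>\<^sub>B k0) \<le> 1" unfolding BB.nrm_smult[OF k0c] using r by simp
    have "k0 y = h y \<oplus> of_real (- t) \<odot> y" using y hc D(1) by (simp add: k0_def del: of_real_minus)
    then have "Re \<langle>k0 y, y\<rangle> = Re \<langle>h y, y\<rangle> - t * (hnorm H y)\<^sup>2"
      using y bopD(2)[OF hc y(1)] by (simp add: ip_simps ip_self del: of_real_minus)
    also have "\<dots> = 0" using hnorm_eq_0[OF y(1)] y(2) by (simp add: t_def)
    finally show "Re \<langle>(of_real r \<odot>\<^sub>B k0) y, y\<rangle> = 0" using y bopD(2)[OF k0c y(1)] by (simp add: ip_simps)
  qed
  then have "cmod (of_real r) * nrm BH k0 = 0" using BB.nrm_smult[OF k0c, of "of_real r"] BB.nrm_eq_0 BB.zero_closed by metis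
  then have "k0 = \<zero>\<^sub>B" using r BB.nrm_eq_0[OF k0c] by simp
  then have "h = of_real t \<odot>\<^sub>B P"
    using BB.diff_eq_0[of h "of_real t \<odot>\<^sub>B P"] hc D(1) by (simp add: k0_def BB.minus_eq)
  then show ?thesis by blast
qed

lemma schur:
  assumes i: "irreducible_on M P" and h: "commutant_on M P h" "commutant_on M P (star BH h)"
  shows "\<exists>c. h = c \<odot>\<^sub>B P"
proof -
  note D = irreducible_onD[OF i] and cs = commutant_simps[OF i]
  have hc: "h \<in> carrier BH" using h by (simp add: commutant_on_def)
  define a where "a = h \<oplus>\<^sub>B star BH h"
  define b where "b = \<i> \<odot>\<^sub>B (h \<oplus>\<^sub>B (-1) \<odot>\<^sub>B star BH h)"
  have a: "commutant_on M P a" "star BH a = a" using cs(2)[OF h] hc by (simp_all add: a_def BB.star_add BB.a_comm)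
  have "commutant_on M P b" unfolding b_def by (intro cs(2,3) h)
  moreover have "star BH b = b"
    using hc by (simp add: b_def BB.star_smult BB.star_add BB.smult_simps BB.a_comm del: BB.smult_minus)
  ultimately obtain t u :: real where tu: "a = of_real t \<odot>\<^sub>B P" "b = of_real u \<odot>\<^sub>B P"
    using schur_selfadjoint[OF i] a by blast
  have "h = (1/2) \<odot>\<^sub>B (a \<oplus>\<^sub>B (- \<i>) \<odot>\<^sub>B b)"
  proof (rule bop_eqI[OF hc])
    fix x assume x: "x \<in> carrier H"
    have c: "h x \<in> carrier H" "star BH h x \<in> carrier H" using bopD(2)[OF hc x] bopD(2)[OF bop_star(1)[OF hc] x] by auto
    show "h x = ((1/2) \<odot>\<^sub>B (a \<oplus>\<^sub>B (- \<i>) \<odot>\<^sub>B b)) x"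
      by (rule vec_eqI) (use x c in \<open>simp_all add: a_def b_def ip_simps algebra_simps del: smult_minus BB.smult_minus\<close>)
  qed (use hc in \<open>simp add: a_def b_def\<close>)
  also have "\<dots> = ((1/2) * (of_real t + (- \<i>) * of_real u)) \<odot>\<^sub>B P"
    unfolding tu using D(1) BB.smult_simps(1)[OF D(1), of "of_real t / 2" "- (\<i> * of_real u / 2)"]
    by (simp add: BB.smult_simps(2,3) diff_divide_distrib del: BB.smult_minus)
  finally show ?thesis by blast
qed

end

section \<open>Irreducible representations\<close>

locale irr_rep = cstar_rep A H \<pi> for A :: "'a cstar" and H :: "'h hilbert" and \<pi> +
  assumes irr: "irreducible_rep A H \<pi>"
begin

lemma invariant_total:
  assumes "H.closed_sub K" "\<And>a x. a \<in> carrier A \<Longrightarrow> x \<in> K \<Longrightarrow> \<pi> a x \<in> K" "x \<in> K" "x \<noteq> \<zero>\<^bsub>H\<^esub>"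
  shows "K = carrier H"
  using irr assms unfolding irreducible_rep_def by blast

lemma nonzero: "\<exists>a \<in> carrier A. \<pi> a \<noteq> \<zero>\<^sub>B"
  using irr unfolding irreducible_rep_def by blast

text \<open>The vectors whose orbit is mapped into \<open>K\<close> by \<open>S\<close> form a closed invariant subspace.\<close>

lemma orbit_total:
  assumes S: "S \<in> carrier H.BH" and K: "H.closed_sub K" and x: "x \<in> carrier H" "x \<noteq> \<zero>\<^bsub>H\<^esub>" "\<And>a. a \<in> carrier A \<Longrightarrow> S (\<pi> a x) \<in> K"
    and a: "a \<in> carrier A" and y: "y \<in> carrier H"
  shows "S (\<pi> a y) \<in> K"
proof -
  define L where "L = {y \<in> carrier H. \<forall>a \<in> carrier A. S (\<pi> a y) \<in> K}"
  note SD = H.bopD(2-4)[OF S]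
  have sub: "submodule K complex_ring H" using K by blast
  have K0: "\<zero>\<^bsub>H\<^esub> \<in> K" "\<And>x y. x \<in> K \<Longrightarrow> y \<in> K \<Longrightarrow> x \<oplus>\<^bsub>H\<^esub> y \<in> K" "\<And>c x. x \<in> K \<Longrightarrow> c \<odot>\<^bsub>H\<^esub> x \<in> K"
    using submodule_simps[OF sub] by simp_all
  note S0 = H.bop_zero[OF S] and p0 = H.bop_zero[OF rep_closed]
  have "L = carrier H"
  proof (rule invariant_total)
    show "H.closed_sub L"
    proof (rule H.closed_subI)
      show "\<zero>\<^bsub>H\<^esub> \<in> L" using S0 p0 K0 by (simp add: L_def)
      show "u \<oplus>\<^bsub>H\<^esub> w \<in> L" if "u \<in> L" "w \<in> L" for u w
        using that K0(2) SD H.bopD(3)[OF rep_closed] by (simp add: L_def)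
      show "c \<odot>\<^bsub>H\<^esub> u \<in> L" if "u \<in> L" for c u
        using that K0(3) SD H.bopD(4)[OF rep_closed] by (simp add: L_def)
      fix X l assume X: "\<And>n. X n \<in> L" "H.tends X l"
      have "S (\<pi> b l) \<in> K" if b: "b \<in> carrier A" for b
        by (rule H.closed_subD(2)[OF K _ H.bop_tends[OF S H.bop_tends[OF rep_closed[OF b] X(2)]]]) (use X(1) b in \<open>auto simp: L_def\<close>)
      then show "l \<in> L" using H.tendsD(2)[OF X(2)] by (simp add: L_def)
    qed (auto simp: L_def)
    fix b u assume b: "b \<in> carrier A" and u: "u \<in> L"
    have "\<pi> c (\<pi> b u) = \<pi> (c \<otimes>\<^bsub>A\<^esub> b) u" if "c \<in> carrier A" for c
      using that b u by (simp add: rep_simps L_def)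
    then show "\<pi> b u \<in> L" using b u by (simp add: L_def)
  next
    show "x \<in> L" using x by (simp add: L_def)
  qed (rule x)
  then show ?thesis using a y by (auto simp: L_def)
qed

text \<open>If \<open>\<pi>(c)x \<noteq> 0\<close>, then \<open>\<pi>(b)\<close> kills the orbit of this vector, hence every orbit, in particular all \<open>\<pi>(b\<^sup>*)y\<close>.\<close>

lemma prime:
  assumes b: "b \<in> carrier A" and c: "c \<in> carrier A" and 0: "\<And>a. a \<in> carrier A \<Longrightarrow> rep_norm (b \<otimes>\<^bsub>A\<^esub> a \<otimes>\<^bsub>A\<^esub> c) = 0"
  shows "rep_norm b = 0 \<or> rep_norm c = 0"
proof (rule disjCI)
  assume "rep_norm c \<noteq> 0"
  then have "\<pi> c \<noteq> \<zero>\<^sub>B" using c by (simp add: rep_norm_def H.BB.nrm_eq_0)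
  then obtain x where x: "x \<in> carrier H" "\<pi> c x \<noteq> \<zero>\<^bsub>H\<^esub>"
    using H.bop_eqI[OF rep_closed[OF c] H.BB.zero_closed] by auto
  have K: "H.closed_sub {\<zero>\<^bsub>H\<^esub>}"
  proof (rule H.closed_subI)
    fix X l assume X: "\<And>n. X n \<in> {\<zero>\<^bsub>H\<^esub>}" "H.tends X l"
    have "X = (\<lambda>n. \<zero>\<^bsub>H\<^esub>)" using X(1) by auto
    then show "l \<in> {\<zero>\<^bsub>H\<^esub>}" using H.tends_unique[OF _ H.tends_const[OF H.zero_closed], of l] X(2) by simp
  qed auto
  have "\<pi> b (\<pi> (star A b) y) \<in> {\<zero>\<^bsub>H\<^esub>}" if y: "y \<in> carrier H" for y
  proof (rule orbit_total[OF rep_closed[OF b] K _ x(2)])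
    fix a assume a: "a \<in> carrier A"
    have "\<pi> (b \<otimes>\<^bsub>A\<^esub> a \<otimes>\<^bsub>A\<^esub> c) = \<zero>\<^sub>B" using 0[OF a] a b c by (simp add: rep_norm_def H.BB.nrm_eq_0)
    then have "\<pi> (b \<otimes>\<^bsub>A\<^esub> a \<otimes>\<^bsub>A\<^esub> c) x = \<zero>\<^bsub>H\<^esub>" using x by simp
    then show "\<pi> b (\<pi> a (\<pi> c x)) \<in> {\<zero>\<^bsub>H\<^esub>}" using a b c x by (simp add: rep_simps)
  qed (use b c x y in auto)
  then have "\<pi> b \<otimes>\<^sub>B star H.BH (\<pi> b) = \<zero>\<^sub>B"
    by (intro H.bop_eqI) (use b in \<open>auto simp: rep_simps(4)[symmetric] H.BB.mult_closed\<close>)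
  then show "rep_norm b = 0"
    using H.BB.cstar_identity[of "star H.BH (\<pi> b)"] b H.BB.nrm_star[of "\<pi> b"] by (simp add: rep_norm_def)
qed

text \<open>If \<open>K\<close> is invariant under the corner and \<open>x \<in> K\<close>, then \<open>\<pi>(e)\<close> maps the orbit of \<open>x\<close> into \<open>K\<close>, and hence every orbit if \<open>x \<noteq> 0\<close>.\<close>

lemma corner_irreducible:
  assumes e: "A.is_proj e"
  shows "H.irreducible_on {\<pi> (e \<otimes>\<^bsub>A\<^esub> a \<otimes>\<^bsub>A\<^esub> e) | a. a \<in> carrier A} (\<pi> e)"
  unfolding H.irreducible_on_def
proof (intro conjI allI impI ballI)
  have ec: "e \<in> carrier A" "star A e = e" "e \<otimes>\<^bsub>A\<^esub> e = e" using e by (auto simp: A.is_proj_def)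
  have ee: "\<pi> e (\<pi> e x) = \<pi> e x" if "x \<in> carrier H" for x using that ec rep_simps(2)[of e e] H.BH_simps(1) by metis
  show "H.BB.is_proj (\<pi> e)" using ec rep_simps(2)[of e e] rep_simps(4)[of e] by (simp add: H.BB.is_proj_def)
  {
    fix m assume "m \<in> {\<pi> (e \<otimes>\<^bsub>A\<^esub> a \<otimes>\<^bsub>A\<^esub> e) | a. a \<in> carrier A}"
    then obtain a where a: "a \<in> carrier A" "m = \<pi> (e \<otimes>\<^bsub>A\<^esub> a \<otimes>\<^bsub>A\<^esub> e)" by blast
    show "m \<in> carrier H.BH" using a ec by simp
    have "e \<otimes>\<^bsub>A\<^esub> (e \<otimes>\<^bsub>A\<^esub> a \<otimes>\<^bsub>A\<^esub> e) = e \<otimes>\<^bsub>A\<^esub> a \<otimes>\<^bsub>A\<^esub> e" using a ec A.mult_assoc[of e e "a \<otimes>\<^bsub>A\<^esub> e"] by (simp add: A.mult_assoc)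
    then show "\<pi> e \<otimes>\<^sub>B m = m" using a ec rep_simps(2)[of e "e \<otimes>\<^bsub>A\<^esub> a \<otimes>\<^bsub>A\<^esub> e"] by simp
    have "(e \<otimes>\<^bsub>A\<^esub> a \<otimes>\<^bsub>A\<^esub> e) \<otimes>\<^bsub>A\<^esub> e = e \<otimes>\<^bsub>A\<^esub> a \<otimes>\<^bsub>A\<^esub> e" using a ec by (simp add: A.mult_assoc)
    then show "m \<otimes>\<^sub>B \<pi> e = m" using a ec rep_simps(2)[of "e \<otimes>\<^bsub>A\<^esub> a \<otimes>\<^bsub>A\<^esub> e" e] by simp
  }
  fix K assume K: "H.closed_sub K" and KP: "\<forall>x\<in>K. \<pi> e x = x"
    and inv: "\<forall>m\<in>{\<pi> (e \<otimes>\<^bsub>A\<^esub> a \<otimes>\<^bsub>A\<^esub> e) | a. a \<in> carrier A}. \<forall>x\<in>K. m x \<in> K"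
  have sub: "submodule K complex_ring H" using K by blast
  show "K = {\<zero>\<^bsub>H\<^esub>} \<or> (\<forall>x \<in> carrier H. \<pi> e x \<in> K)"
  proof (cases "K = {\<zero>\<^bsub>H\<^esub>}")
    case False
    then obtain x where x: "x \<in> K" "x \<noteq> \<zero>\<^bsub>H\<^esub>" using submodule_simps[OF sub] by blast
    have xH: "x \<in> carrier H" using H.closed_subD(1)[OF K] x by blast
    have "\<pi> e (\<pi> a x) \<in> K" if a: "a \<in> carrier A" for a
    proof -
      have "\<pi> (e \<otimes>\<^bsub>A\<^esub> a \<otimes>\<^bsub>A\<^esub> e) x = \<pi> e (\<pi> a x)" using a ec xH KP x by (simp add: rep_simps)
      moreover have "\<pi> (e \<otimes>\<^bsub>A\<^esub> a \<otimes>\<^bsub>A\<^esub> e) x \<in> K" using inv x a by blast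
      ultimately show ?thesis by simp
    qed
    then have "\<pi> e (\<pi> e y) \<in> K" if "y \<in> carrier H" for y
      using orbit_total[OF rep_closed[OF ec(1)] K xH x(2)] ec(1) that by blast
    then show ?thesis using ee by simp
  qed simp
qed

end

sublocale cstar_rep \<subseteq> N: cseminorm A rep_norm
  by unfold_locales (rule rep_seminorm)

context cstar_rep
begin

lemma kernel_eq: "a_kernel A H.BH \<pi> = N.ker" by (simp add: kernel_iff N.ker_def)

lemma ker_rep: "a \<in> N.ker \<longleftrightarrow> a \<in> carrier A \<and> \<pi> a = \<zero>\<^sub>B"
  by (auto simp: N.ker_def rep_norm_def H.BB.nrm_eq_0)

end

section \<open>The maximal tail and the character of a primitive ideal\<close>

context rf_k_graph
begin

text \<open>The partial bijection \<open>\<nu>\<^sup>*\<mu>\<close> moves the paths \<open>e\<close> with range \<open>s(\<mu>)\<close> within their equivalence classes.\<close>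

lemma per_equiv_action:
  assumes "per_equiv G a b" "e \<in> mor G" "rng G e = src G a" "deg G b \<le> deg G e"
  obtains e' where "e' \<in> mor G" "rng G e' = src G a" "a \<cdot> e = b \<cdot> e'" "per_equiv G e e'" "deg G e' + deg G b = deg G e + deg G a"
proof -
  note D = per_equivD[OF assms(1)]
  have "per_equiv G (b \<cdot> e) (a \<cdot> e)" using per_equiv_right[OF per_equiv_sym[OF assms(1)], of e] D assms by simp
  moreover have "deg G b \<le> deg G (a \<cdot> e)" using D assms order_trans[OF assms(4), of "deg G a + deg G e"] by simp
  ultimately obtain e' where e': "e' \<in> mor G" "src G b = rng G e'" "a \<cdot> e = b \<cdot> e'" "per_equiv G e e'"
    using per_equiv_left_cancel[of b e "a \<cdot> e"] D assms by metis
  have "deg G a + deg G e = deg G b + deg G e'" using arg_cong[OF e'(3), of "deg G"] D(1-3) e'(1,2) assms(2,3) by simp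
  then have "deg G e' + deg G b = deg G e + deg G a" by (simp add: add.commute)
  then show ?thesis using that[of e'] e' D by simp
qed

end

locale irr_graph = graph_cstar G A s + irr_rep A H \<pi>
  for G :: "('l, 'k::finite) kgraph" and A :: "'a cstar" and s and H :: "'h hilbert" and \<pi>
begin

text \<open>By density it suffices to test the elements \<open>s\<^sub>b s\<^sub>c\<^sup>*\<close>. The second product makes the lemma apply to commutators.\<close>

lemma dense_ker:
  assumes "x \<in> carrier A" "y \<in> carrier A" "x' \<in> carrier A" "y' \<in> carrier A" and a: "a \<in> carrier A"
    and gen: "\<And>b c. b \<in> mor G \<Longrightarrow> c \<in> mor G \<Longrightarrow> src G b = src G c \<Longrightarrow> x \<otimes> (s b \<otimes> (s c)\<^sup>\<star>) \<otimes> y \<ominus> x' \<otimes> (s b \<otimes> (s c)\<^sup>\<star>) \<otimes> y' \<in> N.ker"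
  shows "x \<otimes> a \<otimes> y \<ominus> x' \<otimes> a \<otimes> y' \<in> N.ker"
proof -
  define f where "f a = x \<otimes> a \<otimes> y \<ominus> x' \<otimes> a \<otimes> y'" for a
  have f_closed: "f a \<in> carrier A" if "a \<in> carrier A" for a using that assms by (simp add: f_def)
  have f_add: "f (a \<oplus> b) = f a \<oplus> f b" if "a \<in> carrier A" "b \<in> carrier A" for a b
    using that assms by (simp add: f_def A.mult_r_distr A.mult_l_distr A.add_diff_add)
  have f_smult: "f (c \<odot> a) = c \<odot> f a" if "a \<in> carrier A" for a c
    using that assms by (simp add: f_def A.smult_mult_l A.smult_mult_r A.smult_diff)
  have f_ker: "f b \<in> N.ker" if "b \<in> mspan (\<lambda>a b. True)" for b
    using that
  proof (induction rule: mspan.induct)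
    case zero show ?case using f_smult[of \<zero> 0] f_closed[of \<zero>] N.ker_simps(1) by simp
  next
    case (step z b c k)
    have "f (s b \<otimes> (s c)\<^sup>\<star>) \<in> N.ker" unfolding f_def using gen step by blast
    then show ?case using step by (simp add: f_add f_smult mspan_carrier N.ker_simps)
  qed
  define K where "K = nrm A x * nrm A y + nrm A x' * nrm A y' + 1"
  have nn: "nrm A x * nrm A y \<ge> 0" "nrm A x' * nrm A y' \<ge> 0" using assms A.nrm_nonneg by simp_all
  have bound: "rep_norm (f c) \<le> K * nrm A c" if c: "c \<in> carrier A" for c
  proof -
    have tri: "nrm A (u \<otimes> c \<otimes> w) \<le> nrm A u * nrm A w * nrm A c" if "u \<in> carrier A" "w \<in> carrier A" for u w
      using A.nrm_mult[of "u \<otimes> c" w] mult_right_mono[OF A.nrm_mult[OF that(1) c], of "nrm A w"] A.nrm_nonneg[OF that(2)] that c by (simp add: mult_ac)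
    have "rep_norm (f c) \<le> nrm A (f c)" using N.sn_simps(2) f_closed[OF c] by blast
    also have "\<dots> \<le> nrm A (x \<otimes> c \<otimes> y) + nrm A (\<ominus>\<^bsub>A\<^esub> (x' \<otimes> c \<otimes> y'))"
      unfolding f_def A.minus_eq by (rule A.nrm_triangle) (use assms c in auto)
    also have "\<dots> \<le> nrm A x * nrm A y * nrm A c + nrm A x' * nrm A y' * nrm A c"
      using tri assms c by (intro add_mono) (simp_all add: A.nrm_uminus)
    also have "\<dots> \<le> K * nrm A c" using A.nrm_nonneg[OF c] by (simp add: K_def algebra_simps)
    finally show ?thesis .
  qed
  have "rep_norm (f a) \<le> 0"
  proof (rule le_0_by_density[OF _ _ _ a])
    fix a b assume ab: "a \<in> carrier A" "b \<in> carrier A"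
    have "a = b \<oplus> (a \<ominus> b)" using ab by (simp add: A.minus_eq A.a_lcomm[of b a "\<ominus>\<^bsub>A\<^esub> b"] A.r_neg)
    then have "f a = f b \<oplus> f (a \<ominus> b)" using f_add[of b "a \<ominus> b"] ab by simp
    then show "rep_norm (f a) \<le> rep_norm (f b) + K * nrm A (a \<ominus> b)"
      using N.sn_simps(5)[of "f b" "f (a \<ominus> b)"] f_closed bound[of "a \<ominus> b"] ab by simp
  qed (use nn f_ker in \<open>auto simp: K_def N.ker_def\<close>)
  then show ?thesis using N.sn_simps(1)[OF f_closed[OF a]] f_closed[OF a] by (simp add: N.ker_def f_def)
qed

lemma ker_prime:
  assumes "x \<in> carrier A" "y \<in> carrier A"
    and "\<And>b c. b \<in> mor G \<Longrightarrow> c \<in> mor G \<Longrightarrow> src G b = src G c \<Longrightarrow> x \<otimes> (s b \<otimes> (s c)\<^sup>\<star>) \<otimes> y \<in> N.ker"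
  shows "x \<in> N.ker \<or> y \<in> N.ker"
proof -
  have "x \<otimes> a \<otimes> y \<in> N.ker" if a: "a \<in> carrier A" for a
    using dense_ker[OF assms(1,2) A.zero_closed A.zero_closed a] assms a by (simp add: A.diff_0)
  then show ?thesis using prime[OF assms(1,2)] assms by (auto simp: N.ker_def)
qed

definition T :: "'l set" where "T = {v \<in> verts G. s v \<notin> N.ker}"

lemma T_iff: "a \<in> mor G \<Longrightarrow> src G a \<in> T \<longleftrightarrow> s a \<notin> N.ker"
  using N.ker_simps(6)[of "s a" "(s a)\<^sup>\<star>"] N.ker_simps(6)[of "s (src G a)" "s a"] s_star_s[of a] s_src[of a] by (auto simp: T_def)

text \<open>Directedness is primeness: if \<open>s\<^sub>v A s\<^sub>w\<close> is not contained in the kernel, some \<open>s\<^sub>b s\<^sub>c\<^sup>*\<close> with \<open>r(b) = v\<close> and \<open>r(c) = w\<close> is not. A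
  vertex all of whose edges of one colour leave \<open>T\<close> does not lie in \<open>T\<close> by the relation for \<open>s\<^sub>v\<close>.\<close>

lemma T_maximal_tail: "maximal_tail G T"
  unfolding maximal_tail_def
proof (intro conjI ballI allI impI)
  show "T \<noteq> {}"
  proof
    assume "T = {}"
    then have "s a \<in> N.ker" if "a \<in> mor G" for a using T_iff[OF that] by simp
    then have "x \<otimes> (s b \<otimes> (s c)\<^sup>\<star>) \<otimes> x \<in> N.ker" if "x \<in> carrier A" "b \<in> mor G" "c \<in> mor G" for x b c
      using that N.ker_simps(5,6) by simp
    then have "x \<in> N.ker" if "x \<in> carrier A" for x using ker_prime[OF that that] that by blast
    then show False using nonzero ker_rep by blast
  qed
  show "T \<subseteq> verts G" by (auto simp: T_def)
next
  fix v w assume v: "v \<in> T" and w: "w \<in> T"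
  have vc: "s v \<in> carrier A" "s w \<in> carrier A" "s v \<notin> N.ker" "s w \<notin> N.ker" "v \<in> verts G" "w \<in> verts G" using v w by (auto simp: T_def)
  then obtain b c where bc: "b \<in> mor G" "c \<in> mor G" "src G b = src G c" "s v \<otimes> (s b \<otimes> (s c)\<^sup>\<star>) \<otimes> s w \<notin> N.ker"
    using ker_prime[OF vc(1,2)] by blast
  have eq: "s v \<otimes> (s b \<otimes> (s c)\<^sup>\<star>) \<otimes> s w = (s v \<otimes> s b) \<otimes> ((s c)\<^sup>\<star> \<otimes> s w)" using bc vc by (simp add: A.mult_assoc)
  have "rng G b = v" "rng G c = w"
    using bc(4) s_vertex_s(1)[OF vc(5) bc(1)] s_vertex_s(2)[OF vc(6) bc(2)] bc(1,2) vc N.ker_simps(1) unfolding eq by (auto split: if_splits)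
  moreover have "src G b \<in> T"
  proof (rule ccontr)
    assume "src G b \<notin> T"
    then have "s b \<in> N.ker" using T_iff bc by blast
    then show False using bc vc N.ker_simps(5,6) by simp
  qed
  ultimately show "\<exists>u\<in>T. connects G v u \<and> connects G w u" using bc connectsI[of b G] connectsI[of c G] by metis
next
  fix v i assume v: "v \<in> T"
  then have vv: "v \<in> verts G" "s v \<in> carrier A" "s v \<notin> N.ker" by (auto simp: T_def)
  show "\<exists>a\<in>mor G. rng G a = v \<and> deg G a = axis i 1 \<and> src G a \<in> T"
  proof (rule ccontr)
    assume neg: "\<not> ?thesis"
    have "s v \<otimes> s v \<otimes> s v \<in> N.ker"
    proof (rule expand_mem[where n = "axis i 1"])
      fix e assume e: "e \<in> mor G" "rng G e = v" "deg G e = axis i 1"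
      then have "s e \<in> N.ker" using neg T_iff by blast
      then show "(s v \<otimes> s e) \<otimes> ((s e)\<^sup>\<star> \<otimes> s v) \<in> N.ker" using e vv N.ker_simps(5,6) by simp
    qed (use vv N.ker_simps N.ker_carrier in auto)
    then show False using vv s_vertex(2)[OF vv(1)] by simp
  qed
next
  fix w v assume w: "w \<in> T" and v: "v \<in> verts G" and c: "connects G v w"
  then obtain a where a: "a \<in> mor G" "rng G a = v" "src G a = w" unfolding connects_def by blast
  then have "s a \<notin> N.ker" using T_iff w by blast
  then show "v \<in> T" using N.ker_simps(5)[of "s v" "s a"] a v s_rng[of a] by (auto simp: T_def)
qed

abbreviation Sg where "Sg \<equiv> tail_graph G T"

sublocale S: directed_k_graph Sg by (rule tail_directed[OF T_maximal_tail])

lemma in_Sg: "per_equiv Sg a b \<Longrightarrow> a \<in> mor G \<and> b \<in> mor G \<and> src G b = src G a \<and> src G a \<in> T \<and> rng G b = rng G a"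
  using S.per_equivD[of a b] S.per_equiv_rng[of a b] by simp

text \<open>Expand the unit at \<open>w\<close>; the paths ending outside \<open>T\<close> contribute elements of the kernel.\<close>

lemma ker_test:
  assumes x: "x \<in> carrier A" "x \<otimes> s w = x" and w: "w \<in> verts G"
    and e: "\<And>e. e \<in> mor Sg \<Longrightarrow> rng G e = w \<Longrightarrow> deg G e = n \<Longrightarrow> x \<otimes> s e \<in> N.ker"
  shows "x \<in> N.ker"
proof -
  have "x \<otimes> s w \<otimes> s w \<in> N.ker"
  proof (rule expand_mem[where n = n])
    fix e assume e': "e \<in> mor G" "rng G e = w" "deg G e = n"
    have "x \<otimes> s e \<in> N.ker"
      using e[of e] e' T_iff[of e] N.ker_simps(6)[of "s e" x] x by (cases "src G e \<in> T") auto
    then show "(x \<otimes> s e) \<otimes> ((s e)\<^sup>\<star> \<otimes> s w) \<in> N.ker" using e' w N.ker_simps(5) by simp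
  qed (use x w N.ker_simps N.ker_carrier in auto)
  then show ?thesis using x by simp
qed

text \<open>For \<open>a \<sim> b\<close> this element replaces a long path \<open>e\<close> by the equivalent path \<open>e'\<close> with \<open>ae = be'\<close>.\<close>

definition shifter :: "'l \<Rightarrow> 'l \<Rightarrow> 'a" where "shifter a b = (s b)\<^sup>\<star> \<otimes> s a"

lemma shifter_apply:
  assumes ab: "per_equiv Sg a b" and e: "e \<in> mor Sg" "rng G e = src G a" "deg G b \<le> deg G e"
  obtains e' where "e' \<in> mor Sg" "rng G e' = src G a" "per_equiv Sg e e'" "deg G e' + deg G b = deg G e + deg G a"
    "shifter a b \<otimes> s e = s e'" "s a \<otimes> s e = s b \<otimes> s e'"
proof -
  obtain e' where e': "e' \<in> mor Sg" "rng G e' = src G a" "a \<cdot> e = b \<cdot> e'" "per_equiv Sg e e'" "deg G e' + deg G b = deg G e + deg G a"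
    using S.per_equiv_action[OF ab e(1)] e by (auto simp del: tail_graph_simps(1))
  have m: "a \<in> mor G" "b \<in> mor G" "src G b = src G a" "e \<in> mor G" "e' \<in> mor G" using in_Sg[OF ab] in_Sg[OF e'(4)] by auto
  have "s a \<otimes> s e = s b \<otimes> s e'" using s_cmp[of a e] s_cmp[of b e'] e' e m by simp
  moreover have "shifter a b \<otimes> s e = s e'"
    using calculation m e' A.mult_assoc[of "(s b)\<^sup>\<star>" "s a" "s e"] A.mult_assoc[of "(s b)\<^sup>\<star>" "s b" "s e'"] s_star_s[of b] s_rng[of e']
    by (simp add: shifter_def)
  ultimately show ?thesis using that e' by blast
qed

lemma shifter_closed:
  assumes "per_equiv Sg a b"
  shows "shifter a b \<in> carrier A" "shifter a b \<otimes> s (src G a) = shifter a b" "s (src G a) \<otimes> shifter a b = shifter a b"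
    "(shifter a b)\<^sup>\<star> = shifter b a"
proof -
  note m = in_Sg[OF assms]
  show "shifter a b \<in> carrier A" "(shifter a b)\<^sup>\<star> = shifter b a" using m by (auto simp: shifter_def A.star_mult)
  show "shifter a b \<otimes> s (src G a) = shifter a b" using m s_src[of a] by (simp add: shifter_def A.mult_assoc)
  show "s (src G a) \<otimes> shifter a b = shifter a b"
    using m st_src[of b] A.mult_assoc[of "s (src G a)" "(s b)\<^sup>\<star>" "s a"] by (simp add: shifter_def)
qed

text \<open>Let \<open>u\<close> be the shifter and \<open>g = s\<^sub>b s\<^sub>c\<^sup>*\<close>, and test on \<open>s\<^sub>e\<close> for long \<open>e = cf\<close>. Then \<open>us\<^sub>e = s\<^bsub>e'\<^esub>\<close> with \<open>e' \<sim> cf\<close>, so \<open>e' = cf'\<close> with \<open>f' \<sim> f\<close>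
  and \<open>gus\<^sub>e = s\<^bsub>bf'\<^esub>\<close>; while \<open>ugs\<^sub>e = us\<^bsub>bf\<^esub> = s\<^sub>h\<close> with \<open>h \<sim> bf \<sim> bf'\<close>. Since \<open>h\<close> and \<open>bf'\<close> have the same degree, they are equal. If
  \<open>e\<close> does not start with \<open>c\<close>, neither does \<open>e'\<close>, and both products vanish.\<close>

lemma shifter_commutes:
  assumes mn: "per_equiv Sg m n" and a: "a \<in> carrier A"
  shows "shifter m n \<otimes> a \<otimes> s (src G m) \<ominus> s (src G m) \<otimes> a \<otimes> shifter m n \<in> N.ker"
proof (rule dense_ker[OF _ _ _ _ a])
  note mm = in_Sg[OF mn] and u = shifter_closed[OF mn]
  let ?u = "shifter m n" and ?w = "src G m"
  have w: "?w \<in> verts G" "s ?w \<in> carrier A" using mm by auto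
  show "?u \<in> carrier A" "s ?w \<in> carrier A" "s ?w \<in> carrier A" "?u \<in> carrier A" using u w by auto
  fix b c assume b: "b \<in> mor G" and c: "c \<in> mor G" and bc: "src G b = src G c"
  let ?g = "s b \<otimes> (s c)\<^sup>\<star>"
  have gc: "?g \<in> carrier A" using b c by simp
  show "?u \<otimes> ?g \<otimes> s ?w \<ominus> s ?w \<otimes> ?g \<otimes> ?u \<in> N.ker"
  proof (cases "rng G b = ?w")
    case False
    have g1: "s ?w \<otimes> ?g = \<zero>" using False s_vertex_s(1)[OF w(1) b] A.mult_assoc[of "s ?w" "s b" "(s c)\<^sup>\<star>"] b c w by simp
    moreover have "?u \<otimes> ?g = \<zero>" using A.mult_assoc[OF u(1) w(2) gc] unfolding u(2) g1 using u(1) by simp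
    ultimately have "?u \<otimes> ?g = \<zero>" "s ?w \<otimes> ?g = \<zero>" by simp_all
    then show ?thesis using u w A.diff_eq_0[of \<zero> \<zero>] N.ker_simps(1) by simp
  next
    case True
    have "?u \<otimes> ?g \<otimes> s ?w \<ominus> s ?w \<otimes> ?g \<otimes> ?u = ?u \<otimes> ?g \<otimes> s ?w \<ominus> ?g \<otimes> ?u"
      using True b c s_rng[OF b] A.mult_assoc[of "s ?w" "s b" "(s c)\<^sup>\<star>"] w by simp
    also have "\<dots> \<in> N.ker"
    proof (rule ker_test[OF _ _ w(1)])
      show "?u \<otimes> ?g \<otimes> s ?w \<ominus> ?g \<otimes> ?u \<in> carrier A" using u gc w by simp
      show "(?u \<otimes> ?g \<otimes> s ?w \<ominus> ?g \<otimes> ?u) \<otimes> s ?w = ?u \<otimes> ?g \<otimes> s ?w \<ominus> ?g \<otimes> ?u"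
        using u gc w s_vertex(2)[OF w(1)] by (simp add: A.mult_diff A.mult_assoc)
      fix e assume e: "e \<in> mor Sg" "rng G e = ?w" "deg G e = deg G c + deg G n"
      obtain e' where e': "e' \<in> mor Sg" "rng G e' = ?w" "per_equiv Sg e e'" "deg G e' + deg G n = deg G e + deg G m" "?u \<otimes> s e = s e'"
        using shifter_apply[OF mn e(1,2)] e(3) by (auto simp: vec_le_iff)
      have em: "e \<in> mor G" "e' \<in> mor G" using e e' by auto
      have dc: "deg G c \<le> deg G e" "deg G c \<le> deg G e'"
      proof -
        show "deg G c \<le> deg G e" using e(3) by simp
        have "deg G e' + deg G n = (deg G c + deg G m) + deg G n" using e'(4) e(3) by (simp add: ac_simps)
        then have "deg G e' = deg G c + deg G m" by simp
        then show "deg G c \<le> deg G e'" by simp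
      qed
      have eq: "(?u \<otimes> ?g \<otimes> s ?w \<ominus> ?g \<otimes> ?u) \<otimes> s e = ?u \<otimes> (s b \<otimes> ((s c)\<^sup>\<star> \<otimes> s e)) \<ominus> s b \<otimes> ((s c)\<^sup>\<star> \<otimes> s e')"
        using u gc w em b c e'(5) s_rng[OF em(1)] e(2) by (simp add: A.mult_diff A.mult_assoc)
      show "(?u \<otimes> ?g \<otimes> s ?w \<ominus> ?g \<otimes> ?u) \<otimes> s e \<in> N.ker"
      proof (cases "ini (deg G c) e = c")
        case True
        define f where "f = fin (deg G c) e"
        have f: "f \<in> mor Sg" "rng G f = src G c" "e = c \<cdot> f" "deg G f = deg G n" "src G f \<in> T"
          using ini_fin[OF em(1) dc(1)] e True by (auto simp: f_def)
        have cS: "c \<in> mor Sg" "b \<in> mor Sg" using c b bc f(2) S.rng_verts[OF f(1)] verts_tail[OF T_maximal_tail] by auto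
        obtain f' where f': "f' \<in> mor Sg" "src G c = rng G f'" "e' = c \<cdot> f'" "per_equiv Sg f f'"
          using S.per_equiv_left_cancel[of c f e'] e'(3) f cS dc(2) by (auto simp del: tail_graph_simps(1))
        have fm: "f \<in> mor G" "f' \<in> mor G" using f f' by auto
        have "(s c)\<^sup>\<star> \<otimes> s e = s f" "(s c)\<^sup>\<star> \<otimes> s e' = s f'"
          using star_s_mult_ini[OF c em(1) dc(1)] star_s_mult_ini[OF c em(2) dc(2)] f f' fm c by simp_all
        moreover have "?u \<otimes> s (b \<cdot> f) = s (b \<cdot> f')"
        proof -
          have bf: "b \<cdot> f \<in> mor Sg" "rng G (b \<cdot> f) = ?w" using \<open>rng G b = ?w\<close> b bc f fm by auto
          have "deg G n \<le> deg G (b \<cdot> f)" using b bc f fm by simp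
          from shifter_apply[OF mn bf this] obtain h where h: "per_equiv Sg (b \<cdot> f) h" "deg G h + deg G n = deg G (b \<cdot> f) + deg G m" "?u \<otimes> s (b \<cdot> f) = s h"
            by metis
          have "per_equiv Sg (b \<cdot> f) (b \<cdot> f')" using S.per_equiv_left[OF f'(4) cS(2)] bc f by simp
          then have "per_equiv Sg h (b \<cdot> f')" using h(1) S.per_equiv_sym S.per_equiv_trans by blast
          moreover have "deg G h = deg G (b \<cdot> f')"
          proof -
            have "deg G f' + (deg G c + deg G n) = deg G m + (deg G c + deg G n)" using e'(4) e(3) f' fm c by (simp add: ac_simps)
            then have "deg G f' = deg G m" by (rule add_right_imp_eq)
            then have "deg G h + deg G n = deg G (b \<cdot> f') + deg G n" using h(2) f f' fm b bc by (simp add: ac_simps)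
            then show ?thesis by (rule add_right_imp_eq)
          qed
          ultimately show ?thesis using S.per_equiv_deg_eq[of h "b \<cdot> f'"] h(3) by simp
        qed
        ultimately show ?thesis unfolding eq using b bc f f' fm c s_cmp[of b f] s_cmp[of b f'] A.diff_eq_0[of "s (b \<cdot> f')" "s (b \<cdot> f')"] N.ker_simps(1) by simp
      next
        case False
        have "ini (deg G c) e' \<noteq> c"
        proof
          assume True: "ini (deg G c) e' = c"
          define f where "f = fin (deg G c) e'"
          have f: "f \<in> mor Sg" "rng G f = src G c" "e' = c \<cdot> f"
            using ini_fin[OF em(2) dc(2)] e' True by (auto simp: f_def)
          have cS: "c \<in> mor Sg" using c f(2) S.rng_verts[OF f(1)] verts_tail[OF T_maximal_tail] by auto
          obtain f' where "f' \<in> mor Sg" "src G c = rng G f'" "e = c \<cdot> f'"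
            using S.per_equiv_left_cancel[of c f e] S.per_equiv_sym[OF e'(3)] f cS dc(1) by (auto simp del: tail_graph_simps(1))
          then show False using False c by auto
        qed
        then show ?thesis unfolding eq star_s_mult_ini[OF c em(1) dc(1)] star_s_mult_ini[OF c em(2) dc(2)]
          using False u b A.diff_eq_0[of \<zero> \<zero>] N.ker_simps(1) by simp
      qed
    qed
    finally show ?thesis .
  qed
qed

end

context irr_graph
begin

lemma T_verts: "verts Sg = T" by (rule verts_tail[OF T_maximal_tail])

text \<open>The shifter and its adjoint commute with the irreducible corner at \<open>s(m)\<close>, so the shifter is a scalar modulo the kernel
  by Schur's lemma. The scalar has modulus \<open>1\<close> since \<open>s\<^sub>m\<close> and \<open>s\<^sub>n\<close> have the same norm in the quotient.\<close>

lemma scalar_exists: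
  assumes mn: "per_equiv Sg m n"
  shows "\<exists>c. cmod c = 1 \<and> s m \<ominus> c \<odot> s n \<in> N.ker"
proof -
  note mm = in_Sg[OF mn] and u = shifter_closed[OF mn]
  let ?u = "shifter m n" and ?w = "src G m"
  have w: "?w \<in> verts G" "s ?w \<in> carrier A" "s ?w \<otimes> s ?w = s ?w" using mm s_vertex(2) by auto
  let ?M = "{\<pi> (s ?w \<otimes> a \<otimes> s ?w) | a. a \<in> carrier A}"
  have comm: "H.commutant_on ?M (\<pi> (s ?w)) (\<pi> (shifter m' n'))" if mn': "per_equiv Sg m' n'" "src G m' = ?w" for m' n'
    unfolding H.commutant_on_def
  proof (intro conjI ballI)
    note u = shifter_closed[OF mn'(1), unfolded mn'(2)]
    let ?u = "shifter m' n'"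
    show "\<pi> ?u \<in> carrier H.BH" using u by simp
    show "\<pi> (s ?w) \<otimes>\<^sub>B \<pi> ?u = \<pi> ?u" "\<pi> ?u \<otimes>\<^sub>B \<pi> (s ?w) = \<pi> ?u"
      using rep_simps(2)[of "s ?w" ?u] rep_simps(2)[of ?u "s ?w"] u w by simp_all
    fix k assume "k \<in> ?M"
    then obtain a where a: "a \<in> carrier A" "k = \<pi> (s ?w \<otimes> a \<otimes> s ?w)" by blast
    have "\<pi> (?u \<otimes> a \<otimes> s ?w) \<ominus>\<^sub>B \<pi> (s ?w \<otimes> a \<otimes> ?u) = \<zero>\<^sub>B"
      using shifter_commutes[OF mn'(1) a(1)] rep_diff[of "?u \<otimes> a \<otimes> s ?w" "s ?w \<otimes> a \<otimes> ?u"] a u w unfolding mn'(2) ker_rep by simp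
    then have "\<pi> (?u \<otimes> a \<otimes> s ?w) = \<pi> (s ?w \<otimes> a \<otimes> ?u)"
      using H.BB.diff_eq_0[of "\<pi> (?u \<otimes> a \<otimes> s ?w)" "\<pi> (s ?w \<otimes> a \<otimes> ?u)"] a u w by simp
    moreover have "?u \<otimes> (s ?w \<otimes> a \<otimes> s ?w) = ?u \<otimes> a \<otimes> s ?w"
      using a u w A.mult_assoc[of ?u "s ?w" "a \<otimes> s ?w"] by (simp add: A.mult_assoc)
    moreover have "(s ?w \<otimes> a \<otimes> s ?w) \<otimes> ?u = s ?w \<otimes> a \<otimes> ?u" using a u w by (simp add: A.mult_assoc)
    ultimately show "\<pi> ?u \<otimes>\<^sub>B k = k \<otimes>\<^sub>B \<pi> ?u"
      using rep_simps(2)[of ?u "s ?w \<otimes> a \<otimes> s ?w"] rep_simps(2)[of "s ?w \<otimes> a \<otimes> s ?w" ?u] a u w by simp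
  qed
  have "H.commutant_on ?M (\<pi> (s ?w)) (star H.BH (\<pi> ?u))"
    using comm[OF S.per_equiv_sym[OF mn]] mm u(4) rep_simps(4)[OF u(1)] by simp
  then obtain c where c: "\<pi> ?u = c \<odot>\<^sub>B \<pi> (s ?w)"
    using H.schur[OF corner_irreducible[OF vertex_proj[OF w(1)]] comm[OF mn]] by blast
  have uc: "?u \<ominus> c \<odot> s ?w \<in> N.ker"
    using c u w rep_diff[of ?u "c \<odot> s ?w"] H.BB.diff_eq_0[of "\<pi> ?u" "\<pi> ?u"] by (simp add: ker_rep rep_simps)
  have sc: "s m \<ominus> c \<odot> s n \<in> N.ker"
  proof (rule ker_test[OF _ _ w(1)])
    show "s m \<ominus> c \<odot> s n \<in> carrier A" using mm by simp
    show "(s m \<ominus> c \<odot> s n) \<otimes> s ?w = s m \<ominus> c \<odot> s n"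
      using mm s_src[of m] s_src[of n] w by (simp add: A.mult_diff A.smult_mult_l)
    fix e assume e: "e \<in> mor Sg" "rng G e = ?w" "deg G e = deg G n"
    obtain e' where e': "e' \<in> mor Sg" "?u \<otimes> s e = s e'" "s m \<otimes> s e = s n \<otimes> s e'" using shifter_apply[OF mn e(1,2)] e(3) by auto
    have em: "e \<in> mor G" "e' \<in> mor G" using e e' by auto
    have "(s m \<ominus> c \<odot> s n) \<otimes> s e = s n \<otimes> ((?u \<ominus> c \<odot> s ?w) \<otimes> s e)"
      using e' mm em u w s_rng[OF em(1)] e(2) by (simp add: A.mult_diff A.smult_mult_l A.smult_mult_r)
    then show "(s m \<ominus> c \<odot> s n) \<otimes> s e \<in> N.ker" using N.ker_simps(5,6) uc mm em(1) by simp
  qed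
  have sq: "(rep_norm (s a))\<^sup>2 = rep_norm (s ?w)" if "a = m \<or> a = n" for a
    using that N.sn_simps(3)[of "s a"] s_star_s[of a] mm by auto
  have "rep_norm (s m) = cmod c * rep_norm (s n)"
    using N.sn_eq_of_null[of "s m" "c \<odot> s n"] sc mm N.sn_simps(4)[of "s n" c] by (simp add: N.ker_def)
  moreover have "rep_norm (s ?w) \<noteq> 0" using mm w by (auto simp: T_def N.ker_def)
  ultimately have "(cmod c)\<^sup>2 = 1" using sq[of m] sq[of n] by (simp add: power_mult_distrib)
  then have "cmod c = 1" by (simp add: power2_eq_1_iff) (metis norm_ge_zero not_one_le_zero neg_0_le_iff_le)
  then show ?thesis using sc by blast
qed

lemma scalar_unique:
  assumes "s m \<ominus> c \<odot> s n \<in> N.ker" "s m \<ominus> d \<odot> s n \<in> N.ker" "m \<in> mor G" "n \<in> mor G" "src G n \<in> T"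
  shows "c = d"
proof -
  have "(s m \<ominus> d \<odot> s n) \<ominus> (s m \<ominus> c \<odot> s n) = (c - d) \<odot> s n"
    using assms(3,4) A.smult_simps(1)[of "s n" c "- d"] by (simp add: A.minus_eq A.minus_add A.a_ac A.r_neg2)
  then have "(c - d) \<odot> s n \<in> N.ker" using N.ker_simps(4) assms by metis
  then have "cmod (c - d) * rep_norm (s n) = 0" using N.sn_simps(4) assms by (simp add: N.ker_def)
  moreover have "rep_norm (s n) \<noteq> 0" using T_iff[of n] assms by (simp add: N.ker_def)
  ultimately show ?thesis by simp
qed

lemma scalar_right:
  assumes "s m \<ominus> c \<odot> s n \<in> N.ker" "m \<in> mor G" "n \<in> mor G" "src G n = src G m" "e \<in> mor G" "rng G e = src G m"
  shows "s (m \<cdot> e) \<ominus> c \<odot> s (n \<cdot> e) \<in> N.ker"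
  using N.ker_simps(5)[OF assms(1), of "s e"] assms s_cmp[of m e] s_cmp[of n e] by (simp add: A.mult_diff A.smult_mult_l)

text \<open>The scalar of \<open>m \<sim> n\<close> is also that of the pair formed by the image of a long path under the shifter and the path itself.\<close>

lemma scalar_move:
  assumes mn: "per_equiv Sg m n" and c: "s m \<ominus> c \<odot> s n \<in> N.ker" and e: "e \<in> mor Sg" "rng G e = src G m" "deg G n \<le> deg G e"
  obtains e' where "e' \<in> mor Sg" "rng G e' = src G m" "per_equiv Sg e e'" "deg G e' + deg G n = deg G e + deg G m" "s e' \<ominus> c \<odot> s e \<in> N.ker"
proof -
  obtain e' where e': "e' \<in> mor Sg" "rng G e' = src G m" "per_equiv Sg e e'" "deg G e' + deg G n = deg G e + deg G m" "s m \<otimes> s e = s n \<otimes> s e'"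
    using shifter_apply[OF mn e] by metis
  note mm = in_Sg[OF mn]
  have em: "e \<in> mor G" "e' \<in> mor G" using e e' by auto
  have nn: "(s n)\<^sup>\<star> \<otimes> (s n \<otimes> s a) = s a" if "a \<in> mor G" "rng G a = src G m" for a
    using that mm A.mult_assoc[of "(s n)\<^sup>\<star>" "s n" "s a"] s_star_s[of n] s_rng[of a] by simp
  have "(s n)\<^sup>\<star> \<otimes> ((s m \<ominus> c \<odot> s n) \<otimes> s e) = (s n)\<^sup>\<star> \<otimes> (s n \<otimes> s e') \<ominus> c \<odot> ((s n)\<^sup>\<star> \<otimes> (s n \<otimes> s e))"
    using mm em e'(5) by (simp add: A.mult_diff A.smult_mult_l A.smult_mult_r)
  also have "\<dots> = s e' \<ominus> c \<odot> s e" using nn em e(2) e'(2) by simp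
  finally have "s e' \<ominus> c \<odot> s e \<in> N.ker" using N.ker_simps(5,6) c mm em by (metis A.mult_closed A.star_closed s_closed)
  then show ?thesis using that e' by blast
qed

text \<open>By directedness; extending a pair changes neither its scalar nor the difference of its degrees.\<close>

lemma common_source:
  assumes mn: "per_equiv Sg m n" and c: "s m \<ominus> c \<odot> s n \<in> N.ker" and mn': "per_equiv Sg m' n'" and d: "s m' \<ominus> d \<odot> s n' \<in> N.ker"
  obtains m1 n1 m2 n2 where "per_equiv Sg m1 n1" "s m1 \<ominus> c \<odot> s n1 \<in> N.ker" "per_equiv Sg m2 n2" "s m2 \<ominus> d \<odot> s n2 \<in> N.ker"
    "src G m1 = src G m2" "dd m1 n1 = dd m n"
    "dd m2 n2 = dd m' n'"
proof -
  note mm = in_Sg[OF mn] and mm' = in_Sg[OF mn']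
  obtain u where "connects Sg (src G m) u" "connects Sg (src G m') u"
    using S.directed[of "src G m" "src G m'"] mm mm' unfolding T_verts by blast
  then obtain p q where pq: "p \<in> mor Sg" "q \<in> mor Sg" "rng G p = src G m" "rng G q = src G m'" "src G p = src G q"
    unfolding connects_def tail_graph_simps(2,3) by metis
  have pm: "p \<in> mor G" "q \<in> mor G" using pq by auto
  show ?thesis
  proof (rule that[of "m \<cdot> p" "n \<cdot> p" "m' \<cdot> q" "n' \<cdot> q"])
    show "per_equiv Sg (m \<cdot> p) (n \<cdot> p)" "per_equiv Sg (m' \<cdot> q) (n' \<cdot> q)"
      using S.per_equiv_right[OF mn pq(1)] S.per_equiv_right[OF mn' pq(2)] pq by simp_all
    show "s (m \<cdot> p) \<ominus> c \<odot> s (n \<cdot> p) \<in> N.ker" "s (m' \<cdot> q) \<ominus> d \<odot> s (n' \<cdot> q) \<in> N.ker"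
      using scalar_right[OF c] scalar_right[OF d] mm mm' pm pq by blast+
  qed (use mm mm' pm pq in simp_all)
qed

text \<open>The images of one long path under both shifters are equivalent and have the same degree, so they are equal.\<close>

lemma scalar_consistent:
  assumes mn: "per_equiv Sg m n" and c: "s m \<ominus> c \<odot> s n \<in> N.ker" and mn': "per_equiv Sg m' n'" and d: "s m' \<ominus> d \<odot> s n' \<in> N.ker"
    and g: "dd m n = dd m' n'"
  shows "c = d"
proof -
  obtain m1 n1 m2 n2 where 1: "per_equiv Sg m1 n1" "s m1 \<ominus> c \<odot> s n1 \<in> N.ker" and 2: "per_equiv Sg m2 n2" "s m2 \<ominus> d \<odot> s n2 \<in> N.ker"
    and src: "src G m1 = src G m2" and g1: "dd m1 n1 = dd m2 n2"
    using common_source[OF mn c mn' d] g by metis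
  obtain e where e: "e \<in> mor Sg" "rng G e = src G m1" "deg G e = deg G n1 + deg G n2"
    using S.ex_path[of "src G m1" "deg G n1 + deg G n2"] in_Sg[OF 1(1)] T_verts by auto
  obtain a where a: "a \<in> mor Sg" "per_equiv Sg e a" "deg G a + deg G n1 = deg G e + deg G m1" "s a \<ominus> c \<odot> s e \<in> N.ker"
    using scalar_move[OF 1 e(1,2)] e(3) by auto
  have "rng G e = src G m2" "deg G n2 \<le> deg G e" using e src by (auto simp: vec_le_iff)
  from scalar_move[OF 2 e(1) this]
  obtain b where b: "b \<in> mor Sg" "per_equiv Sg e b" "deg G b + deg G n2 = deg G e + deg G m2" "s b \<ominus> d \<odot> s e \<in> N.ker" by metis
  have "deg G m1 + deg G n2 = deg G m2 + deg G n1" using g1 zvec_diff_eq by blast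
  moreover have "deg G a + (deg G n1 + deg G n2) = deg G e + (deg G m1 + deg G n2)" by (simp only: a(3) add.assoc[symmetric])
  moreover have "deg G b + (deg G n2 + deg G n1) = deg G e + (deg G m2 + deg G n1)" by (simp only: b(3) add.assoc[symmetric])
  ultimately have "deg G a + (deg G n1 + deg G n2) = deg G b + (deg G n1 + deg G n2)" by (simp only: add.commute[of "deg G n1"])
  then have "deg G a = deg G b" by (rule add_right_imp_eq)
  moreover have "per_equiv Sg a b" using a b S.per_equiv_sym S.per_equiv_trans by blast
  ultimately have "a = b" using S.per_equiv_deg_eq by simp
  then show ?thesis using scalar_unique[OF a(4)] b a e by simp
qed

text \<open>Any choice will do by \<open>scalar_consistent\<close>.\<close>

definition gam :: "int ^ 'k \<Rightarrow> complex" where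
  "gam = (\<lambda>g \<in> Per Sg. SOME c. \<exists>m n. per_equiv Sg m n \<and> g = dd m n \<and> s m \<ominus> c \<odot> s n \<in> N.ker)"

lemma gam: assumes mn: "per_equiv Sg m n"
  shows "s m \<ominus> gam (dd m n) \<odot> s n \<in> N.ker" "cmod (gam (dd m n)) = 1"
proof -
  let ?g = "dd m n"
  have gP: "?g \<in> Per Sg" using mn unfolding Per_def by auto
  obtain c where c: "cmod c = 1" "s m \<ominus> c \<odot> s n \<in> N.ker" using scalar_exists[OF mn] by blast
  have "\<exists>m' n'. per_equiv Sg m' n' \<and> ?g = dd m' n' \<and> s m' \<ominus> gam ?g \<odot> s n' \<in> N.ker"
    unfolding gam_def using gP by (simp del: tail_graph_simps) (rule someI[of _ c], use mn c in blast)
  then have "gam ?g = c" using scalar_consistent[OF _ _ mn c(2)] by metis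
  then show "s m \<ominus> gam ?g \<odot> s n \<in> N.ker" "cmod (gam ?g) = 1" using c by simp_all
qed

text \<open>Move \<open>e\<close> to \<open>a\<close> by a pair for \<open>g\<close>, then \<open>a\<close> to \<open>b\<close> by a pair for \<open>h\<close>: the pair \<open>(b, e)\<close> belongs to \<open>g + h\<close>, and its scalar is the
  product.\<close>

lemma gam_character: "is_character (Per Sg) gam"
  unfolding is_character_def
proof (intro conjI ballI)
  have "cmod (gam g) = 1" if "g \<in> Per Sg" for g using that gam(2) unfolding Per_def by auto
  then show "gam \<in> Per Sg \<rightarrow>\<^sub>E sphere 0 1" by (auto simp: gam_def)
  fix g h assume g: "g \<in> Per Sg" and h: "h \<in> Per Sg"
  obtain m n where mn: "per_equiv Sg m n" "g = dd m n" using g unfolding Per_def by auto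
  obtain m' n' where mn': "per_equiv Sg m' n'" "h = dd m' n'" using h unfolding Per_def by auto
  obtain m1 n1 m2 n2 where 1: "per_equiv Sg m1 n1" "s m1 \<ominus> gam g \<odot> s n1 \<in> N.ker" and 2: "per_equiv Sg m2 n2" "s m2 \<ominus> gam h \<odot> s n2 \<in> N.ker"
    and src: "src G m1 = src G m2" and gh: "g = dd m1 n1" "h = dd m2 n2"
    using common_source[OF mn(1) gam(1)[OF mn(1)] mn'(1) gam(1)[OF mn'(1)]] mn(2) mn'(2) by metis
  obtain e where e: "e \<in> mor Sg" "rng G e = src G m1" "deg G e = deg G n1 + deg G n2"
    using S.ex_path[of "src G m1" "deg G n1 + deg G n2"] in_Sg[OF 1(1)] T_verts by auto
  obtain a where a: "a \<in> mor Sg" "rng G a = src G m1" "per_equiv Sg e a" "deg G a + deg G n1 = deg G e + deg G m1" "s a \<ominus> gam g \<odot> s e \<in> N.ker"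
    using scalar_move[OF 1 e(1,2)] e(3) by auto
  have "deg G a + deg G n1 = (deg G n2 + deg G m1) + deg G n1" using a(4) e(3) by (simp add: ac_simps)
  then have "deg G a = deg G n2 + deg G m1" by (rule add_right_imp_eq)
  then have "rng G a = src G m2" "deg G n2 \<le> deg G a" using a src by (auto simp: vec_le_iff)
  from scalar_move[OF 2 a(1) this]
  obtain b where b: "b \<in> mor Sg" "per_equiv Sg a b" "deg G b + deg G n2 = deg G a + deg G m2" "s b \<ominus> gam h \<odot> s a \<in> N.ker" by metis
  have em: "e \<in> mor G" "a \<in> mor G" "b \<in> mor G" "src G e \<in> T" using e a b by auto
  have "(s b \<ominus> gam h \<odot> s a) \<oplus> gam h \<odot> (s a \<ominus> gam g \<odot> s e) \<in> N.ker" using b(4) a(5) N.ker_simps(2,3) by simp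
  moreover have "(s b \<ominus> gam h \<odot> s a) \<oplus> gam h \<odot> (s a \<ominus> gam g \<odot> s e) = s b \<ominus> (gam g * gam h) \<odot> s e"
    using em by (simp add: A.smult_diff A.smult_simps A.diff_add_diff mult.commute)
  ultimately have *: "s b \<ominus> (gam g * gam h) \<odot> s e \<in> N.ker" by simp
  have be: "per_equiv Sg b e" using a b S.per_equiv_sym S.per_equiv_trans by blast
  have "zvec (deg G a) + zvec (deg G n1) = zvec (deg G e) + zvec (deg G m1)" "zvec (deg G b) + zvec (deg G n2) = zvec (deg G a) + zvec (deg G m2)"
    using arg_cong[OF a(4), of zvec] arg_cong[OF b(3), of zvec] by simp_all
  then have "dd b e = g + h" unfolding gh by (simp add: algebra_simps)
  then show "gam (g + h) = gam g * gam h" using scalar_unique[OF gam(1)[OF be] * em(3,1,4)] by simp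
qed

lemma gam_ideal_character: "ideal_character G A s N.ker T gam"
  unfolding ideal_character_def Let_def using gam_character gam(1) by blast

lemma per_equiv_in_H:
  assumes "g \<in> Per Sg"
  obtains a b where "per_equiv Sg a b" "rng G a \<in> H_Per Sg" "rng G b \<in> H_Per Sg" "g = dd a b"
proof -
  obtain v where v: "v \<in> H_Per Sg" using S.H_Per_nonempty by blast
  obtain m n where g: "g = zvec m - zvec n" using zvec_surj by metis
  obtain a where a: "a \<in> mor Sg" "rng G a = v" "deg G a = m" using S.ex_path[OF S.H_Per_verts[OF v], of m] by auto
  obtain b where "b \<in> mor Sg" "rng G b = v" "deg G b = n" "per_equiv Sg a b"
    using S.H_Per_D[OF v a(1)] a assms g by auto
  then show ?thesis using that[of a b] a v g by simp
qed

lemma ideal_character_unique: "\<exists>!\<gamma>. ideal_character G A s N.ker T \<gamma>"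
proof (rule ex1I[of _ gam])
  fix \<gamma> assume \<gamma>: "ideal_character G A s N.ker T \<gamma>"
  show "\<gamma> = gam"
  proof
    fix g
    show "\<gamma> g = gam g"
    proof (cases "g \<in> Per Sg")
      case True
      obtain a b where ab: "per_equiv Sg a b" "rng G a \<in> H_Per Sg" "rng G b \<in> H_Per Sg" "g = dd a b"
        using per_equiv_in_H[OF True] .
      note m = in_Sg[OF ab(1)]
      have "s a \<ominus> \<gamma> g \<odot> s b \<in> N.ker" using \<gamma> ab m unfolding ideal_character_def Let_def by auto
      moreover have "s a \<ominus> gam g \<odot> s b \<in> N.ker" using gam(1)[OF ab(1)] ab(4) by simp
      ultimately show ?thesis using scalar_unique m by simp
    next
      case False
      then show ?thesis using \<gamma> unfolding ideal_character_def is_character_def Let_def gam_def by (auto simp: PiE_def extensional_def)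
    qed
  qed
qed (rule gam_ideal_character)

end

section \<open>The kernels of path representations\<close>

context tail_data
begin

lemma tail_inf_paths: "x \<in> inf_paths Sg \<longleftrightarrow> x \<in> inf_paths G \<and> (\<forall>n. x (n, n) \<in> T)"
proof
  assume x: "x \<in> inf_paths Sg"
  then have "x \<in> mor Omega \<rightarrow>\<^sub>E mor Sg" by (simp add: inf_paths_def)
  then have "x \<in> mor Omega \<rightarrow>\<^sub>E mor G" by (rule rev_subsetD) (intro PiE_mono, simp)
  moreover have "x (n, n) \<in> T" for n using S.inf_path_vertex[OF x, of n] verts_tail[OF mt] by simp
  ultimately show "x \<in> inf_paths G \<and> (\<forall>n. x (n, n) \<in> T)" using x unfolding inf_paths_def by simp
next
  assume x: "x \<in> inf_paths G \<and> (\<forall>n. x (n, n) \<in> T)"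
  have "x \<in> mor Omega \<rightarrow>\<^sub>E mor Sg"
  proof (rule PiE_I)
    fix a :: "(nat ^ 'k) \<times> (nat ^ 'k)" assume "a \<in> mor Omega"
    then obtain m n where a: "a = (m, n)" "m \<le> n" by (auto simp: Omega_def)
    then show "x a \<in> mor Sg" using inf_pathD[of x m n] x by simp
  next
    fix a :: "(nat ^ 'k) \<times> (nat ^ 'k)" assume "a \<notin> mor Omega"
    then show "x a = undefined" using x unfolding inf_paths_def by (cases a) (auto simp: PiE_def extensional_def)
  qed
  then show "x \<in> inf_paths Sg" using x unfolding inf_paths_def by simp
qed

lemma tail_prepend:
  assumes "a \<in> mor Sg" "y \<in> inf_paths Sg" "y (0, 0) = src G a" shows "prepend Sg a y = prepend G a y"
proof -
  have p: "prepend Sg a y \<in> inf_paths Sg" "prepend Sg a y (0, deg G a) = a" "shift (deg G a) (prepend Sg a y) = y"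
    using S.prepend(1-3)[OF assms(1,2)] assms(3) by simp_all
  then show ?thesis using prepend_eqI[of "prepend Sg a y" a y] by (simp add: tail_inf_paths)
qed

text \<open>For \<open>a\<close> in the first kernel and \<open>v\<close> in \<open>H\<^bsub>Per\<^esub>\<close>, all elements \<open>s\<^sub>v bac s\<^sub>v\<close> lie in the first kernel, hence in the second one, because
  the two norms agree on the corner at \<open>v\<close>. The second kernel is prime and does not contain \<open>s\<^sub>v\<close>, so it contains \<open>a\<close>.\<close>

lemma kernel_subset:
  assumes "irr_rep A H \<pi>" "irr_rep A H' \<pi>'" and ad: "adapted (cstar_rep.rep_norm H \<pi>)" "adapted (cstar_rep.rep_norm H' \<pi>')"
  shows "a_kernel A (bounded_ops H) \<pi> \<subseteq> a_kernel A (bounded_ops H') \<pi>'"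
proof
  interpret P: irr_rep A H \<pi> by fact
  interpret Q: irr_rep A H' \<pi>' by fact
  obtain v where v: "v \<in> H_Per Sg" using S.H_Per_nonempty by blast
  interpret v: tail_vertex G A s T \<gamma> v by unfold_locales (rule v)
  have sv: "s v \<in> carrier A" "Q.rep_norm (s v) \<noteq> 0" using v.vT adapted_vertex[OF ad(2)] by simp_all
  fix a assume "a \<in> a_kernel A (bounded_ops H) \<pi>"
  then have a: "a \<in> P.N.ker" "a \<in> carrier A" unfolding P.kernel_eq using P.N.ker_carrier by blast+
  have "Q.rep_norm (s v \<otimes> b \<otimes> a) = 0" if b: "b \<in> carrier A" for b
  proof -
    have "Q.rep_norm ((s v \<otimes> b \<otimes> a) \<otimes> c \<otimes> s v) = 0" if c: "c \<in> carrier A" for c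
    proof -
      have eq: "(s v \<otimes> b \<otimes> a) \<otimes> c \<otimes> s v = s v \<otimes> (b \<otimes> a \<otimes> c) \<otimes> s v" using a b c sv by (simp add: A.mult_assoc)
      have "s v \<otimes> (b \<otimes> a \<otimes> c) \<otimes> s v \<in> P.N.ker" using a b c sv by (simp add: P.N.ker_simps)
      then have "P.rep_norm (s v \<otimes> (b \<otimes> a \<otimes> c) \<otimes> s v) = 0" by (simp add: P.N.ker_def)
      then show ?thesis unfolding eq using v.corner_unique[OF ad, of "b \<otimes> a \<otimes> c"] a b c by simp
    qed
    then show ?thesis using Q.prime[of "s v \<otimes> b \<otimes> a" "s v"] a b sv by auto
  qed
  then have "Q.rep_norm a = 0" using Q.prime[of "s v" a] a sv by auto
  then show "a \<in> a_kernel A (bounded_ops H') \<pi>'" unfolding Q.kernel_eq using a by (simp add: Q.N.ker_def)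
qed

end

locale tail_path_rep = tail_data G A s T \<gamma> + path_space_algebra G x z A s
  for G :: "('l, 'k::finite) kgraph" and A :: "'a cstar" and s T \<gamma> x z +
  fixes \<rho>
  assumes xT: "x \<in> inf_paths (tail_graph G T)" and cof: "cofinal_path G T x"
    and zg: "\<forall>g \<in> Per (tail_graph G T). zpow z g = \<gamma> g" and rho: "is_path_rep G A s x z \<rho>"
begin

sublocale R: irr_rep A LX \<rho>
  using rho path_rep_irreducible[OF rho] unfolding is_path_rep_iff irr_rep_def irr_rep_axioms_def by blast

lemma rho_s: "a \<in> mor G \<Longrightarrow> \<rho> (s a) = path_op a"
  using rho is_path_rep_iff by blast

lemma X_tail: assumes "y \<in> X" shows "y \<in> inf_paths Sg"
proof -
  obtain a m where a: "a \<in> mor G" "src G a = x (m, m)" "y = prepend G a (shift m x)" using X_memD[OF assms] .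
  have sx: "shift m x \<in> inf_paths G" "shift m x (0, 0) = src G a" using a x by (simp_all add: shift_initial)
  have y: "y \<in> inf_paths G" using X_paths[OF assms] .
  have "y (n, n) \<in> T" for n
  proof -
    have "src G (y (0, n + deg G a)) = x (n + m, n + m)"
      unfolding a(3) prepend(5)[OF a(1) sx] using inf_pathD[OF sx(1), of 0 n] a sx by (simp add: shift_initial)
    then have "src G (y (n, n + deg G a)) \<in> T"
      using inf_pathD(4)[OF y, of n "n + deg G a"] inf_pathD(4)[OF y, of 0 "n + deg G a"] xT by (simp add: tail_inf_paths)
    then show ?thesis using TD(5)[of "y (n, n + deg G a)"] inf_pathD[OF y, of n "n + deg G a"] by simp
  qed
  then show ?thesis using y by (simp add: tail_inf_paths)
qed

text \<open>Cofinality of \<open>x\<close> provides for each \<open>v \<in> T\<close> a path in \<open>[x]\<close> with range \<open>v\<close>; and if \<open>\<mu> \<sim> \<nu>\<close>, then \<open>\<mu>y = \<nu>y\<close> for \<open>y \<in> [x]\<close>, so that the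
  operators of \<open>\<mu>\<close> and \<open>\<nu>\<close> differ by \<open>z\<^bsup>d(\<mu>) - d(\<nu>)\<^esup> = \<gamma>(d(\<mu>) - d(\<nu>))\<close>.\<close>

lemma rep_norm_adapted: "adapted R.rep_norm"
  unfolding adapted_def
proof (intro conjI ballI allI impI)
  show "A.cstar_seminorm R.rep_norm" by (rule R.rep_seminorm)
next
  fix v assume v: "v \<in> verts G"
  have vm: "v \<in> mor G" using vertsD[OF v] by simp
  have "R.rep_norm (s v) = 0 \<longleftrightarrow> path_op v = \<zero>\<^sub>B"
    using R.N.ker_def R.ker_rep[of "s v"] rho_s[OF vm] vm by auto
  also have "\<dots> \<longleftrightarrow> v \<notin> T"
  proof
    assume 0: "path_op v = \<zero>\<^sub>B"
    show "v \<notin> T"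
    proof
      assume "v \<in> T"
      then obtain n a where a: "a \<in> mor G" "rng G a = v" "src G a = x (n, n)" using cof unfolding cofinal_path_def connects_def by blast
      define y where "y = prepend G a (shift n x)"
      have y: "y \<in> X" using a unfolding y_def shift_tail_class_def by blast
      have "y (0, 0) = v" using prepend(4)[OF a(1), of "shift n x"] a x by (simp add: y_def shift_initial)
      then have "path_op v (basis_vec y) y = 1"
        using path_op_vertex_apply[OF v basis_vec_carrier[OF y]] y by (simp add: basis_vec_def)
      then show False using 0 H.BH_simps(4)[OF basis_vec_carrier[OF y]] by simp
    qed
  next
    assume vT: "v \<notin> T"
    show "path_op v = \<zero>\<^sub>B"
    proof (rule H.bop_eqI[OF path_op_closed[OF vm] H.BB.zero_closed])
      fix f assume f: "f \<in> carrier LX"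
      have "y (0, 0) \<in> T" if "y \<in> X" for y using X_tail[OF that] by (simp add: tail_inf_paths)
      then show "path_op v f = \<zero>\<^sub>B f"
        unfolding path_op_vertex_apply[OF v f] using f vT by (auto simp: fun_eq_iff)
    qed
  qed
  finally show "R.rep_norm (s v) = 0 \<longleftrightarrow> v \<notin> T" .
next
  fix a b assume ab: "per_equiv Sg a b"
  have m: "a \<in> mor Sg" "b \<in> mor Sg" "src G b = src G a" "a \<in> mor G" "b \<in> mor G" using S.per_equivD(1-3)[OF ab] by simp_all
  define g where "g = dd a b"
  have "g \<in> Per Sg" using ab unfolding g_def Per_def by auto
  then have "zpow z (zvec (deg G a)) = \<gamma> g * zpow z (zvec (deg G b))"
    using zg zpow_simps(2)[OF z, of g "zvec (deg G b)"] by (simp add: g_def)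
  note zp = this
  have "path_op a = \<gamma> g \<odot>\<^sub>B path_op b"
  proof (rule ell2_op_eqI)
    show "path_op a \<in> carrier H.BH" "\<gamma> g \<odot>\<^sub>B path_op b \<in> carrier H.BH"
      using path_op_closed m by simp_all
    fix y assume y: "y \<in> X"
    have "prepend G a y = prepend G b y" if "y (0, 0) = src G a"
      using S.per_equivD(4)[OF ab X_tail[OF y]] tail_prepend[OF m(1) X_tail[OF y]] tail_prepend[OF m(2) X_tail[OF y]] that m(3) by simp
    then show "path_op a (basis_vec y) = (\<gamma> g \<odot>\<^sub>B path_op b) (basis_vec y)"
      using y path_op_basis[OF m(4) y] path_op_basis[OF m(5) y] m(3) zp by (auto simp: mult.assoc)
  qed
  then have "s a \<ominus> \<gamma> g \<odot> s b \<in> R.N.ker"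
    using m R.rep_diff[of "s a" "\<gamma> g \<odot> s b"] path_op_closed H.BB.diff_eq_0[of "path_op a" "path_op a"] by (simp add: R.ker_rep R.rep_simps rho_s)
  then show "R.rep_norm (s a \<ominus> \<gamma> (dd a b) \<odot> s b) = 0" by (simp add: R.N.ker_def g_def)
qed

end

context irr_graph
begin

lemma kernel_eq_path_rep:
  assumes \<gamma>: "ideal_character G A s N.ker T \<gamma>" and x: "x \<in> inf_paths (tail_graph G T)" "cofinal_path G T x"
    and z: "z \<in> torus" "\<forall>g \<in> Per (tail_graph G T). zpow z g = \<gamma> g" and \<rho>: "is_path_rep G A s x z \<rho>"
  shows "N.ker = a_kernel A (bounded_ops (ell2 (shift_tail_class G x))) \<rho>"
proof -
  interpret D: tail_data G A s T \<gamma>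
    by unfold_locales (use T_maximal_tail \<gamma> in \<open>auto simp: ideal_character_def Let_def\<close>)
  interpret D: tail_path_rep G A s T \<gamma> x z \<rho>
    by unfold_locales (use x z \<rho> D.tail_inf_paths in blast)+
  have ad: "D.adapted rep_norm"
    unfolding D.adapted_def
  proof (intro conjI ballI allI impI)
    fix v assume "v \<in> verts G"
    then show "rep_norm (s v) = 0 \<longleftrightarrow> v \<notin> T" by (simp add: T_def N.ker_def)
  next
    fix a b assume "per_equiv Sg a b" "rng G a \<in> H_Per Sg"
    then have "s a \<ominus> \<gamma> (dd a b) \<odot> s b \<in> N.ker"
      using in_Sg[of a b] \<gamma> unfolding ideal_character_def Let_def by auto
    then show "rep_norm (s a \<ominus> \<gamma> (dd a b) \<odot> s b) = 0" by (simp add: N.ker_def)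
  qed (rule rep_seminorm)
  show ?thesis
    using D.kernel_subset[OF irr_rep_axioms D.R.irr_rep_axioms ad D.rep_norm_adapted]
      D.kernel_subset[OF D.R.irr_rep_axioms irr_rep_axioms D.rep_norm_adapted ad]
    unfolding kernel_eq by blast
qed

end

theorem theorem5p3:
  fixes \<Lambda> :: "('l, 'k::finite) kgraph"
    and A :: "'a cstar" and s :: "'l \<Rightarrow> 'a"
  assumes "k_graph \<Lambda>" and "row_finite_no_sources \<Lambda>"
    and "graph_algebra \<Lambda> A s"
  shows
    "(\<forall>T \<gamma> z x.
        maximal_tail \<Lambda> T \<and> is_character (Per (tail_graph \<Lambda> T)) \<gamma> \<and>
        z \<in> torus \<and> (\<forall>g \<in> Per (tail_graph \<Lambda> T). zpow z g = \<gamma> g) \<and>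
        x \<in> inf_paths (tail_graph \<Lambda> T) \<and> cofinal_path \<Lambda> T x \<longrightarrow>
        (\<exists>\<pi>. is_path_rep \<Lambda> A s x z \<pi> \<and>
             irreducible_rep A (ell2 (shift_tail_class \<Lambda> x)) \<pi> \<and>
             (\<forall>\<pi>'. is_path_rep \<Lambda> A s x z \<pi>' \<longrightarrow> (\<forall>a \<in> carrier A. \<pi>' a = \<pi> a))))
     \<and>
     (\<forall>I T.
        primitive_ideal TYPE('h) A I \<and> T = {v \<in> verts \<Lambda>. s v \<notin> I} \<longrightarrow>
        maximal_tail \<Lambda> T \<and>
        (\<exists>!\<gamma>. ideal_character \<Lambda> A s I T \<gamma>) \<and>
        (\<forall>\<gamma> x z.
           ideal_character \<Lambda> A s I T \<gamma> \<and>
           x \<in> inf_paths (tail_graph \<Lambda> T) \<and> cofinal_path \<Lambda> T x \<and>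
           z \<in> torus \<and> (\<forall>g \<in> Per (tail_graph \<Lambda> T). zpow z g = \<gamma> g) \<longrightarrow>
           (\<forall>\<pi>. is_path_rep \<Lambda> A s x z \<pi> \<longrightarrow>
                I = a_kernel A (bounded_ops (ell2 (shift_tail_class \<Lambda> x))) \<pi>)))"
proof -
  have gc: "graph_cstar \<Lambda> A s"
    using assms unfolding graph_cstar_def graph_cstar_axioms_def rf_k_graph_def rf_k_graph_axioms_def graph_algebra_def by blast
  show ?thesis
  proof (intro conjI allI impI)
    fix T :: "'l set" and \<gamma> z x
    assume h: "maximal_tail \<Lambda> T \<and> is_character (Per (tail_graph \<Lambda> T)) \<gamma> \<and>
        z \<in> torus \<and> (\<forall>g \<in> Per (tail_graph \<Lambda> T). zpow z g = \<gamma> g) \<and>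
        x \<in> inf_paths (tail_graph \<Lambda> T) \<and> cofinal_path \<Lambda> T x"
    interpret graph_cstar \<Lambda> A s by (rule gc)
    interpret tail_data \<Lambda> A s T \<gamma> by unfold_locales (use h in blast)+
    interpret path_space_algebra \<Lambda> x z A s by unfold_locales (use h tail_inf_paths in blast)+
    show "\<exists>\<pi>. is_path_rep \<Lambda> A s x z \<pi> \<and> irreducible_rep A (ell2 (shift_tail_class \<Lambda> x)) \<pi> \<and>
             (\<forall>\<pi>'. is_path_rep \<Lambda> A s x z \<pi>' \<longrightarrow> (\<forall>a \<in> carrier A. \<pi>' a = \<pi> a))"
      using ex_path_rep path_rep_irreducible path_rep_unique by blast
  next
    fix I T
    assume h: "primitive_ideal TYPE('h) A I \<and> T = {v \<in> verts \<Lambda>. s v \<notin> I}"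
    then obtain H :: "'h hilbert" and \<pi> where \<pi>: "irreducible_rep A H \<pi>" "I = a_kernel A (bounded_ops H) \<pi>"
      unfolding primitive_ideal_def by blast
    interpret irr_graph \<Lambda> A s H \<pi>
      using gc \<pi>(1) unfolding irr_graph_def irr_rep_def irr_rep_axioms_def cstar_rep_def cstar_rep_axioms_def irreducible_rep_def representation_def graph_cstar_def
      by blast
    have I: "I = N.ker" using \<pi>(2) kernel_eq by simp
    have T: "T = irr_graph.T \<Lambda> A s H \<pi>" using h unfolding T_def I by simp
    show "maximal_tail \<Lambda> T" unfolding T by (rule T_maximal_tail)
    show "\<exists>!\<gamma>. ideal_character \<Lambda> A s I T \<gamma>" unfolding T I by (rule ideal_character_unique)
    show "I = a_kernel A (bounded_ops (ell2 (shift_tail_class \<Lambda> x))) \<rho>"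
      if "ideal_character \<Lambda> A s I T \<gamma> \<and> x \<in> inf_paths (tail_graph \<Lambda> T) \<and> cofinal_path \<Lambda> T x \<and>
           z \<in> torus \<and> (\<forall>g \<in> Per (tail_graph \<Lambda> T). zpow z g = \<gamma> g)" "is_path_rep \<Lambda> A s x z \<rho>" for \<gamma> x z \<rho>
      unfolding I by (rule kernel_eq_path_rep) (use that in \<open>auto simp: T I\<close>)
  qed
qed

end
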